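(* Let $f\colon X\to Y$ be a homologically $n$-spherical map between posets such that $Y$ is homologically $n$-spherical. Then $X$ is homologically $n$-spherical, $f_*\colon \widetilde{H}_n(X)\to\widetilde{H}_n(Y)$ is an epimorphism, and $$\widetilde{H}_n(X)\simeq \widetilde{H}_n(Y)\oplus\bigoplus_{y\in Y}\widetilde{H}_{h(y)}(f/y)\otimes \widetilde{H}_{n-h(y)-1}(Y_{>y}).$$ Moreover, suppose that $X=\mathcal{X}(K)$ for a certain simplicial complex $K$ and that: (i) If $f(\sigma_1)\le f(\sigma_2)$ then $\mathrm{lk}(\sigma_2,K)\subseteq \mathrm{lk}(\sigma_1,K)$. (ii) If $f(\sigma_1)\le f(\sigma_2)$ and $f(\tau_1)\le f(\tau_2)$ then $f(\sigma_1\cup\tau_1)\le f(\sigma_2\cup\tau_2)$, whenever $\sigma_1\cup\tau_1,\ \sigma_2\cup\tau_2\in K$. (iii) For every $y\in Y$ and every $\sigma\in f^{-1}(y)$, the map $f_*\colon \widetilde{H}_{n-h(y)-1}(X_{>\sigma})\to\widetilde{H}_{n-h(y)-1}(Y_{>y})$ is an epimorphism. Then a basis of $\widetilde{H}_n(K)$ can be produced as follows. Since $f_*$ is an epimorphism, take $\{\gamma_i\}_{i\in I}\subseteq\widetilde{H}_n(K)$ such that $\{f_*(\gamma_i')\}_{i\in I}$ is a basis of $\widetilde{H}_n(Y)$. In addition, for every $y\in Y$ choose $x\in f^{-1}(y)$ and consider the subcomplexes $K_y=\{\sigma : f(\sigma)\le y\}$ and $K^y=\mathrm{lk}(x,K)$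 of $K$. By (i), $K^y$ does not depend on the choice of $x$, and $K_y*K^y$ is a subcomplex of $K$. Let $\widetilde{f}\colon\mathcal{X}(K^y)\to Y_{>y}$ be defined by $\widetilde{f}(\tau)=f(x\cup\tau)$; by (ii), $\widetilde{f}$ does not depend on the choice of $x$. Take a basis $\{\alpha_i\}_{i\in I_y}$ of $\widetilde{H}_{h(y)}(K_y)$ and, using (iii), take $\{\beta_j\}_{j\in J_y}\subseteq\widetilde{H}_{n-h(y)-1}(K^y)$ such that $\{\widetilde{f}_*(\beta_j')\}_{j\in J_y}$ is a basis of $\widetilde{H}_{n-h(y)-1}(Y_{>y})$. Then $$\{\gamma_i : i\in I\}\cup\{\alpha_i*\beta_j : y\in Y,\ i\in I_y,\ j\in J_y\}$$ is a basis of $\widetilde{H}_n(K)$.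
   Context: Homology has integer coefficients; $\widetilde{H}$ is reduced homology, computed from the augmented simplicial chain complex $\widetilde{C}_\bullet$ (so $\widetilde{H}_{-1}(\emptyset)=\mathbb{Z}$). For a poset $X$, $\mathcal{K}(X)$ is its order complex and $\widetilde{H}_\bullet(X)=\widetilde{H}_\bullet(\mathcal{K}(X))$. For a simplicial complex $K$, $\mathcal{X}(K)$ is its face poset (nonempty simplices ordered by inclusion); $\mathcal{K}(\mathcal{X}(K))$ is the barycentric subdivision $K'$ of $K$. For a chain, cycle or homology class $\alpha$ of $K$, $\alpha'$ denotes its image in $K'$ under the subdivision operator $\widetilde{C}_\bullet(K)\to\widetilde{C}_\bullet(K')$. The height $h(x)$ of $x\in X$ is $\dim\mathcal{K}(X_{\le x})$. The link $\mathrm{lk}(\sigma,K)$ consists of simplices $\tau$ with $\sigma\cap\tau=\emptyset$ and $\sigma\cup\tau\in K$; the poset $\mathcal{X}(\mathrm{lk}(\sigma,K))$ is identified with $\mathcal{X}(K)_{>\sigma}$ via $\tau\mapsto\sigma\cup\tau$. The empty complex has dimension $-1$. A simplicial complex $K$ is homologically $m$-spherical if $\dim K=m$ and $\widetilde{H}_i(K)=0$ for all $i<m$; a poset $X$ is homologically $m$-spherical if $\mathcal{K}(X)$ is. For an order preserving map $f\colon X\to Y$ and $y\in Y$, the fiber is $f/y=\{x\in X : f(x)\le y\}$. An order preserving map $f\colon X\to Y$ is homologically $n$-spherical if for all $y\in Y$ the poset $Y_{>y}$ is homologically $(n-h(y)-1)$-spherical and $f/y$ is homologically $h(y)$-spherical.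 $K_1*K_2$ denotes the join of simplicial complexes, and $\widetilde{C}_\bullet(K_1*K_2)=\widetilde{C}_\bullet(K_1)*\widetilde{C}_\bullet(K_2)$, the join of chain complexes (suspension of the tensor product); $\alpha*\beta$ is the join of cycles of degrees $p$ and $q$, a cycle of degree $p+q+1$, here viewed in $\widetilde{H}_n(K)$ through the inclusion $K_y*K^y\subseteq K$. In (iii), $f_*$ is induced by the restriction $X_{>\sigma}\to Y_{>y}$ of $f$; condition (i) ensures that $f$ maps $X_{>\sigma}$ into $Y_{>f(\sigma)}$. *)

theory Defs
  imports "HOL-Algebra.Free_Abelian_Groups" "HOL-Combinatorics.Permutations"
begin

section \<open>Simplicial complexes\<close>

text \<open>Every complex contains the empty simplex, which generates the augmentation degree \<open>-1\<close>.
  The empty complex is therefore \<open>{{}}\<close>.\<close>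

definition simplicial_complex :: "'v set set \<Rightarrow> bool" where
  "simplicial_complex K \<longleftrightarrow>
     {} \<in> K \<and> (\<forall>\<sigma>\<in>K. finite \<sigma> \<and> (\<forall>\<tau>. \<tau> \<subseteq> \<sigma> \<longrightarrow> \<tau> \<in> K))"

definition finite_dimensional :: "'v set set \<Rightarrow> bool" where
  "finite_dimensional K \<longleftrightarrow> bdd_above (card ` K)"

text \<open>Only meaningful if \<open>K\<close> is finite dimensional.\<close>

definition complex_dim :: "'v set set \<Rightarrow> int" where
  "complex_dim K = (SUP \<sigma>\<in>K. int (card \<sigma>) - 1)"

definition link :: "'v set \<Rightarrow> 'v set set \<Rightarrow> 'v set set" where
  "link \<sigma> K = {\<tau>. \<sigma> \<inter> \<tau> = {} \<and> \<sigma> \<union> \<tau> \<in> K}"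

text \<open>The join, for complexes on disjoint vertex sets.\<close>

definition complex_join :: "'v set set \<Rightarrow> 'v set set \<Rightarrow> 'v set set" where
  "complex_join K L = {\<sigma> \<union> \<tau> | \<sigma> \<tau>. \<sigma> \<in> K \<and> \<tau> \<in> L}"

text \<open>The order is that of the type, i.e. inclusion.\<close>

definition face_poset :: "'v set set \<Rightarrow> 'v set set" where
  "face_poset K = K - {{}}"

section \<open>Oriented chains and reduced homology\<close>

text \<open>A chain is a finitely supported integer combination of simplices. The basis element
  \<open>frag_of \<sigma>\<close> is \<open>\<sigma>\<close> with the orientation given by the arbitrarily chosen enumeration
  \<open>orientation \<sigma>\<close> of its vertices.\<close>

definition orientation :: "'v set \<Rightarrow> 'v list" where
  "orientation \<sigma> = (SOME xs. distinct xs \<and> set xs = \<sigma>)"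

text \<open>The sign of the permutation taking the list \<open>xs\<close> to the list \<open>ys\<close>, for lists without
  repetitions having the same elements.\<close>

definition list_sign :: "'v list \<Rightarrow> 'v list \<Rightarrow> int" where
  "list_sign xs ys = sign (THE \<pi>. \<pi> permutes {..<length xs} \<and> permute_list \<pi> xs = ys)"

text \<open>The oriented simplex \<open>[v\<^sub>0, \<dots>, v\<^sub>p]\<close>; zero if a vertex is repeated.\<close>

definition oriented_simplex :: "'v list \<Rightarrow> ('v set \<Rightarrow>\<^sub>0 int)" where
  "oriented_simplex xs =
     (if distinct xs then frag_cmul (list_sign (orientation (set xs)) xs) (frag_of (set xs)) else 0)"

definition chain_group :: "int \<Rightarrow> 'v set set \<Rightarrow> ('v set \<Rightarrow>\<^sub>0 int) monoid" where
  "chain_group p K = free_Abelian_group {\<sigma> \<in> K. int (card \<sigma>) = p + 1}"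

definition boundary :: "('v set \<Rightarrow>\<^sub>0 int) \<Rightarrow> ('v set \<Rightarrow>\<^sub>0 int)" where
  "boundary = frag_extend (\<lambda>\<sigma>. let xs = orientation \<sigma> in
     (\<Sum>i<length xs. frag_cmul ((-1) ^ i) (oriented_simplex (take i xs @ drop (Suc i) xs))))"

definition cycles :: "int \<Rightarrow> 'v set set \<Rightarrow> ('v set \<Rightarrow>\<^sub>0 int) set" where
  "cycles p K = {c \<in> carrier (chain_group p K). boundary c = 0}"

definition boundaries :: "int \<Rightarrow> 'v set set \<Rightarrow> ('v set \<Rightarrow>\<^sub>0 int) set" where
  "boundaries p K = boundary ` carrier (chain_group (p + 1) K)"

definition homology :: "int \<Rightarrow> 'v set set \<Rightarrow> ('v set \<Rightarrow>\<^sub>0 int) set monoid" where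
  "homology p K = subgroup_generated (chain_group p K) (cycles p K) Mod boundaries p K"

definition homology_class :: "int \<Rightarrow> 'v set set \<Rightarrow> ('v set \<Rightarrow>\<^sub>0 int) \<Rightarrow> ('v set \<Rightarrow>\<^sub>0 int) set" where
  "homology_class p K z = boundaries p K #>\<^bsub>chain_group p K\<^esub> z"

definition representative :: "('v set \<Rightarrow>\<^sub>0 int) set \<Rightarrow> ('v set \<Rightarrow>\<^sub>0 int)" where
  "representative a = (SOME z. z \<in> a)"

text \<open>The map on degree \<open>p\<close> homology induced by a chain map \<open>F\<close> into the chains of \<open>L\<close>.\<close>

definition induced ::
  "int \<Rightarrow> 'w set set \<Rightarrow> (('v set \<Rightarrow>\<^sub>0 int) \<Rightarrow> ('w set \<Rightarrow>\<^sub>0 int)) \<Rightarrow>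
    ('v set \<Rightarrow>\<^sub>0 int) set \<Rightarrow> ('w set \<Rightarrow>\<^sub>0 int) set" where
  "induced p L F a = homology_class p L (F (representative a))"

definition simplicial_chain_map :: "('v \<Rightarrow> 'w) \<Rightarrow> ('v set \<Rightarrow>\<^sub>0 int) \<Rightarrow> ('w set \<Rightarrow>\<^sub>0 int)" where
  "simplicial_chain_map \<phi> = frag_extend (\<lambda>\<sigma>. oriented_simplex (map \<phi> (orientation \<sigma>)))"

text \<open>The join of chains, \<open>[v\<^sub>0, \<dots>, v\<^sub>p] * [w\<^sub>0, \<dots>, w\<^sub>q] = [v\<^sub>0, \<dots>, v\<^sub>p, w\<^sub>0, \<dots>, w\<^sub>q]\<close>,
  and of the homology classes of degrees \<open>p\<close> and \<open>q\<close> that two chains represent, as a class of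
  a complex \<open>K\<close> containing the join of their complexes.\<close>

definition chain_join :: "('v set \<Rightarrow>\<^sub>0 int) \<Rightarrow> ('v set \<Rightarrow>\<^sub>0 int) \<Rightarrow> ('v set \<Rightarrow>\<^sub>0 int)" where
  "chain_join a b =
     frag_extend (\<lambda>\<sigma>. frag_extend (\<lambda>\<tau>. oriented_simplex (orientation \<sigma> @ orientation \<tau>)) b) a"

definition homology_join ::
  "int \<Rightarrow> int \<Rightarrow> 'v set set \<Rightarrow> ('v set \<Rightarrow>\<^sub>0 int) set \<Rightarrow> ('v set \<Rightarrow>\<^sub>0 int) set \<Rightarrow> ('v set \<Rightarrow>\<^sub>0 int) set" where
  "homology_join p q K a b =
     homology_class (p + q + 1) K (chain_join (representative a) (representative b))"

definition homologically_spherical :: "int \<Rightarrow> 'v set set \<Rightarrow> bool" where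
  "homologically_spherical m K \<longleftrightarrow>
     finite_dimensional K \<and> complex_dim K = m \<and> (\<forall>i<m. trivial_group (homology i K))"

section \<open>Posets\<close>

text \<open>A poset is a subset of a type of class \<open>order\<close>, with the induced order.\<close>

definition order_complex :: "'a::order set \<Rightarrow> 'a set set" where
  "order_complex X = {s. finite s \<and> s \<subseteq> X \<and> (\<forall>x\<in>s. \<forall>y\<in>s. x \<le> y \<or> y \<le> x)}"

definition poset_homology :: "int \<Rightarrow> 'a::order set \<Rightarrow> ('a set \<Rightarrow>\<^sub>0 int) set monoid" where
  "poset_homology p X = homology p (order_complex X)"

definition poset_induced ::
  "int \<Rightarrow> 'b::order set \<Rightarrow> ('a::order \<Rightarrow> 'b) \<Rightarrow> ('a set \<Rightarrow>\<^sub>0 int) set \<Rightarrow> ('b set \<Rightarrow>\<^sub>0 int) set" where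
  "poset_induced p Y f = induced p (order_complex Y) (simplicial_chain_map f)"

definition poset_spherical :: "int \<Rightarrow> 'a::order set \<Rightarrow> bool" where
  "poset_spherical m X \<longleftrightarrow> homologically_spherical m (order_complex X)"

definition height :: "'a::order set \<Rightarrow> 'a \<Rightarrow> int" where
  "height X x = complex_dim (order_complex {z \<in> X. z \<le> x})"

definition strictly_above :: "'a::order set \<Rightarrow> 'a \<Rightarrow> 'a set" where
  "strictly_above X x = {z \<in> X. x < z}"

definition fiber :: "'a set \<Rightarrow> ('a \<Rightarrow> 'b::order) \<Rightarrow> 'b \<Rightarrow> 'a set" where
  "fiber X f y = {x \<in> X. f x \<le> y}"

definition spherical_map ::
  "int \<Rightarrow> 'a::order set \<Rightarrow> 'b::order set \<Rightarrow> ('a \<Rightarrow> 'b) \<Rightarrow> bool" where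
  "spherical_map n X Y f \<longleftrightarrow>
     f \<in> X \<rightarrow> Y \<and> mono_on X f \<and>
     (\<forall>y\<in>Y. poset_spherical (n - height Y y - 1) (strictly_above Y y) \<and>
            poset_spherical (height Y y) (fiber X f y))"

text \<open>The subdivision operator from the chains of \<open>K\<close> to those of its barycentric subdivision
  \<open>order_complex (face_poset K)\<close>: it sends \<open>[v\<^sub>0, \<dots>, v\<^sub>p]\<close> to the sum over all permutations
  \<open>\<pi>\<close> of \<open>sign \<pi>\<close> times the oriented flag
  \<open>[{v\<^bsub>\<pi> 0\<^esub>}, {v\<^bsub>\<pi> 0\<^esub>, v\<^bsub>\<pi> 1\<^esub>}, \<dots>, {v\<^bsub>\<pi> 0\<^esub>, \<dots>, v\<^bsub>\<pi> p\<^esub>}]\<close>. This is the only augmentation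
  preserving chain map that sends each simplex to a chain of its own subdivision, so it agrees
  with the recursive definition by coning from barycenters.\<close>

definition flag :: "'v list \<Rightarrow> 'v set list" where
  "flag xs = map (\<lambda>i. set (take (Suc i) xs)) [0..<length xs]"

definition subdivision :: "('v set \<Rightarrow>\<^sub>0 int) \<Rightarrow> ('v set set \<Rightarrow>\<^sub>0 int)" where
  "subdivision = frag_extend (\<lambda>\<sigma>. let xs = orientation \<sigma> in
     (\<Sum>\<pi> | \<pi> permutes {..<length xs}.
        frag_cmul (sign \<pi>) (oriented_simplex (flag (permute_list \<pi> xs)))))"

definition homology_subdivision ::
  "int \<Rightarrow> 'v set set \<Rightarrow> ('v set \<Rightarrow>\<^sub>0 int) set \<Rightarrow> ('v set set \<Rightarrow>\<^sub>0 int) set" where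
  "homology_subdivision p K = induced p (order_complex (face_poset K)) subdivision"

text \<open>The subcomplex \<open>K\<^sub>y\<close>, for a map \<open>f\<close> defined on the face poset of \<open>K\<close>.\<close>

definition subcomplex_below :: "'v set set \<Rightarrow> ('v set \<Rightarrow> 'b::order) \<Rightarrow> 'b \<Rightarrow> 'v set set" where
  "subcomplex_below K f y = insert {} (fiber (face_poset K) f y)"

section \<open>Abelian groups\<close>

definition tensor_relations ::
  "('g, 'm) monoid_scheme \<Rightarrow> ('h, 'n) monoid_scheme \<Rightarrow> ('g \<times> 'h \<Rightarrow>\<^sub>0 int) set" where
  "tensor_relations G H =
     {frag_of (a \<otimes>\<^bsub>G\<^esub> a', b) - frag_of (a, b) - frag_of (a', b) | a a' b.
        a \<in> carrier G \<and> a' \<in> carrier G \<and> b \<in> carrier H} \<union>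
     {frag_of (a, b \<otimes>\<^bsub>H\<^esub> b') - frag_of (a, b) - frag_of (a, b') | a b b'.
        a \<in> carrier G \<and> b \<in> carrier H \<and> b' \<in> carrier H}"

definition tensor_product ::
  "('g, 'm) monoid_scheme \<Rightarrow> ('h, 'n) monoid_scheme \<Rightarrow> ('g \<times> 'h \<Rightarrow>\<^sub>0 int) set monoid" where
  "tensor_product G H =
     (let F = free_Abelian_group (carrier G \<times> carrier H) in F Mod generate F (tensor_relations G H))"

text \<open>The family \<open>(b i)\<close> indexed by \<open>I\<close> is a basis of the abelian group \<open>G\<close>: every element
  is a finite integer combination of the family in a unique way.\<close>

definition free_basis :: "('g, 'm) monoid_scheme \<Rightarrow> 'i set \<Rightarrow> ('i \<Rightarrow> 'g) \<Rightarrow> bool" where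
  "free_basis G I b \<longleftrightarrow>
     b \<in> I \<rightarrow> carrier G \<and>
     bij_betw (\<lambda>c. \<Otimes>\<^bsub>G\<^esub>i\<in>Poly_Mapping.keys c. b i [^]\<^bsub>G\<^esub> Poly_Mapping.lookup c i)
       (carrier (free_Abelian_group I)) (carrier G)"

end

theory Submission
  imports Defs
begin

text \<open>
  The map \<open>f\<close> is studied through its mapping cylinder: the disjoint union of \<open>X\<close> and \<open>Y\<close>, ordered so
  that \<open>x\<close> lies below \<open>y\<close> exactly if \<open>f x \<le> y\<close>. Sending \<open>x\<close> to \<open>f x\<close> deforms the cylinder onto \<open>Y\<close>.
  On the other hand the cylinder arises from \<open>X\<close> by adding the elements of \<open>Y\<close> in the order of
  decreasing height. Adding \<open>y\<close> attaches a cone over the join of \<open>f/y\<close> with the part of \<open>Y\<close> strictly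
  above \<open>y\<close>; elements of the same height are incomparable, so their cones are attached independently.
  By hypothesis the two factors are spherical of dimensions \<open>h(y)\<close> and \<open>n - h(y) - 1\<close>, hence the link
  is spherical of dimension \<open>n\<close> and its top homology is the tensor product of those of the factors
  (\<open>acyclic_below_join\<close>, \<open>join_basis\<close>).

  Since cycles in a link bound there in all degrees below \<open>n\<close>, a cycle of the cylinder of degree at
  most \<open>n\<close> can be pushed off the added elements (\<open>push\<close>), and a filling of a cycle of degree below
  \<open>n\<close> can be replaced by one in \<open>X\<close> (\<open>acyclic_level\<close>). So \<open>X\<close> is spherical and \<open>f\<close> induces a
  surjection in degree \<open>n\<close>. A top cycle of \<open>X\<close> with image \<open>0\<close> bounds in the cylinder; the filling
  has degree \<open>n + 1\<close> and is built from cones over top cycles of the links. It follows that the kernel has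
  a basis consisting of the cycles obtained by pushing the basis elements of the links into \<open>X\<close>
  (\<open>cylinder_basis\<close>). The pushing is not canonical, but any lift of a basis
  of the homology of \<open>Y\<close> together with any choice of pushed link cycles is a basis. All the groups
  are free, because top homology is a subgroup of a chain group (\<open>subgroup_int_basis\<close>); comparing
  bases gives the direct sum decomposition.

  For the face poset of a complex \<open>K\<close> the freedom in the choice of pushed cycles is used. The link of \<open>y\<close>
  has the basis of all joins of \<open>\<alpha>\<^sub>i'\<close> with the image of \<open>\<beta>\<^sub>j'\<close> in \<open>Y\<close>. The subdivision of
  \<open>\<alpha>\<^sub>i * \<beta>\<^sub>j\<close>, a cycle in the face poset of \<open>K\<close>, is homologous to this join in the cylinder without the elements of
  height at most \<open>h(y)\<close>: both are images of \<open>\<alpha>\<^sub>i * \<beta>\<^sub>j\<close> under chain maps carried by the same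
  family of cones (\<open>subdivided_join_homologous\<close>). So it is an admissible choice, and since subdivision
  is an isomorphism in the top degree, the resulting basis comes from the asserted one of \<open>K\<close>.

  Throughout, chains are graded by the number \<open>k\<close> of vertices of their simplices rather than by the
  degree \<open>k - 1\<close>, so that \<open>N\<close> stands for \<open>n + 1\<close>. As there are no chains above the dimension, top
  homology classes are single cycles, and all arguments deal with cycles; homology groups
  enter only when the results are translated back.
\<close>

section \<open>Oriented simplices\<close>

text \<open>The operators on chains are defined through arbitrarily chosen orientations. A formula
  in terms of lists of vertices is independent of that choice if it is alternating; adjacent
  transpositions are enough, as they generate all permutations.\<close>

definition alternating :: "('v list \<Rightarrow> ('w \<Rightarrow>\<^sub>0 int)) \<Rightarrow> bool" where
  "alternating F \<longleftrightarrow> (\<forall>us a b vs. F (us @ a # b # vs) = - F (us @ b # a # vs))"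

lemma alternatingD: "alternating F \<Longrightarrow> F (us @ a # b # vs) = - F (us @ b # a # vs)"
  unfolding alternating_def by blast

lemma alternating_prefix:
  assumes "alternating F" shows "alternating (\<lambda>xs. F (us @ xs))"
  unfolding alternating_def
proof (intro allI)
  fix us' a b vs
  show "F (us @ us' @ a # b # vs) = - F (us @ us' @ b # a # vs)"
    using alternatingD[OF assms, of "us @ us'" a b vs] by simp
qed

lemma alternating_suffix:
  assumes "alternating F" shows "alternating (\<lambda>xs. F (xs @ vs))"
  unfolding alternating_def
proof (intro allI)
  fix us a b vs'
  show "F ((us @ a # b # vs') @ vs) = - F ((us @ b # a # vs') @ vs)"
    using alternatingD[OF assms, of us a b "vs' @ vs"] by simp
qed

lemma alternating_Cons:
  assumes "alternating F" shows "alternating (\<lambda>xs. F (x # xs))"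
  using alternating_prefix[OF assms, of "[x]"] by simp

lemma alternating_map:
  assumes "alternating F" shows "alternating (\<lambda>xs. F (map h xs))"
  unfolding alternating_def map_append list.map using alternatingD[OF assms] by blast

lemma frag_eq_uminus_self: "c = - c \<longleftrightarrow> c = (0::'v \<Rightarrow>\<^sub>0 int)"
proof
  assume c: "c = - c"
  have "Poly_Mapping.lookup c v = - Poly_Mapping.lookup c v" for v
    by (subst c) simp
  then show "c = 0" by (intro poly_mapping_eqI) simp
qed simp

lemma alternating_move:
  assumes "alternating F"
  shows "F (us @ ms @ x # vs) = frag_cmul ((-1) ^ length ms) (F (us @ x # ms @ vs))"
proof (induction ms arbitrary: vs rule: rev_induct)
  case (snoc m ms)
  have "F (us @ (ms @ [m]) @ x # vs) = - F (us @ ms @ x # m # vs)"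
    using alternatingD[OF assms, of "us @ ms" m x vs] by simp
  then show ?case using snoc[of "m # vs"] by simp
qed simp

lemma alternating_not_distinct:
  assumes "alternating F" "\<not> distinct xs" shows "F xs = 0"
proof -
  obtain us a ms vs where xs: "xs = us @ [a] @ ms @ [a] @ vs"
    using not_distinct_decomp[OF assms(2)] by blast
  have "F (us @ a # a # ms @ vs) = - F (us @ a # a # ms @ vs)"
    by (rule alternatingD[OF assms(1)])
  then have "F (us @ a # a # ms @ vs) = 0" using frag_eq_uminus_self by blast
  moreover have "F xs = frag_cmul ((-1) ^ length ms) (F ((us @ [a]) @ a # ms @ vs))"
    using alternating_move[OF assms(1), of "us @ [a]" ms a vs] xs by simp
  ultimately show ?thesis by simp
qed

text \<open>The factor by which a reordering changes an alternating function is the sign of the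
  reordering and so does not depend on the function. Comparing with a second alternating function
  makes it possible to say this without mentioning signs.\<close>

lemma alternating_same_sign:
  assumes "alternating F" "alternating G" "mset xs = mset ys"
  shows "\<exists>s. F ys = frag_cmul s (F xs) \<and> G ys = frag_cmul s (G xs)"
  using assms
proof (induction xs arbitrary: ys F G)
  case Nil
  then show ?case by (intro exI[of _ 1]) simp
next
  case (Cons x xs)
  then have "x \<in> set ys" by (metis list.set_intros(1) mset_eq_setD)
  then obtain us vs where ys: "ys = us @ x # vs" by (meson split_list)
  then have "mset xs = mset (us @ vs)" using Cons.prems(3) by simp
  then obtain s where s: "F (x # us @ vs) = frag_cmul s (F (x # xs))"
      "G (x # us @ vs) = frag_cmul s (G (x # xs))"
    using Cons.IH[OF alternating_Cons alternating_Cons] Cons.prems(1,2) by blast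
  have "F ys = frag_cmul ((-1) ^ length us) (F (x # us @ vs))"
       "G ys = frag_cmul ((-1) ^ length us) (G (x # us @ vs))"
    using alternating_move[OF Cons.prems(1), of "[]" us x vs]
          alternating_move[OF Cons.prems(2), of "[]" us x vs] ys by simp_all
  then show ?case using s by (auto intro!: exI[of _ "(-1) ^ length us * s"])
qed

lemma permute_list_inject:
  assumes "distinct xs" "\<pi> permutes {..<length xs}" "\<rho> permutes {..<length xs}"
    "permute_list \<pi> xs = permute_list \<rho> xs"
  shows "\<pi> = \<rho>"
proof
  fix i
  show "\<pi> i = \<rho> i"
  proof (cases "i < length xs")
    case True
    then have "xs ! \<pi> i = xs ! \<rho> i" "\<pi> i < length xs" "\<rho> i < length xs"
      using assms permute_list_nth permutes_in_image by (metis, (metis lessThan_iff)+)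
    then show ?thesis using assms(1) nth_eq_iff_index_eq by blast
  next
    case False
    then show ?thesis using assms(2,3) by (simp add: permutes_def)
  qed
qed

lemma list_sign_permute_list:
  assumes "distinct xs" "\<pi> permutes {..<length xs}"
  shows "list_sign xs (permute_list \<pi> xs) = sign \<pi>"
  unfolding list_sign_def
  by (rule arg_cong[where f=sign], rule the_equality) (use assms permute_list_inject in blast)+

lemma list_sign_trans:
  assumes "distinct xs" "distinct ys" "distinct zs" "set xs = set ys" "set ys = set zs"
  shows "list_sign xs zs = list_sign xs ys * list_sign ys zs"
proof -
  have ms: "mset xs = mset ys" "mset ys = mset zs"
    using assms set_eq_iff_mset_eq_distinct by blast+
  then have l: "length xs = length ys" using mset_eq_length by blast
  obtain p where p: "p permutes {..<length ys}" "permute_list p xs = ys"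
    using mset_eq_permutation[of ys xs] ms l by metis
  obtain q where q: "q permutes {..<length ys}" "permute_list q ys = zs"
    using mset_eq_permutation[of zs ys] ms by metis
  have "permute_list (p \<circ> q) xs = zs"
    using permute_list_compose[of q xs p] p q l by metis
  moreover have "p \<circ> q permutes {..<length ys}" using p q permutes_compose by blast
  ultimately have "list_sign xs zs = sign (p \<circ> q)"
    using list_sign_permute_list assms(1) l by metis
  also have "\<dots> = sign p * sign q"
    using p q by (intro sign_compose permutes_imp_permutation[of "{..<length ys}"]) auto
  also have "\<dots> = list_sign xs ys * list_sign ys zs"
    using list_sign_permute_list p q assms l by metis
  finally show ?thesis .
qed

lemma list_sign_self [simp]: "distinct xs \<Longrightarrow> list_sign xs xs = 1"
  using list_sign_permute_list[of xs id] by simp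

lemma list_sign_swap:
  assumes "distinct (us @ a # b # vs)"
  shows "list_sign (us @ a # b # vs) (us @ b # a # vs) = -1"
proof -
  let ?xs = "us @ a # b # vs" and ?n = "length us"
  let ?t = "transpose ?n (Suc ?n)"
  have t: "?t permutes {..<length ?xs}" by (rule permutes_swap_id) auto
  have "permute_list ?t ?xs = us @ b # a # vs"
  proof (rule nth_equalityI)
    fix i assume "i < length (permute_list ?t ?xs)"
    then have "permute_list ?t ?xs ! i = ?xs ! ?t i"
      using permute_list_nth[OF t] by simp
    also have "\<dots> = (us @ b # a # vs) ! i"
      by (auto simp: transpose_def nth_append nth_Cons split: nat.splits)
    finally show "permute_list ?t ?xs ! i = (us @ b # a # vs) ! i" .
  qed simp
  then show ?thesis using list_sign_permute_list[OF assms t] by (simp add: sign_swap_id)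
qed

lemma orientation_finite:
  assumes "finite \<sigma>" shows "distinct (orientation \<sigma>)" "set (orientation \<sigma>) = \<sigma>"
proof -
  have "\<exists>xs. distinct xs \<and> set xs = \<sigma>" using finite_distinct_list[OF assms] by blast
  then have "distinct (orientation \<sigma>) \<and> set (orientation \<sigma>) = \<sigma>"
    unfolding orientation_def by (rule someI_ex)
  then show "distinct (orientation \<sigma>)" "set (orientation \<sigma>) = \<sigma>" by auto
qed

lemma length_orientation: "finite \<sigma> \<Longrightarrow> length (orientation \<sigma>) = card \<sigma>"
  by (metis distinct_card orientation_finite)

lemma alternating_oriented_simplex: "alternating oriented_simplex"
  unfolding alternating_def
proof (intro allI)
  fix us vs :: "'v list" and a b :: 'v
  let ?o = "orientation (set (us @ a # b # vs))"
  have s: "set (us @ b # a # vs) = set (us @ a # b # vs)" by auto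
  show "oriented_simplex (us @ a # b # vs) = - oriented_simplex (us @ b # a # vs)"
  proof (cases "distinct (us @ a # b # vs)")
    case True
    have "list_sign ?o (us @ b # a # vs) =
        list_sign ?o (us @ a # b # vs) * list_sign (us @ a # b # vs) (us @ b # a # vs)"
      using True by (intro list_sign_trans) (auto simp: orientation_finite)
    then show ?thesis using True s list_sign_swap[OF True]
      unfolding oriented_simplex_def by (auto simp: s)
  qed (auto simp: oriented_simplex_def)
qed

lemma oriented_simplex_orientation [simp]:
  "finite \<sigma> \<Longrightarrow> oriented_simplex (orientation \<sigma>) = frag_of \<sigma>"
  by (simp add: oriented_simplex_def orientation_finite)

lemma oriented_simplex_not_distinct: "\<not> distinct xs \<Longrightarrow> oriented_simplex xs = 0"
  by (simp add: oriented_simplex_def)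

lemma oriented_simplex_Nil [simp]: "oriented_simplex [] = frag_of {}"
  by (metis finite.emptyI orientation_finite(2) oriented_simplex_orientation set_empty)

lemma oriented_simplex_singleton [simp]: "oriented_simplex [v] = frag_of {v}"
proof -
  have "orientation {v} = [v]"
    using length_orientation[of "{v}"] orientation_finite(2)[of "{v}"]
    by (auto simp: length_Suc_conv)
  then show ?thesis using oriented_simplex_orientation[of "{v}"] by simp
qed

text \<open>This turns an alternating formula on vertex lists into the linear operator that it
  describes, whatever the chosen orientations are.\<close>

lemma alternating_extend:
  assumes F: "alternating F"
  shows "frag_extend (\<lambda>\<sigma>. F (orientation \<sigma>)) (oriented_simplex xs) = F xs"
proof (cases "distinct xs")
  case True
  let ?o = "orientation (set xs)"
  have "mset ?o = mset xs"
    using set_eq_iff_mset_eq_distinct[of ?o xs] True orientation_finite[of "set xs"] by simp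
  then obtain s where s: "F xs = frag_cmul s (F ?o)"
     "oriented_simplex xs = frag_cmul s (oriented_simplex ?o)"
    using alternating_same_sign[OF F alternating_oriented_simplex] by blast
  then show ?thesis unfolding s by (simp add: frag_extend_cmul)
next
  case False
  then show ?thesis by (simp add: alternating_not_distinct[OF F] oriented_simplex_not_distinct)
qed

lemma oriented_simplex_in_keys:
  "\<sigma> \<in> Poly_Mapping.keys (oriented_simplex xs) \<Longrightarrow> \<sigma> = set xs \<and> card \<sigma> = length xs \<and> distinct xs"
  by (auto simp: oriented_simplex_def distinct_card split: if_splits)

text \<open>Infinite sets of vertices have no enumeration, so identities between chain operators
  are only meaningful for chains on finite simplices.\<close>

definition finitary :: "('v set \<Rightarrow>\<^sub>0 int) \<Rightarrow> bool" where
  "finitary c \<longleftrightarrow> (\<forall>\<sigma>\<in>Poly_Mapping.keys c. finite \<sigma>)"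

text \<open>Identities between additive operators need only be checked on lists of distinct
  vertices, where the operators are given by explicit formulas.\<close>

lemma chain_induct [consumes 1, case_names finite zero simplex diff]:
  assumes "Poly_Mapping.keys c \<subseteq> S" "\<And>\<sigma>. \<sigma> \<in> S \<Longrightarrow> finite \<sigma>"
    and "P 0" "\<And>xs. distinct xs \<Longrightarrow> set xs \<in> S \<Longrightarrow> P (oriented_simplex xs)"
    and "\<And>a b. P a \<Longrightarrow> P b \<Longrightarrow> P (a - b)"
  shows "P c"
  using assms(1)
proof (induction c rule: frag_induction)
  case (one \<sigma>)
  then show ?case using assms(4)[of "orientation \<sigma>"] assms(2)[of \<sigma>] by (simp add: orientation_finite)
qed (use assms in auto)

lemma finitary_induct [consumes 1, case_names zero simplex diff]:
  assumes "finitary c"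
    and "P 0" "\<And>xs. distinct xs \<Longrightarrow> P (oriented_simplex xs)"
    and "\<And>a b. P a \<Longrightarrow> P b \<Longrightarrow> P (a - b)"
  shows "P c"
  by (rule chain_induct[of c "Poly_Mapping.keys c"]) (use assms in \<open>auto simp: finitary_def\<close>)

lemma finitary_oriented_simplex [simp]: "finitary (oriented_simplex xs)"
  unfolding finitary_def using oriented_simplex_in_keys by blast

section \<open>Joins of chains\<close>

lemma chain_join_0_left [simp]: "chain_join 0 b = 0"
  by (simp add: chain_join_def)

lemma frag_extend_zero_fun: "frag_extend (\<lambda>\<sigma>. 0) a = 0"
  by (simp add: frag_extend_eq_0)

lemma frag_cmul_diff_right: "frag_cmul k (a - b) = frag_cmul k a - frag_cmul k b"
  by (rule poly_mapping_eqI) (simp add: lookup_minus right_diff_distrib)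

lemma frag_extend_fun_diff:
  "frag_extend (\<lambda>\<sigma>. F \<sigma> - G \<sigma>) a = frag_extend F a - frag_extend G a"
  unfolding frag_extend_def by (simp add: sum_subtractf frag_cmul_diff_right)

lemma frag_extend_fun_cmul:
  "frag_extend (\<lambda>\<sigma>. frag_cmul k (F \<sigma>)) a = frag_cmul k (frag_extend F a)"
  unfolding frag_extend_def by (simp add: frag_cmul_sum mult.commute)

lemma chain_join_0_right [simp]: "chain_join a 0 = 0"
  by (simp add: chain_join_def frag_extend_zero_fun)

lemma chain_join_diff_left: "chain_join (a - a') b = chain_join a b - chain_join a' b"
  by (simp add: chain_join_def frag_extend_diff)

lemma chain_join_diff_right: "chain_join a (b - b') = chain_join a b - chain_join a b'"
  by (simp add: chain_join_def frag_extend_diff frag_extend_fun_diff)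

lemma chain_join_minus_left: "chain_join (- a) b = - chain_join a b"
  using chain_join_diff_left[of 0 a b] by simp

lemma chain_join_minus_right: "chain_join a (- b) = - chain_join a b"
  using chain_join_diff_right[of a 0 b] by simp

lemma chain_join_add_left: "chain_join (a + a') b = chain_join a b + chain_join a' b"
  using chain_join_diff_left[of a "- a'" b] by (simp add: chain_join_minus_left)

lemma chain_join_add_right: "chain_join a (b + b') = chain_join a b + chain_join a b'"
  using chain_join_diff_right[of a b "- b'"] by (simp add: chain_join_minus_right)

lemma chain_join_oriented_simplex:
  "chain_join (oriented_simplex xs) (oriented_simplex ys) = oriented_simplex (xs @ ys)"
proof -
  have "chain_join (oriented_simplex xs) (oriented_simplex ys) =
     frag_extend (\<lambda>\<sigma>. oriented_simplex (orientation \<sigma> @ ys)) (oriented_simplex xs)"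
    unfolding chain_join_def
    by (rule frag_extend_eq)
       (rule alternating_extend[OF alternating_prefix[OF alternating_oriented_simplex]])
  then show ?thesis
    using alternating_extend[OF alternating_suffix[OF alternating_oriented_simplex]] by simp
qed

lemma chain_join_simplex:
  "chain_join (frag_of {v}) (oriented_simplex xs) = oriented_simplex (v # xs)"
  using chain_join_oriented_simplex[of "[v]" xs] by simp

lemma chain_join_empty_left [simp]: "finitary c \<Longrightarrow> chain_join (frag_of {}) c = c"
  by (induction c rule: finitary_induct)
     (simp_all add: chain_join_diff_right chain_join_oriented_simplex[of "[]", simplified])

lemma chain_join_assoc:
  assumes "finitary a" "finitary b" "finitary c"
  shows "chain_join (chain_join a b) c = chain_join a (chain_join b c)"
  using assms(1)
proof (induction a rule: finitary_induct)
  case (simplex xs)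
  show ?case using assms(2)
  proof (induction b rule: finitary_induct)
    case (simplex ys)
    show ?case using assms(3)
      by (induction c rule: finitary_induct)
         (simp_all add: chain_join_oriented_simplex chain_join_diff_right)
  qed (simp_all add: chain_join_diff_left chain_join_diff_right)
qed (simp_all add: chain_join_diff_left)

lemma vertex_join_anticommute:
  assumes "finitary c"
  shows "chain_join (frag_of {v}) (chain_join (frag_of {w}) c) =
     - chain_join (frag_of {w}) (chain_join (frag_of {v}) c)"
  using assms
proof (induction c rule: finitary_induct)
  case (simplex xs)
  show ?case
    unfolding chain_join_simplex
    by (rule alternatingD[OF alternating_oriented_simplex, of "[]", unfolded append_Nil])
qed (simp_all add: chain_join_diff_right)

section \<open>The boundary of a chain\<close>

definition list_boundary :: "'v list \<Rightarrow> ('v set \<Rightarrow>\<^sub>0 int)" where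
  "list_boundary xs =
     (\<Sum>i<length xs. frag_cmul ((-1) ^ i) (oriented_simplex (take i xs @ drop (Suc i) xs)))"

lemma finitary_frag_of [simp]: "finitary (frag_of \<sigma>) \<longleftrightarrow> finite \<sigma>" by (simp add: finitary_def)

lemma finitary_sum: "(\<And>i. i \<in> I \<Longrightarrow> finitary (F i)) \<Longrightarrow> finitary (sum F I)"
  unfolding finitary_def using keys_sum[of F I] by blast

lemma finitary_cmul: "finitary a \<Longrightarrow> finitary (frag_cmul k a)"
  unfolding finitary_def by simp

lemma finitary_frag_extend:
  assumes "\<And>\<sigma>. \<sigma> \<in> Poly_Mapping.keys c \<Longrightarrow> finitary (F \<sigma>)"
  shows "finitary (frag_extend F c)"
  using assms keys_frag_extend[of F c] unfolding finitary_def by blast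

lemma finitary_chain_join [simp]: "finitary (chain_join a b)"
  unfolding chain_join_def by (intro finitary_frag_extend) simp

lemma finitary_list_boundary [simp]: "finitary (list_boundary xs)"
  unfolding list_boundary_def by (intro finitary_sum finitary_cmul) simp

lemma chain_join_cmul_right: "chain_join a (frag_cmul k b) = frag_cmul k (chain_join a b)"
  unfolding chain_join_def frag_extend_cmul by (rule frag_extend_fun_cmul)

lemma chain_join_cmul_left: "chain_join (frag_cmul k a) b = frag_cmul k (chain_join a b)"
  unfolding chain_join_def frag_extend_cmul by simp

lemma chain_join_sum_right: "chain_join a (sum F I) = (\<Sum>i\<in>I. chain_join a (F i))"
  by (induction I rule: infinite_finite_induct) (auto simp: chain_join_add_right)

lemma chain_join_sum_left: "chain_join (sum F I) b = (\<Sum>i\<in>I. chain_join (F i) b)"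
  by (induction I rule: infinite_finite_induct) (auto simp: chain_join_add_left)

lemma list_boundary_Nil [simp]: "list_boundary [] = 0"
  by (simp add: list_boundary_def)

lemma list_boundary_Cons:
  "list_boundary (x # xs) = oriented_simplex xs - chain_join (frag_of {x}) (list_boundary xs)"
proof -
  have "list_boundary (x # xs) = oriented_simplex xs +
     (\<Sum>i<length xs. frag_cmul ((-1) ^ Suc i) (oriented_simplex (x # take i xs @ drop (Suc i) xs)))"
    unfolding list_boundary_def by (simp add: sum.lessThan_Suc_shift del: sum.lessThan_Suc)
  also have "(\<Sum>i<length xs. frag_cmul ((-1) ^ Suc i) (oriented_simplex (x # take i xs @ drop (Suc i) xs)))
      = - chain_join (frag_of {x}) (list_boundary xs)"
    unfolding list_boundary_def chain_join_sum_right chain_join_cmul_right chain_join_simplex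
    by (simp add: sum_negf[symmetric])
  finally show ?thesis by simp
qed

text \<open>The two faces that omit one of the exchanged vertices trade places with opposite
  signs, and in every other face the exchange changes the orientation.\<close>

lemma alternating_list_boundary: "alternating list_boundary"
  unfolding alternating_def
proof (intro allI)
  fix us vs :: "'v list" and a b
  show "list_boundary (us @ a # b # vs) = - list_boundary (us @ b # a # vs)"
  proof (induction us)
    case Nil
    show ?case
      using vertex_join_anticommute[of "list_boundary vs" a b]
      by (simp add: list_boundary_Cons chain_join_diff_right chain_join_simplex)
  next
    case (Cons u us)
    then show ?case
      using alternatingD[OF alternating_oriented_simplex, of us a b vs]
      by (simp add: list_boundary_Cons chain_join_minus_right)
  qed
qed

lemma boundary_oriented_simplex: "boundary (oriented_simplex xs) = list_boundary xs"
  using alternating_extend[OF alternating_list_boundary]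
  unfolding boundary_def list_boundary_def Let_def .

lemma boundary_diff: "boundary (a - b) = boundary a - boundary b"
  by (simp add: boundary_def frag_extend_diff)
lemma boundary_add: "boundary (a + b) = boundary a + boundary b"
  by (simp add: boundary_def frag_extend_add)
lemma boundary_minus: "boundary (- a) = - boundary a"
  by (simp add: boundary_def frag_extend_minus)
lemma boundary_zero [simp]: "boundary 0 = 0"
  by (simp add: boundary_def)
lemma boundary_cmul: "boundary (frag_cmul k a) = frag_cmul k (boundary a)"
  by (simp add: boundary_def frag_extend_cmul)
lemma boundary_sum: "boundary (sum F I) = (\<Sum>i\<in>I. boundary (F i))"
  by (induction I rule: infinite_finite_induct) (auto simp: boundary_add)

lemma boundary_Cons:
  "boundary (oriented_simplex (x # xs)) =
     oriented_simplex xs - chain_join (frag_of {x}) (boundary (oriented_simplex xs))"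
  by (simp add: boundary_oriented_simplex list_boundary_Cons)

lemma boundary_empty [simp]: "boundary (frag_of {}) = 0"
  using boundary_oriented_simplex[of "[]"] by simp

text \<open>Coning is a contraction of the chain complex. This formula is the source of all
  explicit fillings.\<close>

lemma boundary_cone:
  assumes "finitary c"
  shows "boundary (chain_join (frag_of {v}) c) = c - chain_join (frag_of {v}) (boundary c)"
  using assms
  by (induction c rule: finitary_induct)
     (simp_all add: chain_join_simplex boundary_Cons boundary_diff chain_join_diff_right)

lemma finitary_boundary [simp]: "finitary (boundary c)"
  unfolding boundary_def Let_def list_boundary_def[symmetric] by (intro finitary_frag_extend) simp

lemma boundary_boundary: "finitary c \<Longrightarrow> boundary (boundary c) = 0"
proof (induction c rule: finitary_induct)
  case (simplex xs)
  show ?case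
    by (induction xs) (simp_all add: boundary_Cons boundary_diff boundary_cone)
qed (simp_all add: boundary_diff)

lemma boundary_join_simplex:
  assumes b: "finitary b"
  shows "boundary (chain_join (oriented_simplex xs) b) =
     chain_join (boundary (oriented_simplex xs)) b
     + frag_cmul ((-1) ^ length xs) (chain_join (oriented_simplex xs) (boundary b))"
proof (induction xs)
  case Nil
  then show ?case using b by simp
next
  case (Cons x xs)
  let ?x = "frag_of {x}" and ?s = "oriented_simplex xs"
  have e: "oriented_simplex (x # xs) = chain_join ?x ?s" by (simp add: chain_join_simplex)
  have "boundary (chain_join (oriented_simplex (x # xs)) b) = boundary (chain_join ?x (chain_join ?s b))"
    unfolding e using b by (simp add: chain_join_assoc)
  also have "\<dots> = chain_join ?s b - chain_join ?x (boundary (chain_join ?s b))"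
    by (simp add: boundary_cone)
  also have "\<dots> = chain_join ?s b - chain_join ?x (chain_join (boundary ?s) b)
      - frag_cmul ((-1) ^ length xs) (chain_join ?x (chain_join ?s (boundary b)))"
    by (simp only: Cons.IH chain_join_add_right chain_join_cmul_right) simp
  finally show ?case
    unfolding boundary_Cons using b
    by (simp add: chain_join_diff_left chain_join_assoc[symmetric] e)
qed


text \<open>The sign is that of moving the omitted vertex past the \<open>k\<close> vertices of
  the first factor.\<close>

lemma boundary_join:
  assumes "Poly_Mapping.keys a \<subseteq> {\<sigma>. finite \<sigma> \<and> card \<sigma> = k}" "finitary b"
  shows "boundary (chain_join a b) = chain_join (boundary a) b + frag_cmul ((-1) ^ k) (chain_join a (boundary b))"
  using assms(1)
proof (induction a rule: chain_induct)
  case (simplex xs)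
  then show ?case using boundary_join_simplex[OF assms(2), of xs] by (simp add: distinct_card)
qed (simp_all add: boundary_diff chain_join_diff_left frag_cmul_diff_right)

lemma chain_join_vertex_commute:
  assumes "Poly_Mapping.keys a \<subseteq> {\<sigma>. finite \<sigma> \<and> card \<sigma> = k}"
  shows "chain_join a (frag_of {v}) = frag_cmul ((-1) ^ k) (chain_join (frag_of {v}) a)"
  using assms
proof (induction a rule: chain_induct)
  case (simplex xs)
  then have "length xs = k" by (simp add: distinct_card)
  then show ?case
    using alternating_move[OF alternating_oriented_simplex, of "[]" xs v "[]"]
      chain_join_oriented_simplex[of xs "[v]"]
    by (simp add: chain_join_simplex)
qed (simp_all add: chain_join_diff_left chain_join_diff_right frag_cmul_diff_right)

section \<open>Chain maps of simplicial maps\<close>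

lemma simplicial_chain_map_simplex:
  "simplicial_chain_map f (oriented_simplex xs) = oriented_simplex (map f xs)"
  unfolding simplicial_chain_map_def
  by (rule alternating_extend[OF alternating_map[OF alternating_oriented_simplex]])

lemma simplicial_chain_map_0 [simp]: "simplicial_chain_map f 0 = 0"
  by (simp add: simplicial_chain_map_def)

lemma simplicial_chain_map_diff:
  "simplicial_chain_map f (a - b) = simplicial_chain_map f a - simplicial_chain_map f b"
  by (simp add: simplicial_chain_map_def frag_extend_diff)

lemma finitary_simplicial_chain_map [simp]: "finitary (simplicial_chain_map f c)"
  unfolding simplicial_chain_map_def by (intro finitary_frag_extend) simp

lemma simplicial_chain_map_join:
  assumes "finitary a" "finitary b"
  shows "simplicial_chain_map f (chain_join a b) =
    chain_join (simplicial_chain_map f a) (simplicial_chain_map f b)"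
  using assms(1)
proof (induction a rule: finitary_induct)
  case (simplex xs)
  show ?case using assms(2)
    by (induction b rule: finitary_induct)
       (simp_all add: chain_join_oriented_simplex simplicial_chain_map_simplex
          simplicial_chain_map_diff chain_join_diff_right)
qed (simp_all add: simplicial_chain_map_diff chain_join_diff_left)

lemma simplicial_chain_map_compose:
  assumes "finitary c"
  shows "simplicial_chain_map f (simplicial_chain_map h c) = simplicial_chain_map (f \<circ> h) c"
  using assms
  by (induction c rule: finitary_induct)
     (simp_all add: simplicial_chain_map_simplex simplicial_chain_map_diff comp_def)

lemma simplicial_chain_map_cong:
  assumes "\<And>v. v \<in> \<Union>(Poly_Mapping.keys c) \<Longrightarrow> f v = h v" "finitary c"
  shows "simplicial_chain_map f c = simplicial_chain_map h c"
  unfolding simplicial_chain_map_def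
proof (rule frag_extend_eq)
  fix \<sigma> assume "\<sigma> \<in> Poly_Mapping.keys c"
  then have "map f (orientation \<sigma>) = map h (orientation \<sigma>)"
    using assms orientation_finite(2)[of \<sigma>] by (auto simp: finitary_def intro!: map_cong)
  then show "oriented_simplex (map f (orientation \<sigma>)) = oriented_simplex (map h (orientation \<sigma>))"
    by (rule arg_cong)
qed

lemma simplicial_chain_map_id:
  "finitary c \<Longrightarrow> simplicial_chain_map (\<lambda>x. x) c = c"
  by (induction c rule: finitary_induct)
     (simp_all add: simplicial_chain_map_simplex simplicial_chain_map_diff)

lemma simplicial_chain_map_vertex [simp]: "simplicial_chain_map f (frag_of {v}) = frag_of {f v}"
  using simplicial_chain_map_simplex[of f "[v]"] by simp

lemma simplicial_chain_map_empty [simp]: "simplicial_chain_map f (frag_of {}) = frag_of {}"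
  using simplicial_chain_map_simplex[of f "[]"] by simp

text \<open>If the map identifies two vertices of a simplex, the image of the simplex is zero, and
  so is that of its boundary: the faces omitting one of the two vertices cancel and the others
  degenerate.\<close>

lemma boundary_simplicial_chain_map:
  assumes "finitary c"
  shows "boundary (simplicial_chain_map f c) = simplicial_chain_map f (boundary c)"
  using assms
proof (induction c rule: finitary_induct)
  case (simplex xs)
  show ?case
    by (induction xs)
       (simp_all add: simplicial_chain_map_simplex boundary_Cons simplicial_chain_map_diff
          simplicial_chain_map_join)
qed (simp_all add: boundary_diff simplicial_chain_map_diff)

section \<open>The subdivision operator\<close>

definition list_subdivision :: "'v list \<Rightarrow> ('v set set \<Rightarrow>\<^sub>0 int)" where
  "list_subdivision xs = (\<Sum>\<pi> | \<pi> permutes {..<length xs}.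
     frag_cmul (sign \<pi>) (oriented_simplex (flag (permute_list \<pi> xs))))"

lemma list_subdivision_permute:
  assumes \<rho>: "\<rho> permutes {..<length xs}"
  shows "list_subdivision (permute_list \<rho> xs) = frag_cmul (sign \<rho>) (list_subdivision xs)"
proof -
  let ?S = "{\<pi>. \<pi> permutes {..<length xs}}"
  have sg: "sign (\<rho> \<circ> \<pi>) = sign \<rho> * sign \<pi>" if "\<pi> \<in> ?S" for \<pi>
    using \<rho> that by (intro sign_compose permutes_imp_permutation[of "{..<length xs}"]) auto
  have "list_subdivision (permute_list \<rho> xs) =
     (\<Sum>\<pi>\<in>?S. frag_cmul (sign \<rho>) (frag_cmul (sign (\<rho> \<circ> \<pi>))
        (oriented_simplex (flag (permute_list (\<rho> \<circ> \<pi>) xs)))))"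
    unfolding list_subdivision_def using sg
    by (intro sum.cong) (simp_all add: permute_list_compose mult.assoc[symmetric])
  also have "\<dots> = (\<Sum>\<pi>\<in>?S. frag_cmul (sign \<rho>) (frag_cmul (sign \<pi>)
        (oriented_simplex (flag (permute_list \<pi> xs)))))"
    by (rule setum_permutations_compose_left[OF \<rho>, symmetric])
  finally show ?thesis unfolding list_subdivision_def by (simp only: frag_cmul_sum)
qed

lemma alternating_list_subdivision: "alternating list_subdivision"
  unfolding alternating_def
proof (intro allI)
  fix us vs :: "'v list" and a b
  let ?xs = "us @ a # b # vs" and ?n = "length us"
  let ?t = "transpose ?n (Suc ?n)"
  have t: "?t permutes {..<length ?xs}" by (rule permutes_swap_id) auto
  have "permute_list ?t ?xs = us @ b # a # vs"
  proof (rule nth_equalityI)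
    fix i assume "i < length (permute_list ?t ?xs)"
    then have "permute_list ?t ?xs ! i = ?xs ! ?t i"
      using permute_list_nth[OF t] by simp
    also have "\<dots> = (us @ b # a # vs) ! i"
      by (auto simp: transpose_def nth_append nth_Cons split: nat.splits)
    finally show "permute_list ?t ?xs ! i = (us @ b # a # vs) ! i" .
  qed simp
  then show "list_subdivision ?xs = - list_subdivision (us @ b # a # vs)"
    using list_subdivision_permute[OF t] by (metis frag_cmul_minus_one minus_minus n_not_Suc_n sign_swap_id)
qed

lemma subdivision_simplex: "subdivision (oriented_simplex xs) = list_subdivision xs"
  using alternating_extend[OF alternating_list_subdivision]
  unfolding subdivision_def list_subdivision_def Let_def .

lemma flag_snoc: "flag (xs @ [v]) = flag xs @ [insert v (set xs)]"
  unfolding flag_def by (auto intro!: map_cong)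

lemma length_flag [simp]: "length (flag xs) = length xs"
  by (simp add: flag_def)

lemma permute_list_snoc:
  assumes "p permutes {..<length zs}"
  shows "permute_list p (zs @ [v]) = permute_list p zs @ [v]"
proof (rule nth_equalityI)
  have p: "p permutes {..<length (zs @ [v])}"
    using permutes_subset[OF assms, of "{..<length (zs @ [v])}"] by auto
  fix i assume i: "i < length (permute_list p (zs @ [v]))"
  have "permute_list p (zs @ [v]) ! i = (zs @ [v]) ! p i"
    using permute_list_nth[OF p] i by simp
  also have "\<dots> = (permute_list p zs @ [v]) ! i"
  proof (cases "i < length zs")
    case True
    then have "p i < length zs" using assms permutes_in_image by (metis lessThan_iff)
    then show ?thesis using True permute_list_nth[OF assms] by (simp add: nth_append)
  next
    case False
    then have "p i = i" using assms by (simp add: permutes_def)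
    then show ?thesis using False by (simp add: nth_append)
  qed
  finally show "permute_list p (zs @ [v]) ! i = (permute_list p zs @ [v]) ! i" .
qed simp


lemma subdivision_0 [simp]: "subdivision 0 = 0" by (simp add: subdivision_def)
lemma subdivision_diff: "subdivision (a - b) = subdivision a - subdivision b"
  by (simp add: subdivision_def frag_extend_diff)
lemma subdivision_add: "subdivision (a + b) = subdivision a + subdivision b"
  by (simp add: subdivision_def frag_extend_add)
lemma subdivision_cmul: "subdivision (frag_cmul k a) = frag_cmul k (subdivision a)"
  by (simp add: subdivision_def frag_extend_cmul)
lemma subdivision_sum: "subdivision (sum F I) = (\<Sum>i\<in>I. subdivision (F i))"
  by (induction I rule: infinite_finite_induct) (auto simp: subdivision_add)

lemma set_flag: "set (flag xs) = (\<lambda>i. set (take (Suc i) xs)) ` {..<length xs}"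
  by (auto simp: flag_def)

lemma finitary_subdivision [simp]: "finitary (subdivision c)"
  unfolding subdivision_def Let_def
  by (intro finitary_frag_extend finitary_sum finitary_cmul) simp

lemma keys_list_subdivision:
  assumes "s \<in> Poly_Mapping.keys (list_subdivision xs)"
  obtains \<pi> where "\<pi> permutes {..<length xs}" "s = set (flag (permute_list \<pi> xs))" "card s = length xs"
proof -
  obtain \<pi> where "\<pi> permutes {..<length xs}"
     "s \<in> Poly_Mapping.keys (frag_cmul (sign \<pi>) (oriented_simplex (flag (permute_list \<pi> xs))))"
    using assms keys_sum[of "\<lambda>\<pi>. frag_cmul (sign \<pi>) (oriented_simplex (flag (permute_list \<pi> xs)))"]
    unfolding list_subdivision_def by fast
  then show thesis using that[of \<pi>] oriented_simplex_in_keys[of s "flag (permute_list \<pi> xs)"] by simp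
qed

text \<open>The flags of a simplex that add the vertex at position \<open>b\<close> last are the
  flags of the opposite face, extended by the whole simplex. The permutations with this property
  are exactly the compositions of the transposition of \<open>m\<close> and \<open>b\<close> with
  a permutation fixing \<open>m\<close>.\<close>

lemma list_subdivision_last:
  assumes len: "length xs = Suc m" and b: "b < Suc m"
  shows "(\<Sum>p | p permutes {..<m}. frag_cmul (sign (transpose m b \<circ> p))
           (oriented_simplex (flag (permute_list (transpose m b \<circ> p) xs))))
       = frag_cmul ((-1) ^ m) (frag_cmul ((-1) ^ b)
           (chain_join (list_subdivision (take b xs @ drop (Suc b) xs)) (frag_of {set xs})))"
proof -
  let ?t = "transpose m b"
  have t: "?t permutes {..<length xs}" using b len by (intro permutes_swap_id) auto
  \<comment> \<open>up to order, \<open>ws\<close> is the list of vertices of the face opposite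
    to the vertex at position \<open>b\<close>: the last vertex has taken the free place\<close>
  obtain ws where ws: "permute_list ?t xs = ws @ [xs ! b]" "length ws = m"
      "frag_cmul (sign ?t) (list_subdivision ws) =
         frag_cmul ((-1) ^ m) (frag_cmul ((-1) ^ b) (list_subdivision (take b xs @ drop (Suc b) xs)))"
  proof (cases "b = m")
    case True
    have "permute_list ?t xs = take b xs @ [xs ! b]"
      using True len by (simp add: take_Suc_conv_app_nth[symmetric])
    then show thesis using that[of "take b xs"] True len by (simp add: power_add[symmetric])
  next
    case False
    then have bm: "b < m" using b by simp
    define us where "us = take b xs"
    define ms where "ms = take (m - Suc b) (drop (Suc b) xs)"
    have dm: "drop (Suc b) xs = ms @ [xs ! m]"
      using take_Suc_conv_app_nth[of "m - Suc b" "drop (Suc b) xs"] len bm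
      unfolding ms_def by (simp add: Suc_diff_Suc)
    have xs: "xs = us @ xs ! b # ms @ [xs ! m]"
      using id_take_nth_drop[of b xs] dm bm len unfolding us_def by simp
    have lu: "length us = b" and lm: "length ms = m - Suc b"
      using bm len by (simp_all add: us_def ms_def)
    have "permute_list ?t xs = (us @ xs ! m # ms) @ [xs ! b]"
    proof (rule nth_equalityI)
      fix i assume "i < length (permute_list ?t xs)"
      then have i: "i < Suc m" using len by simp
      then have "permute_list ?t xs ! i = xs ! ?t i"
        using permute_list_nth[OF t] len by simp
      also have "xs ! ?t i = ((us @ xs ! m # ms) @ [xs ! b]) ! i"
      proof -
        consider "i = b" | "i = m" | "i \<noteq> b" "i \<noteq> m" by blast
        then show ?thesis
        proof cases
          case 3
          then have "xs ! i = (us @ xs ! b # ms @ [xs ! m]) ! i" using xs by metis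
          then show ?thesis using 3 lu lm bm i by (auto simp: nth_append nth_Cons split: nat.splits)
        qed (use lu lm bm in \<open>auto simp: nth_append nth_Cons split: nat.splits\<close>)
      qed
      finally show "permute_list ?t xs ! i = ((us @ xs ! m # ms) @ [xs ! b]) ! i" .
    qed (use len lu lm bm in simp)
    moreover have "list_subdivision (take b xs @ drop (Suc b) xs)
        = frag_cmul ((-1) ^ (m - Suc b)) (list_subdivision (us @ xs ! m # ms))"
      using alternating_move[OF alternating_list_subdivision, of us ms "xs ! m" "[]"] dm lm
      unfolding us_def by simp
    moreover have "(-1 :: int) ^ m * ((-1) ^ b * (-1) ^ (m - Suc b)) = -1"
    proof -
      have "m + (b + (m - Suc b)) = Suc (2 * (m - 1))" using bm by simp
      then show ?thesis by (simp add: power_add[symmetric] del: power_Suc)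
    qed
    ultimately show thesis
      using that[of "us @ xs ! m # ms"] False lu lm bm by (simp add: sign_swap_id mult.assoc)
  qed
  have set_ws: "insert (xs ! b) (set ws) = set xs"
    using set_permute_list[OF t] ws(1) by simp
  have "(\<Sum>p | p permutes {..<m}. frag_cmul (sign (?t \<circ> p))
           (oriented_simplex (flag (permute_list (?t \<circ> p) xs))))
      = (\<Sum>p | p permutes {..<m}. frag_cmul (sign ?t) (frag_cmul (sign p)
           (chain_join (oriented_simplex (flag (permute_list p ws))) (frag_of {set xs}))))"
  proof (rule sum.cong[OF refl])
    fix p assume "p \<in> {p. p permutes {..<m}}"
    then have p: "p permutes {..<m}" and p': "p permutes {..<length xs}"
      using permutes_subset[of p "{..<m}" "{..<length xs}"] len by auto
    have "permute_list (?t \<circ> p) xs = permute_list p ws @ [xs ! b]"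
      using permute_list_compose[OF p', of ?t] ws(1,2) permute_list_snoc[of p ws "xs ! b"] p by simp
    then have "flag (permute_list (?t \<circ> p) xs) = flag (permute_list p ws) @ [set xs]"
      using set_ws p ws(2) by (simp add: flag_snoc)
    moreover have "sign (?t \<circ> p) = sign ?t * sign p"
      using t p' by (intro sign_compose permutes_imp_permutation[of "{..<length xs}"]) auto
    ultimately show "frag_cmul (sign (?t \<circ> p)) (oriented_simplex (flag (permute_list (?t \<circ> p) xs)))
      = frag_cmul (sign ?t) (frag_cmul (sign p)
           (chain_join (oriented_simplex (flag (permute_list p ws))) (frag_of {set xs})))"
      by (simp add: chain_join_oriented_simplex[symmetric])
  qed
  also have "\<dots> = chain_join (frag_cmul (sign ?t) (list_subdivision ws)) (frag_of {set xs})"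
    unfolding list_subdivision_def ws(2)
    by (simp only: chain_join_cmul_left chain_join_sum_left frag_cmul_sum)
  also have "\<dots> = frag_cmul ((-1) ^ m) (frag_cmul ((-1) ^ b)
           (chain_join (list_subdivision (take b xs @ drop (Suc b) xs)) (frag_of {set xs})))"
    unfolding ws(3) by (simp only: chain_join_cmul_left)
  finally show ?thesis .
qed

text \<open>Every flag of a simplex ends with the simplex itself, so the subdivision is the cone
  from the barycentre over the subdivided boundary. This recursion makes subdivision a chain
  map.\<close>

lemma subdivision_cone:
  assumes "xs \<noteq> []"
  shows "subdivision (oriented_simplex xs) =
    chain_join (frag_of {set xs}) (subdivision (boundary (oriented_simplex xs)))"
proof -
  obtain m where len: "length xs = Suc m" using assms by (cases xs) auto
  let ?F = "\<lambda>\<pi>. frag_cmul (sign \<pi>) (oriented_simplex (flag (permute_list \<pi> xs)))"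
  let ?D = "\<lambda>b. take b xs @ drop (Suc b) xs"
  have bd: "subdivision (boundary (oriented_simplex xs)) =
      (\<Sum>b<Suc m. frag_cmul ((-1) ^ b) (list_subdivision (?D b)))"
    unfolding boundary_oriented_simplex list_boundary_def len
    by (simp only: subdivision_sum subdivision_cmul subdivision_simplex)
  have "Poly_Mapping.keys (subdivision (boundary (oriented_simplex xs))) \<subseteq> {s. finite s \<and> card s = m}"
  proof
    fix s assume "s \<in> Poly_Mapping.keys (subdivision (boundary (oriented_simplex xs)))"
    then obtain b where b: "b < Suc m" "s \<in> Poly_Mapping.keys (list_subdivision (?D b))"
      unfolding bd using keys_sum[of "\<lambda>b. frag_cmul ((-1) ^ b) (list_subdivision (?D b))" "{..<Suc m}"]
      by (auto simp del: sum.lessThan_Suc)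
    then show "s \<in> {s. finite s \<and> card s = m}"
      by (elim keys_list_subdivision) (use len in auto)
  qed
  note comm = chain_join_vertex_commute[OF this]
  have "subdivision (oriented_simplex xs) = (\<Sum>\<pi> | \<pi> permutes insert m {..<m}. ?F \<pi>)"
    unfolding subdivision_simplex list_subdivision_def len lessThan_Suc ..
  \<comment> \<open>a permutation is determined by the vertex added last and the order of the
    others\<close>
  also have "\<dots> = (\<Sum>b\<in>insert m {..<m}. \<Sum>p | p permutes {..<m}. ?F (transpose m b \<circ> p))"
    by (rule sum_over_permutations_insert) auto
  also have "\<dots> = (\<Sum>b\<in>insert m {..<m}. frag_cmul ((-1) ^ m) (frag_cmul ((-1) ^ b)
           (chain_join (list_subdivision (?D b)) (frag_of {set xs}))))"
    by (rule sum.cong[OF refl], rule list_subdivision_last[OF len]) auto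
  also have "\<dots> = frag_cmul ((-1) ^ m)
      (chain_join (subdivision (boundary (oriented_simplex xs))) (frag_of {set xs}))"
    unfolding bd lessThan_Suc
    by (simp only: chain_join_sum_left chain_join_cmul_left frag_cmul_sum)
  also have "\<dots> = chain_join (frag_of {set xs}) (subdivision (boundary (oriented_simplex xs)))"
    unfolding comm by (simp add: power_mult_distrib[symmetric])
  finally show ?thesis .
qed

lemma subdivision_empty [simp]: "subdivision (frag_of {}) = frag_of {}"
  using subdivision_simplex[of "[]"] by (simp add: list_subdivision_def flag_def)

lemma keys_boundary:
  assumes "\<tau> \<in> Poly_Mapping.keys (boundary c)" "finitary c"
  obtains \<sigma> v where "\<sigma> \<in> Poly_Mapping.keys c" "v \<in> \<sigma>" "\<tau> = \<sigma> - {v}"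
proof -
  obtain \<sigma> where \<sigma>: "\<sigma> \<in> Poly_Mapping.keys c"
      "\<tau> \<in> Poly_Mapping.keys (list_boundary (orientation \<sigma>))"
    using assms(1) keys_frag_extend[of "\<lambda>\<sigma>. list_boundary (orientation \<sigma>)" c]
    unfolding boundary_def Let_def list_boundary_def[symmetric] by blast
  let ?o = "orientation \<sigma>"
  let ?F = "\<lambda>i. frag_cmul ((-1) ^ i) (oriented_simplex (take i ?o @ drop (Suc i) ?o))"
  have "\<tau> \<in> (\<Union>i<length ?o. Poly_Mapping.keys (?F i))"
    using \<sigma>(2) keys_sum[of ?F "{..<length ?o}"] unfolding list_boundary_def by blast
  then obtain i where i: "i < length ?o"
    and "\<tau> \<in> Poly_Mapping.keys (oriented_simplex (take i ?o @ drop (Suc i) ?o))" by auto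
  then have \<tau>: "\<tau> = set (take i ?o @ drop (Suc i) ?o)" using oriented_simplex_in_keys by blast
  have "finite \<sigma>" using assms(2) \<sigma>(1) by (simp add: finitary_def)
  note o = orientation_finite[OF this]
  have "?o = take i ?o @ ?o ! i # drop (Suc i) ?o" using i by (rule id_take_nth_drop)
  then have d: "distinct (take i ?o @ ?o ! i # drop (Suc i) ?o)"
       "\<sigma> = set (take i ?o @ ?o ! i # drop (Suc i) ?o)" using o by metis+
  have "?o ! i \<in> \<sigma>" using i o(2) nth_mem by blast
  moreover have "\<sigma> - {?o ! i} = \<tau>"
    unfolding \<tau> by (subst (1) d(2)) (use d(1) in auto)
  ultimately show thesis using \<sigma>(1) that by blast
qed

lemma keys_boundary_card:
  assumes "Poly_Mapping.keys c \<subseteq> {\<sigma>. finite \<sigma> \<and> card \<sigma> = Suc k}"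
  shows "Poly_Mapping.keys (boundary c) \<subseteq> {\<sigma>. finite \<sigma> \<and> card \<sigma> = k}"
proof
  fix \<tau> assume "\<tau> \<in> Poly_Mapping.keys (boundary c)"
  moreover have "finitary c" using assms by (auto simp: finitary_def)
  ultimately obtain \<sigma> v where "\<sigma> \<in> Poly_Mapping.keys c" "v \<in> \<sigma>" "\<tau> = \<sigma> - {v}"
    by (rule keys_boundary)
  moreover from this have "finite \<sigma>" "card \<sigma> = Suc k" using assms by auto
  ultimately show "\<tau> \<in> {\<sigma>. finite \<sigma> \<and> card \<sigma> = k}" by simp
qed

text \<open>By induction on the number of vertices: the formula for the boundary of a cone reduces
  the claim for a simplex to the claim for its boundary.\<close>

lemma boundary_subdivision:
  assumes "finitary c"
  shows "boundary (subdivision c) = subdivision (boundary c)"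
proof -
  have *: "boundary (subdivision c) = subdivision (boundary c)"
    if "Poly_Mapping.keys c \<subseteq> {\<sigma>. finite \<sigma> \<and> card \<sigma> = k}" for c :: "'a set \<Rightarrow>\<^sub>0 int" and k
    using that
  proof (induction k arbitrary: c)
    case 0
    then show ?case
    proof (induction c rule: chain_induct)
      case (simplex xs)
      then show ?case by simp
    qed (auto simp: subdivision_diff boundary_diff)
  next
    case (Suc k)
    from Suc.prems show ?case
    proof (induction c rule: chain_induct)
      case (simplex xs)
      let ?s = "oriented_simplex xs"
      have "Poly_Mapping.keys ?s \<subseteq> {\<sigma>. finite \<sigma> \<and> card \<sigma> = Suc k}"
        using oriented_simplex_in_keys[of _ xs] simplex by (auto simp: distinct_card)
      then have "boundary (subdivision (boundary ?s)) = subdivision (boundary (boundary ?s))"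
        by (intro Suc.IH keys_boundary_card)
      moreover have "xs \<noteq> []" using simplex by auto
      ultimately show ?case
        by (simp add: subdivision_cone boundary_cone boundary_boundary)
    qed (auto simp: subdivision_diff boundary_diff)
  qed
  from assms show ?thesis
  proof (induction c rule: finitary_induct)
    case (simplex xs)
    have "Poly_Mapping.keys (oriented_simplex xs) \<subseteq> {\<sigma>. finite \<sigma> \<and> card \<sigma> = length xs}"
      using oriented_simplex_in_keys[of _ xs] by (auto simp: oriented_simplex_def split: if_splits)
    then show ?case by (rule *)
  qed (auto simp: subdivision_diff boundary_diff)
qed

section \<open>Chains and cycles of a complex\<close>

text \<open>Chains of degree \<open>k - 1\<close>. Counting vertices keeps the augmentation degree
  within the natural numbers.\<close>

definition chain_space :: "nat \<Rightarrow> 'v set set \<Rightarrow> ('v set \<Rightarrow>\<^sub>0 int) set" where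
  "chain_space k K = {c. Poly_Mapping.keys c \<subseteq> {\<sigma> \<in> K. card \<sigma> = k}}"

definition cycle_space :: "nat \<Rightarrow> 'v set set \<Rightarrow> ('v set \<Rightarrow>\<^sub>0 int) set" where
  "cycle_space k K = {c \<in> chain_space k K. boundary c = 0}"

lemma chain_spaceI: "(\<And>\<sigma>. \<sigma> \<in> Poly_Mapping.keys c \<Longrightarrow> \<sigma> \<in> K \<and> card \<sigma> = k) \<Longrightarrow> c \<in> chain_space k K"
  by (auto simp: chain_space_def)

lemma chain_spaceD: "c \<in> chain_space k K \<Longrightarrow> \<sigma> \<in> Poly_Mapping.keys c \<Longrightarrow> \<sigma> \<in> K \<and> card \<sigma> = k"
  by (auto simp: chain_space_def)

lemma chain_space_0 [simp]: "0 \<in> chain_space k K" by (simp add: chain_space_def)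

lemma chain_space_diff: "a \<in> chain_space k K \<Longrightarrow> b \<in> chain_space k K \<Longrightarrow> a - b \<in> chain_space k K"
  using keys_diff[of a b] by (auto simp: chain_space_def)

lemma chain_space_minus: "a \<in> chain_space k K \<Longrightarrow> - a \<in> chain_space k K"
  by (auto simp: chain_space_def)

lemma chain_space_add: "a \<in> chain_space k K \<Longrightarrow> b \<in> chain_space k K \<Longrightarrow> a + b \<in> chain_space k K"
  using keys_add[of a b] by (auto simp: chain_space_def)

lemma chain_space_cmul: "a \<in> chain_space k K \<Longrightarrow> frag_cmul m a \<in> chain_space k K"
  by (auto simp: chain_space_def)

lemma chain_space_sum: "(\<And>i. i \<in> I \<Longrightarrow> F i \<in> chain_space k K) \<Longrightarrow> sum F I \<in> chain_space k K"
  by (induction I rule: infinite_finite_induct) (auto intro: chain_space_add)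

lemma chain_space_frag_extend:
  "(\<And>\<sigma>. \<sigma> \<in> Poly_Mapping.keys c \<Longrightarrow> F \<sigma> \<in> chain_space k K) \<Longrightarrow> frag_extend F c \<in> chain_space k K"
  unfolding frag_extend_def by (intro chain_space_sum chain_space_cmul)

lemma chain_space_mono: "K \<subseteq> L \<Longrightarrow> a \<in> chain_space k K \<Longrightarrow> a \<in> chain_space k L"
  by (auto simp: chain_space_def)

lemma cycle_space_0 [simp]: "0 \<in> cycle_space k K" by (simp add: cycle_space_def)

lemma cycle_space_diff: "a \<in> cycle_space k K \<Longrightarrow> b \<in> cycle_space k K \<Longrightarrow> a - b \<in> cycle_space k K"
  by (simp add: cycle_space_def chain_space_diff boundary_diff)

lemma cycle_space_add: "a \<in> cycle_space k K \<Longrightarrow> b \<in> cycle_space k K \<Longrightarrow> a + b \<in> cycle_space k K"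
  by (simp add: cycle_space_def chain_space_add boundary_add)

lemma cycle_space_minus: "a \<in> cycle_space k K \<Longrightarrow> - a \<in> cycle_space k K"
  by (simp add: cycle_space_def chain_space_minus boundary_minus)

lemma cycle_space_cmul: "a \<in> cycle_space k K \<Longrightarrow> frag_cmul m a \<in> cycle_space k K"
  by (simp add: cycle_space_def chain_space_cmul boundary_cmul)

lemma cycle_space_sum: "(\<And>i. i \<in> I \<Longrightarrow> F i \<in> cycle_space k K) \<Longrightarrow> sum F I \<in> cycle_space k K"
  by (induction I rule: infinite_finite_induct) (auto intro: cycle_space_add)

lemma cycle_space_frag_extend:
  "(\<And>\<sigma>. \<sigma> \<in> Poly_Mapping.keys c \<Longrightarrow> F \<sigma> \<in> cycle_space k K) \<Longrightarrow> frag_extend F c \<in> cycle_space k K"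
  unfolding frag_extend_def by (intro cycle_space_sum cycle_space_cmul)

lemma cycle_space_mono: "K \<subseteq> L \<Longrightarrow> a \<in> cycle_space k K \<Longrightarrow> a \<in> cycle_space k L"
  by (auto simp: cycle_space_def intro: chain_space_mono)

lemma cycle_space_chain: "z \<in> cycle_space k K \<Longrightarrow> z \<in> chain_space k K"
  by (simp add: cycle_space_def)

lemma cycle_space_boundary: "z \<in> cycle_space k K \<Longrightarrow> boundary z = 0"
  by (simp add: cycle_space_def)

lemma complex_finite: "simplicial_complex K \<Longrightarrow> \<sigma> \<in> K \<Longrightarrow> finite \<sigma>"
  by (simp add: simplicial_complex_def)

lemma complex_face: "simplicial_complex K \<Longrightarrow> \<sigma> \<in> K \<Longrightarrow> \<tau> \<subseteq> \<sigma> \<Longrightarrow> \<tau> \<in> K"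
  by (simp add: simplicial_complex_def)

lemma complex_empty: "simplicial_complex K \<Longrightarrow> {} \<in> K"
  by (simp add: simplicial_complex_def)

lemma chain_space_finitary: "simplicial_complex K \<Longrightarrow> c \<in> chain_space k K \<Longrightarrow> finitary c"
  unfolding finitary_def using chain_spaceD complex_finite by blast

lemma chain_space_keys_card:
  "simplicial_complex K \<Longrightarrow> c \<in> chain_space k K \<Longrightarrow>
     Poly_Mapping.keys c \<subseteq> {\<sigma>. finite \<sigma> \<and> card \<sigma> = k}"
  using chain_spaceD complex_finite by blast

lemma boundary_chain_space:
  assumes "simplicial_complex K" "c \<in> chain_space (Suc k) K"
  shows "boundary c \<in> chain_space k K"
proof (rule chain_spaceI)
  fix \<tau> assume "\<tau> \<in> Poly_Mapping.keys (boundary c)"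
  then obtain \<sigma> v where \<sigma>: "\<sigma> \<in> Poly_Mapping.keys c" "v \<in> \<sigma>" "\<tau> = \<sigma> - {v}"
    using keys_boundary[OF _ chain_space_finitary[OF assms]] by metis
  then have "\<sigma> \<in> K" "card \<sigma> = Suc k" using chain_spaceD[OF assms(2)] by auto
  then show "\<tau> \<in> K \<and> card \<tau> = k"
    using \<sigma> complex_face[OF assms(1), of \<sigma> \<tau>] complex_finite[OF assms(1)] by auto
qed

lemma boundary_degree_0:
  assumes "simplicial_complex K" "c \<in> chain_space 0 K" shows "boundary c = 0"
proof -
  have "Poly_Mapping.keys c \<subseteq> {{}}"
    using chain_space_keys_card[OF assms] by auto
  then show ?thesis
    by (induction c rule: frag_induction) (auto simp: boundary_diff)
qed

lemma boundary_cycle: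
  assumes "simplicial_complex K" "c \<in> chain_space (Suc k) K"
  shows "boundary c \<in> cycle_space k K"
  using boundary_chain_space[OF assms] boundary_boundary[OF chain_space_finitary[OF assms]]
  by (simp add: cycle_space_def)

lemma keys_chain_join:
  assumes "\<rho> \<in> Poly_Mapping.keys (chain_join a b)" "finitary a" "finitary b"
  obtains \<sigma> \<tau> where "\<sigma> \<in> Poly_Mapping.keys a" "\<tau> \<in> Poly_Mapping.keys b" "\<rho> = \<sigma> \<union> \<tau>"
    "\<sigma> \<inter> \<tau> = {}" "card \<rho> = card \<sigma> + card \<tau>"
proof -
  let ?G = "\<lambda>\<sigma>. frag_extend (\<lambda>\<tau>. oriented_simplex (orientation \<sigma> @ orientation \<tau>)) b"
  obtain \<sigma> where \<sigma>: "\<sigma> \<in> Poly_Mapping.keys a" "\<rho> \<in> Poly_Mapping.keys (?G \<sigma>)"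
    using assms(1) keys_frag_extend[of ?G a] unfolding chain_join_def by blast
  obtain \<tau> where \<tau>: "\<tau> \<in> Poly_Mapping.keys b"
     "\<rho> \<in> Poly_Mapping.keys (oriented_simplex (orientation \<sigma> @ orientation \<tau>))"
    using \<sigma>(2) keys_frag_extend[of "\<lambda>\<tau>. oriented_simplex (orientation \<sigma> @ orientation \<tau>)" b] by blast
  have f: "finite \<sigma>" "finite \<tau>" using assms \<sigma> \<tau> by (auto simp: finitary_def)
  have "\<rho> = \<sigma> \<union> \<tau>" "\<sigma> \<inter> \<tau> = {}"
    using oriented_simplex_in_keys[OF \<tau>(2)] orientation_finite[OF f(1)] orientation_finite[OF f(2)]
    by auto
  then show thesis using that[of \<sigma> \<tau>] \<sigma> \<tau> f by (simp add: card_Un_disjoint)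
qed

lemma chain_join_chain_space:
  assumes "a \<in> chain_space k K" "b \<in> chain_space l L" "simplicial_complex K" "simplicial_complex L"
    and "\<And>\<sigma> \<tau>. \<sigma> \<in> K \<Longrightarrow> \<tau> \<in> L \<Longrightarrow> card \<sigma> = k \<Longrightarrow> card \<tau> = l \<Longrightarrow> \<sigma> \<inter> \<tau> = {} \<Longrightarrow> \<sigma> \<union> \<tau> \<in> M"
  shows "chain_join a b \<in> chain_space (k + l) M"
proof (rule chain_spaceI)
  have f: "finitary a" "finitary b" using assms chain_space_finitary by blast+
  fix \<rho> assume "\<rho> \<in> Poly_Mapping.keys (chain_join a b)"
  then obtain \<sigma> \<tau> where "\<sigma> \<in> Poly_Mapping.keys a" "\<tau> \<in> Poly_Mapping.keys b" "\<rho> = \<sigma> \<union> \<tau>"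
    "\<sigma> \<inter> \<tau> = {}" "card \<rho> = card \<sigma> + card \<tau>"
    using keys_chain_join[OF _ f] by metis
  then show "\<rho> \<in> M \<and> card \<rho> = k + l"
    using assms(5)[of \<sigma> \<tau>] chain_spaceD[OF assms(1), of \<sigma>] chain_spaceD[OF assms(2), of \<tau>] by simp
qed

lemma cone_chain_space:
  assumes "c \<in> chain_space k K" "simplicial_complex K"
    and "\<And>\<sigma>. \<sigma> \<in> K \<Longrightarrow> card \<sigma> = k \<Longrightarrow> insert v \<sigma> \<in> M"
  shows "chain_join (frag_of {v}) c \<in> chain_space (Suc k) M"
proof -
  have "frag_of {v} \<in> chain_space 1 {{}, {v}}" by (simp add: chain_space_def)
  moreover have "simplicial_complex {{}, {v}}" by (auto simp: simplicial_complex_def)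
  ultimately have "chain_join (frag_of {v}) c \<in> chain_space (1 + k) M"
    using assms by (intro chain_join_chain_space[where K = "{{}, {v}}" and L = K]) auto
  then show ?thesis by simp
qed

lemma keys_simplicial_chain_map:
  assumes "\<rho> \<in> Poly_Mapping.keys (simplicial_chain_map f c)" "finitary c"
  obtains \<sigma> where "\<sigma> \<in> Poly_Mapping.keys c" "\<rho> = f ` \<sigma>" "card \<rho> = card \<sigma>"
proof -
  obtain \<sigma> where \<sigma>: "\<sigma> \<in> Poly_Mapping.keys c"
      "\<rho> \<in> Poly_Mapping.keys (oriented_simplex (map f (orientation \<sigma>)))"
    using assms(1) keys_frag_extend[of "\<lambda>\<sigma>. oriented_simplex (map f (orientation \<sigma>))" c]
    unfolding simplicial_chain_map_def by blast
  have "finite \<sigma>" using assms \<sigma> by (auto simp: finitary_def)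
  then have "\<rho> = f ` \<sigma>" "card \<rho> = card \<sigma>"
    using oriented_simplex_in_keys[OF \<sigma>(2)] orientation_finite[of \<sigma>] length_orientation[of \<sigma>]
    by auto
  then show thesis using that \<sigma>(1) by blast
qed

lemma simplicial_chain_map_chain_space:
  assumes "c \<in> chain_space k K" "simplicial_complex K" "\<And>\<sigma>. \<sigma> \<in> K \<Longrightarrow> f ` \<sigma> \<in> L"
  shows "simplicial_chain_map f c \<in> chain_space k L"
proof (rule chain_spaceI)
  fix \<rho> assume "\<rho> \<in> Poly_Mapping.keys (simplicial_chain_map f c)"
  then obtain \<sigma> where "\<sigma> \<in> Poly_Mapping.keys c" "\<rho> = f ` \<sigma>" "card \<rho> = card \<sigma>"
    using keys_simplicial_chain_map[OF _ chain_space_finitary[OF assms(2,1)]] by metis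
  then show "\<rho> \<in> L \<and> card \<rho> = k" using assms chain_spaceD[OF assms(1), of \<sigma>] by simp
qed

lemma simplicial_chain_map_cycle_space:
  assumes "z \<in> cycle_space k K" "simplicial_complex K" "\<And>\<sigma>. \<sigma> \<in> K \<Longrightarrow> f ` \<sigma> \<in> L"
  shows "simplicial_chain_map f z \<in> cycle_space k L"
  using assms simplicial_chain_map_chain_space[of z k K f L] chain_space_finitary[of K z k]
  by (simp add: cycle_space_def boundary_simplicial_chain_map)

lemma simplicial_complex_order_complex: "simplicial_complex (order_complex X)"
  by (auto simp: simplicial_complex_def order_complex_def intro: finite_subset)

lemma keys_subdivision:
  assumes "s \<in> Poly_Mapping.keys (subdivision c)" "finitary c"
  obtains \<sigma> where "\<sigma> \<in> Poly_Mapping.keys c" "s \<in> order_complex {\<tau>. \<tau> \<noteq> {} \<and> \<tau> \<subseteq> \<sigma>}" "card s = card \<sigma>"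
proof -
  obtain \<sigma> where \<sigma>: "\<sigma> \<in> Poly_Mapping.keys c" "s \<in> Poly_Mapping.keys (list_subdivision (orientation \<sigma>))"
    using assms(1) keys_frag_extend[of "\<lambda>\<sigma>. list_subdivision (orientation \<sigma>)" c]
    unfolding subdivision_def Let_def list_subdivision_def[symmetric] by blast
  have f: "finite \<sigma>" using assms \<sigma> by (auto simp: finitary_def)
  let ?o = "orientation \<sigma>"
  obtain \<pi> where \<pi>: "\<pi> permutes {..<length ?o}" "s = set (flag (permute_list \<pi> ?o))" "card s = length ?o"
    using \<sigma>(2) by (rule keys_list_subdivision)
  let ?p = "permute_list \<pi> ?o"
  have sp: "set ?p = \<sigma>" using set_permute_list[OF \<pi>(1)] orientation_finite[OF f] by simp
  have s: "s = (\<lambda>i. set (take (Suc i) ?p)) ` {..<length ?p}" using \<pi>(2) set_flag by blast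
  have "s \<in> order_complex {\<tau>. \<tau> \<noteq> {} \<and> \<tau> \<subseteq> \<sigma>}"
    unfolding order_complex_def
  proof (intro CollectI conjI ballI)
    show "finite s" unfolding s by simp
    show "s \<subseteq> {\<tau>. \<tau> \<noteq> {} \<and> \<tau> \<subseteq> \<sigma>}"
    proof
      fix \<tau> assume "\<tau> \<in> s"
      then obtain i where i: "i < length ?p" "\<tau> = set (take (Suc i) ?p)" unfolding s by blast
      moreover have "take (Suc i) ?p \<noteq> []" using i(1) by (auto simp del: length_permute_list)
      ultimately show "\<tau> \<in> {\<tau>. \<tau> \<noteq> {} \<and> \<tau> \<subseteq> \<sigma>}" using set_take_subset[of "Suc i" ?p] sp by auto
    qed
    fix x y assume "x \<in> s" "y \<in> s"
    then obtain i j where ij: "x = set (take (Suc i) ?p)" "y = set (take (Suc j) ?p)" unfolding s by blast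
    show "x \<le> y \<or> y \<le> x"
      unfolding ij using set_take_subset_set_take[of "Suc i" "Suc j" ?p] set_take_subset_set_take[of "Suc j" "Suc i" ?p]
      by linarith
  qed
  then show thesis using that[of \<sigma>] \<sigma>(1) \<pi>(3) length_orientation[OF f] by simp
qed

lemma order_complex_mono: "A \<subseteq> B \<Longrightarrow> order_complex A \<subseteq> order_complex B"
  by (auto simp: order_complex_def)

lemma subdivision_chain_space:
  assumes "simplicial_complex K" "c \<in> chain_space k K"
  shows "subdivision c \<in> chain_space k (order_complex (face_poset K))"
proof (rule chain_spaceI)
  fix s assume "s \<in> Poly_Mapping.keys (subdivision c)"
  then obtain \<sigma> where \<sigma>: "\<sigma> \<in> Poly_Mapping.keys c"
     "s \<in> order_complex {\<tau>. \<tau> \<noteq> {} \<and> \<tau> \<subseteq> \<sigma>}" "card s = card \<sigma>"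
    using keys_subdivision[OF _ chain_space_finitary[OF assms]] by metis
  then have \<sigma>K: "\<sigma> \<in> K" "card \<sigma> = k" using chain_spaceD[OF assms(2)] by auto
  then have "{\<tau>. \<tau> \<noteq> {} \<and> \<tau> \<subseteq> \<sigma>} \<subseteq> face_poset K"
    using complex_face[OF assms(1)] by (auto simp: face_poset_def)
  then show "s \<in> order_complex (face_poset K) \<and> card s = k"
    using order_complex_mono \<sigma> \<sigma>K by blast
qed

lemma subdivision_cycle_space:
  assumes "simplicial_complex K" "c \<in> cycle_space k K"
  shows "subdivision c \<in> cycle_space k (order_complex (face_poset K))"
  using assms subdivision_chain_space[of K c k] boundary_subdivision[of c] chain_space_finitary[of K c k]
  by (simp add: cycle_space_def)

section \<open>Acyclic carriers\<close>

text \<open>The construction of a chain homotopy by induction on the dimension; \<open>B \<sigma>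
  z\<close> is a filling of the cycle \<open>z\<close> inside the carrier of
  \<open>\<sigma>\<close>.\<close>

primrec carrier_lift ::
  "('v set \<Rightarrow> ('w set \<Rightarrow>\<^sub>0 int) \<Rightarrow> ('w set \<Rightarrow>\<^sub>0 int)) \<Rightarrow> (('v set \<Rightarrow>\<^sub>0 int) \<Rightarrow> ('w set \<Rightarrow>\<^sub>0 int)) \<Rightarrow>
    nat \<Rightarrow> 'v set \<Rightarrow> ('w set \<Rightarrow>\<^sub>0 int)" where
  "carrier_lift B \<delta> 0 = (\<lambda>\<sigma>. B \<sigma> (\<delta> (frag_of \<sigma>)))"
| "carrier_lift B \<delta> (Suc k) =
     (\<lambda>\<sigma>. B \<sigma> (\<delta> (frag_of \<sigma>) - frag_extend (carrier_lift B \<delta> k) (boundary (frag_of \<sigma>))))"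

text \<open>The acyclic carrier theorem, for the difference \<open>\<delta>\<close> of two chain
  maps. Once the homotopy \<open>h\<close> is known on the boundary of \<open>\<sigma>\<close>,
  the chain \<open>\<delta> \<sigma> - h (\<partial> \<sigma>)\<close> is a cycle in the carrier
  of \<open>\<sigma>\<close>, and \<open>h \<sigma>\<close> is a filling of it. The condition on
  the empty simplex is stated so that maps which agree there may have an empty carrier for
  it.\<close>

theorem acyclic_carrier:
  fixes \<delta> :: "('v set \<Rightarrow>\<^sub>0 int) \<Rightarrow> ('w set \<Rightarrow>\<^sub>0 int)" and \<Phi> :: "'v set \<Rightarrow> 'w set set"
  assumes L: "simplicial_complex L"
    and diff: "\<And>a b. \<delta> (a - b) = \<delta> a - \<delta> b"
    and bd: "\<And>\<sigma>. \<sigma> \<in> L \<Longrightarrow> boundary (\<delta> (frag_of \<sigma>)) = \<delta> (boundary (frag_of \<sigma>))"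
    and carr: "\<And>\<sigma>. \<sigma> \<in> L \<Longrightarrow> \<delta> (frag_of \<sigma>) \<in> chain_space (card \<sigma>) (\<Phi> \<sigma>)"
    and mono: "\<And>\<sigma> \<tau>. \<sigma> \<in> L \<Longrightarrow> \<tau> \<subseteq> \<sigma> \<Longrightarrow> \<Phi> \<tau> \<subseteq> \<Phi> \<sigma>"
    and acyclic: "\<And>\<sigma> z. \<sigma> \<in> L \<Longrightarrow> \<sigma> \<noteq> {} \<or> \<delta> (frag_of {}) \<noteq> 0 \<Longrightarrow> z \<in> cycle_space (card \<sigma>) (\<Phi> \<sigma>) \<Longrightarrow>
       \<exists>d\<in>chain_space (Suc (card \<sigma>)) (\<Phi> \<sigma>). boundary d = z"
  obtains h where "\<And>\<sigma>. \<sigma> \<in> L \<Longrightarrow> h \<sigma> \<in> chain_space (Suc (card \<sigma>)) (\<Phi> \<sigma>)"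
    "\<And>\<sigma>. \<sigma> \<notin> L \<Longrightarrow> h \<sigma> = 0"
    "\<And>c. Poly_Mapping.keys c \<subseteq> L \<Longrightarrow>
       boundary (frag_extend h c) + frag_extend h (boundary c) = \<delta> c"
proof -
  define B where "B \<sigma> z = (if z = 0 then 0
      else SOME d. d \<in> chain_space (Suc (card \<sigma>)) (\<Phi> \<sigma>) \<and> boundary d = z)" for \<sigma> z
  define h where "h \<sigma> = (if \<sigma> \<in> L then carrier_lift B \<delta> (card \<sigma>) \<sigma> else 0)" for \<sigma>
  have \<delta>0: "\<delta> 0 = 0" using diff[of 0 0] by simp
  have B: "B \<sigma> z \<in> chain_space (Suc (card \<sigma>)) (\<Phi> \<sigma>) \<and> boundary (B \<sigma> z) = z"
    if "\<sigma> \<in> L" "\<sigma> \<noteq> {} \<or> \<delta> (frag_of {}) \<noteq> 0" "z \<in> cycle_space (card \<sigma>) (\<Phi> \<sigma>)" for \<sigma> z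
  proof (cases "z = 0")
    case False
    then show ?thesis
      using someI_ex[of "\<lambda>d. d \<in> chain_space (Suc (card \<sigma>)) (\<Phi> \<sigma>) \<and> boundary d = z"] acyclic[OF that]
      unfolding B_def by auto
  qed (simp add: B_def)
  have hom: "boundary (frag_extend h c) + frag_extend h (boundary c) = \<delta> c"
    if "Poly_Mapping.keys c \<subseteq> S" "S \<subseteq> L"
       "\<And>\<sigma>. \<sigma> \<in> S \<Longrightarrow> boundary (h \<sigma>) = \<delta> (frag_of \<sigma>) - frag_extend h (boundary (frag_of \<sigma>))" for c S
    using that(1)
  proof (induction c rule: frag_induction)
    case (diff a b)
    then show ?case
      by (simp add: frag_extend_diff boundary_diff assms(2) algebra_simps)
  qed (use that in \<open>auto simp: \<delta>0\<close>)
  have main: "\<forall>\<sigma>\<in>L. card \<sigma> = k \<longrightarrow> h \<sigma> \<in> chain_space (Suc (card \<sigma>)) (\<Phi> \<sigma>) \<and>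
      boundary (h \<sigma>) = \<delta> (frag_of \<sigma>) - frag_extend h (boundary (frag_of \<sigma>))" for k
  proof (induction k)
    case 0
    have "h {} \<in> chain_space (Suc 0) (\<Phi> {}) \<and> boundary (h {}) = \<delta> (frag_of {})"
    proof (cases "\<delta> (frag_of {}) = 0")
      case True
      then have "h {} = 0" by (simp add: h_def B_def)
      then show ?thesis using True by simp
    next
      case False
      have "{} \<in> L" using L complex_empty by blast
      then have "\<delta> (frag_of {}) \<in> cycle_space (card {}) (\<Phi> {})"
        using carr bd \<delta>0 by (fastforce simp: cycle_space_def)
      then show ?thesis using B[OF \<open>{} \<in> L\<close> disjI2[OF False]] \<open>{} \<in> L\<close> by (simp add: h_def)
    qed
    then show ?case using complex_finite[OF L] by auto
  next
    case (Suc k)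
    show ?case
    proof (intro ballI impI)
      fix \<sigma> assume \<sigma>: "\<sigma> \<in> L" "card \<sigma> = Suc k"
      let ?b = "boundary (frag_of \<sigma>)" and ?z = "\<delta> (frag_of \<sigma>) - frag_extend h (boundary (frag_of \<sigma>))"
      have ne: "\<sigma> \<noteq> {}" and fin: "finite \<sigma>" using \<sigma> complex_finite[OF L] by auto
      have kb: "\<tau> \<in> L \<and> card \<tau> = k \<and> \<tau> \<subseteq> \<sigma>" if tb: "\<tau> \<in> Poly_Mapping.keys ?b" for \<tau>
      proof -
        obtain v where "v \<in> \<sigma>" "\<tau> = \<sigma> - {v}"
          using keys_boundary[OF tb] fin by auto
        then show ?thesis using \<sigma> complex_face[OF L \<sigma>(1)] by auto
      qed
      have "frag_extend (carrier_lift B \<delta> k) ?b = frag_extend h ?b"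
        by (rule frag_extend_eq) (use kb in \<open>auto simp: h_def\<close>)
      then have h: "h \<sigma> = B \<sigma> ?z" using \<sigma> by (simp add: h_def)
      have "frag_extend h ?b \<in> chain_space (card \<sigma>) (\<Phi> \<sigma>)"
      proof (rule chain_space_frag_extend)
        fix \<tau> assume "\<tau> \<in> Poly_Mapping.keys ?b"
        from kb[OF this] show "h \<tau> \<in> chain_space (card \<sigma>) (\<Phi> \<sigma>)"
          using Suc.IH \<sigma> mono[OF \<sigma>(1), of \<tau>] chain_space_mono by metis
      qed
      then have "?z \<in> chain_space (card \<sigma>) (\<Phi> \<sigma>)" using carr[OF \<sigma>(1)] by (intro chain_space_diff)
      moreover have "boundary ?z = 0"
      proof -
        have "boundary (frag_extend h ?b) + frag_extend h (boundary ?b) = \<delta> ?b"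
          by (rule hom[of _ "{\<tau> \<in> L. card \<tau> = k}"]) (use kb Suc.IH in auto)
        then show ?thesis using bd[OF \<sigma>(1)] fin by (simp add: boundary_diff boundary_boundary)
      qed
      ultimately have "?z \<in> cycle_space (card \<sigma>) (\<Phi> \<sigma>)" by (simp add: cycle_space_def)
      from B[OF \<sigma>(1) disjI1[OF ne] this]
      show "h \<sigma> \<in> chain_space (Suc (card \<sigma>)) (\<Phi> \<sigma>) \<and> boundary (h \<sigma>) = ?z"
        unfolding h .
    qed
  qed
  show thesis
  proof (rule that)
    show "h \<sigma> \<in> chain_space (Suc (card \<sigma>)) (\<Phi> \<sigma>)" if "\<sigma> \<in> L" for \<sigma> using main that by blast
    show "h \<sigma> = 0" if "\<sigma> \<notin> L" for \<sigma> using that by (simp add: h_def)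
    show "boundary (frag_extend h c) + frag_extend h (boundary c) = \<delta> c"
      if "Poly_Mapping.keys c \<subseteq> L" for c
      by (rule hom[OF that order_refl]) (use main in blast)
  qed
qed

text \<open>The filling is the cone over \<open>z\<close>. Simplices of \<open>z\<close> that
  contain \<open>v\<close> contribute nothing to it, and the formula for the boundary of a cone
  remains true.\<close>

lemma cone_acyclic:
  assumes "simplicial_complex M" "\<And>\<rho>. \<rho> \<in> M \<Longrightarrow> insert v \<rho> \<in> M" "z \<in> cycle_space k M"
  shows "\<exists>d\<in>chain_space (Suc k) M. boundary d = z"
proof
  show "chain_join (frag_of {v}) z \<in> chain_space (Suc k) M"
    using assms by (intro cone_chain_space[where K = M]) (auto simp: cycle_space_def)
  show "boundary (chain_join (frag_of {v}) z) = z"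
    using assms chain_space_finitary[of M z k] by (simp add: boundary_cone cycle_space_def)
qed

text \<open>The form in which carriers are applied: cones are acyclic, so two augmentation
  preserving chain maps carried by the same cones have homologous values on every cycle.\<close>

lemma conical_carrier_homologous:
  fixes \<phi> \<psi> :: "('v set \<Rightarrow>\<^sub>0 int) \<Rightarrow> ('w set \<Rightarrow>\<^sub>0 int)" and \<Phi> :: "'v set \<Rightarrow> 'w set set"
  assumes L: "simplicial_complex L"
    and diff: "\<And>a b. \<phi> (a - b) = \<phi> a - \<phi> b" "\<And>a b. \<psi> (a - b) = \<psi> a - \<psi> b"
    and bd: "\<And>\<sigma>. \<sigma> \<in> L \<Longrightarrow> boundary (\<phi> (frag_of \<sigma>)) = \<phi> (boundary (frag_of \<sigma>))"
            "\<And>\<sigma>. \<sigma> \<in> L \<Longrightarrow> boundary (\<psi> (frag_of \<sigma>)) = \<psi> (boundary (frag_of \<sigma>))"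
    and aug: "\<phi> (frag_of {}) = \<psi> (frag_of {})"
    and carr: "\<And>\<sigma>. \<sigma> \<in> L \<Longrightarrow> \<sigma> \<noteq> {} \<Longrightarrow> \<phi> (frag_of \<sigma>) \<in> chain_space (card \<sigma>) (\<Phi> \<sigma>)"
              "\<And>\<sigma>. \<sigma> \<in> L \<Longrightarrow> \<sigma> \<noteq> {} \<Longrightarrow> \<psi> (frag_of \<sigma>) \<in> chain_space (card \<sigma>) (\<Phi> \<sigma>)"
    and mono: "\<And>\<sigma> \<tau>. \<sigma> \<in> L \<Longrightarrow> \<tau> \<noteq> {} \<Longrightarrow> \<tau> \<subseteq> \<sigma> \<Longrightarrow> \<Phi> \<tau> \<subseteq> \<Phi> \<sigma>"
    and cone: "\<And>\<sigma>. \<sigma> \<in> L \<Longrightarrow> \<sigma> \<noteq> {} \<Longrightarrow> simplicial_complex (\<Phi> \<sigma>)"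
      "\<And>\<sigma>. \<sigma> \<in> L \<Longrightarrow> \<sigma> \<noteq> {} \<Longrightarrow> \<exists>v. \<forall>\<rho>\<in>\<Phi> \<sigma>. insert v \<rho> \<in> \<Phi> \<sigma>"
    and M: "\<And>\<sigma>. \<sigma> \<in> L \<Longrightarrow> \<sigma> \<noteq> {} \<Longrightarrow> \<Phi> \<sigma> \<subseteq> M"
    and z: "z \<in> cycle_space k L"
  shows "\<exists>d\<in>chain_space (Suc k) M. boundary d = \<phi> z - \<psi> z"
proof -
  \<comment> \<open>the difference of the two maps vanishes on the empty simplex, whose carrier
    can therefore be taken without any simplices\<close>
  define \<Psi> where "\<Psi> \<sigma> = (if \<sigma> = {} then {} else \<Phi> \<sigma>)" for \<sigma>
  define \<delta> where "\<delta> c = \<phi> c - \<psi> c" for c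
  obtain h where h: "\<And>\<sigma>. \<sigma> \<in> L \<Longrightarrow> h \<sigma> \<in> chain_space (Suc (card \<sigma>)) (\<Psi> \<sigma>)"
    "\<And>c. Poly_Mapping.keys c \<subseteq> L \<Longrightarrow>
       boundary (frag_extend h c) + frag_extend h (boundary c) = \<delta> c"
  proof (rule acyclic_carrier[OF L, of \<delta> \<Psi>])
    fix \<sigma> z assume "\<sigma> \<in> L" "\<sigma> \<noteq> {} \<or> \<delta> (frag_of {}) \<noteq> 0" "z \<in> cycle_space (card \<sigma>) (\<Psi> \<sigma>)"
    then have "\<sigma> \<noteq> {}" "z \<in> cycle_space (card \<sigma>) (\<Phi> \<sigma>)" using aug by (auto simp: \<delta>_def \<Psi>_def)
    then show "\<exists>d\<in>chain_space (Suc (card \<sigma>)) (\<Psi> \<sigma>). boundary d = z"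
      using cone_acyclic[of "\<Phi> \<sigma>"] cone[OF \<open>\<sigma> \<in> L\<close>] by (auto simp: \<Psi>_def)
  next
    fix \<sigma> assume "\<sigma> \<in> L"
    then show "boundary (\<delta> (frag_of \<sigma>)) = \<delta> (boundary (frag_of \<sigma>))"
      using bd by (simp add: \<delta>_def boundary_diff)
    show "\<delta> (frag_of \<sigma>) \<in> chain_space (card \<sigma>) (\<Psi> \<sigma>)"
      using carr[OF \<open>\<sigma> \<in> L\<close>] aug by (cases "\<sigma> = {}") (auto simp: \<delta>_def \<Psi>_def intro: chain_space_diff)
    fix \<tau> assume "\<tau> \<subseteq> \<sigma>"
    then show "\<Psi> \<tau> \<subseteq> \<Psi> \<sigma>" using mono[OF \<open>\<sigma> \<in> L\<close>, of \<tau>] by (auto simp: \<Psi>_def)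
  qed (use diff in \<open>auto simp: \<delta>_def\<close>)
  have "Poly_Mapping.keys z \<subseteq> L" using z chain_spaceD by (auto simp: cycle_space_def)
  from h(2)[OF this] have "boundary (frag_extend h z) = \<delta> z" using z by (simp add: cycle_space_def)
  moreover have "frag_extend h z \<in> chain_space (Suc k) M"
  proof (rule chain_space_frag_extend)
    fix \<sigma> assume "\<sigma> \<in> Poly_Mapping.keys z"
    then have "\<sigma> \<in> L" "card \<sigma> = k" using z chain_spaceD by (auto simp: cycle_space_def)
    then show "h \<sigma> \<in> chain_space (Suc k) M"
      using h(1)[of \<sigma>] M[of \<sigma>] chain_space_mono[of "\<Psi> \<sigma>" M] by (auto simp: \<Psi>_def split: if_splits)
  qed
  ultimately show ?thesis unfolding \<delta>_def by blast
qed

section \<open>Homologous chains and subdivision\<close>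

definition homologous :: "nat \<Rightarrow> 'v set set \<Rightarrow> ('v set \<Rightarrow>\<^sub>0 int) \<Rightarrow> ('v set \<Rightarrow>\<^sub>0 int) \<Rightarrow> bool" where
  "homologous k K a b \<longleftrightarrow> (\<exists>d\<in>chain_space (Suc k) K. boundary d = a - b)"

lemma homologous_refl: "homologous k K a a"
  unfolding homologous_def by (rule bexI[of _ 0]) simp_all

lemma homologous_sym: "homologous k K a b \<Longrightarrow> homologous k K b a"
  unfolding homologous_def by (metis boundary_minus chain_space_minus minus_diff_eq)

lemma homologous_trans:
  assumes "homologous k K a b" "homologous k K b c" shows "homologous k K a c"
proof -
  obtain d e where "d \<in> chain_space (Suc k) K" "boundary d = a - b"
    "e \<in> chain_space (Suc k) K" "boundary e = b - c"
    using assms by (auto simp: homologous_def)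
  then show ?thesis unfolding homologous_def
    by (intro bexI[of _ "d + e"]) (simp_all add: boundary_add chain_space_add)
qed

lemma homologous_mono: "K \<subseteq> L \<Longrightarrow> homologous k K a b \<Longrightarrow> homologous k L a b"
  unfolding homologous_def using chain_space_mono[of K L _ "Suc k"] by blast

lemma homologous_simplicial:
  assumes "homologous k K a b" "simplicial_complex K" "\<And>\<sigma>. \<sigma> \<in> K \<Longrightarrow> f ` \<sigma> \<in> L"
  shows "homologous k L (simplicial_chain_map f a) (simplicial_chain_map f b)"
proof -
  obtain d where d: "d \<in> chain_space (Suc k) K" "boundary d = a - b"
    using assms(1) by (auto simp: homologous_def)
  have "boundary (simplicial_chain_map f d) = simplicial_chain_map f a - simplicial_chain_map f b"
    using boundary_simplicial_chain_map[OF chain_space_finitary[OF assms(2) d(1)], of f] d(2)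
    by (simp add: simplicial_chain_map_diff)
  then show ?thesis
    unfolding homologous_def using simplicial_chain_map_chain_space[OF d(1) assms(2,3)] by blast
qed

lemma chain_space_above:
  assumes "\<And>\<sigma>. \<sigma> \<in> K \<Longrightarrow> card \<sigma> \<le> d" "d < k" "c \<in> chain_space k K"
  shows "c = 0"
  using assms chain_spaceD[OF assms(3)] keys_eq_empty[of c] by fastforce

lemma homologous_top:
  assumes "\<And>\<sigma>. \<sigma> \<in> K \<Longrightarrow> card \<sigma> \<le> k" "homologous k K a b" shows "a = b"
proof -
  obtain d where d: "d \<in> chain_space (Suc k) K" "boundary d = a - b"
    using assms(2) by (auto simp: homologous_def)
  have "d = 0" using chain_space_above[OF assms(1) lessI d(1)] by blast
  then show ?thesis using d(2) by simp
qed

lemma simplicial_complex_Pow: "finite \<sigma> \<Longrightarrow> simplicial_complex (Pow \<sigma>)"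
  by (auto simp: simplicial_complex_def intro: finite_subset)

text \<open>Choosing a vertex of every face is a simplicial map from the subdivision back to the
  complex, whatever the choices are. In homology it inverts the subdivision operator.\<close>

definition vertex_choice :: "'v set \<Rightarrow> 'v" where
  "vertex_choice \<sigma> = (SOME v. v \<in> \<sigma>)"

lemma vertex_choice_in: "\<sigma> \<noteq> {} \<Longrightarrow> vertex_choice \<sigma> \<in> \<sigma>"
  unfolding vertex_choice_def by (rule someI_ex) auto

lemma chain_Union_in:
  assumes "s \<in> order_complex X" "s \<noteq> {}" shows "\<Union>s \<in> (s :: 'v set set)"
proof -
  have "finite s" using assms by (simp add: order_complex_def)
  then show ?thesis
    using assms(2) assms(1)
  proof (induction s rule: finite_ne_induct)
    case (insert a s)
    then have "\<Union>s \<in> s" by (auto simp: order_complex_def)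
    moreover have "a \<subseteq> \<Union>s \<or> \<Union>s \<subseteq> a"
      using insert.prems calculation by (auto simp: order_complex_def)
    ultimately show ?case by (metis Union_insert insertCI sup.absorb1 sup.absorb2)
  qed auto
qed

lemma vertex_choice_image:
  assumes "simplicial_complex K" "s \<in> order_complex (face_poset K)"
  shows "vertex_choice ` s \<in> K"
proof (cases "s = {}")
  case False
  have sub: "s \<subseteq> face_poset K" using assms(2) by (simp add: order_complex_def)
  then have "\<Union>s \<in> K" using chain_Union_in[OF assms(2) False] by (auto simp: face_poset_def)
  moreover have "vertex_choice ` s \<subseteq> \<Union>s"
  proof
    fix v assume "v \<in> vertex_choice ` s"
    then obtain \<tau> where "\<tau> \<in> s" "v = vertex_choice \<tau>" by blast
    moreover from this have "\<tau> \<noteq> {}" using sub by (auto simp: face_poset_def)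
    ultimately show "v \<in> \<Union>s" using vertex_choice_in[of \<tau>] by auto
  qed
  ultimately show ?thesis using complex_face[OF assms(1)] by blast
qed (simp add: complex_empty[OF assms(1)])

text \<open>Both maps send a simplex to a chain on its own faces.\<close>

lemma vertex_choice_subdivision:
  assumes K: "simplicial_complex K" and z: "z \<in> cycle_space k K"
  shows "homologous k K (simplicial_chain_map vertex_choice (subdivision z)) z"
  unfolding homologous_def
proof (rule conical_carrier_homologous[OF K, where \<Phi> = Pow and \<psi> = "\<lambda>c. c"
     and \<phi> = "\<lambda>c. simplicial_chain_map vertex_choice (subdivision c)"])
  fix \<sigma> assume \<sigma>: "\<sigma> \<in> K"
  then have fin: "finite \<sigma>" using complex_finite K by blast
  show "boundary (simplicial_chain_map vertex_choice (subdivision (frag_of \<sigma>))) =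
     simplicial_chain_map vertex_choice (subdivision (boundary (frag_of \<sigma>)))"
    using fin by (simp add: boundary_simplicial_chain_map boundary_subdivision)
  show f: "frag_of \<sigma> \<in> chain_space (card \<sigma>) (Pow \<sigma>)" by (simp add: chain_space_def)
  show "simplicial_chain_map vertex_choice (subdivision (frag_of \<sigma>)) \<in> chain_space (card \<sigma>) (Pow \<sigma>)"
    by (rule simplicial_chain_map_chain_space[OF subdivision_chain_space[OF simplicial_complex_Pow[OF fin] f]])
       (use vertex_choice_image[OF simplicial_complex_Pow[OF fin]] simplicial_complex_order_complex in auto)
  show "simplicial_complex (Pow \<sigma>)" by (rule simplicial_complex_Pow[OF fin])
  show "Pow \<sigma> \<subseteq> K" using complex_face[OF K \<sigma>] by blast
  assume "\<sigma> \<noteq> {}"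
  then show "\<exists>v. \<forall>\<rho>\<in>Pow \<sigma>. insert v \<rho> \<in> Pow \<sigma>" by blast
qed (use z in \<open>auto simp: subdivision_diff simplicial_chain_map_diff\<close>)

text \<open>A chain of faces and its image both lie in the subdivision of the largest face of the
  chain, which is a cone from the barycentre of that face.\<close>

lemma subdivision_vertex_choice:
  assumes K: "simplicial_complex K" and z: "z \<in> cycle_space k (order_complex (face_poset K))"
  shows "homologous k (order_complex (face_poset K)) (subdivision (simplicial_chain_map vertex_choice z)) z"
  unfolding homologous_def
proof (rule conical_carrier_homologous[OF simplicial_complex_order_complex,
     where \<Phi> = "\<lambda>s. order_complex (face_poset (Pow (\<Union>s)))" and \<psi> = "\<lambda>c. c"
     and \<phi> = "\<lambda>c. subdivision (simplicial_chain_map vertex_choice c)"])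
  fix s assume s: "s \<in> order_complex (face_poset K)"
  then have fin: "finite s" by (simp add: order_complex_def)
  have ne: "\<tau> \<noteq> {}" if "\<tau> \<in> s" for \<tau> using s that by (auto simp: order_complex_def face_poset_def)
  have sub: "s \<in> order_complex (face_poset (Pow (\<Union>s)))"
    using s by (auto simp: order_complex_def face_poset_def)
  have finU: "finite (\<Union>s)"
    using s complex_finite[OF K] by (auto simp: order_complex_def face_poset_def)
  show "boundary (subdivision (simplicial_chain_map vertex_choice (frag_of s))) =
     subdivision (simplicial_chain_map vertex_choice (boundary (frag_of s)))"
    using fin by (simp add: boundary_simplicial_chain_map boundary_subdivision)
  show f: "frag_of s \<in> chain_space (card s) (order_complex (face_poset (Pow (\<Union>s))))"
    using sub by (simp add: chain_space_def)
  have "simplicial_chain_map vertex_choice (frag_of s) \<in> chain_space (card s) (Pow (\<Union>s))"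
    by (rule simplicial_chain_map_chain_space[OF f simplicial_complex_order_complex])
       (rule vertex_choice_image[OF simplicial_complex_Pow[OF finU]])
  then show "subdivision (simplicial_chain_map vertex_choice (frag_of s))
     \<in> chain_space (card s) (order_complex (face_poset (Pow (\<Union>s))))"
    by (rule subdivision_chain_space[OF simplicial_complex_Pow[OF finU]])
  assume "s \<noteq> {}"
  then have Us: "\<Union>s \<in> s" using chain_Union_in s by blast
  then have "\<Union>s \<in> K" "\<Union>s \<noteq> {}" using s ne by (auto simp: order_complex_def face_poset_def)
  then show "order_complex (face_poset (Pow (\<Union>s))) \<subseteq> order_complex (face_poset K)"
    using complex_face[OF K] by (intro order_complex_mono) (auto simp: face_poset_def)
  show "\<exists>v. \<forall>\<rho>\<in>order_complex (face_poset (Pow (\<Union>s))). insert v \<rho> \<in> order_complex (face_poset (Pow (\<Union>s)))"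
    using \<open>\<Union>s \<noteq> {}\<close> by (intro exI[of _ "\<Union>s"]) (auto simp: order_complex_def face_poset_def)
next
  fix s t assume "t \<subseteq> (s :: 'a set set)"
  then show "order_complex (face_poset (Pow (\<Union>t))) \<subseteq> order_complex (face_poset (Pow (\<Union>s)))"
    by (intro order_complex_mono) (auto simp: face_poset_def)
qed (use z simplicial_complex_order_complex in \<open>auto simp: subdivision_diff simplicial_chain_map_diff\<close>)

section \<open>Integral bases\<close>

text \<open>Bases over the integers of subgroups of chain groups, in particular of groups of
  cycles. This is the form in which bases of top homology are handled.\<close>

definition int_basis :: "('v \<Rightarrow>\<^sub>0 int) set \<Rightarrow> 'i set \<Rightarrow> ('i \<Rightarrow> ('v \<Rightarrow>\<^sub>0 int)) \<Rightarrow> bool" where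
  "int_basis Z I b \<longleftrightarrow> (\<forall>i\<in>I. b i \<in> Z) \<and>
     (\<forall>z\<in>Z. \<exists>c. Poly_Mapping.keys c \<subseteq> I \<and> z = frag_extend b c) \<and>
     (\<forall>c. Poly_Mapping.keys c \<subseteq> I \<longrightarrow> frag_extend b c = 0 \<longrightarrow> c = 0)"

lemma int_basisI:
  assumes "\<And>i. i \<in> I \<Longrightarrow> b i \<in> Z"
    "\<And>z. z \<in> Z \<Longrightarrow> \<exists>c. Poly_Mapping.keys c \<subseteq> I \<and> z = frag_extend b c"
    "\<And>c. Poly_Mapping.keys c \<subseteq> I \<Longrightarrow> frag_extend b c = 0 \<Longrightarrow> c = 0"
  shows "int_basis Z I b"
  using assms by (simp add: int_basis_def)

lemma int_basis_in: "int_basis Z I b \<Longrightarrow> i \<in> I \<Longrightarrow> b i \<in> Z"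
  by (simp add: int_basis_def)

lemma int_basis_span:
  assumes "int_basis Z I b" "z \<in> Z" obtains c where "Poly_Mapping.keys c \<subseteq> I" "z = frag_extend b c"
  using assms unfolding int_basis_def by metis

lemma int_basis_independent:
  "int_basis Z I b \<Longrightarrow> Poly_Mapping.keys c \<subseteq> I \<Longrightarrow> frag_extend b c = 0 \<Longrightarrow> c = 0"
  by (simp add: int_basis_def)

lemma int_basis_cong:
  assumes b: "int_basis Z I b" and eq: "\<And>i. i \<in> I \<Longrightarrow> b i = b' i"
  shows "int_basis Z I b'"
proof -
  have ext: "frag_extend b c = frag_extend b' c" if "Poly_Mapping.keys c \<subseteq> I" for c
    using that eq by (intro frag_extend_eq) auto
  show ?thesis
  proof (rule int_basisI)
    fix z assume "z \<in> Z"
    then obtain c where "Poly_Mapping.keys c \<subseteq> I" "z = frag_extend b c"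
      using int_basis_span[OF b] by blast
    then show "\<exists>c. Poly_Mapping.keys c \<subseteq> I \<and> z = frag_extend b' c" using ext by auto
  qed (use int_basis_in[OF b] int_basis_independent[OF b] ext eq in auto)
qed

lemma additive_frag_extend:
  fixes F :: "('v \<Rightarrow>\<^sub>0 int) \<Rightarrow> ('w \<Rightarrow>\<^sub>0 int)"
  assumes "\<And>a b. F (a - b) = F a - F b"
  shows "F (frag_extend g c) = frag_extend (\<lambda>i. F (g i)) c"
proof -
  have "F 0 = 0" using assms[of 0 0] by simp
  then show ?thesis
    by (induction c rule: frag_induction[OF order_refl]) (simp_all add: frag_extend_diff assms)
qed

lemma int_basis_image:
  fixes F :: "('v \<Rightarrow>\<^sub>0 int) \<Rightarrow> ('w \<Rightarrow>\<^sub>0 int)"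
  assumes b: "int_basis Z I b" and F: "\<And>a b. F (a - b) = F a - F b"
    and bij: "bij_betw F Z Z'" and Z: "0 \<in> Z"
    and cl: "\<And>c. Poly_Mapping.keys c \<subseteq> I \<Longrightarrow> frag_extend b c \<in> Z"
  shows "int_basis Z' I (\<lambda>i. F (b i))"
proof (rule int_basisI)
  have F0: "F 0 = 0" using F[of 0 0] by simp
  show "F (b i) \<in> Z'" if "i \<in> I" for i
    using bij int_basis_in[OF b that] by (rule bij_betw_apply)
  fix z assume "z \<in> Z'"
  then obtain y where "y \<in> Z" "z = F y" using bij by (auto simp: bij_betw_def)
  then show "\<exists>c. Poly_Mapping.keys c \<subseteq> I \<and> z = frag_extend (\<lambda>i. F (b i)) c"
    using int_basis_span[OF b, of y] additive_frag_extend[of F b, OF F] by metis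
next
  have F0: "F 0 = 0" using F[of 0 0] by simp
  fix c assume c: "Poly_Mapping.keys c \<subseteq> I" "frag_extend (\<lambda>i. F (b i)) c = 0"
  then have "F (frag_extend b c) = F 0" using additive_frag_extend[of F b c, OF F] F0 by simp
  then have "frag_extend b c = 0"
    using bij cl[OF c(1)] Z by (auto simp: bij_betw_def dest: inj_onD)
  then show "c = 0" using int_basis_independent[OF b c(1)] by blast
qed

lemma int_basis_reflect:
  fixes F :: "('v \<Rightarrow>\<^sub>0 int) \<Rightarrow> ('w \<Rightarrow>\<^sub>0 int)"
  assumes b: "int_basis Z' I (\<lambda>i. F (b i))" and F: "\<And>a b. F (a - b) = F a - F b"
    and inj: "inj_on F Z" and bZ: "\<And>i. i \<in> I \<Longrightarrow> b i \<in> Z"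
    and im: "\<And>z. z \<in> Z \<Longrightarrow> F z \<in> Z'"
    and cl: "\<And>c. Poly_Mapping.keys c \<subseteq> I \<Longrightarrow> frag_extend b c \<in> Z"
  shows "int_basis Z I b"
proof (rule int_basisI)
  fix z assume z: "z \<in> Z"
  then obtain c where "Poly_Mapping.keys c \<subseteq> I" "F z = frag_extend (\<lambda>i. F (b i)) c"
    using int_basis_span[OF b im] by metis
  then show "\<exists>c. Poly_Mapping.keys c \<subseteq> I \<and> z = frag_extend b c"
    using additive_frag_extend[of F b, OF F] inj cl z by (metis inj_onD)
next
  have F0: "F 0 = 0" using F[of 0 0] by simp
  fix c assume c: "Poly_Mapping.keys c \<subseteq> I" "frag_extend b c = 0"
  then have "frag_extend (\<lambda>i. F (b i)) c = 0" using additive_frag_extend[of F b c, OF F] F0 by simp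
  then show "c = 0" using int_basis_independent[OF b c(1)] by blast
qed (rule bZ)

section \<open>Joins of complexes\<close>

lemma chain_join_empty_right [simp]: "finitary c \<Longrightarrow> chain_join c (frag_of {}) = c"
  by (induction c rule: finitary_induct)
     (simp_all add: chain_join_diff_left chain_join_oriented_simplex[of _ "[]", simplified])

text \<open>The join of two additive maps, on chains of a join whose first factor has its vertices
  in \<open>V\<close> and whose second factor has none there. The coefficient looked up is the
  sign that compares the chosen orientation of \<open>\<rho>\<close> with the orientations of its
  two parts.\<close>

definition join_map ::
  "'v set \<Rightarrow> (('v set \<Rightarrow>\<^sub>0 int) \<Rightarrow> ('w set \<Rightarrow>\<^sub>0 int)) \<Rightarrow> (('v set \<Rightarrow>\<^sub>0 int) \<Rightarrow> ('w set \<Rightarrow>\<^sub>0 int)) \<Rightarrow>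
    ('v set \<Rightarrow>\<^sub>0 int) \<Rightarrow> ('w set \<Rightarrow>\<^sub>0 int)" where
  "join_map V \<phi> \<psi> = frag_extend (\<lambda>\<rho>.
     frag_cmul (Poly_Mapping.lookup (chain_join (frag_of (\<rho> \<inter> V)) (frag_of (\<rho> - V))) \<rho>)
       (chain_join (\<phi> (frag_of (\<rho> \<inter> V))) (\<psi> (frag_of (\<rho> - V)))))"

lemma join_map_diff: "join_map V \<phi> \<psi> (a - b) = join_map V \<phi> \<psi> a - join_map V \<phi> \<psi> b"
  by (simp add: join_map_def frag_extend_diff)

lemma join_map_0 [simp]: "join_map V \<phi> \<psi> 0 = 0"
  by (simp add: join_map_def)

lemma join_map_add: "join_map V \<phi> \<psi> (a + b) = join_map V \<phi> \<psi> a + join_map V \<phi> \<psi> b"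
  by (simp add: join_map_def frag_extend_add)

lemma join_map_cmul: "join_map V \<phi> \<psi> (frag_cmul m a) = frag_cmul m (join_map V \<phi> \<psi> a)"
  by (simp add: join_map_def frag_extend_cmul)

lemma chain_join_disjoint:
  assumes "finite \<sigma>" "finite \<tau>" "\<sigma> \<inter> \<tau> = {}"
  shows "\<exists>\<epsilon>. \<epsilon> * \<epsilon> = 1 \<and> chain_join (frag_of \<sigma>) (frag_of \<tau>) = frag_cmul \<epsilon> (frag_of (\<sigma> \<union> \<tau>))"
proof -
  let ?xs = "orientation \<sigma> @ orientation \<tau>"
  have d: "distinct ?xs" "set ?xs = \<sigma> \<union> \<tau>"
    using assms orientation_finite[of \<sigma>] orientation_finite[of \<tau>] by auto
  have "chain_join (frag_of \<sigma>) (frag_of \<tau>) = oriented_simplex ?xs"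
    using chain_join_oriented_simplex[of "orientation \<sigma>" "orientation \<tau>"] assms by simp
  also have "\<dots> = frag_cmul (list_sign (orientation (\<sigma> \<union> \<tau>)) ?xs) (frag_of (\<sigma> \<union> \<tau>))"
    unfolding oriented_simplex_def using d by simp
  finally show ?thesis
    by (intro exI[of _ "list_sign (orientation (\<sigma> \<union> \<tau>)) ?xs"]) (simp add: list_sign_def)
qed

locale disjoint_join =
  fixes A B :: "'v set set" and V :: "'v set"
  assumes A: "simplicial_complex A" and B: "simplicial_complex B"
    and AV: "\<And>\<sigma>. \<sigma> \<in> A \<Longrightarrow> \<sigma> \<subseteq> V" and BV: "\<And>\<tau>. \<tau> \<in> B \<Longrightarrow> \<tau> \<inter> V = {}"
begin

lemma simplicial_complex_join: "simplicial_complex (complex_join A B)"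
  unfolding simplicial_complex_def
proof (intro conjI ballI allI impI)
  show "{} \<in> complex_join A B"
    using complex_empty[OF A] complex_empty[OF B] by (auto simp: complex_join_def)
  fix \<rho> assume "\<rho> \<in> complex_join A B"
  then obtain \<sigma> \<tau> where r: "\<sigma> \<in> A" "\<tau> \<in> B" "\<rho> = \<sigma> \<union> \<tau>" by (auto simp: complex_join_def)
  then show "finite \<rho>" using complex_finite[OF A] complex_finite[OF B] by simp
  fix \<upsilon> assume "\<upsilon> \<subseteq> \<rho>"
  then have "\<upsilon> = (\<upsilon> \<inter> \<sigma>) \<union> (\<upsilon> \<inter> \<tau>)" using r by auto
  moreover have "\<upsilon> \<inter> \<sigma> \<in> A" "\<upsilon> \<inter> \<tau> \<in> B"
    using complex_face[OF A r(1)] complex_face[OF B r(2)] by auto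
  ultimately show "\<upsilon> \<in> complex_join A B" unfolding complex_join_def by blast
qed

lemma disjoint: "\<sigma> \<in> A \<Longrightarrow> \<tau> \<in> B \<Longrightarrow> \<sigma> \<inter> \<tau> = {}"
  using AV[of \<sigma>] BV[of \<tau>] by blast

lemma card_join: "\<sigma> \<in> A \<Longrightarrow> \<tau> \<in> B \<Longrightarrow> card (\<sigma> \<union> \<tau>) = card \<sigma> + card \<tau>"
  using disjoint[of \<sigma> \<tau>] complex_finite[OF A, of \<sigma>] complex_finite[OF B, of \<tau>]
  by (simp add: card_Un_disjoint)

lemma join_map_simplex:
  assumes "\<sigma> \<in> A" "\<tau> \<in> B"
  shows "join_map V \<phi> \<psi> (chain_join (frag_of \<sigma>) (frag_of \<tau>)) = chain_join (\<phi> (frag_of \<sigma>)) (\<psi> (frag_of \<tau>))"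
proof -
  obtain \<epsilon> where e: "\<epsilon> * \<epsilon> = 1" "chain_join (frag_of \<sigma>) (frag_of \<tau>) = frag_cmul \<epsilon> (frag_of (\<sigma> \<union> \<tau>))"
    using chain_join_disjoint[of \<sigma> \<tau>] disjoint[OF assms] complex_finite[OF A assms(1)]
      complex_finite[OF B assms(2)] by blast
  have "(\<sigma> \<union> \<tau>) \<inter> V = \<sigma>" "(\<sigma> \<union> \<tau>) - V = \<tau>" using AV[OF assms(1)] BV[OF assms(2)] by auto
  then show ?thesis using e(1) by (simp add: join_map_def e(2) frag_extend_cmul)
qed

lemma join_map_join:
  assumes "Poly_Mapping.keys a \<subseteq> A" "Poly_Mapping.keys b \<subseteq> B"
    and \<phi>: "\<And>a b. \<phi> (a - b) = \<phi> a - \<phi> b" and \<psi>: "\<And>a b. \<psi> (a - b) = \<psi> a - \<psi> b"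
  shows "join_map V \<phi> \<psi> (chain_join a b) = chain_join (\<phi> a) (\<psi> b)"
proof -
  have 0: "\<phi> 0 = 0" "\<psi> 0 = 0" using \<phi>[of 0 0] \<psi>[of 0 0] by simp_all
  have 1: "join_map V \<phi> \<psi> (chain_join (frag_of \<sigma>) b) = chain_join (\<phi> (frag_of \<sigma>)) (\<psi> b)"
    if "\<sigma> \<in> A" for \<sigma>
    using assms(2)
    by (induction b rule: frag_induction)
       (simp_all add: 0 join_map_simplex[OF that] chain_join_diff_right \<psi> join_map_diff)
  show ?thesis using assms(1)
    by (induction a rule: frag_induction)
       (simp_all add: 0 1 chain_join_diff_left \<phi> join_map_diff)
qed

lemma join_induct [consumes 1, case_names zero simplex diff]:
  assumes "c \<in> chain_space k (complex_join A B)"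
    and "P 0"
    and simplex: "\<And>\<sigma> \<tau>. \<sigma> \<in> A \<Longrightarrow> \<tau> \<in> B \<Longrightarrow> card \<sigma> + card \<tau> = k \<Longrightarrow> P (chain_join (frag_of \<sigma>) (frag_of \<tau>))"
    and diff: "\<And>a b. P a \<Longrightarrow> P b \<Longrightarrow> P (a - b)"
  shows "P c"
proof -
  have "Poly_Mapping.keys c \<subseteq> {\<rho> \<in> complex_join A B. card \<rho> = k}"
    using assms(1) by (simp add: chain_space_def)
  then show ?thesis
  proof (induction c rule: frag_induction)
    case (one \<rho>)
    then obtain \<sigma> \<tau> where r: "\<sigma> \<in> A" "\<tau> \<in> B" "\<rho> = \<sigma> \<union> \<tau>" "card \<rho> = k" by (auto simp: complex_join_def)
    obtain \<epsilon> where e: "\<epsilon> * \<epsilon> = 1" "chain_join (frag_of \<sigma>) (frag_of \<tau>) = frag_cmul \<epsilon> (frag_of (\<sigma> \<union> \<tau>))"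
      using chain_join_disjoint[of \<sigma> \<tau>] disjoint[OF r(1,2)] complex_finite[OF A r(1)]
        complex_finite[OF B r(2)] by blast
    have P: "P (chain_join (frag_of \<sigma>) (frag_of \<tau>))"
      using simplex[OF r(1,2)] r(3,4) card_join[OF r(1,2)] by simp
    have "frag_of \<rho> = frag_cmul \<epsilon> (chain_join (frag_of \<sigma>) (frag_of \<tau>))"
      using e r(3) by simp
    moreover have "P (frag_cmul \<epsilon> (chain_join (frag_of \<sigma>) (frag_of \<tau>)))"
      by (rule frag_closure_minus_cmul) (use assms(2) diff P in blast)+
    ultimately show ?case by simp
  qed (use assms in auto)
qed

lemma chain_join_in_join:
  assumes "a \<in> chain_space k A" "b \<in> chain_space l B"
  shows "chain_join a b \<in> chain_space (k + l) (complex_join A B)"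
  by (rule chain_join_chain_space[OF assms A B]) (auto simp: complex_join_def)

lemma chain_join_cycle:
  assumes "a \<in> cycle_space k A" "b \<in> cycle_space l B"
  shows "chain_join a b \<in> cycle_space (k + l) (complex_join A B)"
proof -
  have ab: "a \<in> chain_space k A" "b \<in> chain_space l B" using assms by (auto simp: cycle_space_def)
  have "boundary (chain_join a b) = 0"
    using boundary_join[OF chain_space_keys_card[OF A ab(1)] chain_space_finitary[OF B ab(2)]] assms
    by (simp add: cycle_space_def)
  then show ?thesis using chain_join_in_join[OF ab] by (simp add: cycle_space_def)
qed

text \<open>The Leibniz signs agree on both sides because the two maps preserve degrees.\<close>

lemma join_map_chain_map:
  assumes add: "\<And>a b. \<phi> (a - b) = \<phi> a - \<phi> b" "\<And>a b. \<psi> (a - b) = \<psi> a - \<psi> b"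
    and \<phi>: "\<And>\<sigma>. \<sigma> \<in> A \<Longrightarrow> \<phi> (frag_of \<sigma>) \<in> chain_space (card \<sigma>) A'"
      "\<And>\<sigma>. \<sigma> \<in> A \<Longrightarrow> boundary (\<phi> (frag_of \<sigma>)) = \<phi> (boundary (frag_of \<sigma>))"
    and \<psi>: "\<And>\<sigma>. \<sigma> \<in> B \<Longrightarrow> \<psi> (frag_of \<sigma>) \<in> chain_space (card \<sigma>) B'"
      "\<And>\<sigma>. \<sigma> \<in> B \<Longrightarrow> boundary (\<psi> (frag_of \<sigma>)) = \<psi> (boundary (frag_of \<sigma>))"
    and A': "simplicial_complex A'" and B': "simplicial_complex B'"
    and c: "c \<in> chain_space k (complex_join A B)"
  shows "boundary (join_map V \<phi> \<psi> c) = join_map V \<phi> \<psi> (boundary c)"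
  using c
proof (induction c rule: join_induct)
  case (simplex \<sigma> \<tau>)
  have s: "finite \<sigma>" "finite \<tau>" using simplex complex_finite[OF A] complex_finite[OF B] by auto
  have kb: "Poly_Mapping.keys (boundary (frag_of \<upsilon>)) \<subseteq> K" if "simplicial_complex K" "\<upsilon> \<in> K" for \<upsilon> :: "'v set" and K
  proof
    fix \<omega> assume "\<omega> \<in> Poly_Mapping.keys (boundary (frag_of \<upsilon>))"
    then show "\<omega> \<in> K"
      using keys_boundary[of \<omega> "frag_of \<upsilon>"] complex_finite[OF that] complex_face[OF that]
      by (metis Diff_subset finitary_frag_of keys_frag_of singletonD)
  qed
  have "boundary (chain_join (frag_of \<sigma>) (frag_of \<tau>)) = chain_join (boundary (frag_of \<sigma>)) (frag_of \<tau>)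
      + frag_cmul ((-1) ^ card \<sigma>) (chain_join (frag_of \<sigma>) (boundary (frag_of \<tau>)))"
    by (rule boundary_join) (use s in auto)
  moreover have "boundary (chain_join (\<phi> (frag_of \<sigma>)) (\<psi> (frag_of \<tau>))) =
      chain_join (boundary (\<phi> (frag_of \<sigma>))) (\<psi> (frag_of \<tau>))
      + frag_cmul ((-1) ^ card \<sigma>) (chain_join (\<phi> (frag_of \<sigma>)) (boundary (\<psi> (frag_of \<tau>))))"
    using boundary_join[OF chain_space_keys_card[OF A' \<phi>(1)[OF simplex(1)]]
       chain_space_finitary[OF B' \<psi>(1)[OF simplex(2)]]] .
  moreover have "join_map V \<phi> \<psi> (chain_join (boundary (frag_of \<sigma>)) (frag_of \<tau>)) =
      chain_join (\<phi> (boundary (frag_of \<sigma>))) (\<psi> (frag_of \<tau>))"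
    by (rule join_map_join) (use kb[OF A simplex(1)] simplex(2) add in auto)
  moreover have "join_map V \<phi> \<psi> (chain_join (frag_of \<sigma>) (boundary (frag_of \<tau>))) =
      chain_join (\<phi> (frag_of \<sigma>)) (\<psi> (boundary (frag_of \<tau>)))"
    by (rule join_map_join) (use kb[OF B simplex(2)] simplex(1) add in auto)
  ultimately show ?case
    using \<phi>(2)[OF simplex(1)] \<psi>(2)[OF simplex(2)]
    by (simp add: join_map_simplex[OF simplex(1,2)] join_map_add join_map_cmul)
qed (simp_all add: join_map_diff boundary_diff)

end

section \<open>Complexes that are acyclic below their dimension\<close>

text \<open>The vanishing of reduced homology below degree \<open>d - 1\<close>; together with the
  next notion this is sphericity, up to the question whether the dimension is attained.\<close>

definition acyclic_below :: "nat \<Rightarrow> 'v set set \<Rightarrow> bool" where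
  "acyclic_below d K \<longleftrightarrow> (\<forall>k<d. \<forall>z\<in>cycle_space k K. \<exists>c\<in>chain_space (Suc k) K. boundary c = z)"

definition dim_below :: "nat \<Rightarrow> 'v set set \<Rightarrow> bool" where
  "dim_below d K \<longleftrightarrow> (\<forall>\<sigma>\<in>K. card \<sigma> \<le> d)"

lemma acyclic_belowD:
  "acyclic_below d K \<Longrightarrow> k < d \<Longrightarrow> z \<in> cycle_space k K \<Longrightarrow> \<exists>c\<in>chain_space (Suc k) K. boundary c = z"
  by (simp add: acyclic_below_def)

lemma dim_belowD: "dim_below d K \<Longrightarrow> \<sigma> \<in> K \<Longrightarrow> card \<sigma> \<le> d"
  by (simp add: dim_below_def)

lemma chain_space_above_dim:
  "dim_below d K \<Longrightarrow> d < k \<Longrightarrow> c \<in> chain_space k K \<Longrightarrow> c = 0"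
  by (rule chain_space_above) (auto simp: dim_below_def)

text \<open>Since cycles with fewer than \<open>d\<close> vertices bound, the identity is
  null-homotopic below the top degree. In the top degree, where the homotopy \<open>s\<close> is
  chosen to be zero, what remains of the identity is a map to the top cycles.\<close>

lemma acyclic_below_contraction:
  assumes K: "simplicial_complex K" and ac: "acyclic_below d K" and dim: "dim_below d K"
  obtains s where "\<And>a b. s (a - b) = s a - s b"
    "\<And>\<sigma>. \<sigma> \<in> K \<Longrightarrow> s (frag_of \<sigma>) \<in> chain_space (Suc (card \<sigma>)) K"
    "\<And>\<sigma>. \<sigma> \<in> K \<Longrightarrow> card \<sigma> < d \<Longrightarrow>
        boundary (s (frag_of \<sigma>)) + s (boundary (frag_of \<sigma>)) = frag_of \<sigma>"
    "\<And>\<sigma>. \<sigma> \<in> K \<Longrightarrow> card \<sigma> = d \<Longrightarrow> frag_of \<sigma> - s (boundary (frag_of \<sigma>)) \<in> cycle_space d K"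
    "\<And>\<sigma>. \<sigma> \<in> K \<Longrightarrow> card \<sigma> = d \<Longrightarrow> s (frag_of \<sigma>) = 0"
proof -
  let ?L = "{\<sigma> \<in> K. card \<sigma> < d}"
  show thesis
  proof (cases "d = 0")
    case True
    then have "\<sigma> = {}" if "\<sigma> \<in> K" for \<sigma>
      using dim_belowD[OF dim that] complex_finite[OF K that] by simp
    then have "boundary (frag_of \<sigma>) = 0" if "\<sigma> \<in> K" for \<sigma> using that boundary_empty by metis
    then show thesis
      using True by (intro that[of "\<lambda>_. 0"])
        (auto simp: cycle_space_def chain_space_def)
  next
    case False
    have L: "simplicial_complex ?L"
      unfolding simplicial_complex_def
      using False complex_empty[OF K] complex_finite[OF K] complex_face[OF K]
      by (auto intro: le_less_trans[OF card_mono])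
    obtain h where h: "\<And>\<sigma>. \<sigma> \<in> ?L \<Longrightarrow> h \<sigma> \<in> chain_space (Suc (card \<sigma>)) K"
      "\<And>\<sigma>. \<sigma> \<notin> ?L \<Longrightarrow> h \<sigma> = 0"
      "\<And>c. Poly_Mapping.keys c \<subseteq> ?L \<Longrightarrow> boundary (frag_extend h c) + frag_extend h (boundary c) = c"
    \<comment> \<open>every simplex is carried by all of \<open>K\<close>\<close>
    proof (rule acyclic_carrier[OF L, of "\<lambda>c. c" "\<lambda>_. K"])
      fix \<sigma> z assume "\<sigma> \<in> ?L" "z \<in> cycle_space (card \<sigma>) K"
      then show "\<exists>d\<in>chain_space (Suc (card \<sigma>)) K. boundary d = z" using acyclic_belowD[OF ac] by auto
    qed (auto simp: chain_space_def)
    show thesis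
    proof (rule that[of "frag_extend h"])
      show "frag_extend h (frag_of \<sigma>) \<in> chain_space (Suc (card \<sigma>)) K" if "\<sigma> \<in> K" for \<sigma>
        using h(1)[of \<sigma>] h(2)[of \<sigma>] that by (cases "\<sigma> \<in> ?L") auto
      show "boundary (frag_extend h (frag_of \<sigma>)) + frag_extend h (boundary (frag_of \<sigma>)) = frag_of \<sigma>"
        if "\<sigma> \<in> K" "card \<sigma> < d" for \<sigma>
        using h(3)[of "frag_of \<sigma>"] that by simp
      fix \<sigma> assume \<sigma>: "\<sigma> \<in> K" "card \<sigma> = d"
      then show "frag_extend h (frag_of \<sigma>) = 0" using h(2)[of \<sigma>] by simp
      obtain e where e: "d = Suc e" using False by (cases d) auto
      let ?b = "boundary (frag_of \<sigma>)"
      have f: "frag_of \<sigma> \<in> chain_space d K" using \<sigma> by (simp add: chain_space_def)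
      have b: "?b \<in> chain_space e K" using boundary_chain_space[OF K, of "frag_of \<sigma>" e] f e by simp
      have kb: "\<tau> \<in> ?L \<and> card \<tau> = e" if "\<tau> \<in> Poly_Mapping.keys ?b" for \<tau>
        using chain_spaceD[OF b that] e by simp
      have "frag_extend h ?b \<in> chain_space d K"
      proof (rule chain_space_frag_extend)
        fix \<tau> assume "\<tau> \<in> Poly_Mapping.keys ?b"
        then show "h \<tau> \<in> chain_space d K" using kb[of \<tau>] h(1)[of \<tau>] e by simp
      qed
      moreover have "boundary (frag_extend h ?b) = ?b"
        using h(3)[of ?b] kb boundary_boundary[of "frag_of \<sigma>"] complex_finite[OF K \<sigma>(1)] by auto
      ultimately show "frag_of \<sigma> - frag_extend h ?b \<in> cycle_space d K"
        using f by (simp add: cycle_space_def chain_space_diff boundary_diff)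
    qed (simp add: frag_extend_diff)
  qed
qed

locale spherical_join = disjoint_join +
  fixes p q :: nat
  assumes Ap: "acyclic_below p A" "dim_below p A" and Bq: "acyclic_below q B" "dim_below q B"
begin

text \<open>Both factors are contracted as far as possible, which makes the identity of each
  homotopic to a map \<open>e\<close> or \<open>f\<close> concentrated in the top degree with
  values in the cycles. So the identity of the join is homotopic to a map concentrated in the top
  degree whose values are joins of cycles. This contains the vanishing half of the Kuenneth
  theorem and the fact that joins of cycles span the top cycles.\<close>

lemma join_homotopy:
  obtains H e f where
    "\<And>c k. c \<in> chain_space k (complex_join A B) \<Longrightarrow> H c \<in> chain_space (Suc k) (complex_join A B)"
    "\<And>c k. c \<in> chain_space k (complex_join A B) \<Longrightarrow> boundary (H c) + H (boundary c) = c - join_map V e f c"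
    "\<And>\<sigma>. \<sigma> \<in> A \<Longrightarrow> card \<sigma> < p \<Longrightarrow> e (frag_of \<sigma>) = 0"
    "\<And>\<sigma>. \<sigma> \<in> A \<Longrightarrow> card \<sigma> = p \<Longrightarrow> e (frag_of \<sigma>) \<in> cycle_space p A"
    "\<And>\<tau>. \<tau> \<in> B \<Longrightarrow> card \<tau> < q \<Longrightarrow> f (frag_of \<tau>) = 0"
    "\<And>\<tau>. \<tau> \<in> B \<Longrightarrow> card \<tau> = q \<Longrightarrow> f (frag_of \<tau>) \<in> cycle_space q B"
proof -
  obtain s where s: "\<And>a b. s (a - b) = s a - s b"
    "\<And>\<sigma>. \<sigma> \<in> A \<Longrightarrow> s (frag_of \<sigma>) \<in> chain_space (Suc (card \<sigma>)) A"
    "\<And>\<sigma>. \<sigma> \<in> A \<Longrightarrow> card \<sigma> < p \<Longrightarrow> boundary (s (frag_of \<sigma>)) + s (boundary (frag_of \<sigma>)) = frag_of \<sigma>"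
    "\<And>\<sigma>. \<sigma> \<in> A \<Longrightarrow> card \<sigma> = p \<Longrightarrow> frag_of \<sigma> - s (boundary (frag_of \<sigma>)) \<in> cycle_space p A"
    "\<And>\<sigma>. \<sigma> \<in> A \<Longrightarrow> card \<sigma> = p \<Longrightarrow> s (frag_of \<sigma>) = 0"
    using acyclic_below_contraction[OF A Ap] by blast
  obtain t where t: "\<And>a b. t (a - b) = t a - t b"
    "\<And>\<sigma>. \<sigma> \<in> B \<Longrightarrow> t (frag_of \<sigma>) \<in> chain_space (Suc (card \<sigma>)) B"
    "\<And>\<sigma>. \<sigma> \<in> B \<Longrightarrow> card \<sigma> < q \<Longrightarrow> boundary (t (frag_of \<sigma>)) + t (boundary (frag_of \<sigma>)) = frag_of \<sigma>"
    "\<And>\<sigma>. \<sigma> \<in> B \<Longrightarrow> card \<sigma> = q \<Longrightarrow> frag_of \<sigma> - t (boundary (frag_of \<sigma>)) \<in> cycle_space q B"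
    "\<And>\<sigma>. \<sigma> \<in> B \<Longrightarrow> card \<sigma> = q \<Longrightarrow> t (frag_of \<sigma>) = 0"
    using acyclic_below_contraction[OF B Bq] by blast
  define e where "e c = c - boundary (s c) - s (boundary c)" for c
  define f where "f c = c - boundary (t c) - t (boundary c)" for c
  \<comment> \<open>the homotopy for a join of two maps: move the first factor, then the second.
    The second term is only nonzero on simplices with \<open>p\<close> vertices in the first
    factor, so its sign can be constant.\<close>
  define H where "H c = join_map V s (\<lambda>c. c) c + frag_cmul ((-1) ^ p) (join_map V e t c)" for c
  have e_diff: "e (a - b) = e a - e b" for a b by (simp add: e_def s(1) boundary_diff)
  have f_diff: "f (a - b) = f a - f b" for a b by (simp add: f_def t(1) boundary_diff)
  have H_diff: "H (a - b) = H a - H b" for a b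
    by (simp add: H_def join_map_diff frag_cmul_diff_right)
  have s0: "s 0 = 0" and t0: "t 0 = 0" and e0: "e 0 = 0" and H0: "H 0 = 0"
    using s(1)[of 0 0] t(1)[of 0 0] e_diff[of 0 0] H_diff[of 0 0] by simp_all
  have H_add: "H (a + b) = H a + H b" for a b
    by (simp add: H_def join_map_add frag_cmul_distrib2)
  have H_cmul: "H (frag_cmul m a) = frag_cmul m (H a)" for m a
    by (simp add: H_def join_map_cmul frag_cmul_distrib2 mult.commute)
  have e_low: "e (frag_of \<sigma>) = 0" if "\<sigma> \<in> A" "card \<sigma> < p" for \<sigma>
    using s(3)[OF that] by (simp add: e_def algebra_simps)
  have e_top: "e (frag_of \<sigma>) \<in> cycle_space p A" if "\<sigma> \<in> A" "card \<sigma> = p" for \<sigma>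
    using s(4,5)[OF that] by (simp add: e_def)
  have f_low: "f (frag_of \<sigma>) = 0" if "\<sigma> \<in> B" "card \<sigma> < q" for \<sigma>
    using t(3)[OF that] by (simp add: f_def algebra_simps)
  have f_top: "f (frag_of \<sigma>) \<in> cycle_space q B" if "\<sigma> \<in> B" "card \<sigma> = q" for \<sigma>
    using t(4,5)[OF that] by (simp add: f_def)
  have e_in: "e (frag_of \<sigma>) \<in> cycle_space (card \<sigma>) A" if "\<sigma> \<in> A" for \<sigma>
    using e_low[OF that] e_top[OF that] dim_belowD[OF Ap(2) that] by (cases "card \<sigma> = p") auto
  have e_sign: "frag_cmul ((-1) ^ p) (frag_cmul ((-1) ^ card \<sigma>) (chain_join (e (frag_of \<sigma>)) b)) =
      chain_join (e (frag_of \<sigma>)) b" if "\<sigma> \<in> A" for \<sigma> b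
    using e_low[OF that] dim_belowD[OF Ap(2) that]
    by (cases "card \<sigma> = p") (auto simp: power_add[symmetric])
  have kbA: "\<tau> \<in> A \<and> card \<tau> < card \<sigma>" if \<sigma>: "\<sigma> \<in> A" and \<tau>: "\<tau> \<in> Poly_Mapping.keys (boundary (frag_of \<sigma>))" for \<sigma> \<tau>
  proof -
    obtain v where "v \<in> \<sigma>" "\<tau> = \<sigma> - {v}"
      using keys_boundary[OF \<tau>] complex_finite[OF A \<sigma>] by auto
    then show ?thesis
      using complex_face[OF A \<sigma>, of \<tau>] card_Diff1_less[OF complex_finite[OF A \<sigma>], of v] by auto
  qed
  have kbB: "\<tau> \<in> B" if \<sigma>: "\<sigma> \<in> B" and \<tau>: "\<tau> \<in> Poly_Mapping.keys (boundary (frag_of \<sigma>))" for \<sigma> \<tau>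
  proof -
    obtain v where "v \<in> \<sigma>" "\<tau> = \<sigma> - {v}"
      using keys_boundary[OF \<tau>] complex_finite[OF B \<sigma>] by auto
    then show ?thesis using complex_face[OF B \<sigma>, of \<tau>] by auto
  qed
  have e_bd: "e (boundary (frag_of \<sigma>)) = 0" if \<sigma>: "\<sigma> \<in> A" for \<sigma>
  proof -
    have "Poly_Mapping.keys (boundary (frag_of \<sigma>)) \<subseteq> {\<tau> \<in> A. card \<tau> < p}"
    proof
      fix \<tau> assume "\<tau> \<in> Poly_Mapping.keys (boundary (frag_of \<sigma>))"
      then show "\<tau> \<in> {\<tau> \<in> A. card \<tau> < p}"
        using kbA[OF \<sigma>, of \<tau>] dim_belowD[OF Ap(2) \<sigma>] by simp
    qed
    then show ?thesis
      by (induction rule: frag_induction) (simp_all add: e0 e_diff e_low)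
  qed
  have hom: "boundary (H (chain_join (frag_of \<sigma>) (frag_of \<tau>))) + H (boundary (chain_join (frag_of \<sigma>) (frag_of \<tau>)))
      = chain_join (frag_of \<sigma>) (frag_of \<tau>) - chain_join (e (frag_of \<sigma>)) (f (frag_of \<tau>))"
    if \<sigma>: "\<sigma> \<in> A" and \<tau>: "\<tau> \<in> B" for \<sigma> \<tau>
  proof -
    let ?a = "frag_of \<sigma>" and ?b = "frag_of \<tau>" and ?i = "(-1::int) ^ card \<sigma>" and ?p = "(-1::int) ^ p"
    have fin: "finite \<sigma>" "finite \<tau>" using complex_finite[OF A \<sigma>] complex_finite[OF B \<tau>] by auto
    have ka: "Poly_Mapping.keys ?a \<subseteq> A" "Poly_Mapping.keys (boundary ?a) \<subseteq> A"
      using \<sigma> kbA[OF \<sigma>] by auto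
    have kb: "Poly_Mapping.keys ?b \<subseteq> B" "Poly_Mapping.keys (boundary ?b) \<subseteq> B"
      using \<tau> kbB[OF \<tau>] by auto
    have H_join: "H (chain_join a b) = chain_join (s a) b + frag_cmul ?p (chain_join (e a) (t b))"
      if "Poly_Mapping.keys a \<subseteq> A" "Poly_Mapping.keys b \<subseteq> B" for a b
      unfolding H_def using that by (simp add: join_map_join s(1) t(1) e_diff)
    have bd: "boundary (chain_join ?a ?b) =
        chain_join (boundary ?a) ?b + frag_cmul ?i (chain_join ?a (boundary ?b))"
      by (rule boundary_join) (use fin in auto)
    have bs: "boundary (chain_join (s ?a) ?b) = chain_join (boundary (s ?a)) ?b
        - frag_cmul ?i (chain_join (s ?a) (boundary ?b))"
      using boundary_join[OF chain_space_keys_card[OF A s(2)[OF \<sigma>]], of ?b] fin by simp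
    have be: "boundary (chain_join (e ?a) (t ?b)) = frag_cmul ?i (chain_join (e ?a) (boundary (t ?b)))"
      using boundary_join[OF chain_space_keys_card[OF A cycle_space_chain[OF e_in[OF \<sigma>]]]
          chain_space_finitary[OF B t(2)[OF \<tau>]]] cycle_space_boundary[OF e_in[OF \<sigma>]] by simp
    have h1: "boundary (H (chain_join ?a ?b)) = chain_join (boundary (s ?a)) ?b
        - frag_cmul ?i (chain_join (s ?a) (boundary ?b)) + chain_join (e ?a) (boundary (t ?b))"
      unfolding H_join[OF ka(1) kb(1)] boundary_add boundary_cmul bs be e_sign[OF \<sigma>] ..
    have h2: "H (boundary (chain_join ?a ?b)) = chain_join (s (boundary ?a)) ?b
        + frag_cmul ?i (chain_join (s ?a) (boundary ?b)) + chain_join (e ?a) (t (boundary ?b))"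
    proof -
      have "frag_cmul ?i (frag_cmul ?p (chain_join (e ?a) (t (boundary ?b)))) = chain_join (e ?a) (t (boundary ?b))"
        using e_sign[OF \<sigma>, of "t (boundary ?b)"] by (simp add: mult.commute)
      then show ?thesis
        unfolding bd H_add H_cmul H_join[OF ka(2) kb(1)] H_join[OF ka(1) kb(2)] e_bd[OF \<sigma>]
        by (simp add: frag_cmul_distrib2)
    qed
    have h3: "chain_join (boundary (s ?a)) ?b + chain_join (s (boundary ?a)) ?b =
        chain_join (?a - e ?a) ?b"
      unfolding chain_join_add_left[symmetric] by (rule arg_cong[where f="\<lambda>x. chain_join x ?b"]) (simp add: e_def algebra_simps)
    have h4: "chain_join (e ?a) (boundary (t ?b)) + chain_join (e ?a) (t (boundary ?b)) =
        chain_join (e ?a) (?b - f ?b)"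
      unfolding chain_join_add_right[symmetric] by (rule arg_cong[where f="chain_join (e ?a)"]) (simp add: f_def algebra_simps)
    have "boundary (H (chain_join ?a ?b)) + H (boundary (chain_join ?a ?b)) =
        (chain_join (boundary (s ?a)) ?b + chain_join (s (boundary ?a)) ?b)
        + (chain_join (e ?a) (boundary (t ?b)) + chain_join (e ?a) (t (boundary ?b)))"
      unfolding h1 h2 by (simp add: algebra_simps)
    also have "\<dots> = chain_join ?a ?b - chain_join (e ?a) (f ?b)"
      unfolding h3 h4 by (simp add: chain_join_diff_left chain_join_diff_right)
    finally show ?thesis .
  qed
  show thesis
  proof (rule that[of H e f])
    fix c k assume c: "c \<in> chain_space k (complex_join A B)"
    show "H c \<in> chain_space (Suc k) (complex_join A B)"
      using c
    proof (induction c rule: join_induct)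
      case (simplex \<sigma> \<tau>)
      have "frag_of \<tau> \<in> chain_space (card \<tau>) B" using simplex by (simp add: chain_space_def)
      from chain_join_in_join[OF s(2)[OF simplex(1)] this]
        chain_join_in_join[OF cycle_space_chain[OF e_in[OF simplex(1)]] t(2)[OF simplex(2)]]
      show ?case
        using simplex by (auto simp: H_def join_map_simplex intro!: chain_space_add chain_space_cmul)
    qed (simp_all add: H0 H_diff chain_space_diff)
    show "boundary (H c) + H (boundary c) = c - join_map V e f c"
      using c
    proof (induction c rule: join_induct)
      case (simplex \<sigma> \<tau>)
      then show ?case using hom by (simp add: join_map_simplex)
    next
      case (diff a b)
      then show ?case by (simp add: boundary_diff H_diff join_map_diff algebra_simps)
    qed (simp add: H0)
  qed (use e_low e_top f_low f_top in auto)
qed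

lemma dim_below_join: "dim_below (p + q) (complex_join A B)"
  unfolding dim_below_def
proof
  fix \<rho> assume "\<rho> \<in> complex_join A B"
  then obtain \<sigma> \<tau> where "\<sigma> \<in> A" "\<tau> \<in> B" "\<rho> = \<sigma> \<union> \<tau>" by (auto simp: complex_join_def)
  then show "card \<rho> \<le> p + q"
    using card_join[of \<sigma> \<tau>] dim_belowD[OF Ap(2), of \<sigma>] dim_belowD[OF Bq(2), of \<tau>] by simp
qed

lemma acyclic_below_join: "acyclic_below (p + q) (complex_join A B)"
  unfolding acyclic_below_def
proof (intro allI impI ballI)
  obtain H e f where
    H: "\<And>c k. c \<in> chain_space k (complex_join A B) \<Longrightarrow> H c \<in> chain_space (Suc k) (complex_join A B)"
    "\<And>c k. c \<in> chain_space k (complex_join A B) \<Longrightarrow> boundary (H c) + H (boundary c) = c - join_map V e f c"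
    and e: "\<And>\<sigma>. \<sigma> \<in> A \<Longrightarrow> card \<sigma> < p \<Longrightarrow> e (frag_of \<sigma>) = 0"
    and f: "\<And>\<tau>. \<tau> \<in> B \<Longrightarrow> card \<tau> < q \<Longrightarrow> f (frag_of \<tau>) = 0"
    using join_homotopy by metis
  fix k z assume k: "k < p + q" and z: "z \<in> cycle_space k (complex_join A B)"
  have "H 0 \<in> chain_space (Suc (p + q)) (complex_join A B)" using H(1)[of 0 "p + q"] by simp
  then have H0: "H 0 = 0" using chain_space_above_dim[OF dim_below_join] by blast
  have "join_map V e f c = 0" if "c \<in> chain_space k (complex_join A B)" for c
    using that
  proof (induction c rule: join_induct)
    case (simplex \<sigma> \<tau>)
    then have "card \<sigma> < p \<or> card \<tau> < q" using k by auto
    then show ?case using e[of \<sigma>] f[of \<tau>] simplex by (auto simp: join_map_simplex)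
  qed (simp_all add: join_map_diff)
  then have "boundary (H z) = z" using H(2)[of z k] z H0 by (simp add: cycle_space_def)
  then show "\<exists>c\<in>chain_space (Suc k) (complex_join A B). boundary c = z"
    using H(1)[of z k] z by (auto simp: cycle_space_def)
qed

end

section \<open>The top homology of a join\<close>

text \<open>The tensor product of two elements of free abelian groups, in coordinates.\<close>

definition frag_prod :: "('i \<Rightarrow>\<^sub>0 int) \<Rightarrow> ('j \<Rightarrow>\<^sub>0 int) \<Rightarrow> ('i \<times> 'j \<Rightarrow>\<^sub>0 int)" where
  "frag_prod u v = frag_extend (\<lambda>i. frag_extend (\<lambda>j. frag_of (i, j)) v) u"

lemma frag_prod_diff_left: "frag_prod (u - u') v = frag_prod u v - frag_prod u' v"
  by (simp add: frag_prod_def frag_extend_diff)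

lemma frag_prod_diff_right: "frag_prod u (v - v') = frag_prod u v - frag_prod u v'"
  by (simp add: frag_prod_def frag_extend_diff frag_extend_fun_diff)

lemma frag_prod_0 [simp]: "frag_prod 0 v = 0" "frag_prod u 0 = 0"
  by (simp_all add: frag_prod_def frag_extend_zero_fun)

lemma frag_prod_of [simp]: "frag_prod (frag_of i) (frag_of j) = frag_of (i, j)"
  by (simp add: frag_prod_def)

lemma keys_frag_prod:
  assumes "Poly_Mapping.keys u \<subseteq> I" "Poly_Mapping.keys v \<subseteq> J"
  shows "Poly_Mapping.keys (frag_prod u v) \<subseteq> I \<times> J"
proof -
  have 1: "Poly_Mapping.keys (frag_extend (\<lambda>j. frag_of (i, j)) v) \<subseteq> {i} \<times> J" for i
    using assms(2) by (intro order_trans[OF keys_frag_extend]) auto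
  show ?thesis
    unfolding frag_prod_def
  proof (rule order_trans[OF keys_frag_extend], rule UN_least)
    fix i assume "i \<in> Poly_Mapping.keys u"
    then show "Poly_Mapping.keys (frag_extend (\<lambda>j. frag_of (i, j)) v) \<subseteq> I \<times> J"
      using 1[of i] assms(1) by auto
  qed
qed

lemma frag_extend_bilinear:
  assumes "\<And>a b c. G (a - b) c = G a c - G b c" "\<And>a b c. G a (b - c) = G a b - G a c"
  shows "frag_extend (\<lambda>(i, j). G (\<alpha> i) (\<beta> j)) (frag_prod u v) = G (frag_extend \<alpha> u) (frag_extend \<beta> v)"
proof -
  have 0: "G 0 b = 0" "G a 0 = 0" for a b using assms(1)[of 0 0 b] assms(2)[of a 0 0] by simp_all
  have 1: "frag_extend (\<lambda>(i, j). G (\<alpha> i) (\<beta> j)) (frag_prod (frag_of i) v) = G (\<alpha> i) (frag_extend \<beta> v)" for i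
    by (induction v rule: frag_induction[OF order_refl])
       (simp_all add: 0 frag_prod_diff_right frag_extend_diff assms)
  show ?thesis
    by (induction u rule: frag_induction[OF order_refl])
       (simp_all add: 0 1 frag_prod_diff_left frag_extend_diff assms)
qed

context spherical_join
begin

text \<open>For a top cycle the homotopy between the identity and the join of \<open>e\<close> and
  \<open>f\<close> vanishes for reasons of dimension, so every top cycle is a combination of joins
  of cycles. A linear relation between joins gives one between the first factors for each simplex
  of \<open>B\<close>, by taking coefficients, and then one between the second factors.\<close>

lemma join_basis:
  fixes \<alpha> :: "'i \<Rightarrow> ('a set \<Rightarrow>\<^sub>0 int)" and \<beta> :: "'j \<Rightarrow> ('a set \<Rightarrow>\<^sub>0 int)"
  assumes \<alpha>: "int_basis (cycle_space p A) I \<alpha>" and \<beta>: "int_basis (cycle_space q B) J \<beta>"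
  shows "int_basis (cycle_space (p + q) (complex_join A B)) (I \<times> J) (\<lambda>(i, j). chain_join (\<alpha> i) (\<beta> j))"
proof (rule int_basisI)
  show "(case ij of (i, j) \<Rightarrow> chain_join (\<alpha> i) (\<beta> j)) \<in> cycle_space (p + q) (complex_join A B)"
    if "ij \<in> I \<times> J" for ij
    using that chain_join_cycle[OF int_basis_in[OF \<alpha>, of "fst ij"] int_basis_in[OF \<beta>, of "snd ij"]]
    by (cases ij) simp
next
  obtain H e f where
    H: "\<And>c k. c \<in> chain_space k (complex_join A B) \<Longrightarrow> H c \<in> chain_space (Suc k) (complex_join A B)"
    "\<And>c k. c \<in> chain_space k (complex_join A B) \<Longrightarrow> boundary (H c) + H (boundary c) = c - join_map V e f c"
    and e: "\<And>\<sigma>. \<sigma> \<in> A \<Longrightarrow> card \<sigma> < p \<Longrightarrow> e (frag_of \<sigma>) = 0"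
      "\<And>\<sigma>. \<sigma> \<in> A \<Longrightarrow> card \<sigma> = p \<Longrightarrow> e (frag_of \<sigma>) \<in> cycle_space p A"
    and f: "\<And>\<tau>. \<tau> \<in> B \<Longrightarrow> card \<tau> < q \<Longrightarrow> f (frag_of \<tau>) = 0"
     "\<And>\<tau>. \<tau> \<in> B \<Longrightarrow> card \<tau> = q \<Longrightarrow> f (frag_of \<tau>) \<in> cycle_space q B"
    by (rule join_homotopy) (assumption | rule that)+
  let ?G = "\<lambda>(i, j). chain_join (\<alpha> i) (\<beta> j)"
  let ?J = "complex_join A B"
  have top0: "H c = 0" if "c \<in> chain_space (p + q) ?J" for c
    using chain_space_above_dim[OF dim_below_join lessI H(1)[OF that]] .
  have span: "\<exists>c. Poly_Mapping.keys c \<subseteq> I \<times> J \<and> join_map V e f z = frag_extend ?G c"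
    if "z \<in> chain_space (p + q) ?J" for z
    using that
  proof (induction z rule: join_induct)
    case zero
    show ?case by (rule exI[of _ 0]) simp
  next
    case (simplex \<sigma> \<tau>)
    show ?case
    proof (cases "card \<sigma> = p")
      case True
      then have "card \<tau> = q" using simplex by simp
      from e(2)[OF simplex(1) True] obtain u where u: "Poly_Mapping.keys u \<subseteq> I" "e (frag_of \<sigma>) = frag_extend \<alpha> u"
        using int_basis_span[OF \<alpha>] by blast
      from f(2)[OF simplex(2) \<open>card \<tau> = q\<close>] obtain v where v: "Poly_Mapping.keys v \<subseteq> J" "f (frag_of \<tau>) = frag_extend \<beta> v"
        using int_basis_span[OF \<beta>] by blast
      have "join_map V e f (chain_join (frag_of \<sigma>) (frag_of \<tau>)) = frag_extend ?G (frag_prod u v)"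
        unfolding join_map_simplex[OF simplex(1,2)] u(2) v(2)
        by (rule frag_extend_bilinear[symmetric]) (simp_all add: chain_join_diff_left chain_join_diff_right)
      then show ?thesis using keys_frag_prod[OF u(1) v(1)] by blast
    next
      case False
      then have "card \<sigma> < p" using dim_belowD[OF Ap(2) simplex(1)] by simp
      then have "join_map V e f (chain_join (frag_of \<sigma>) (frag_of \<tau>)) = 0"
        using e(1) simplex by (simp add: join_map_simplex)
      then show ?thesis by (intro exI[of _ 0]) simp
    qed
  next
    case (diff a b)
    then obtain u v where "Poly_Mapping.keys u \<subseteq> I \<times> J" "join_map V e f a = frag_extend ?G u"
      "Poly_Mapping.keys v \<subseteq> I \<times> J" "join_map V e f b = frag_extend ?G v" by blast
    then show ?case using keys_diff[of u v]
      by (intro exI[of _ "u - v"]) (auto simp: join_map_diff frag_extend_diff)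
  qed
  fix z assume z: "z \<in> cycle_space (p + q) ?J"
  then have zc: "z \<in> chain_space (p + q) ?J" by (rule cycle_space_chain)
  have "H 0 = 0" by (rule top0) simp
  then have "z = join_map V e f z"
    using H(2)[OF zc] top0[OF zc] cycle_space_boundary[OF z] by simp
  then show "\<exists>c. Poly_Mapping.keys c \<subseteq> I \<times> J \<and> z = frag_extend ?G c" using span[OF zc] by simp
next
  fix w assume w: "Poly_Mapping.keys w \<subseteq> I \<times> J" "frag_extend (\<lambda>(i, j). chain_join (\<alpha> i) (\<beta> j)) w = 0"
  have kA: "Poly_Mapping.keys (\<alpha> i) \<subseteq> A" "finitary (\<alpha> i)" if "i \<in> I" for i
    using int_basis_in[OF \<alpha> that] chain_spaceD[of "\<alpha> i"] chain_space_finitary[OF A, of "\<alpha> i"]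
    by (auto simp: cycle_space_def)
  have kB: "Poly_Mapping.keys (\<beta> j) \<subseteq> B" if "j \<in> J" for j
    using int_basis_in[OF \<beta> that] chain_spaceD[of "\<beta> j"] by (auto simp: cycle_space_def)
  \<comment> \<open>\<open>slice \<tau>\<close> and \<open>row i\<close> extend to linear maps.
    The first one replaces each second factor by its coefficient at \<open>\<tau>\<close>; the
    second one extracts the part of a relation with first index \<open>i\<close>.\<close>
  define slice :: "'a set \<Rightarrow> 'i \<times> 'j \<Rightarrow> 'i \<Rightarrow>\<^sub>0 int" where
    "slice \<tau> = (\<lambda>(i, j). frag_cmul (Poly_Mapping.lookup (\<beta> j) \<tau>) (frag_of i))" for \<tau>
  define row :: "'i \<Rightarrow> 'i \<times> 'j \<Rightarrow> 'j \<Rightarrow>\<^sub>0 int" where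
    "row i = (\<lambda>(i', j). if i' = i then frag_of j else 0)" for i
  have slice0: "frag_extend (slice \<tau>) w = 0" for \<tau>
  proof (rule int_basis_independent[OF \<alpha>])
    show "Poly_Mapping.keys (frag_extend (slice \<tau>) w) \<subseteq> I"
      by (rule order_trans[OF keys_frag_extend], rule UN_least)
         (use w(1) in \<open>auto simp: slice_def split: prod.splits\<close>)
    let ?\<psi> = "\<lambda>b. frag_cmul (Poly_Mapping.lookup b \<tau>) (frag_of {}) :: 'a set \<Rightarrow>\<^sub>0 int"
    \<comment> \<open>on joins, taking the coefficient at \<open>\<tau>\<close> of the second
      factor is a join of maps\<close>
    let ?T = "join_map V (\<lambda>a. a) ?\<psi>"
    have T: "?T (chain_join (\<alpha> i) (\<beta> j)) = frag_cmul (Poly_Mapping.lookup (\<beta> j) \<tau>) (\<alpha> i)"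
      if "i \<in> I" "j \<in> J" for i j
      using kA[OF that(1)] kB[OF that(2)]
      by (subst join_map_join) (auto simp: lookup_minus frag_cmul_diff_distrib chain_join_cmul_right)
    have "frag_extend \<alpha> (frag_extend (slice \<tau>) w) = frag_extend (\<lambda>ij. frag_extend \<alpha> (slice \<tau> ij)) w"
      by (rule additive_frag_extend) (rule frag_extend_diff)
    also have "\<dots> = frag_extend (\<lambda>ij. ?T (case ij of (i, j) \<Rightarrow> chain_join (\<alpha> i) (\<beta> j))) w"
      by (rule frag_extend_eq) (use w(1) T in \<open>auto simp: slice_def frag_extend_cmul split: prod.splits\<close>)
    also have "\<dots> = ?T (frag_extend (\<lambda>(i, j). chain_join (\<alpha> i) (\<beta> j)) w)"
      by (rule additive_frag_extend[symmetric]) (rule join_map_diff)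
    finally show "frag_extend \<alpha> (frag_extend (slice \<tau>) w) = 0" using w(2) by simp
  qed
  have row0: "frag_extend (row i) w = 0" for i
  proof (rule int_basis_independent[OF \<beta>])
    show "Poly_Mapping.keys (frag_extend (row i) w) \<subseteq> J"
      by (rule order_trans[OF keys_frag_extend], rule UN_least)
         (use w(1) in \<open>auto simp: row_def split: prod.splits if_splits\<close>)
    show "frag_extend \<beta> (frag_extend (row i) w) = 0"
    proof (rule poly_mapping_eqI)
      fix \<tau>
      have "Poly_Mapping.lookup (frag_extend \<beta> (frag_extend (row i) w)) \<tau> =
          Poly_Mapping.lookup (frag_extend (slice \<tau>) w) i"
      proof (induction w rule: frag_induction[OF order_refl])
        case (2 x)
        then show ?case by (cases x) (simp add: row_def slice_def)
      qed (simp_all add: frag_extend_diff lookup_minus)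
      then show "Poly_Mapping.lookup (frag_extend \<beta> (frag_extend (row i) w)) \<tau> = Poly_Mapping.lookup 0 \<tau>"
        by (simp add: slice0)
    qed
  qed
  show "w = 0"
  proof (rule poly_mapping_eqI)
    fix ij :: "'i \<times> 'j"
    obtain i j where ij: "ij = (i, j)" by (cases ij)
    have "Poly_Mapping.lookup w (i, j) = Poly_Mapping.lookup (frag_extend (row i) w) j"
    proof (induction w rule: frag_induction[OF order_refl])
      case (2 x)
      then show ?case by (cases x) (simp add: row_def)
    qed (simp_all add: frag_extend_diff lookup_minus)
    then show "Poly_Mapping.lookup w ij = Poly_Mapping.lookup 0 ij" by (simp add: row0 ij)
  qed
qed

end

section \<open>Relabelling vertices\<close>

lemma simplicial_complex_image:
  assumes "simplicial_complex K" shows "simplicial_complex ((`) h ` K)"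
  unfolding simplicial_complex_def
proof (intro conjI ballI allI impI)
  show "{} \<in> (`) h ` K" using complex_empty[OF assms] by (metis image_empty imageI)
  fix \<rho> assume "\<rho> \<in> (`) h ` K"
  then obtain \<sigma> where \<sigma>: "\<sigma> \<in> K" "\<rho> = h ` \<sigma>" by blast
  then show "finite \<rho>" using complex_finite[OF assms] by simp
  fix \<tau> assume "\<tau> \<subseteq> \<rho>"
  then obtain \<sigma>' where "\<sigma>' \<subseteq> \<sigma>" "\<tau> = h ` \<sigma>'" using \<sigma>(2) by (meson subset_imageE)
  then show "\<tau> \<in> (`) h ` K" using complex_face[OF assms \<sigma>(1)] by blast
qed

lemma relabel_cycle_space:
  assumes K: "simplicial_complex K" and h: "inj h"
  shows "bij_betw (simplicial_chain_map h) (cycle_space k K) (cycle_space k ((`) h ` K))"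
proof (rule bij_betwI[where g = "simplicial_chain_map (inv_into UNIV h)"])
  have K': "simplicial_complex ((`) h ` K)" by (rule simplicial_complex_image[OF K])
  show "simplicial_chain_map h \<in> cycle_space k K \<rightarrow> cycle_space k ((`) h ` K)"
    using simplicial_chain_map_cycle_space[OF _ K, of _ _ h "(`) h ` K"] by auto
  have im: "inv_into UNIV h ` \<sigma> \<in> K" if "\<sigma> \<in> (`) h ` K" for \<sigma>
    using that image_inv_f_f[OF h] by auto
  show "simplicial_chain_map (inv_into UNIV h) \<in> cycle_space k ((`) h ` K) \<rightarrow> cycle_space k K"
    by (intro funcsetI) (rule simplicial_chain_map_cycle_space[OF _ K' im])
  show "simplicial_chain_map (inv_into UNIV h) (simplicial_chain_map h z) = z" if "z \<in> cycle_space k K" for z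
    using chain_space_finitary[OF K cycle_space_chain[OF that]] h
    by (simp add: simplicial_chain_map_compose simplicial_chain_map_id comp_def)
  show "simplicial_chain_map h (simplicial_chain_map (inv_into UNIV h) z) = z"
    if z: "z \<in> cycle_space k ((`) h ` K)" for z
  proof -
    have f: "finitary z" using chain_space_finitary[OF K' cycle_space_chain[OF z]] .
    have "v \<in> range h" if "v \<in> \<Union>(Poly_Mapping.keys z)" for v
      using that chain_spaceD[OF cycle_space_chain[OF z]] by blast
    then have "simplicial_chain_map (h \<circ> inv_into UNIV h) z = simplicial_chain_map (\<lambda>v. v) z"
      by (intro simplicial_chain_map_cong f) (auto simp: f_inv_into_f)
    then show ?thesis by (simp only: simplicial_chain_map_compose[OF f] simplicial_chain_map_id[OF f])
  qed
qed

lemma relabel_basis: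
  assumes K: "simplicial_complex K" and h: "inj h" and b: "int_basis (cycle_space k K) I b"
  shows "int_basis (cycle_space k ((`) h ` K)) I (\<lambda>i. simplicial_chain_map h (b i))"
proof (rule int_basis_image[OF b simplicial_chain_map_diff relabel_cycle_space[OF K h]])
  show "frag_extend b c \<in> cycle_space k K" if "Poly_Mapping.keys c \<subseteq> I" for c
    using that int_basis_in[OF b] by (intro cycle_space_frag_extend) auto
qed simp

lemma relabel_acyclic_below:
  assumes K: "simplicial_complex K" and h: "inj h" and ac: "acyclic_below d K"
  shows "acyclic_below d ((`) h ` K)"
  unfolding acyclic_below_def
proof (intro allI impI ballI)
  fix k z assume k: "k < d" and "z \<in> cycle_space k ((`) h ` K)"
  then obtain y where y: "y \<in> cycle_space k K" "z = simplicial_chain_map h y"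
    using relabel_cycle_space[OF K h, of k] by (auto simp: bij_betw_def)
  then obtain c where c: "c \<in> chain_space (Suc k) K" "boundary c = y"
    using acyclic_belowD[OF ac k] by blast
  then show "\<exists>c\<in>chain_space (Suc k) ((`) h ` K). boundary c = z"
    using simplicial_chain_map_chain_space[OF c(1) K, of h "(`) h ` K"] y(2)
      boundary_simplicial_chain_map[OF chain_space_finitary[OF K c(1)], of h] by auto
qed

lemma relabel_dim_below:
  assumes "simplicial_complex K" "dim_below d K" shows "dim_below d ((`) h ` K)"
  unfolding dim_below_def
proof
  fix \<rho> assume "\<rho> \<in> (`) h ` K"
  then obtain \<sigma> where "\<sigma> \<in> K" "\<rho> = h ` \<sigma>" by blast
  then show "card \<rho> \<le> d"
    using dim_belowD[OF assms(2), of \<sigma>] card_image_le[OF complex_finite[OF assms(1)], of \<sigma> h] by simp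
qed

section \<open>Coefficients of a vertex\<close>

text \<open>The chain \<open>c\<^sub>v\<close> in the decomposition of \<open>c\<close> into the
  cone from \<open>v\<close> over \<open>c\<^sub>v\<close> and simplices without \<open>v\<close>.
  The coefficient looked up is the sign from putting \<open>v\<close> first.\<close>

definition vertex_coeff :: "'v \<Rightarrow> ('v set \<Rightarrow>\<^sub>0 int) \<Rightarrow> ('v set \<Rightarrow>\<^sub>0 int)" where
  "vertex_coeff v = frag_extend (\<lambda>\<sigma>. if v \<in> \<sigma> then
      frag_cmul (Poly_Mapping.lookup (chain_join (frag_of {v}) (frag_of (\<sigma> - {v}))) \<sigma>) (frag_of (\<sigma> - {v})) else 0)"

lemma vertex_coeff_diff: "vertex_coeff v (a - b) = vertex_coeff v a - vertex_coeff v b"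
  by (simp add: vertex_coeff_def frag_extend_diff)

lemma vertex_coeff_0 [simp]: "vertex_coeff v 0 = 0"
  by (simp add: vertex_coeff_def)

lemma vertex_coeff_cmul: "vertex_coeff v (frag_cmul m a) = frag_cmul m (vertex_coeff v a)"
  by (simp add: vertex_coeff_def frag_extend_cmul)

lemma vertex_coeff_absent:
  assumes "\<And>\<sigma>. \<sigma> \<in> Poly_Mapping.keys c \<Longrightarrow> v \<notin> \<sigma>" shows "vertex_coeff v c = 0"
  unfolding vertex_coeff_def by (rule frag_extend_eq_0) (use assms in simp)

lemma cone_simplex:
  assumes "finite \<tau>" "v \<notin> \<tau>"
  shows "\<exists>\<epsilon>. \<epsilon> * \<epsilon> = 1 \<and> chain_join (frag_of {v}) (frag_of \<tau>) = frag_cmul \<epsilon> (frag_of (insert v \<tau>))"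
  using chain_join_disjoint[of "{v}" \<tau>] assms by simp

lemma vertex_coeff_cone_simplex:
  assumes "finite \<tau>" "v \<notin> \<tau>"
  shows "vertex_coeff v (chain_join (frag_of {v}) (frag_of \<tau>)) = frag_of \<tau>"
proof -
  obtain \<epsilon> where e: "\<epsilon> * \<epsilon> = 1" "chain_join (frag_of {v}) (frag_of \<tau>) = frag_cmul \<epsilon> (frag_of (insert v \<tau>))"
    using cone_simplex[OF assms] by blast
  have "insert v \<tau> - {v} = \<tau>" using assms by auto
  then show ?thesis
    by (subst e(2), subst vertex_coeff_cmul) (simp add: vertex_coeff_def e)
qed

lemma vertex_coeff_cone:
  assumes "finitary c" "\<And>\<sigma>. \<sigma> \<in> Poly_Mapping.keys c \<Longrightarrow> v \<notin> \<sigma>"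
  shows "vertex_coeff v (chain_join (frag_of {v}) c) = c"
proof -
  have "Poly_Mapping.keys c \<subseteq> {\<sigma>. finite \<sigma> \<and> v \<notin> \<sigma>}" using assms by (auto simp: finitary_def)
  then show ?thesis
    by (induction c rule: frag_induction)
       (simp_all add: vertex_coeff_cone_simplex chain_join_diff_right vertex_coeff_diff)
qed

lemma keys_vertex_coeff:
  assumes "\<tau> \<in> Poly_Mapping.keys (vertex_coeff v c)"
  shows "v \<notin> \<tau> \<and> insert v \<tau> \<in> Poly_Mapping.keys c"
proof -
  have "\<tau> \<in> (\<Union>\<sigma>\<in>Poly_Mapping.keys c. Poly_Mapping.keys (if v \<in> \<sigma> then
      frag_cmul (Poly_Mapping.lookup (chain_join (frag_of {v}) (frag_of (\<sigma> - {v}))) \<sigma>) (frag_of (\<sigma> - {v})) else 0))"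
    using assms keys_frag_extend unfolding vertex_coeff_def by (rule rev_subsetD)
  then obtain \<sigma> where "\<sigma> \<in> Poly_Mapping.keys c" "v \<in> \<sigma>" "\<tau> = \<sigma> - {v}"
    by (auto split: if_splits)
  then show ?thesis by (simp add: insert_absorb)
qed

lemma frag_cmul_minus_right: "frag_cmul k (- a) = - frag_cmul k a"
  by (rule poly_mapping_eqI) simp

lemma boundary_vertex_coeff:
  assumes "finitary c" shows "boundary (vertex_coeff v c) = - vertex_coeff v (boundary c)"
proof -
  have "Poly_Mapping.keys c \<subseteq> {\<sigma>. finite \<sigma>}" using assms by (auto simp: finitary_def)
  then show ?thesis
  proof (induction c rule: frag_induction)
    case (one \<sigma>)
    then have fin: "finite \<sigma>" by simp
    show ?case
    proof (cases "v \<in> \<sigma>")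
      case False
      have "vertex_coeff v (boundary (frag_of \<sigma>)) = 0"
      proof (rule vertex_coeff_absent)
        fix \<tau> assume "\<tau> \<in> Poly_Mapping.keys (boundary (frag_of \<sigma>))"
        then obtain \<sigma>' w where "\<sigma>' \<in> Poly_Mapping.keys (frag_of \<sigma>)" "\<tau> = \<sigma>' - {w}"
          by (rule keys_boundary) (use fin in simp_all)
        then show "v \<notin> \<tau>" using False by simp
      qed
      moreover have "vertex_coeff v (frag_of \<sigma>) = 0"
        by (rule vertex_coeff_absent) (use False in simp)
      ultimately show ?thesis by simp
    next
      case True
      let ?\<tau> = "\<sigma> - {v}"
      have \<tau>: "finite ?\<tau>" "v \<notin> ?\<tau>" "insert v ?\<tau> = \<sigma>" using fin True by auto
      obtain \<epsilon> where e: "\<epsilon> * \<epsilon> = 1" "chain_join (frag_of {v}) (frag_of ?\<tau>) = frag_cmul \<epsilon> (frag_of \<sigma>)"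
        using cone_simplex[OF \<tau>(1,2)] unfolding \<tau>(3) by blast
      let ?c = "chain_join (frag_of {v}) (frag_of ?\<tau>)"
      have c: "frag_of \<sigma> = frag_cmul \<epsilon> ?c" using e by simp
      have "vertex_coeff v (chain_join (frag_of {v}) (boundary (frag_of ?\<tau>))) = boundary (frag_of ?\<tau>)"
      proof (rule vertex_coeff_cone)
        fix \<upsilon> assume "\<upsilon> \<in> Poly_Mapping.keys (boundary (frag_of ?\<tau>))"
        then obtain \<sigma>' w where "\<sigma>' \<in> Poly_Mapping.keys (frag_of ?\<tau>)" "\<upsilon> = \<sigma>' - {w}"
          by (rule keys_boundary) (use fin in simp_all)
        then show "v \<notin> \<upsilon>" by simp
      qed simp
      moreover have "vertex_coeff v (frag_of ?\<tau>) = 0" by (rule vertex_coeff_absent) simp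
      ultimately have "vertex_coeff v (boundary ?c) = - boundary (frag_of ?\<tau>)"
        using \<tau>(1) by (simp add: boundary_cone vertex_coeff_diff)
      then show ?thesis
        unfolding c boundary_cmul vertex_coeff_cmul vertex_coeff_cone_simplex[OF \<tau>(1,2)]
        by (simp add: frag_cmul_minus_right)
    qed
  qed (simp_all add: boundary_diff vertex_coeff_diff)
qed

text \<open>A simplex that meets \<open>W\<close> does so in one vertex only and thus belongs to
  exactly one of the cones.\<close>

lemma vertex_decomposition:
  assumes "finite W" "finitary c"
    and one: "\<And>\<sigma> v w. \<sigma> \<in> Poly_Mapping.keys c \<Longrightarrow> v \<in> \<sigma> \<inter> W \<Longrightarrow> w \<in> \<sigma> \<inter> W \<Longrightarrow> v = w"
  shows "Poly_Mapping.keys (c - (\<Sum>v\<in>W. chain_join (frag_of {v}) (vertex_coeff v c)))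
          \<subseteq> {\<sigma> \<in> Poly_Mapping.keys c. \<sigma> \<inter> W = {}}"
proof -
  define S where "S = {\<sigma>. finite \<sigma> \<and> (\<forall>v\<in>\<sigma> \<inter> W. \<forall>w\<in>\<sigma> \<inter> W. v = w)}"
  let ?R = "\<lambda>\<sigma>. if \<sigma> \<inter> W = {} then frag_of \<sigma> else (0 :: 'a set \<Rightarrow>\<^sub>0 int)"
  have "Poly_Mapping.keys c \<subseteq> S"
    unfolding S_def using one assms(2) by (simp add: finitary_def subset_iff)
  then have "c - (\<Sum>v\<in>W. chain_join (frag_of {v}) (vertex_coeff v c)) = frag_extend ?R c"
  proof (induction c rule: frag_induction)
    case (one \<sigma>)
    then have fin: "finite \<sigma>" by (simp add: S_def)
    show ?case
    proof (cases "\<sigma> \<inter> W = {}")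
      case True
      have "vertex_coeff v (frag_of \<sigma>) = 0" if "v \<in> W" for v
        by (rule vertex_coeff_absent) (use that True in auto)
      then show ?thesis using True by simp
    next
      case False
      then obtain v where v: "v \<in> \<sigma>" "v \<in> W" by blast
      let ?\<tau> = "\<sigma> - {v}"
      have \<tau>: "finite ?\<tau>" "v \<notin> ?\<tau>" "insert v ?\<tau> = \<sigma>" using fin v by auto
      obtain \<epsilon> where e: "\<epsilon> * \<epsilon> = 1" "chain_join (frag_of {v}) (frag_of ?\<tau>) = frag_cmul \<epsilon> (frag_of \<sigma>)"
        using cone_simplex[OF \<tau>(1,2)] unfolding \<tau>(3) by blast
      then have c: "frag_of \<sigma> = frag_cmul \<epsilon> (chain_join (frag_of {v}) (frag_of ?\<tau>))" by simp
      have "vertex_coeff w (frag_of \<sigma>) = 0" if "w \<in> W - {v}" for w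
        by (rule vertex_coeff_absent) (use that one v in \<open>auto simp: S_def\<close>)
      then have "(\<Sum>w\<in>W. chain_join (frag_of {w}) (vertex_coeff w (frag_of \<sigma>))) =
          chain_join (frag_of {v}) (vertex_coeff v (frag_of \<sigma>))"
        using v(2) assms(1) by (subst sum.remove[of W v]) simp_all
      also have "\<dots> = frag_of \<sigma>"
        unfolding c vertex_coeff_cmul vertex_coeff_cone_simplex[OF \<tau>(1,2)] chain_join_cmul_right ..
      finally show ?thesis using False by simp
    qed
  next
    case (diff a b)
    have S: "(\<Sum>v\<in>W. chain_join (frag_of {v}) (vertex_coeff v (a - b))) =
      (\<Sum>v\<in>W. chain_join (frag_of {v}) (vertex_coeff v a)) - (\<Sum>v\<in>W. chain_join (frag_of {v}) (vertex_coeff v b))"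
      by (simp add: vertex_coeff_diff chain_join_diff_right sum_subtractf)
    show ?case unfolding S frag_extend_diff diff.IH[symmetric] by (simp add: algebra_simps)
  qed simp
  moreover have "Poly_Mapping.keys (frag_extend ?R c) \<subseteq> {\<sigma> \<in> Poly_Mapping.keys c. \<sigma> \<inter> W = {}}"
    by (rule order_trans[OF keys_frag_extend], rule UN_least) auto
  ultimately show ?thesis by simp
qed

section \<open>The mapping cylinder of a poset map\<close>

lemma homologous_add:
  assumes "homologous k K a b" "homologous k K a' b'" shows "homologous k K (a + a') (b + b')"
proof -
  obtain d e where "d \<in> chain_space (Suc k) K" "boundary d = a - b"
    "e \<in> chain_space (Suc k) K" "boundary e = a' - b'"
    using assms by (auto simp: homologous_def)
  then show ?thesis unfolding homologous_def
    by (intro bexI[of _ "d + e"]) (simp_all add: boundary_add chain_space_add)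
qed

lemma homologous_cmul:
  assumes "homologous k K a b" shows "homologous k K (frag_cmul m a) (frag_cmul m b)"
proof -
  obtain d where "d \<in> chain_space (Suc k) K" "boundary d = a - b"
    using assms by (auto simp: homologous_def)
  then show ?thesis unfolding homologous_def
    by (intro bexI[of _ "frag_cmul m d"]) (simp_all add: boundary_cmul chain_space_cmul frag_cmul_diff_right)
qed

lemma homologous_sum:
  "(\<And>i. i \<in> I \<Longrightarrow> homologous k K (F i) (G i)) \<Longrightarrow> homologous k K (sum F I) (sum G I)"
  by (induction I rule: infinite_finite_induct) (auto intro: homologous_refl homologous_add)

lemma homologous_frag_extend:
  assumes "\<And>i. i \<in> Poly_Mapping.keys c \<Longrightarrow> homologous k K (F i) (G i)"
  shows "homologous k K (frag_extend F c) (frag_extend G c)"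
  unfolding frag_extend_def by (intro homologous_sum homologous_cmul assms)

lemma homologous_0_boundary:
  "d \<in> chain_space (Suc k) K \<Longrightarrow> homologous k K (boundary d) 0"
  unfolding homologous_def by auto

lemma vertex_coeff_frag_extend:
  "vertex_coeff v (frag_extend g c) = frag_extend (\<lambda>i. vertex_coeff v (g i)) c"
  by (rule additive_frag_extend) (rule vertex_coeff_diff)

text \<open>The order complex of the mapping cylinder: the disjoint union of source and target in
  which \<open>x\<close> lies below \<open>y\<close> if \<open>f x \<le> y\<close>. The target is
  a parameter so that its elements can be removed by height.\<close>

definition cylinder :: "'a::order set \<Rightarrow> ('a \<Rightarrow> 'b) \<Rightarrow> 'b::order set \<Rightarrow> ('a + 'b) set set" where
  "cylinder X f U = {Inl ` s \<union> Inr ` t | s t.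
     s \<in> order_complex X \<and> t \<in> order_complex U \<and> (\<forall>x\<in>s. \<forall>y\<in>t. f x \<le> y)}"

lemma cylinderI:
  "s \<in> order_complex X \<Longrightarrow> t \<in> order_complex U \<Longrightarrow> (\<And>x y. x \<in> s \<Longrightarrow> y \<in> t \<Longrightarrow> f x \<le> y) \<Longrightarrow>
    Inl ` s \<union> Inr ` t \<in> cylinder X f U"
  unfolding cylinder_def by blast

lemma cylinderE:
  assumes "\<rho> \<in> cylinder X f U"
  obtains s t where "\<rho> = Inl ` s \<union> Inr ` t" "s \<in> order_complex X" "t \<in> order_complex U"
    "\<forall>x\<in>s. \<forall>y\<in>t. f x \<le> y"
  using assms unfolding cylinder_def by blast

lemma cylinder_iff:
  "\<rho> \<in> cylinder X f U \<longleftrightarrow> Inl -` \<rho> \<in> order_complex X \<and> Inr -` \<rho> \<in> order_complex U \<and>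
     (\<forall>x y. Inl x \<in> \<rho> \<longrightarrow> Inr y \<in> \<rho> \<longrightarrow> f x \<le> y)"
proof
  assume "\<rho> \<in> cylinder X f U"
  then obtain s t where r: "\<rho> = Inl ` s \<union> Inr ` t" "s \<in> order_complex X" "t \<in> order_complex U"
    "\<forall>x\<in>s. \<forall>y\<in>t. f x \<le> y" by (rule cylinderE)
  have "Inl -` \<rho> = s" "Inr -` \<rho> = t" using r(1) by auto
  then show "Inl -` \<rho> \<in> order_complex X \<and> Inr -` \<rho> \<in> order_complex U \<and>
     (\<forall>x y. Inl x \<in> \<rho> \<longrightarrow> Inr y \<in> \<rho> \<longrightarrow> f x \<le> y)" using r by auto
next
  assume r: "Inl -` \<rho> \<in> order_complex X \<and> Inr -` \<rho> \<in> order_complex U \<and>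
     (\<forall>x y. Inl x \<in> \<rho> \<longrightarrow> Inr y \<in> \<rho> \<longrightarrow> f x \<le> y)"
  have "\<rho> = Inl ` (Inl -` \<rho>) \<union> Inr ` (Inr -` \<rho>)" by (auto simp: image_iff) (metis sum.exhaust)
  moreover have "Inl ` (Inl -` \<rho>) \<union> Inr ` (Inr -` \<rho>) \<in> cylinder X f U"
    using r by (intro cylinderI) auto
  ultimately show "\<rho> \<in> cylinder X f U" by simp
qed

lemma simplicial_complex_cylinder: "simplicial_complex (cylinder X f U)"
  unfolding simplicial_complex_def
proof (intro conjI ballI allI impI)
  show "{} \<in> cylinder X f U" by (simp add: cylinder_iff order_complex_def)
  fix \<rho> assume r: "\<rho> \<in> cylinder X f U"
  then show "finite \<rho>" by (elim cylinderE) (simp add: order_complex_def)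
  fix \<tau> assume t: "\<tau> \<subseteq> \<rho>"
  have "Inl -` \<tau> \<subseteq> Inl -` \<rho>" "Inr -` \<tau> \<subseteq> Inr -` \<rho>" using t by auto
  then have "Inl -` \<tau> \<in> order_complex X" "Inr -` \<tau> \<in> order_complex U"
    using r complex_face[OF simplicial_complex_order_complex] by (auto simp: cylinder_iff)
  then show "\<tau> \<in> cylinder X f U" using r t by (auto simp: cylinder_iff)
qed

lemma cylinder_mono: "U \<subseteq> U' \<Longrightarrow> cylinder X f U \<subseteq> cylinder X f U'"
  using order_complex_mono[of U U'] by (auto simp: cylinder_iff)

lemma Inl_in_cylinder: "s \<in> order_complex X \<Longrightarrow> Inl ` s \<in> cylinder X f U"
  using cylinderI[of s X "{}" U f] by (simp add: order_complex_def)

lemma Inr_in_cylinder: "t \<in> order_complex U \<Longrightarrow> Inr ` t \<in> cylinder X f U"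
  using cylinderI[of "{}" X t U f] by (simp add: order_complex_def)

lemma cylinder_empty: "cylinder X f {} = (`) Inl ` order_complex X"
proof
  show "cylinder X f {} \<subseteq> (`) Inl ` order_complex X"
  proof
    fix \<rho> assume "\<rho> \<in> cylinder X f {}"
    then show "\<rho> \<in> (`) Inl ` order_complex X" by (elim cylinderE) (auto simp: order_complex_def)
  qed
qed (auto intro: Inl_in_cylinder)

lemma finite_chain_Max:
  assumes "finite s" "s \<noteq> {}" "\<And>x y. x \<in> s \<Longrightarrow> y \<in> s \<Longrightarrow> x \<le> y \<or> y \<le> (x::'c::order)"
  shows "\<exists>m\<in>s. \<forall>x\<in>s. x \<le> m"
  using assms
proof (induction s rule: finite_ne_induct)
  case (insert a s)
  then obtain m where m: "m \<in> s" "\<forall>x\<in>s. x \<le> m" by blast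
  show ?case
  proof (cases "a \<le> m")
    case True
    then show ?thesis using m by blast
  next
    case False
    then have "m \<le> a" using insert.prems[of a m] m(1) by auto
    then show ?thesis using m(2) by (intro bexI[of _ a]) (auto intro: order_trans)
  qed
qed simp

lemma finite_chain_Min:
  assumes "finite s" "s \<noteq> {}" "\<And>x y. x \<in> s \<Longrightarrow> y \<in> s \<Longrightarrow> x \<le> y \<or> y \<le> (x::'c::order)"
  shows "\<exists>m\<in>s. \<forall>x\<in>s. m \<le> x"
  using assms
proof (induction s rule: finite_ne_induct)
  case (insert a s)
  then obtain m where m: "m \<in> s" "\<forall>x\<in>s. m \<le> x" by blast
  show ?case
  proof (cases "m \<le> a")
    case True
    then show ?thesis using m by blast
  next
    case False
    then have "a \<le> m" using insert.prems[of a m] m(1) by auto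
    then show ?thesis using m(2) by (intro bexI[of _ a]) (auto intro: order_trans)
  qed
qed simp

lemma order_complex_image:
  assumes "mono_on X f" "f \<in> X \<rightarrow> Y" "s \<in> order_complex X"
  shows "f ` s \<in> order_complex Y"
proof -
  have "f x \<le> f y \<or> f y \<le> f x" if "x \<in> s" "y \<in> s" for x y
    using assms(3) that mono_onD[OF assms(1)] by (simp add: order_complex_def subset_iff) metis
  then show ?thesis using assms(2,3) by (auto simp: order_complex_def)
qed

definition retraction :: "('a \<Rightarrow> 'b) \<Rightarrow> 'a + 'b \<Rightarrow> 'b" where
  "retraction f = case_sum f (\<lambda>y. y)"

lemma retraction_simps [simp]: "retraction f (Inl x) = f x" "retraction f (Inr y) = y"
  by (simp_all add: retraction_def)

lemma retraction_cylinder: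
  assumes "mono_on X f" "f \<in> X \<rightarrow> Y" "\<rho> \<in> cylinder X f Y"
  shows "retraction f ` \<rho> \<in> order_complex Y"
proof -
  obtain s t where r: "\<rho> = Inl ` s \<union> Inr ` t" "s \<in> order_complex X" "t \<in> order_complex Y"
    "\<forall>x\<in>s. \<forall>y\<in>t. f x \<le> y" using assms(3) by (rule cylinderE)
  have "retraction f ` \<rho> = f ` s \<union> t" unfolding r(1) by (auto simp: image_Un image_image)
  then show ?thesis
    using order_complex_image[OF assms(1,2) r(2)] r(3,4) by (auto simp: order_complex_def)
qed

text \<open>The images of the vertices of a simplex form a chain with a greatest element, and that
  element is above all vertices of the simplex. So a simplex and its image lie in a common
  cone.\<close>

lemma retraction_homologous:
  assumes f: "mono_on X f" "f \<in> X \<rightarrow> Y" and z: "z \<in> cycle_space k (cylinder X f Y)"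
  shows "homologous k (cylinder X f Y) z (simplicial_chain_map (\<lambda>v. Inr (retraction f v)) z)"
  unfolding homologous_def
proof (rule conical_carrier_homologous[OF simplicial_complex_cylinder _ _ _ _ _ _ _ _ _ _ _ z,
      where \<phi> = "\<lambda>c. c"
      and \<Phi> = "\<lambda>\<sigma>. {\<rho> \<in> cylinder X f Y. \<rho> \<subseteq> \<sigma> \<union> (\<lambda>v. Inr (retraction f v)) ` \<sigma>}"])
  let ?r = "\<lambda>v. Inr (retraction f v) :: 'a + 'b"
  let ?\<Phi> = "\<lambda>\<sigma>. {\<rho> \<in> cylinder X f Y. \<rho> \<subseteq> \<sigma> \<union> ?r ` \<sigma>}"
  fix \<sigma> assume \<sigma>: "\<sigma> \<in> cylinder X f Y"
  have fin: "finite \<sigma>" using complex_finite[OF simplicial_complex_cylinder \<sigma>] .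
  show "boundary (simplicial_chain_map ?r (frag_of \<sigma>)) = simplicial_chain_map ?r (boundary (frag_of \<sigma>))"
    using fin by (simp add: boundary_simplicial_chain_map)
  show "frag_of \<sigma> \<in> chain_space (card \<sigma>) (?\<Phi> \<sigma>)" using \<sigma> by (simp add: chain_space_def)
  show "simplicial_chain_map ?r (frag_of \<sigma>) \<in> chain_space (card \<sigma>) (?\<Phi> \<sigma>)"
  proof (rule simplicial_chain_map_chain_space[where K = "Pow \<sigma>"])
    show "frag_of \<sigma> \<in> chain_space (card \<sigma>) (Pow \<sigma>)" by (simp add: chain_space_def)
    show "simplicial_complex (Pow \<sigma>)" using fin by (rule simplicial_complex_Pow)
    fix \<tau> assume "\<tau> \<in> Pow \<sigma>"
    then have "\<tau> \<in> cylinder X f Y" using complex_face[OF simplicial_complex_cylinder \<sigma>] by blast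
    from Inr_in_cylinder[OF retraction_cylinder[OF f this]]
    show "?r ` \<tau> \<in> ?\<Phi> \<sigma>" using \<open>\<tau> \<in> Pow \<sigma>\<close> by (auto simp: image_image)
  qed
  show "simplicial_complex (?\<Phi> \<sigma>)"
    using simplicial_complex_cylinder[of X f Y] unfolding simplicial_complex_def by blast
  show "?\<Phi> \<sigma> \<subseteq> cylinder X f Y" by blast
  show "?\<Phi> \<tau> \<subseteq> ?\<Phi> \<sigma>" if "\<tau> \<subseteq> \<sigma>" for \<tau> using that by blast
  assume ne: "\<sigma> \<noteq> {}"
  have rs: "retraction f ` \<sigma> \<in> order_complex Y" by (rule retraction_cylinder[OF f \<sigma>])
  then obtain m where m: "m \<in> retraction f ` \<sigma>" "\<forall>y\<in>retraction f ` \<sigma>. y \<le> m"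
    using finite_chain_Max[of "retraction f ` \<sigma>"] ne by (auto simp: order_complex_def)
  have mY: "m \<in> Y" using rs m(1) by (auto simp: order_complex_def)
  have "insert (Inr m) \<rho> \<in> ?\<Phi> \<sigma>" if r: "\<rho> \<in> ?\<Phi> \<sigma>" for \<rho>
  proof -
    have le: "retraction f v \<le> m" if "v \<in> \<rho>" for v using that r m(2) by auto
    have "Inl -` insert (Inr m) \<rho> = Inl -` \<rho>" "Inr -` insert (Inr m) \<rho> = insert m (Inr -` \<rho>)" by auto
    moreover have "insert m (Inr -` \<rho>) \<in> order_complex Y"
      using r mY le[of "Inr _"] by (auto simp: cylinder_iff order_complex_def)
    moreover have "f x \<le> m" if "Inl x \<in> \<rho>" for x using le[OF that] by simp
    ultimately have "insert (Inr m) \<rho> \<in> cylinder X f Y" using r by (simp add: cylinder_iff)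
    then show ?thesis using r m(1) by auto
  qed
  then show "\<exists>v. \<forall>\<rho>\<in>?\<Phi> \<sigma>. insert v \<rho> \<in> ?\<Phi> \<sigma>" by blast
qed (simp_all add: simplicial_chain_map_diff)

section \<open>The mapping cylinder filtered by height\<close>

text \<open>The chain-level content of a homologically spherical map, with \<open>N = n +
  1\<close> and \<open>ht\<close> the height. In terms of numbers of vertices the top degrees of
  \<open>f/y\<close> and of the part above \<open>y\<close> are \<open>ht y + 1\<close> and
  \<open>N - (ht y + 1)\<close>; they add up to \<open>N\<close>.\<close>

locale spherical_poset_map =
  fixes X :: "'a::order set" and Y :: "'b::order set" and f :: "'a \<Rightarrow> 'b" and N :: nat and ht :: "'b \<Rightarrow> nat"
  assumes f_in: "f \<in> X \<rightarrow> Y" and f_mono: "mono_on X f"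
    and ht_less: "\<And>y y'. y \<in> Y \<Longrightarrow> y' \<in> Y \<Longrightarrow> y < y' \<Longrightarrow> ht y < ht y'"
    and ht_bound: "\<And>y. y \<in> Y \<Longrightarrow> ht y < N"
    and target_dim: "dim_below N (order_complex Y)"
    and target_acyclic: "acyclic_below N (order_complex Y)"
    and fiber_dim: "\<And>y. y \<in> Y \<Longrightarrow> dim_below (Suc (ht y)) (order_complex (fiber X f y))"
    and fiber_acyclic: "\<And>y. y \<in> Y \<Longrightarrow> acyclic_below (Suc (ht y)) (order_complex (fiber X f y))"
    and above_dim: "\<And>y. y \<in> Y \<Longrightarrow> dim_below (N - Suc (ht y)) (order_complex (strictly_above Y y))"
    and above_acyclic: "\<And>y. y \<in> Y \<Longrightarrow> acyclic_below (N - Suc (ht y)) (order_complex (strictly_above Y y))"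
begin

text \<open>What lies below \<open>y\<close> in the cylinder joined with what lies above: the link
  of \<open>y\<close> once the elements of smaller height have been removed.\<close>

definition cyl_link :: "'b \<Rightarrow> ('a + 'b) set set" where
  "cyl_link y = complex_join ((`) Inl ` order_complex (fiber X f y)) ((`) Inr ` order_complex (strictly_above Y y))"

text \<open>Level \<open>0\<close> is the whole cylinder; from level \<open>N\<close> on only the
  source is left.\<close>

definition cyl_level :: "nat \<Rightarrow> ('a + 'b) set set" where
  "cyl_level r = cylinder X f {y \<in> Y. r \<le> ht y}"

lemma spherical_join_link:
  assumes "y \<in> Y"
  shows "spherical_join ((`) Inl ` order_complex (fiber X f y)) ((`) Inr ` order_complex (strictly_above Y y))
     (range Inl) (Suc (ht y)) (N - Suc (ht y))"
proof unfold_locales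
  let ?A = "order_complex (fiber X f y)" and ?B = "order_complex (strictly_above Y y)"
  note A = simplicial_complex_order_complex[of "fiber X f y"]
  note B = simplicial_complex_order_complex[of "strictly_above Y y"]
  show "simplicial_complex ((`) Inl ` ?A)" "simplicial_complex ((`) Inr ` ?B)"
    using simplicial_complex_image A B by blast+
  show "acyclic_below (Suc (ht y)) ((`) Inl ` ?A)"
    by (rule relabel_acyclic_below[OF A _ fiber_acyclic[OF assms]]) (simp add: inj_def)
  show "acyclic_below (N - Suc (ht y)) ((`) Inr ` ?B)"
    by (rule relabel_acyclic_below[OF B _ above_acyclic[OF assms]]) (simp add: inj_def)
  show "dim_below (Suc (ht y)) ((`) Inl ` ?A)" by (rule relabel_dim_below[OF A fiber_dim[OF assms]])
  show "dim_below (N - Suc (ht y)) ((`) Inr ` ?B)" by (rule relabel_dim_below[OF B above_dim[OF assms]])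
qed auto

lemma ht_split: "y \<in> Y \<Longrightarrow> Suc (ht y) + (N - Suc (ht y)) = N"
  using ht_bound[of y] by simp

lemma simplicial_complex_link: "y \<in> Y \<Longrightarrow> simplicial_complex (cyl_link y)"
  unfolding cyl_link_def
  using disjoint_join.simplicial_complex_join[OF spherical_join.axioms(1)[OF spherical_join_link]] .

lemma acyclic_link: "y \<in> Y \<Longrightarrow> acyclic_below N (cyl_link y)"
  using spherical_join.acyclic_below_join[OF spherical_join_link, of y] ht_split[of y]
  unfolding cyl_link_def by simp

lemma simplicial_complex_level: "simplicial_complex (cyl_level r)"
  unfolding cyl_level_def by (rule simplicial_complex_cylinder)

lemma level_mono: "r \<le> r' \<Longrightarrow> cyl_level r' \<subseteq> cyl_level r"
  unfolding cyl_level_def by (intro cylinder_mono) auto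

lemma level_0: "cyl_level 0 = cylinder X f Y"
  by (simp add: cyl_level_def)

lemma level_top: "N \<le> r \<Longrightarrow> cyl_level r = (`) Inl ` order_complex X"
proof -
  assume "N \<le> r"
  then have e: "{y \<in> Y. r \<le> ht y} = {}" using ht_bound by fastforce
  show ?thesis unfolding cyl_level_def e by (rule cylinder_empty)
qed

lemma link_in_level:
  assumes y: "y \<in> Y" shows "cyl_link y \<subseteq> cyl_level (Suc (ht y))"
proof
  fix \<rho> assume "\<rho> \<in> cyl_link y"
  then obtain s t where r: "\<rho> = Inl ` s \<union> Inr ` t" "s \<in> order_complex (fiber X f y)"
      "t \<in> order_complex (strictly_above Y y)" by (auto simp: cyl_link_def complex_join_def)
  have le: "f x' \<le> y'" if "x' \<in> s" "y' \<in> t" for x' y'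
  proof -
    have "f x' \<le> y" "y < y'" using r that by (auto simp: order_complex_def fiber_def strictly_above_def)
    then show ?thesis by simp
  qed
  have "s \<in> order_complex X" using r(2) by (auto simp: order_complex_def fiber_def)
  moreover have "t \<in> order_complex {y' \<in> Y. Suc (ht y) \<le> ht y'}"
    using r(3) ht_less[OF y] by (auto simp: order_complex_def strictly_above_def Suc_le_eq)
  ultimately show "\<rho> \<in> cyl_level (Suc (ht y))"
    unfolding r(1) cyl_level_def by (rule cylinderI) (rule le)
qed

lemma insert_link_in_level:
  assumes y: "y \<in> Y" and r: "\<rho> \<in> cyl_link y" shows "insert (Inr y) \<rho> \<in> cyl_level (ht y)"
proof -
  obtain s t where r: "\<rho> = Inl ` s \<union> Inr ` t" "s \<in> order_complex (fiber X f y)"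
      "t \<in> order_complex (strictly_above Y y)" using r by (auto simp: cyl_link_def complex_join_def)
  have t: "y < y' \<and> y' \<in> Y" if "y' \<in> t" for y' using r(3) that by (auto simp: order_complex_def strictly_above_def)
  have s: "f x' \<le> y" if "x' \<in> s" for x' using r(2) that by (auto simp: order_complex_def fiber_def)
  have "s \<in> order_complex X" using r(2) by (auto simp: order_complex_def fiber_def)
  moreover have "insert y t \<in> order_complex {y' \<in> Y. ht y \<le> ht y'}"
    using r(3) t ht_less[OF y] y by (auto simp: order_complex_def less_imp_le)
  moreover have "f x' \<le> y'" if "x' \<in> s" "y' \<in> insert y t" for x' y'
    using s[OF that(1)] t[of y'] that(2) by auto
  ultimately have "Inl ` s \<union> Inr ` insert y t \<in> cyl_level (ht y)"
    unfolding cyl_level_def by (rule cylinderI)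
  then show ?thesis by (simp add: r(1))
qed

lemma level_split:
  assumes \<rho>: "\<rho> \<in> cyl_level r" and y: "Inr y \<in> \<rho>" "ht y = r"
  shows "\<rho> - {Inr y} \<in> cyl_link y"
proof -
  obtain s t where r: "\<rho> = Inl ` s \<union> Inr ` t" "s \<in> order_complex X"
      "t \<in> order_complex {y \<in> Y. r \<le> ht y}" "\<forall>x\<in>s. \<forall>y\<in>t. f x \<le> y"
    using \<rho> unfolding cyl_level_def by (rule cylinderE)
  have yt: "y \<in> t" using r(1) y(1) by auto
  have yY: "y \<in> Y" using r(3) yt by (auto simp: order_complex_def)
  have "s \<in> order_complex (fiber X f y)" using r(2,4) yt by (auto simp: order_complex_def fiber_def)
  moreover have "t - {y} \<in> order_complex (strictly_above Y y)"
  proof -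
    have "y < y'" if "y' \<in> t - {y}" for y'
    proof -
      have "y' \<in> Y" "r \<le> ht y'" "y \<le> y' \<or> y' \<le> y" using that r(3) yt by (auto simp: order_complex_def)
      then show ?thesis using ht_less[of y' y] yY y(2) that by (auto simp: le_less)
    qed
    then show ?thesis using r(3) by (auto simp: order_complex_def strictly_above_def)
  qed
  moreover have "\<rho> - {Inr y} = Inl ` s \<union> Inr ` (t - {y})" using r(1) by auto
  ultimately show ?thesis by (auto simp: cyl_link_def complex_join_def)
qed

lemma level_vertex: "\<rho> \<in> cyl_level r \<Longrightarrow> Inr y \<in> \<rho> \<Longrightarrow> y \<in> Y \<and> r \<le> ht y"
  by (auto simp: cyl_level_def cylinder_iff order_complex_def)

lemma level_unique:
  assumes "\<rho> \<in> cyl_level r" "Inr y \<in> \<rho>" "ht y = r" "Inr y' \<in> \<rho>" "ht y' = r"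
  shows "y = y'"
proof (rule ccontr)
  assume "y \<noteq> y'"
  then have "Inr y' \<in> \<rho> - {Inr y}" using assms by auto
  then have "y' \<in> strictly_above Y y"
    using level_split[OF assms(1-3)] by (auto simp: cyl_link_def complex_join_def order_complex_def)
  moreover have "y \<in> Y" using assms(1,2) by (auto simp: cyl_level_def cylinder_iff order_complex_def)
  ultimately show False using ht_less[of y y'] assms by (auto simp: strictly_above_def)
qed

lemma level_Suc:
  assumes "\<rho> \<in> cyl_level r" "\<And>y. Inr y \<in> \<rho> \<Longrightarrow> ht y \<noteq> r"
  shows "\<rho> \<in> cyl_level (Suc r)"
proof -
  have "y \<in> Y \<and> Suc r \<le> ht y" if "Inr y \<in> \<rho>" for y
    using level_vertex[OF assms(1) that] assms(2)[OF that] by simp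
  then have "Inr -` \<rho> \<subseteq> {y \<in> Y. Suc r \<le> ht y}" by auto
  moreover have "Inr -` \<rho> \<in> order_complex {y \<in> Y. r \<le> ht y}"
    using assms(1) by (simp add: cyl_level_def cylinder_iff)
  ultimately have "Inr -` \<rho> \<in> order_complex {y \<in> Y. Suc r \<le> ht y}"
    by (simp add: order_complex_def)
  then show ?thesis using assms(1) by (simp add: cyl_level_def cylinder_iff)
qed

text \<open>Elements of equal height are incomparable, so no simplex contains two elements of
  height \<open>r\<close>, and the cones over their links can be split off separately.\<close>

lemma level_decomposition:
  assumes c: "c \<in> chain_space (Suc k) (cyl_level r)"
  obtains W c0 where "finite W" "W \<subseteq> {y \<in> Y. ht y = r}" "c0 \<in> chain_space (Suc k) (cyl_level (Suc r))"
    "c = c0 + (\<Sum>y\<in>W. chain_join (frag_of {Inr y}) (vertex_coeff (Inr y) c))"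
    "\<And>y. y \<in> W \<Longrightarrow> vertex_coeff (Inr y) c \<in> chain_space k (cyl_link y)"
proof -
  define W where "W = {y. ht y = r \<and> Inr y \<in> \<Union>(Poly_Mapping.keys c)}"
  have fin: "finitary c" by (rule chain_space_finitary[OF simplicial_complex_level c])
  have "finite (\<Union>(Poly_Mapping.keys c))" using fin by (auto simp: finitary_def)
  then have "finite ((Inr :: 'b \<Rightarrow> 'a + 'b) -` \<Union>(Poly_Mapping.keys c))" by (rule finite_vimageI) (simp add: inj_def)
  then have W: "finite W" by (rule rev_finite_subset) (auto simp: W_def)
  have WY: "W \<subseteq> {y \<in> Y. ht y = r}"
  proof
    fix y assume "y \<in> W"
    then obtain \<rho> where "\<rho> \<in> Poly_Mapping.keys c" "Inr y \<in> \<rho>" "ht y = r" by (auto simp: W_def)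
    then show "y \<in> {y \<in> Y. ht y = r}"
      using chain_spaceD[OF c, of \<rho>] by (auto simp: cyl_level_def cylinder_iff order_complex_def)
  qed
  let ?c0 = "c - (\<Sum>v\<in>Inr ` W. chain_join (frag_of {v}) (vertex_coeff v c))"
  have sub: "Poly_Mapping.keys ?c0 \<subseteq> {\<sigma> \<in> Poly_Mapping.keys c. \<sigma> \<inter> Inr ` W = {}}"
  proof (rule vertex_decomposition)
    show "finite (Inr ` W :: ('a + 'b) set)" using W by simp
    fix \<sigma> and v w :: "'a + 'b" assume "\<sigma> \<in> Poly_Mapping.keys c" "v \<in> \<sigma> \<inter> Inr ` W" "w \<in> \<sigma> \<inter> Inr ` W"
    then show "v = w" using level_unique[of \<sigma> r] chain_spaceD[OF c, of \<sigma>] by (auto simp: W_def)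
  qed (rule fin)
  have c0: "?c0 \<in> chain_space (Suc k) (cyl_level (Suc r))"
  proof (rule chain_spaceI)
    fix \<sigma> assume "\<sigma> \<in> Poly_Mapping.keys ?c0"
    then have s: "\<sigma> \<in> Poly_Mapping.keys c" "\<sigma> \<inter> Inr ` W = {}" using sub by auto
    then have "\<sigma> \<in> cyl_level r" "card \<sigma> = Suc k" using chain_spaceD[OF c] by auto
    moreover have "ht y \<noteq> r" if "Inr y \<in> \<sigma>" for y using that s by (auto simp: W_def)
    ultimately show "\<sigma> \<in> cyl_level (Suc r) \<and> card \<sigma> = Suc k" using level_Suc by blast
  qed
  show thesis
  proof (rule that[OF W WY c0])
    show "c = ?c0 + (\<Sum>y\<in>W. chain_join (frag_of {Inr y}) (vertex_coeff (Inr y) c))"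
      by (subst sum.reindex) (simp_all add: inj_on_def)
    fix y assume y: "y \<in> W"
    show "vertex_coeff (Inr y) c \<in> chain_space k (cyl_link y)"
    proof (rule chain_spaceI)
      fix \<tau> assume "\<tau> \<in> Poly_Mapping.keys (vertex_coeff (Inr y) c)"
      then have t: "Inr y \<notin> \<tau>" "insert (Inr y) \<tau> \<in> Poly_Mapping.keys c" using keys_vertex_coeff[of \<tau> "Inr y" c] by auto
      then have "insert (Inr y) \<tau> \<in> cyl_level r" "card (insert (Inr y) \<tau>) = Suc k"
        using chain_spaceD[OF c] by auto
      moreover from this have "finite \<tau>"
        using complex_finite[OF simplicial_complex_level, of "insert (Inr y) \<tau>" r] by simp
      moreover have "insert (Inr y) \<tau> - {Inr y} = \<tau>" using t by auto
      ultimately show "\<tau> \<in> cyl_link y \<and> card \<tau> = k"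
        using level_split[of "insert (Inr y) \<tau>" r y] t(1) y by (auto simp: W_def)
    qed
  qed
qed

lemma cone_in_level:
  assumes "y \<in> Y" "d \<in> chain_space k (cyl_link y)"
  shows "chain_join (frag_of {Inr y}) d \<in> chain_space (Suc k) (cyl_level (ht y))"
  by (rule cone_chain_space[OF assms(2) simplicial_complex_link[OF assms(1)]])
     (rule insert_link_in_level[OF assms(1)])

lemma link_chain_in_level:
  "y \<in> Y \<Longrightarrow> d \<in> chain_space k (cyl_link y) \<Longrightarrow> d \<in> chain_space k (cyl_level (Suc (ht y)))"
  using chain_space_mono[OF link_in_level] by blast

lemma link_finitary: "y \<in> Y \<Longrightarrow> d \<in> chain_space k (cyl_link y) \<Longrightarrow> finitary d"
  using chain_space_finitary[OF simplicial_complex_link] by blast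

text \<open>The coefficient of \<open>y\<close> in \<open>\<partial> c\<close> is, up to sign, the
  boundary of the coefficient of \<open>y\<close> in \<open>c\<close>. If \<open>\<partial>
  c\<close> avoids height \<open>r\<close>, the coefficients of \<open>c\<close> at these elements
  must therefore be cycles in the links. This is the excision isomorphism for the pair of
  successive levels.\<close>

lemma relative_cycle_decomposition:
  assumes c: "c \<in> chain_space (Suc k) (cyl_level r)" and bd: "boundary c \<in> chain_space k (cyl_level (Suc r))"
  obtains W c0 C where "finite W" "W \<subseteq> {y \<in> Y. ht y = r}" "c0 \<in> chain_space (Suc k) (cyl_level (Suc r))"
    "\<And>y. y \<in> W \<Longrightarrow> C y \<in> cycle_space k (cyl_link y)"
    "c = c0 + (\<Sum>y\<in>W. chain_join (frag_of {Inr y}) (C y))"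
    "boundary c = boundary c0 + sum C W"
proof -
  obtain W c0 where W: "finite W" "W \<subseteq> {y \<in> Y. ht y = r}" "c0 \<in> chain_space (Suc k) (cyl_level (Suc r))"
    "c = c0 + (\<Sum>y\<in>W. chain_join (frag_of {Inr y}) (vertex_coeff (Inr y) c))"
    and C: "\<And>y. y \<in> W \<Longrightarrow> vertex_coeff (Inr y) c \<in> chain_space k (cyl_link y)"
    by (rule level_decomposition[OF c]) (assumption | rule that)+
  let ?C = "\<lambda>y. vertex_coeff (Inr y) c"
  have fin: "finitary c" by (rule chain_space_finitary[OF simplicial_complex_level c])
  have C0: "boundary (?C y) = 0" if y: "y \<in> W" for y
  proof -
    have "vertex_coeff (Inr y) (boundary c) = 0"
    proof (rule vertex_coeff_absent)
      fix \<sigma> assume "\<sigma> \<in> Poly_Mapping.keys (boundary c)"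
      then have "\<sigma> \<in> cyl_level (Suc r)" using chain_spaceD[OF bd] by blast
      then show "Inr y \<notin> \<sigma>" using level_vertex[of \<sigma> "Suc r" y] W(2) y by auto
    qed
    then show ?thesis using boundary_vertex_coeff[OF fin] by simp
  qed
  have "boundary (chain_join (frag_of {Inr y}) (?C y)) = ?C y" if y: "y \<in> W" for y
    using boundary_cone[of "?C y" "Inr y"] C0[OF y] link_finitary[OF _ C[OF y]] W(2) y by auto
  then have "boundary c = boundary c0 + sum ?C W"
    by (subst W(4)) (simp add: boundary_add boundary_sum)
  then show thesis using that[OF W(1-3), of ?C] C C0 W(4) by (simp add: cycle_space_def)
qed

text \<open>The coefficients of a cycle are cycles of the links, with one vertex less; in the
  given range they bound there. The cone over such a coefficient and its filling differ by the
  boundary of the cone over the filling, so the cones can be replaced by the fillings.\<close>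

lemma push_step:
  assumes z: "z \<in> cycle_space k (cyl_level r)" and k: "k \<le> N"
  shows "\<exists>w\<in>cycle_space k (cyl_level (Suc r)). homologous k (cyl_level r) z w"
proof (cases k)
  case 0
  have "z \<in> chain_space 0 (cyl_level (Suc r))"
  proof (rule chain_spaceI)
    fix \<sigma> assume "\<sigma> \<in> Poly_Mapping.keys z"
    then have "\<sigma> = {}"
      using chain_spaceD[OF cycle_space_chain[OF z]] complex_finite[OF simplicial_complex_level] 0 by fastforce
    then show "\<sigma> \<in> cyl_level (Suc r) \<and> card \<sigma> = 0"
      using complex_empty[OF simplicial_complex_level] by simp
  qed
  then show ?thesis using z 0 homologous_refl by (auto simp: cycle_space_def)
next
  case (Suc j)
  have bd: "boundary z \<in> chain_space j (cyl_level (Suc r))" using z by (simp add: cycle_space_def)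
  obtain W c0 C where W: "finite W" "W \<subseteq> {y \<in> Y. ht y = r}" "c0 \<in> chain_space (Suc j) (cyl_level (Suc r))"
    "\<And>y. y \<in> W \<Longrightarrow> C y \<in> cycle_space j (cyl_link y)"
    "z = c0 + (\<Sum>y\<in>W. chain_join (frag_of {Inr y}) (C y))"
    by (rule relative_cycle_decomposition[OF cycle_space_chain[OF z[unfolded Suc]] bd]) (assumption | rule that)+
  have "\<exists>d\<in>chain_space k (cyl_link y). boundary d = C y" if "y \<in> W" for y
    using acyclic_belowD[OF acyclic_link _ W(4)[OF that]] that W(2) k Suc by auto
  then obtain D where D: "\<And>y. y \<in> W \<Longrightarrow> D y \<in> chain_space k (cyl_link y) \<and> boundary (D y) = C y" by metis
  define d where "d = (\<Sum>y\<in>W. chain_join (frag_of {Inr y}) (D y))"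
  have d: "d \<in> chain_space (Suc k) (cyl_level r)"
    unfolding d_def using cone_in_level D W(2) by (intro chain_space_sum) fastforce
  have "boundary d = (\<Sum>y\<in>W. D y - chain_join (frag_of {Inr y}) (C y))"
    unfolding d_def boundary_sum
  proof (rule sum.cong[OF refl])
    fix y assume y: "y \<in> W"
    then have "finitary (D y)" using D[OF y] W(2) link_finitary by blast
    then show "boundary (chain_join (frag_of {Inr y}) (D y)) = D y - chain_join (frag_of {Inr y}) (C y)"
      using boundary_cone[of "D y" "Inr y"] D[OF y] by simp
  qed
  then have w: "z + boundary d = c0 + sum D W" unfolding W(5) by (simp add: sum_subtractf)
  have "z + boundary d \<in> chain_space k (cyl_level (Suc r))"
    unfolding w
  proof (intro chain_space_add chain_space_sum)
    show "c0 \<in> chain_space k (cyl_level (Suc r))" using W(3) Suc by simp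
    fix y assume "y \<in> W"
    then show "D y \<in> chain_space k (cyl_level (Suc r))" using D[of y] W(2) link_chain_in_level[of y] by auto
  qed
  moreover have "boundary (z + boundary d) = 0"
    using z boundary_boundary[OF chain_space_finitary[OF simplicial_complex_level d]]
    by (simp add: boundary_add cycle_space_def)
  moreover have "homologous k (cyl_level r) z (z + boundary d)"
    unfolding homologous_def using d by (intro bexI[of _ "- d"]) (simp_all add: boundary_minus chain_space_minus)
  ultimately show ?thesis by (auto simp: cycle_space_def)
qed

lemma push:
  assumes "z \<in> cycle_space k (cyl_level r)" "k \<le> N"
  shows "\<exists>w\<in>cycle_space k (order_complex X). homologous k (cyl_level r) z (simplicial_chain_map Inl w)"
proof -
  have "\<exists>w\<in>cycle_space k (cyl_level (r + m)). homologous k (cyl_level r) z w" for m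
  proof (induction m)
    case 0
    then show ?case using assms homologous_refl by auto
  next
    case (Suc m)
    then obtain w where w: "w \<in> cycle_space k (cyl_level (r + m))" "homologous k (cyl_level r) z w" by blast
    obtain w' where w': "w' \<in> cycle_space k (cyl_level (Suc (r + m)))" "homologous k (cyl_level (r + m)) w w'"
      using push_step[OF w(1) assms(2)] by blast
    have "homologous k (cyl_level r) w w'"
      using homologous_mono[OF level_mono w'(2)] by simp
    then show ?case using w' homologous_trans[OF w(2)] by auto
  qed
  from this[of N] obtain w where w: "w \<in> cycle_space k (cyl_level (r + N))" "homologous k (cyl_level r) z w" by blast
  have "w \<in> cycle_space k ((`) Inl ` order_complex X)" using w(1) level_top[of "r + N"] by simp
  then obtain u where "u \<in> cycle_space k (order_complex X)" "w = simplicial_chain_map Inl u"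
    using relabel_cycle_space[OF simplicial_complex_order_complex, of Inl k X]
    by (auto simp: bij_betw_def inj_def)
  then show ?thesis using w(2) by blast
qed

text \<open>The whole cylinder is acyclic like \<open>Y\<close>. If a cycle of the next level is
  filled in the present one, the cones in the filling stand over cycles of the links and can be
  replaced by fillings inside the links, as these are acyclic too.\<close>

lemma acyclic_level: "acyclic_below N (cyl_level r)"
proof (induction r)
  case 0
  show ?case unfolding acyclic_below_def
  proof (intro allI impI ballI)
    fix k z assume k: "k < N" and z: "z \<in> cycle_space k (cyl_level 0)"
    let ?r = "retraction f"
    have "simplicial_chain_map ?r z \<in> cycle_space k (order_complex Y)"
      using z retraction_cylinder[OF f_mono f_in]
      by (intro simplicial_chain_map_cycle_space[OF _ simplicial_complex_level[of 0]]) (auto simp: level_0)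
    then obtain c where c: "c \<in> chain_space (Suc k) (order_complex Y)" "boundary c = simplicial_chain_map ?r z"
      using acyclic_belowD[OF target_acyclic k] by blast
    have fc: "finitary c" by (rule chain_space_finitary[OF simplicial_complex_order_complex c(1)])
    have fz: "finitary z" using chain_space_finitary[OF simplicial_complex_level cycle_space_chain[OF z]] .
    have "boundary (simplicial_chain_map Inr c) = simplicial_chain_map (\<lambda>v. Inr (?r v)) z"
      using fc fz c(2) by (simp add: boundary_simplicial_chain_map simplicial_chain_map_compose comp_def)
    moreover have "simplicial_chain_map Inr c \<in> chain_space (Suc k) (cyl_level 0)"
      unfolding level_0 by (rule simplicial_chain_map_chain_space[OF c(1) simplicial_complex_order_complex])
        (rule Inr_in_cylinder)
    ultimately have "homologous k (cyl_level 0) (simplicial_chain_map (\<lambda>v. Inr (?r v)) z) 0"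
      unfolding homologous_def by auto
    moreover have "homologous k (cyl_level 0) z (simplicial_chain_map (\<lambda>v. Inr (?r v)) z)"
      using retraction_homologous[OF f_mono f_in] z by (simp add: level_0)
    ultimately have "homologous k (cyl_level 0) z 0" by (rule homologous_trans[rotated])
    then show "\<exists>c\<in>chain_space (Suc k) (cyl_level 0). boundary c = z" by (simp add: homologous_def)
  qed
next
  case (Suc r)
  show ?case unfolding acyclic_below_def
  proof (intro allI impI ballI)
    fix k z assume k: "k < N" and z: "z \<in> cycle_space k (cyl_level (Suc r))"
    have "z \<in> cycle_space k (cyl_level r)" using cycle_space_mono[OF level_mono z] by simp
    then obtain c where c: "c \<in> chain_space (Suc k) (cyl_level r)" "boundary c = z"
      using acyclic_belowD[OF Suc k] by blast
    have bd: "boundary c \<in> chain_space k (cyl_level (Suc r))" using c(2) z by (simp add: cycle_space_def)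
    obtain W c0 C where W: "finite W" "W \<subseteq> {y \<in> Y. ht y = r}" "c0 \<in> chain_space (Suc k) (cyl_level (Suc r))"
      "\<And>y. y \<in> W \<Longrightarrow> C y \<in> cycle_space k (cyl_link y)" "boundary c = boundary c0 + sum C W"
      by (rule relative_cycle_decomposition[OF c(1) bd]) (assumption | rule that)+
    have "\<exists>d\<in>chain_space (Suc k) (cyl_link y). boundary d = C y" if "y \<in> W" for y
      using acyclic_belowD[OF acyclic_link k W(4)[OF that]] that W(2) by auto
    then obtain D where D: "\<And>y. y \<in> W \<Longrightarrow> D y \<in> chain_space (Suc k) (cyl_link y) \<and> boundary (D y) = C y" by metis
    have "c0 + sum D W \<in> chain_space (Suc k) (cyl_level (Suc r))"
    proof (intro chain_space_add chain_space_sum W(3))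
      fix y assume "y \<in> W"
      then show "D y \<in> chain_space (Suc k) (cyl_level (Suc r))" using D[of y] W(2) link_chain_in_level[of y] by auto
    qed
    moreover have "boundary (c0 + sum D W) = z"
      using W(5) c(2) D by (simp add: boundary_add boundary_sum)
    ultimately show "\<exists>c\<in>chain_space (Suc k) (cyl_level (Suc r)). boundary c = z" by blast
  qed
qed

theorem acyclic_source: "acyclic_below N (order_complex X)"
  unfolding acyclic_below_def
proof (intro allI impI ballI)
  fix k z assume k: "k < N" and z: "z \<in> cycle_space k (order_complex X)"
  let ?g = "case_sum (\<lambda>x. x) (\<lambda>_. undefined) :: 'a + 'b \<Rightarrow> 'a"
  have fz: "finitary z" using chain_space_finitary[OF simplicial_complex_order_complex cycle_space_chain[OF z]] .
  have "simplicial_chain_map Inl z \<in> cycle_space k (cyl_level N)"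
    by (rule simplicial_chain_map_cycle_space[OF z simplicial_complex_order_complex])
       (simp add: level_top)
  then obtain c where c: "c \<in> chain_space (Suc k) (cyl_level N)" "boundary c = simplicial_chain_map Inl z"
    using acyclic_belowD[OF acyclic_level k] by blast
  have "simplicial_chain_map ?g c \<in> chain_space (Suc k) (order_complex X)"
    by (rule simplicial_chain_map_chain_space[OF c(1) simplicial_complex_level])
       (auto simp: level_top image_image)
  moreover have "boundary (simplicial_chain_map ?g c) = z"
    using boundary_simplicial_chain_map[OF chain_space_finitary[OF simplicial_complex_level c(1)], of ?g] c(2) fz
    by (simp add: simplicial_chain_map_compose comp_def simplicial_chain_map_id)
  ultimately show "\<exists>c\<in>chain_space (Suc k) (order_complex X). boundary c = z" by blast
qed

end

section \<open>Top cycles of the source\<close>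

context spherical_poset_map
begin

text \<open>The chain lies in the fibre below the image of its greatest element.\<close>

lemma chain_in_fiber:
  assumes s: "s \<in> order_complex X" and "s \<noteq> {}"
  shows "\<exists>y\<in>Y. s \<in> order_complex (fiber X f y)"
proof -
  obtain m where m: "m \<in> s" "\<forall>x\<in>s. x \<le> m"
    using finite_chain_Max[of s] assms by (auto simp: order_complex_def)
  have "f x \<le> f m" if "x \<in> s" for x
    using mono_onD[OF f_mono, of x m] m that s by (auto simp: order_complex_def)
  then have "s \<in> order_complex (fiber X f (f m))" using s by (auto simp: order_complex_def fiber_def)
  moreover have "f m \<in> Y" using f_in m(1) s by (auto simp: order_complex_def)
  ultimately show ?thesis by blast
qed

lemma source_dim: "dim_below N (order_complex X)"
  unfolding dim_below_def
proof
  fix s assume s: "s \<in> order_complex X"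
  show "card s \<le> N"
  proof (cases "s = {}")
    case False
    then obtain y where y: "y \<in> Y" "s \<in> order_complex (fiber X f y)" using chain_in_fiber[OF s] by blast
    then show ?thesis using dim_belowD[OF fiber_dim[OF y(1)] y(2)] ht_bound[OF y(1)] by simp
  qed simp
qed

lemma cylinder_dim: "dim_below (Suc N) (cyl_level r)"
  unfolding dim_below_def
proof
  fix \<rho> assume "\<rho> \<in> cyl_level r"
  then have "\<rho> \<in> cylinder X f Y" using level_mono[of 0 r] level_0 by auto
  then obtain s t where r: "\<rho> = Inl ` s \<union> Inr ` t" "s \<in> order_complex X" "t \<in> order_complex Y"
    "\<forall>x\<in>s. \<forall>y\<in>t. f x \<le> y" by (rule cylinderE)
  have fin: "finite s" "finite t" using r by (auto simp: order_complex_def)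
  have "Inl ` s \<inter> Inr ` t = {}" by auto
  then have c: "card \<rho> = card s + card t"
    unfolding r(1) using fin by (simp add: card_Un_disjoint card_image inj_on_def)
  show "card \<rho> \<le> Suc N"
  proof (cases "t = {}")
    case True
    then show ?thesis using c dim_belowD[OF source_dim r(2)] by simp
  next
    case False
    then obtain m where m: "m \<in> t" "\<forall>y\<in>t. m \<le> y"
      using finite_chain_Min[of t] r(3) by (auto simp: order_complex_def)
    have mY: "m \<in> Y" using m(1) r(3) by (auto simp: order_complex_def)
    have "s \<in> order_complex (fiber X f m)" using r(2,4) m(1) by (auto simp: order_complex_def fiber_def)
    then have 1: "card s \<le> Suc (ht m)" by (rule dim_belowD[OF fiber_dim[OF mY]])
    have "t - {m} \<in> order_complex (strictly_above Y m)"
      using r(3) m by (auto simp: order_complex_def strictly_above_def le_less)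
    then have "card (t - {m}) \<le> N - Suc (ht m)" by (rule dim_belowD[OF above_dim[OF mY]])
    then show ?thesis using 1 c m(1) fin(2) ht_bound[OF mY] by simp
  qed
qed

lemma homologous_retract:
  assumes "homologous k (cylinder X f Y) a b"
  shows "homologous k (order_complex Y) (simplicial_chain_map (retraction f) a) (simplicial_chain_map (retraction f) b)"
  by (rule homologous_simplicial[OF assms simplicial_complex_cylinder])
     (rule retraction_cylinder[OF f_mono f_in])

lemma retract_Inl: "finitary c \<Longrightarrow> simplicial_chain_map (retraction f) (simplicial_chain_map Inl c) = simplicial_chain_map f c"
  by (simp add: simplicial_chain_map_compose comp_def)

lemma retract_Inr: "finitary c \<Longrightarrow> simplicial_chain_map (retraction f) (simplicial_chain_map Inr c) = c"
  by (simp add: simplicial_chain_map_compose comp_def simplicial_chain_map_id)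

lemma source_finitary: "c \<in> cycle_space k (order_complex X) \<Longrightarrow> finitary c"
  using chain_space_finitary[OF simplicial_complex_order_complex cycle_space_chain] by blast

lemma target_top: "homologous N (order_complex Y) a b \<Longrightarrow> a = b"
  using homologous_top[of "order_complex Y" N] dim_belowD[OF target_dim] by blast

text \<open>The cycle, seen in the cylinder, can be pushed into the source without changing its
  class. Mapping back to \<open>Y\<close> gives a homologous, hence equal, top cycle.\<close>

lemma induced_surjective:
  assumes z: "z \<in> cycle_space N (order_complex Y)"
  shows "\<exists>w\<in>cycle_space N (order_complex X). simplicial_chain_map f w = z"
proof -
  have fz: "finitary z" by (rule chain_space_finitary[OF simplicial_complex_order_complex cycle_space_chain[OF z]])
  have "simplicial_chain_map Inr z \<in> cycle_space N (cyl_level 0)"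
    unfolding level_0
    by (rule simplicial_chain_map_cycle_space[OF z simplicial_complex_order_complex]) (rule Inr_in_cylinder)
  then obtain w where w: "w \<in> cycle_space N (order_complex X)"
    "homologous N (cyl_level 0) (simplicial_chain_map Inr z) (simplicial_chain_map Inl w)"
    using push[of _ N 0] by blast
  have "homologous N (order_complex Y) z (simplicial_chain_map f w)"
    using homologous_retract[OF w(2)[unfolded level_0]] source_finitary[OF w(1)] fz
    by (simp add: retract_Inl retract_Inr)
  then show ?thesis using target_top w(1) by blast
qed

lemma link_push:
  assumes "y \<in> Y" "z \<in> cycle_space N (cyl_link y)"
  shows "\<exists>w\<in>cycle_space N (order_complex X). homologous N (cyl_level (Suc (ht y))) z (simplicial_chain_map Inl w)"
  using push[OF cycle_space_mono[OF link_in_level[OF assms(1)] assms(2)]] by simp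

lemma link_boundary:
  assumes y: "y \<in> Y" and z: "z \<in> cycle_space k (cyl_link y)"
  shows "boundary (chain_join (frag_of {Inr y}) z) = z"
  using boundary_cone[of z "Inr y"] link_finitary[OF y cycle_space_chain[OF z]] cycle_space_boundary[OF z] by simp

lemma level_vertex_absent:
  assumes "c \<in> chain_space k (cyl_level r)" "ht y < r" shows "vertex_coeff (Inr y) c = 0"
proof (rule vertex_coeff_absent)
  fix \<sigma> assume "\<sigma> \<in> Poly_Mapping.keys c"
  then show "Inr y \<notin> \<sigma>" using chain_spaceD[OF assms(1)] level_vertex[of \<sigma> r y] assms(2) by auto
qed

text \<open>Coefficients at \<open>y0\<close> detect the cone with apex \<open>y0\<close>: the
  link of \<open>y\<close> only contains elements of the target that are higher than
  \<open>y0\<close>.\<close>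

lemma link_vertex_coeff:
  assumes y: "y \<in> Y" and z: "z \<in> chain_space k (cyl_link y)" and y0: "ht y0 \<le> ht y"
  shows "vertex_coeff (Inr y0) (chain_join (frag_of {Inr y}) z) = (if y = y0 then z else 0)"
proof (cases "y = y0")
  case True
  have "Inr y0 \<notin> \<sigma>" if "\<sigma> \<in> Poly_Mapping.keys z" for \<sigma>
    using chain_spaceD[OF link_chain_in_level[OF y z] that] level_vertex[of \<sigma> "Suc (ht y)" y0] True by auto
  then show ?thesis using vertex_coeff_cone[OF link_finitary[OF y z]] True by simp
next
  case False
  have "vertex_coeff (Inr y0) (chain_join (frag_of {Inr y}) z) = 0"
  proof (rule vertex_coeff_absent)
    fix \<rho> assume "\<rho> \<in> Poly_Mapping.keys (chain_join (frag_of {Inr y}) z)"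
    then obtain \<sigma> \<tau> where "\<sigma> \<in> Poly_Mapping.keys (frag_of {Inr y :: 'a + 'b})" "\<tau> \<in> Poly_Mapping.keys z" "\<rho> = \<sigma> \<union> \<tau>"
      by (rule keys_chain_join) (use link_finitary[OF y z] in simp_all)
    then show "Inr y0 \<notin> \<rho>"
      using chain_spaceD[OF link_chain_in_level[OF y z]] level_vertex[of \<tau> "Suc (ht y)" y0] False y0 by auto
  qed
  then show ?thesis using False by simp
qed

text \<open>The pushed link cycles \<open>w\<close> form a basis of the kernel of the induced map,
  and the \<open>\<gamma>\<close> lift a basis of its image. The argument uses no particular
  choice of \<open>w\<close>, only that it is homologous to the cycle \<open>\<zeta>\<close> of
  the link by a homology that avoids \<open>y\<close> and everything of at most its
  height.\<close>

theorem cylinder_basis: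
  fixes \<gamma> :: "'i \<Rightarrow> ('a set \<Rightarrow>\<^sub>0 int)" and E :: "'b \<Rightarrow> 'e set"
  assumes \<gamma>: "\<And>i. i \<in> I \<Longrightarrow> \<gamma> i \<in> cycle_space N (order_complex X)"
    and \<gamma>_basis: "int_basis (cycle_space N (order_complex Y)) I (\<lambda>i. simplicial_chain_map f (\<gamma> i))"
    and \<zeta>: "\<And>y. y \<in> Y \<Longrightarrow> int_basis (cycle_space N (cyl_link y)) (E y) (\<zeta> y)"
    and w: "\<And>y e. y \<in> Y \<Longrightarrow> e \<in> E y \<Longrightarrow> w y e \<in> cycle_space N (order_complex X)"
    and hom: "\<And>y e. y \<in> Y \<Longrightarrow> e \<in> E y \<Longrightarrow>
       homologous N (cyl_level (Suc (ht y))) (\<zeta> y e) (simplicial_chain_map Inl (w y e))"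
  shows "int_basis (cycle_space N (order_complex X)) (I <+> (SIGMA y:Y. E y)) (case_sum \<gamma> (\<lambda>(y, e). w y e))"
proof -
  define W where "W = (\<lambda>(y, e). w y e)"
  let ?S = "SIGMA y:Y. E y" and ?ZX = "cycle_space N (order_complex X)"
  let ?l = "simplicial_chain_map (Inl :: 'a \<Rightarrow> 'a + 'b)" and ?f = "simplicial_chain_map f"
  have \<zeta>_in: "\<zeta> y e \<in> cycle_space N (cyl_link y)" if "y \<in> Y" "e \<in> E y" for y e
    using int_basis_in[OF \<zeta>[OF that(1)] that(2)] .
  have W_in: "W ye \<in> ?ZX" if "ye \<in> ?S" for ye using that w by (auto simp: W_def)
  have fW: "?f (W ye) = 0" if yS: "ye \<in> ?S" for ye
  proof -
    obtain y e where ye: "ye = (y, e)" "y \<in> Y" "e \<in> E y" using yS by auto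
    have "homologous N (cylinder X f Y) (\<zeta> y e) (?l (w y e))"
      using homologous_mono[OF level_mono[of 0] hom[OF ye(2,3)]] by (simp add: level_0)
    then have 1: "homologous N (order_complex Y) (simplicial_chain_map (retraction f) (\<zeta> y e)) (?f (w y e))"
      using homologous_retract retract_Inl[OF source_finitary[OF w[OF ye(2,3)]]] by fastforce
    have "homologous N (cyl_level (ht y)) (\<zeta> y e) 0"
      using homologous_0_boundary[OF cone_in_level[OF ye(2) cycle_space_chain[OF \<zeta>_in[OF ye(2,3)]]]]
      by (simp add: link_boundary[OF ye(2) \<zeta>_in[OF ye(2,3)]])
    then have "homologous N (cylinder X f Y) (\<zeta> y e) 0"
      using homologous_mono[OF level_mono[of 0]] by (simp add: level_0)
    then have "homologous N (order_complex Y) (simplicial_chain_map (retraction f) (\<zeta> y e)) 0"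
      using homologous_retract by fastforce
    then show ?thesis using target_top[OF 1] target_top by (simp add: W_def ye(1))
  qed
  have fW_ext: "?f (frag_extend W u) = 0" if "Poly_Mapping.keys u \<subseteq> ?S" for u
  proof -
    have "?f (frag_extend W u) = frag_extend (\<lambda>ye. ?f (W ye)) u"
      by (rule additive_frag_extend) (rule simplicial_chain_map_diff)
    also have "\<dots> = 0" by (rule frag_extend_eq_0) (use that fW in auto)
    finally show ?thesis .
  qed
  have W_ext: "frag_extend W u \<in> ?ZX" if "Poly_Mapping.keys u \<subseteq> ?S" for u
    using that W_in by (intro cycle_space_frag_extend) auto
  have inj_l: "a = b" if "a \<in> ?ZX" "b \<in> ?ZX" "?l a = ?l b" for a b
    using relabel_cycle_space[OF simplicial_complex_order_complex, of "Inl :: 'a \<Rightarrow> 'a + 'b" N X] that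
    by (auto simp: bij_betw_def inj_def dest: inj_onD)

  \<comment> \<open>A top cycle that bounds in level \<open>N - m\<close> is a combination of
    pushed cycles, by induction on \<open>m\<close>: the part of the filling at the lowest
    height consists of cones over top cycles of links. Subtracting the corresponding pushed
    cycles leaves a cycle that bounds one level further up, and in the top level only zero
    bounds.\<close>
  have kernel: "\<exists>u. Poly_Mapping.keys u \<subseteq> ?S \<and> z = frag_extend W u"
    if "z \<in> ?ZX" "homologous N (cyl_level (N - m)) (?l z) 0" "m \<le> N" for z m
    using that
  proof (induction m arbitrary: z)
    case 0
    obtain d where d: "d \<in> chain_space (Suc N) (cyl_level N)" "boundary d = ?l z"
      using 0(2) by (auto simp: homologous_def)
    have "dim_below N (cyl_level N)"
      unfolding level_top[OF order_refl]
      by (rule relabel_dim_below[OF simplicial_complex_order_complex source_dim])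
    then have "d = 0" using chain_space_above_dim[OF _ lessI d(1)] by blast
    then have "z = 0" using d(2) inj_l[OF 0(1) cycle_space_0] by simp
    then show ?case by (intro exI[of _ 0]) simp
  next
    case (Suc m)
    let ?r = "N - Suc m"
    have r: "Suc ?r = N - m" using Suc.prems(3) by simp
    obtain c where c: "c \<in> chain_space (Suc N) (cyl_level ?r)" "boundary c = ?l z"
      using Suc.prems(2) by (auto simp: homologous_def)
    have "?l z \<in> cycle_space N (cyl_level (Suc ?r))"
      by (rule simplicial_chain_map_cycle_space[OF Suc.prems(1) simplicial_complex_order_complex])
         (simp add: cyl_level_def Inl_in_cylinder)
    then have bd: "boundary c \<in> chain_space N (cyl_level (Suc ?r))" using c(2) by (simp add: cycle_space_def)
    obtain V c0 C where V: "finite V" "V \<subseteq> {y \<in> Y. ht y = ?r}" "c0 \<in> chain_space (Suc N) (cyl_level (Suc ?r))"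
      "\<And>y. y \<in> V \<Longrightarrow> C y \<in> cycle_space N (cyl_link y)" "boundary c = boundary c0 + sum C V"
      by (rule relative_cycle_decomposition[OF c(1) bd]) (assumption | rule that)+
    have "\<exists>u. Poly_Mapping.keys u \<subseteq> E y \<and> C y = frag_extend (\<zeta> y) u" if y: "y \<in> V" for y
    proof -
      have "y \<in> Y" using y V(2) by auto
      from int_basis_span[OF \<zeta>[OF this] V(4)[OF y]] show ?thesis by blast
    qed
    then obtain U where U: "\<And>y. y \<in> V \<Longrightarrow> Poly_Mapping.keys (U y) \<subseteq> E y \<and> C y = frag_extend (\<zeta> y) (U y)" by metis
    define u where "u = (\<Sum>y\<in>V. frag_extend (\<lambda>e. frag_of (y, e)) (U y))"
    have u: "Poly_Mapping.keys u \<subseteq> ?S"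
      unfolding u_def
    proof (rule order_trans[OF keys_sum], rule UN_least)
      fix y assume y: "y \<in> V"
      show "Poly_Mapping.keys (frag_extend (\<lambda>e. frag_of (y, e)) (U y)) \<subseteq> ?S"
        by (rule order_trans[OF keys_frag_extend], rule UN_least) (use U[OF y] V(2) y in auto)
    qed
    have "frag_extend W u = (\<Sum>y\<in>V. frag_extend (w y) (U y))"
      unfolding u_def frag_extend_sum[OF V(1)] comp_def
      by (rule sum.cong[OF refl], subst additive_frag_extend) (simp_all add: frag_extend_diff W_def)
    then have lW: "?l (frag_extend W u) = (\<Sum>y\<in>V. frag_extend (\<lambda>e. ?l (w y e)) (U y))"
    proof -
      have "?l (sum F V) = (\<Sum>y\<in>V. ?l (F y))" for F
        unfolding simplicial_chain_map_def frag_extend_sum[OF V(1)] by (simp add: comp_def)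
      moreover have "?l (frag_extend (w y) (U y)) = frag_extend (\<lambda>e. ?l (w y e)) (U y)" for y
        by (rule additive_frag_extend) (rule simplicial_chain_map_diff)
      ultimately show ?thesis using \<open>frag_extend W u = _\<close> by simp
    qed
    have "homologous N (cyl_level (Suc ?r)) (boundary c0) 0" by (rule homologous_0_boundary[OF V(3)])
    moreover have "homologous N (cyl_level (Suc ?r)) (sum C V) (?l (frag_extend W u))"
      unfolding lW
    proof (rule homologous_sum)
      fix y assume y: "y \<in> V"
      then have yY: "y \<in> Y" "ht y = ?r" using V(2) by auto
      have "homologous N (cyl_level (Suc ?r)) (frag_extend (\<zeta> y) (U y)) (frag_extend (\<lambda>e. ?l (w y e)) (U y))"
        by (rule homologous_frag_extend) (use hom[OF yY(1)] yY(2) U[OF y] in auto)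
      then show "homologous N (cyl_level (Suc ?r)) (C y) (frag_extend (\<lambda>e. ?l (w y e)) (U y))"
        using U[OF y] by simp
    qed
    ultimately have "homologous N (cyl_level (Suc ?r)) (boundary c0 + sum C V) (0 + ?l (frag_extend W u))"
      by (rule homologous_add)
    then have "homologous N (cyl_level (N - m)) (?l z) (?l (frag_extend W u))"
      using V(5) c(2) r by simp
    then have "homologous N (cyl_level (N - m)) (?l (z - frag_extend W u)) 0"
      by (simp add: simplicial_chain_map_diff homologous_def)
    moreover have "z - frag_extend W u \<in> ?ZX" using Suc.prems(1) W_ext[OF u] by (rule cycle_space_diff)
    moreover have "m \<le> N" using Suc.prems(3) by simp
    ultimately obtain v where v: "Poly_Mapping.keys v \<subseteq> ?S" "z - frag_extend W u = frag_extend W v"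
      using Suc.IH by blast
    then have "z = frag_extend W (u + v)" by (simp add: frag_extend_add algebra_simps)
    moreover have "Poly_Mapping.keys (u + v) \<subseteq> ?S" using keys_add[of u v] u v(1) by blast
    ultimately show ?case by blast
  qed
  have kernel': "\<exists>u. Poly_Mapping.keys u \<subseteq> ?S \<and> z = frag_extend W u" if z: "z \<in> ?ZX" and fz: "?f z = 0" for z
  proof (rule kernel[OF z _ order_refl])
    have fin: "finitary z" by (rule source_finitary[OF z])
    have "?l z \<in> cycle_space N (cylinder X f Y)"
      by (rule simplicial_chain_map_cycle_space[OF z simplicial_complex_order_complex]) (rule Inl_in_cylinder)
    from retraction_homologous[OF f_mono f_in this]
    have "homologous N (cylinder X f Y) (?l z) (simplicial_chain_map Inr (?f z))"
      using fin by (simp add: simplicial_chain_map_compose comp_def)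
    then show "homologous N (cyl_level (N - N)) (?l z) 0" using fz by (simp add: level_0)
  qed
  \<comment> \<open>such a cycle is homologous to its image in \<open>Y\<close>, which is zero
    because chains of \<open>Y\<close> have at most \<open>N\<close> elements, and the cylinder
    has no simplices with \<open>N + 2\<close> vertices\<close>
  have top_zero: "d = 0" if d: "d \<in> cycle_space (Suc N) (cylinder X f Y)" for d
  proof -
    have "simplicial_chain_map (retraction f) d \<in> chain_space (Suc N) (order_complex Y)"
      by (rule simplicial_chain_map_chain_space[OF cycle_space_chain[OF d] simplicial_complex_cylinder])
         (rule retraction_cylinder[OF f_mono f_in])
    then have "simplicial_chain_map (retraction f) d = 0" by (rule chain_space_above_dim[OF target_dim lessI])
    moreover have "finitary d" by (rule chain_space_finitary[OF simplicial_complex_cylinder cycle_space_chain[OF d]])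
    ultimately have "simplicial_chain_map (\<lambda>v. Inr (retraction f v) :: 'a + 'b) d = 0"
      using simplicial_chain_map_compose[of d Inr "retraction f"] by (simp add: comp_def)
    then have "homologous (Suc N) (cylinder X f Y) d 0"
      using retraction_homologous[OF f_mono f_in d] by simp
    then show "d = 0"
      using homologous_top[of "cylinder X f Y" "Suc N" d 0] dim_belowD[OF cylinder_dim[of 0]] level_0 by auto
  qed
  \<comment> \<open>\<open>D\<close> consists of a cone over a link cycle and a homology from
    there to the pushed cycle. A relation between pushed cycles turns the combination of the
    \<open>D\<close> into a cycle of degree above the top cycles, so into zero. At an element
    \<open>y0\<close> of least height in the relation only the cone over the link of
    \<open>y0\<close> contributes to the coefficient, which gives a relation between basis
    elements of that link.\<close>
  have W_indep: "u = 0" if u: "Poly_Mapping.keys u \<subseteq> ?S" and u0: "frag_extend W u = 0" for u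
  proof (rule ccontr)
    assume "u \<noteq> 0"
    then have ne: "Poly_Mapping.keys u \<noteq> {}" by simp
    define m where "m = Min ((\<lambda>ye. ht (fst ye)) ` Poly_Mapping.keys u)"
    have "m \<in> (\<lambda>ye. ht (fst ye)) ` Poly_Mapping.keys u" unfolding m_def using ne by (intro Min_in) auto
    then obtain y0 e0 where y0: "(y0, e0) \<in> Poly_Mapping.keys u" "ht y0 = m" by auto
    have le: "ht y0 \<le> ht y" if "(y, e) \<in> Poly_Mapping.keys u" for y e
    proof -
      have "m \<le> ht (fst (y, e))" unfolding m_def using that by (intro Min_le) (auto intro: rev_image_eqI)
      then show ?thesis using y0(2) by simp
    qed
    have y0Y: "y0 \<in> Y" "e0 \<in> E y0" using y0(1) u by auto
    have "\<exists>d\<in>chain_space (Suc N) (cyl_level (Suc (ht y))). boundary d = \<zeta> y e - ?l (w y e)"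
      if "y \<in> Y" "e \<in> E y" for y e using hom[OF that] by (simp add: homologous_def)
    then obtain d where d: "\<And>y e. y \<in> Y \<Longrightarrow> e \<in> E y \<Longrightarrow>
      d y e \<in> chain_space (Suc N) (cyl_level (Suc (ht y))) \<and> boundary (d y e) = \<zeta> y e - ?l (w y e)" by metis
    define D where "D = (\<lambda>(y, e). chain_join (frag_of {Inr y}) (\<zeta> y e) - d y e)"
    have D: "D (y, e) \<in> chain_space (Suc N) (cylinder X f Y)" "boundary (D (y, e)) = ?l (W (y, e))"
      "ht y0 \<le> ht y \<Longrightarrow> vertex_coeff (Inr y0) (D (y, e)) = (if y = y0 then \<zeta> y0 e else 0)"
      if "y \<in> Y" "e \<in> E y" for y e
    proof -
      note z = \<zeta>_in[OF that]
      have "d y e \<in> chain_space (Suc N) (cylinder X f Y)"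
        using chain_space_mono[OF level_mono[of 0]] d[OF that] by (auto simp: level_0)
      moreover have "chain_join (frag_of {Inr y}) (\<zeta> y e) \<in> chain_space (Suc N) (cylinder X f Y)"
        using chain_space_mono[OF level_mono[of 0]] cone_in_level[OF that(1) cycle_space_chain[OF z]] by (auto simp: level_0)
      ultimately show "D (y, e) \<in> chain_space (Suc N) (cylinder X f Y)" by (simp add: D_def chain_space_diff)
      show "boundary (D (y, e)) = ?l (W (y, e))"
        using d[OF that] by (simp add: D_def W_def boundary_diff link_boundary[OF that(1) z])
      assume h: "ht y0 \<le> ht y"
      have "vertex_coeff (Inr y0) (d y e) = 0"
        by (rule level_vertex_absent[where r = "Suc (ht y)" and k = "Suc N"]) (use d[OF that] h in auto)
      then show "vertex_coeff (Inr y0) (D (y, e)) = (if y = y0 then \<zeta> y0 e else 0)"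
        by (simp add: D_def vertex_coeff_diff link_vertex_coeff[OF that(1) cycle_space_chain[OF z] h])
    qed
    have "boundary (frag_extend D u) = frag_extend (\<lambda>ye. boundary (D ye)) u"
      by (rule additive_frag_extend) (rule boundary_diff)
    also have "\<dots> = frag_extend (\<lambda>ye. ?l (W ye)) u"
      by (rule frag_extend_eq) (use u D(2) in auto)
    also have "\<dots> = ?l (frag_extend W u)"
      by (rule additive_frag_extend[symmetric]) (rule simplicial_chain_map_diff)
    finally have "boundary (frag_extend D u) = 0" using u0 by simp
    moreover have "frag_extend D u \<in> chain_space (Suc N) (cylinder X f Y)"
      by (rule chain_space_frag_extend) (use u D(1) in auto)
    ultimately have D0: "frag_extend D u = 0" by (intro top_zero) (simp add: cycle_space_def)
    define row where "row = (\<lambda>(y, e). if y = y0 then frag_of e else (0 :: 'e \<Rightarrow>\<^sub>0 int))"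
    have "0 = frag_extend (\<lambda>ye. vertex_coeff (Inr y0) (D ye)) u"
      using vertex_coeff_frag_extend[of "Inr y0" D u] D0 by simp
    also have "\<dots> = frag_extend (\<lambda>ye. frag_extend (\<zeta> y0) (row ye)) u"
    proof (rule frag_extend_eq)
      fix ye assume ye: "ye \<in> Poly_Mapping.keys u"
      obtain y e where "ye = (y, e)" by (cases ye)
      then show "vertex_coeff (Inr y0) (D ye) = frag_extend (\<zeta> y0) (row ye)"
        using D(3)[of y e] le[of y e] u ye by (auto simp: row_def)
    qed
    also have "\<dots> = frag_extend (\<zeta> y0) (frag_extend row u)"
      by (rule additive_frag_extend[symmetric]) (rule frag_extend_diff)
    finally have "frag_extend (\<zeta> y0) (frag_extend row u) = 0" by simp
    moreover have "Poly_Mapping.keys (frag_extend row u) \<subseteq> E y0"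
      by (rule order_trans[OF keys_frag_extend], rule UN_least) (use u in \<open>auto simp: row_def split: if_splits\<close>)
    ultimately have "frag_extend row u = 0" using int_basis_independent[OF \<zeta>[OF y0Y(1)]] by blast
    moreover have "Poly_Mapping.lookup u (y0, e0) = Poly_Mapping.lookup (frag_extend row u) e0"
    proof (induction u rule: frag_induction[OF order_refl])
      case (2 x)
      then show ?case by (cases x) (simp add: row_def)
    qed (simp_all add: frag_extend_diff lookup_minus)
    ultimately have "Poly_Mapping.lookup u (y0, e0) = 0" by simp
    then show False using y0(1) by (simp add: in_keys_iff)
  qed
  \<comment> \<open>the two parts of an element of the free group on the disjoint union\<close>
  define pl where "pl = frag_extend (case_sum frag_of (\<lambda>_. 0) :: 'i + 'b \<times> 'e \<Rightarrow> 'i \<Rightarrow>\<^sub>0 int)"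
  define pr where "pr = frag_extend (case_sum (\<lambda>_. 0) frag_of :: 'i + 'b \<times> 'e \<Rightarrow> 'b \<times> 'e \<Rightarrow>\<^sub>0 int)"
  have pl: "Poly_Mapping.keys (pl c) \<subseteq> I" if "Poly_Mapping.keys c \<subseteq> I <+> ?S" for c
    unfolding pl_def by (rule order_trans[OF keys_frag_extend], rule UN_least) (use that in \<open>auto split: sum.splits\<close>)
  have pr: "Poly_Mapping.keys (pr c) \<subseteq> ?S" if "Poly_Mapping.keys c \<subseteq> I <+> ?S" for c
    unfolding pr_def by (rule order_trans[OF keys_frag_extend], rule UN_least) (use that in \<open>auto split: sum.splits\<close>)
  have split: "frag_extend (case_sum \<gamma> W) c = frag_extend \<gamma> (pl c) + frag_extend W (pr c)" for c
  proof (induction c rule: frag_induction[OF order_refl])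
    case (2 x)
    then show ?case by (cases x) (simp_all add: pl_def pr_def)
  next
    case (3 a b)
    then show ?case by (simp add: pl_def pr_def frag_extend_diff)
  qed (simp add: pl_def pr_def)
  have "int_basis ?ZX (I <+> ?S) (case_sum \<gamma> W)"
  proof (rule int_basisI)
    fix i assume "i \<in> I <+> ?S"
    then show "case_sum \<gamma> W i \<in> ?ZX" using \<gamma> W_in by auto
  next
    fix z assume z: "z \<in> ?ZX"
    have "?f z \<in> cycle_space N (order_complex Y)"
      by (rule simplicial_chain_map_cycle_space[OF z simplicial_complex_order_complex])
         (rule order_complex_image[OF f_mono f_in])
    then obtain a where a: "Poly_Mapping.keys a \<subseteq> I" "?f z = frag_extend (\<lambda>i. ?f (\<gamma> i)) a"
      by (rule int_basis_span[OF \<gamma>_basis])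
    have "frag_extend (\<lambda>i. ?f (\<gamma> i)) a = ?f (frag_extend \<gamma> a)"
      by (rule additive_frag_extend[symmetric]) (rule simplicial_chain_map_diff)
    then have "?f (z - frag_extend \<gamma> a) = 0" using a(2) by (simp add: simplicial_chain_map_diff)
    moreover have "z - frag_extend \<gamma> a \<in> ?ZX"
      using a(1) \<gamma> by (intro cycle_space_diff z cycle_space_frag_extend) auto
    ultimately obtain u where u: "Poly_Mapping.keys u \<subseteq> ?S" "z - frag_extend \<gamma> a = frag_extend W u"
      using kernel' by blast
    let ?c = "frag_extend (\<lambda>i. frag_of (Inl i)) a + frag_extend (\<lambda>s. frag_of (Inr s)) u"
    have k1: "Poly_Mapping.keys (frag_extend (\<lambda>i. frag_of (Inl i)) a) \<subseteq> I <+> ?S"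
      by (rule order_trans[OF keys_frag_extend], rule UN_least) (use a in auto)
    have k2: "Poly_Mapping.keys (frag_extend (\<lambda>s. frag_of (Inr s)) u) \<subseteq> I <+> ?S"
      by (rule order_trans[OF keys_frag_extend], rule UN_least) (use u in auto)
    have "Poly_Mapping.keys ?c \<subseteq> I <+> ?S" by (rule order_trans[OF keys_add Un_least[OF k1 k2]])
    moreover have "frag_extend (case_sum \<gamma> W) ?c = frag_extend \<gamma> a + frag_extend W u"
      unfolding frag_extend_add
      by (subst (1 2) additive_frag_extend) (simp_all add: frag_extend_diff)
    ultimately show "\<exists>c. Poly_Mapping.keys c \<subseteq> I <+> ?S \<and> z = frag_extend (case_sum \<gamma> W) c"
      using u(2) by (intro exI[of _ ?c]) (auto simp: algebra_simps)
  next
    fix c assume c: "Poly_Mapping.keys c \<subseteq> I <+> ?S" "frag_extend (case_sum \<gamma> W) c = 0"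
    then have s0: "frag_extend \<gamma> (pl c) + frag_extend W (pr c) = 0" using split by simp
    have "frag_extend (\<lambda>i. ?f (\<gamma> i)) (pl c) = ?f (frag_extend \<gamma> (pl c))"
      by (rule additive_frag_extend[symmetric]) (rule simplicial_chain_map_diff)
    also have "\<dots> = ?f (0 - frag_extend W (pr c))"
      by (rule arg_cong[of _ _ ?f]) (use s0 in \<open>simp add: eq_neg_iff_add_eq_0\<close>)
    also have "\<dots> = 0" using fW_ext[OF pr[OF c(1)]] by (simp only: simplicial_chain_map_diff) simp
    finally have "pl c = 0" using int_basis_independent[OF \<gamma>_basis pl[OF c(1)]] by blast
    moreover from this have "pr c = 0" using s0 W_indep[OF pr[OF c(1)]] by simp
    moreover have "c = frag_extend (\<lambda>i. frag_of (Inl i)) (pl c) + frag_extend (\<lambda>s. frag_of (Inr s)) (pr c)"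
    proof (induction c rule: frag_induction[OF order_refl])
      case (2 x)
      then show ?case by (cases x) (simp_all add: pl_def pr_def)
    next
      case (3 a b)
      have e: "pl (a - b) = pl a - pl b" "pr (a - b) = pr a - pr b" by (simp_all add: pl_def pr_def frag_extend_diff)
      show ?case unfolding e frag_extend_diff by (subst 3(1), subst (1) 3(2)) (simp add: algebra_simps)
    qed (simp add: pl_def pr_def)
    ultimately show "c = 0" by simp
  qed
  then show ?thesis by (simp add: W_def)
qed

end

section \<open>Subgroups of free abelian groups\<close>

text \<open>Subgroups of free abelian groups are free. The generators are well-ordered. For every
  generator \<open>v\<close> that is the greatest one occurring in some element of the subgroup,
  an element \<open>h v\<close> with the smallest possible positive coefficient at
  \<open>v\<close> is chosen; by division with remainder and transfinite induction these elements
  span, and they are independent because their greatest generators differ.\<close>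

theorem subgroup_int_basis:
  fixes Z :: "('v \<Rightarrow>\<^sub>0 int) set"
  assumes Z0: "0 \<in> Z" and Zdiff: "\<And>a b. a \<in> Z \<Longrightarrow> b \<in> Z \<Longrightarrow> a - b \<in> Z"
  shows "\<exists>S h. int_basis Z (S :: 'v set) h"
proof -
  obtain r :: "'v rel" where "well_order_on UNIV r" using well_order_on by blast
  then have lin: "linear_order_on UNIV r" and wf: "wf (r - Id)" by (auto simp: well_order_on_def)
  define le where "le x y \<longleftrightarrow> (x, y) \<in> r" for x y
  have refl: "le x x" and trans: "le x y \<Longrightarrow> le y z \<Longrightarrow> le x z" and antisym: "le x y \<Longrightarrow> le y x \<Longrightarrow> x = y"
    and total: "le x y \<or> le y x" for x y z
    using lin unfolding linear_order_on_def partial_order_on_def preorder_on_def le_def refl_on_def trans_def antisym_def total_on_def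
    by (blast, blast, blast, metis UNIV_I)
  have greatest: "\<exists>m\<in>A. \<forall>x\<in>A. le x m" if "finite A" "A \<noteq> {}" for A
    using that
  proof (induction A rule: finite_ne_induct)
    case (singleton x)
    then show ?case using refl by auto
  next
    case (insert x A)
    then obtain m where m: "m \<in> A" "\<forall>x\<in>A. le x m" by blast
    show ?case
    proof (cases "le x m")
      case True
      then show ?thesis using m by auto
    next
      case False
      then have "le m x" using total by blast
      then show ?thesis using m trans refl by (intro bexI[of _ x]) blast+
    qed
  qed
  define F where "F v = {c \<in> Z. \<forall>x\<in>Poly_Mapping.keys c. le x v}" for v
  define S where "S = {v. \<exists>c\<in>F v. Poly_Mapping.lookup c v > 0}"
  have cmul: "frag_cmul k c \<in> Z" if "c \<in> Z" for k c
    by (rule frag_closure_minus_cmul[where P = "\<lambda>c. c \<in> Z", OF Z0 Zdiff that])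
  have F_diff: "a - frag_cmul k b \<in> F v" if "a \<in> F v" "b \<in> F v" for a b v k
    using that Zdiff[of a "frag_cmul k b"] cmul[of b k] keys_diff[of a "frag_cmul k b"] unfolding F_def by auto
  have "\<exists>c. c \<in> F v \<and> Poly_Mapping.lookup c v > 0 \<and>
     (\<forall>d\<in>F v. Poly_Mapping.lookup d v > 0 \<longrightarrow> Poly_Mapping.lookup c v \<le> Poly_Mapping.lookup d v)" if vS: "v \<in> S" for v
  proof -
    let ?P = "\<lambda>c. c \<in> F v \<and> Poly_Mapping.lookup c v > 0"
    obtain c0 where "?P c0" using vS by (auto simp: S_def)
    define c where "c = arg_min (\<lambda>c. nat (Poly_Mapping.lookup c v)) ?P"
    have "?P c" unfolding c_def by (rule arg_min_natI) fact
    moreover have "nat (Poly_Mapping.lookup c v) \<le> nat (Poly_Mapping.lookup d v)" if "?P d" for d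
      unfolding c_def by (rule arg_min_nat_le) fact
    ultimately show ?thesis by (intro exI[of _ c]) fastforce
  qed
  then obtain h where h: "\<And>v. v \<in> S \<Longrightarrow> h v \<in> F v" "\<And>v. v \<in> S \<Longrightarrow> Poly_Mapping.lookup (h v) v > 0"
    "\<And>v d. v \<in> S \<Longrightarrow> d \<in> F v \<Longrightarrow> Poly_Mapping.lookup d v > 0 \<Longrightarrow> Poly_Mapping.lookup (h v) v \<le> Poly_Mapping.lookup d v"
    by metis
  have span: "\<exists>u. Poly_Mapping.keys u \<subseteq> S \<and> c = frag_extend h u" if "c \<in> F v" for v c
    using that
  proof (induction v arbitrary: c rule: wf_induct_rule[OF wf])
    case (1 v)
    obtain u0 where u0: "Poly_Mapping.keys u0 \<subseteq> S" "c - frag_extend h u0 \<in> F v"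
      "Poly_Mapping.lookup (c - frag_extend h u0) v = 0"
    proof (cases "v \<in> S")
      case True
      let ?m = "Poly_Mapping.lookup (h v) v"
      define q where "q = Poly_Mapping.lookup c v div ?m"
      let ?c = "c - frag_cmul q (h v)"
      have cF: "?c \<in> F v" by (rule F_diff[OF 1(2) h(1)[OF True]])
      have l: "Poly_Mapping.lookup ?c v = Poly_Mapping.lookup c v mod ?m"
        by (simp add: lookup_minus q_def minus_div_mult_eq_mod)
      have "Poly_Mapping.lookup ?c v = 0"
      proof (rule ccontr)
        assume "Poly_Mapping.lookup ?c v \<noteq> 0"
        then have "Poly_Mapping.lookup ?c v > 0" using l h(2)[OF True] pos_mod_sign[of ?m "Poly_Mapping.lookup c v"] by linarith
        then have "?m \<le> Poly_Mapping.lookup ?c v" by (rule h(3)[OF True cF])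
        then show False using l h(2)[OF True] pos_mod_bound[of ?m "Poly_Mapping.lookup c v"] by linarith
      qed
      moreover have "Poly_Mapping.keys (frag_cmul q (frag_of v)) \<subseteq> S"
        by (rule order_trans[OF keys_cmul]) (use True in simp)
      ultimately show thesis using that[of "frag_cmul q (frag_of v)"] cF by (simp add: frag_extend_cmul)
    next
      case False
      have "Poly_Mapping.lookup c v = 0"
      proof (rule ccontr)
        assume n: "Poly_Mapping.lookup c v \<noteq> 0"
        have "0 - frag_cmul 1 c \<in> F v" by (rule F_diff[OF _ 1(2)]) (use Z0 in \<open>simp add: F_def\<close>)
        then have "- c \<in> F v" by simp
        moreover have "Poly_Mapping.lookup c v > 0 \<or> Poly_Mapping.lookup (- c) v > 0" using n by auto
        ultimately show False using False 1(2) unfolding S_def by blast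
      qed
      then show thesis using that[of 0] 1(2) by simp
    qed
    let ?c = "c - frag_extend h u0"
    show ?case
    proof (cases "?c = 0")
      case True
      then show ?thesis using u0(1) by auto
    next
      case False
      then obtain v' where v': "v' \<in> Poly_Mapping.keys ?c" "\<forall>x\<in>Poly_Mapping.keys ?c. le x v'"
        using greatest[of "Poly_Mapping.keys ?c"] by auto
      have "le v' v" using u0(2) v'(1) by (simp add: F_def)
      moreover have "v' \<noteq> v" using v'(1) u0(3) by (metis in_keys_iff)
      ultimately have "(v', v) \<in> r - Id" by (simp add: le_def)
      moreover have "?c \<in> F v'" using u0(2) v'(2) by (simp add: F_def)
      ultimately obtain u where "Poly_Mapping.keys u \<subseteq> S" "?c = frag_extend h u" using 1(1) by blast
      then have "Poly_Mapping.keys (u + u0) \<subseteq> S" "c = frag_extend h (u + u0)"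
        using keys_add[of u u0] u0(1) by (auto simp: frag_extend_add algebra_simps)
      then show ?thesis by blast
    qed
  qed
  have "int_basis Z S h"
  proof (rule int_basisI)
    show "h i \<in> Z" if "i \<in> S" for i using h(1)[OF that] by (simp add: F_def)
    fix z assume z: "z \<in> Z"
    show "\<exists>c. Poly_Mapping.keys c \<subseteq> S \<and> z = frag_extend h c"
    proof (cases "z = 0")
      case True
      then show ?thesis by (intro exI[of _ 0]) simp
    next
      case False
      then obtain v where "\<forall>x\<in>Poly_Mapping.keys z. le x v"
        using greatest[of "Poly_Mapping.keys z"] by auto
      then show ?thesis using span[of z v] z by (simp add: F_def)
    qed
  next
    fix u assume u: "Poly_Mapping.keys u \<subseteq> S" "frag_extend h u = 0"
    show "u = 0"
    proof (rule ccontr)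
      assume "u \<noteq> 0"
      then obtain v where v: "v \<in> Poly_Mapping.keys u" "\<forall>x\<in>Poly_Mapping.keys u. le x v"
        using greatest[of "Poly_Mapping.keys u"] by auto
      have "Poly_Mapping.lookup (h w) v = 0" if w: "w \<in> Poly_Mapping.keys u - {v}" for w
      proof (rule ccontr)
        assume "Poly_Mapping.lookup (h w) v \<noteq> 0"
        then have "v \<in> Poly_Mapping.keys (h w)" by (simp add: in_keys_iff)
        then have "le v w" using h(1)[of w] w u(1) by (auto simp: F_def)
        then show False using v(2) w antisym by auto
      qed
      then have "Poly_Mapping.lookup (frag_extend h u) v = Poly_Mapping.lookup u v * Poly_Mapping.lookup (h v) v"
        using v(1) by (simp add: frag_extend_def lookup_sum lookup_add sum.remove[of _ v])
      moreover have "Poly_Mapping.lookup u v \<noteq> 0" using v(1) by (simp add: in_keys_iff)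
      moreover have "Poly_Mapping.lookup (h v) v \<noteq> 0" using h(2)[of v] v(1) u(1) by auto
      ultimately show False using u(2) by simp
    qed
  qed
  then show ?thesis by blast
qed

section \<open>Bases of abstract abelian groups\<close>

text \<open>The homomorphism from the free abelian group that extends \<open>b\<close>.\<close>

definition combination :: "('g, 'm) monoid_scheme \<Rightarrow> ('i \<Rightarrow> 'g) \<Rightarrow> ('i \<Rightarrow>\<^sub>0 int) \<Rightarrow> 'g" where
  "combination G b c = (\<Otimes>\<^bsub>G\<^esub>i\<in>Poly_Mapping.keys c. b i [^]\<^bsub>G\<^esub> Poly_Mapping.lookup c i)"

lemma free_basis_combination:
  "free_basis G I b \<longleftrightarrow> b \<in> I \<rightarrow> carrier G \<and>
     bij_betw (combination G b) (carrier (free_Abelian_group I)) (carrier G)"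
  by (simp add: free_basis_def combination_def[abs_def])

context comm_group
begin

lemma combination_superset:
  assumes "b \<in> I \<rightarrow> carrier G" "finite A" "A \<subseteq> I" "Poly_Mapping.keys c \<subseteq> A"
  shows "combination G b c = (\<Otimes>i\<in>A. b i [^] Poly_Mapping.lookup c i)"
  unfolding combination_def
proof (rule finprod_mono_neutral_cong_left[OF assms(2,4)])
  show "b i [^] Poly_Mapping.lookup c i = \<one>" if "i \<in> A - Poly_Mapping.keys c" for i
    using that by (simp add: in_keys_iff)
qed (use assms in auto)

lemma combination_hom:
  assumes b: "b \<in> I \<rightarrow> carrier G"
  shows "combination G b \<in> hom (free_Abelian_group I) G"
proof (rule homI)
  fix c assume "c \<in> carrier (free_Abelian_group I)"
  then show "combination G b c \<in> carrier G"
    using b unfolding combination_def by (intro finprod_closed) auto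
next
  fix c d assume cd: "c \<in> carrier (free_Abelian_group I)" "d \<in> carrier (free_Abelian_group I)"
  let ?A = "Poly_Mapping.keys c \<union> Poly_Mapping.keys d"
  have A: "finite ?A" "?A \<subseteq> I" using cd by auto
  have "combination G b (c + d) = (\<Otimes>i\<in>?A. b i [^] Poly_Mapping.lookup (c + d) i)"
    by (rule combination_superset[OF b A keys_add])
  also have "\<dots> = (\<Otimes>i\<in>?A. b i [^] Poly_Mapping.lookup c i \<otimes> b i [^] Poly_Mapping.lookup d i)"
  proof (rule finprod_cong'[OF refl])
    have bi: "b i \<in> carrier G" if "i \<in> ?A" for i using b A(2) that by blast
    then show "(\<lambda>i. b i [^] Poly_Mapping.lookup c i \<otimes> b i [^] Poly_Mapping.lookup d i) \<in> ?A \<rightarrow> carrier G"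
      by auto
    show "b i [^] Poly_Mapping.lookup (c + d) i = b i [^] Poly_Mapping.lookup c i \<otimes> b i [^] Poly_Mapping.lookup d i"
      if "i \<in> ?A" for i using bi[OF that] by (simp add: lookup_add int_pow_mult)
  qed
  also have "\<dots> = (\<Otimes>i\<in>?A. b i [^] Poly_Mapping.lookup c i) \<otimes> (\<Otimes>i\<in>?A. b i [^] Poly_Mapping.lookup d i)"
    using b A by (intro finprod_multf) auto
  also have "\<dots> = combination G b c \<otimes> combination G b d"
    using combination_superset[OF b A, of c] combination_superset[OF b A, of d] by simp
  finally show "combination G b (c \<otimes>\<^bsub>free_Abelian_group I\<^esub> d) = combination G b c \<otimes> combination G b d"
    by simp
qed

lemma combination_frag_of:
  assumes "b i \<in> carrier G" shows "combination G b (frag_of i) = b i"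
  using assms by (simp add: combination_def)

lemma free_basis_iso:
  assumes "free_basis G I b" shows "combination G b \<in> iso (free_Abelian_group I) G"
  using assms combination_hom[of b I] by (simp add: free_basis_combination iso_def)

lemma free_hom_unique:
  assumes h: "h \<in> hom (free_Abelian_group I) G" and h': "h' \<in> hom (free_Abelian_group I) G"
    and eq: "\<And>i. i \<in> I \<Longrightarrow> h (frag_of i) = h' (frag_of i)" and c: "Poly_Mapping.keys c \<subseteq> I"
  shows "h c = h' c"
proof -
  interpret H: group_hom "free_Abelian_group I" G h
    using h by (simp add: group_hom_def group_hom_axioms_def is_group)
  interpret H': group_hom "free_Abelian_group I" G h'
    using h' by (simp add: group_hom_def group_hom_axioms_def is_group)
  show ?thesis
  proof (rule free_Abelian_group_induct[OF c, of "\<lambda>c. h c = h' c"])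
    show "h 0 = h' 0" using H.hom_one H'.hom_one by simp
    fix x y assume xy: "Poly_Mapping.keys x \<subseteq> I" "Poly_Mapping.keys y \<subseteq> I" "h x = h' x" "h y = h' y"
    have "h (x - y) = h x \<otimes> inv (h y)"
      using xy H.hom_mult[of x "- y"] H.hom_inv[of y] by simp
    moreover have "h' (x - y) = h' x \<otimes> inv (h' y)"
      using xy H'.hom_mult[of x "- y"] H'.hom_inv[of y] by simp
    ultimately show "h (x - y) = h' (x - y)" using xy by simp
  qed (rule eq)
qed

text \<open>A map that is additive up to elements of \<open>R\<close> commutes with integer
  combinations up to elements of \<open>R\<close>. This is used for \<open>s a = (a, d)\<close>
  and the relations defining a tensor product.\<close>

lemma combination_additive_mod:
  fixes s :: "'a \<Rightarrow> ('x \<Rightarrow>\<^sub>0 int)"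
  assumes b: "b \<in> I \<rightarrow> carrier G" and R0: "0 \<in> R" and Rdiff: "\<And>x y. x \<in> R \<Longrightarrow> y \<in> R \<Longrightarrow> x - y \<in> R"
    and s: "\<And>a a'. a \<in> carrier G \<Longrightarrow> a' \<in> carrier G \<Longrightarrow> s (a \<otimes> a') - s a - s a' \<in> R"
    and u: "Poly_Mapping.keys u \<subseteq> I"
  shows "s (combination G b u) - frag_extend (\<lambda>i. s (b i)) u \<in> R"
proof -
  interpret C: group_hom "free_Abelian_group I" G "combination G b"
    using combination_hom[OF b] by (simp add: group_hom_def group_hom_axioms_def is_group)
  show ?thesis
  proof (rule free_Abelian_group_induct[OF u, of "\<lambda>u. s (combination G b u) - frag_extend (\<lambda>i. s (b i)) u \<in> R"])
    have "0 - (s (\<one> \<otimes> \<one>) - s \<one> - s \<one>) \<in> R" by (intro Rdiff R0 s) auto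
    then show "s (combination G b 0) - frag_extend (\<lambda>i. s (b i)) 0 \<in> R"
      using C.hom_one by simp
  next
    fix x y assume xy: "Poly_Mapping.keys x \<subseteq> I" "Poly_Mapping.keys y \<subseteq> I"
      and IH: "s (combination G b x) - frag_extend (\<lambda>i. s (b i)) x \<in> R"
        "s (combination G b y) - frag_extend (\<lambda>i. s (b i)) y \<in> R"
    have "Poly_Mapping.keys (x - y) \<subseteq> I" by (rule order_trans[OF keys_diff]) (use xy in blast)
    then have c: "combination G b (x - y) \<in> carrier G" "combination G b y \<in> carrier G"
       "combination G b (x - y) \<otimes> combination G b y = combination G b x"
      using C.hom_closed[of "x - y"] C.hom_closed[of y] C.hom_mult[of "x - y" y] xy by simp_all
    have "(s (combination G b x) - frag_extend (\<lambda>i. s (b i)) x)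
        - (s (combination G b y) - frag_extend (\<lambda>i. s (b i)) y)
        - (s (combination G b x) - s (combination G b (x - y)) - s (combination G b y)) \<in> R"
      by (rule Rdiff[OF Rdiff[OF IH]]) (use s[OF c(1,2)] in \<open>simp add: c(3)\<close>)
    then show "s (combination G b (x - y)) - frag_extend (\<lambda>i. s (b i)) (x - y) \<in> R"
      by (simp add: frag_extend_diff algebra_simps)
  next
    fix i assume "i \<in> I"
    then show "s (combination G b (frag_of i)) - frag_extend (\<lambda>i. s (b i)) (frag_of i) \<in> R"
      using R0 combination_frag_of[of b i] funcset_mem[OF b \<open>i \<in> I\<close>] by simp
  qed
qed

end

section \<open>Tensor products of free abelian groups\<close>

lemma tensor_relations_carrier:
  assumes G: "comm_group G" and H: "comm_group H"
  shows "tensor_relations G H \<subseteq> carrier (free_Abelian_group (carrier G \<times> carrier H))" (is "_ \<subseteq> carrier ?F")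
proof -
  interpret G: comm_group G by fact
  interpret H: comm_group H by fact
  show ?thesis
  proof
    fix x assume "x \<in> tensor_relations G H"
    then consider a a' d where "x = frag_of (a \<otimes>\<^bsub>G\<^esub> a', d) - frag_of (a, d) - frag_of (a', d)"
        "a \<in> carrier G" "a' \<in> carrier G" "d \<in> carrier H"
      | a d d' where "x = frag_of (a, d \<otimes>\<^bsub>H\<^esub> d') - frag_of (a, d) - frag_of (a, d')"
        "a \<in> carrier G" "d \<in> carrier H" "d' \<in> carrier H"
      unfolding tensor_relations_def by blast
    then show "x \<in> carrier ?F"
    proof cases
      case 1
      then show ?thesis
        unfolding carrier_free_Abelian_group_iff 1(1)
        by (intro order_trans[OF keys_diff] Un_least) auto
    next
      case 2
      then show ?thesis
        unfolding carrier_free_Abelian_group_iff 2(1)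
        by (intro order_trans[OF keys_diff] Un_least) auto
    qed
  qed
qed

lemma comm_group_tensor_product:
  assumes "comm_group G" "comm_group H" shows "comm_group (tensor_product G H)"
proof -
  interpret F: comm_group "free_Abelian_group (carrier G \<times> carrier H)" by (rule abelian_free_Abelian_group)
  show ?thesis
    unfolding tensor_product_def Let_def
    by (rule F.abelian_FactGroup[OF F.generate_is_subgroup[OF tensor_relations_carrier[OF assms]]])
qed

text \<open>The coordinates of both factors define a homomorphism to the free group on pairs of
  basis elements, which kills the tensor relations. Conversely, modulo the relations every
  generator is a combination of pairs of basis elements, so nothing else is killed.\<close>

lemma tensor_free:
  assumes G: "comm_group G" and H: "comm_group H" and b: "free_basis G I b" and c: "free_basis H J c"
  shows "tensor_product G H \<cong> free_Abelian_group (I \<times> J)"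
proof -
  interpret G: comm_group G by fact
  interpret H: comm_group H by fact
  let ?\<phi> = "combination G b" and ?\<psi> = "combination H c"
  have \<phi>: "?\<phi> \<in> iso (free_Abelian_group I) G" by (rule G.free_basis_iso[OF b])
  have \<psi>: "?\<psi> \<in> iso (free_Abelian_group J) H" by (rule H.free_basis_iso[OF c])
  define p where "p = inv_into (carrier (free_Abelian_group I)) ?\<phi>"
  define q where "q = inv_into (carrier (free_Abelian_group J)) ?\<psi>"
  have p: "p \<in> iso G (free_Abelian_group I)" unfolding p_def by (rule group.iso_set_sym[OF group_free_Abelian_group \<phi>])
  have q: "q \<in> iso H (free_Abelian_group J)" unfolding q_def by (rule group.iso_set_sym[OF group_free_Abelian_group \<psi>])
  have pin: "Poly_Mapping.keys (p a) \<subseteq> I" if "a \<in> carrier G" for a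
    using that p hom_in_carrier[of p G "free_Abelian_group I" a] by (auto simp: iso_def)
  have qin: "Poly_Mapping.keys (q a) \<subseteq> J" if "a \<in> carrier H" for a
    using that q hom_in_carrier[of q H "free_Abelian_group J" a] by (auto simp: iso_def)
  have p_add: "p (a \<otimes>\<^bsub>G\<^esub> a') = p a + p a'" if "a \<in> carrier G" "a' \<in> carrier G" for a a'
    using that p hom_mult[of p G "free_Abelian_group I" a a'] by (simp add: iso_def)
  have q_add: "q (a \<otimes>\<^bsub>H\<^esub> a') = q a + q a'" if "a \<in> carrier H" "a' \<in> carrier H" for a a'
    using that q hom_mult[of q H "free_Abelian_group J" a a'] by (simp add: iso_def)
  have \<phi>p: "?\<phi> (p a) = a" if "a \<in> carrier G" for a
    using that \<phi> f_inv_into_f[of a ?\<phi>] by (simp add: p_def iso_def bij_betw_def)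
  have \<psi>q: "?\<psi> (q a) = a" if "a \<in> carrier H" for a
    using that \<psi> f_inv_into_f[of a ?\<psi>] by (simp add: q_def iso_def bij_betw_def)
  have p\<phi>: "p (?\<phi> u) = u" if "Poly_Mapping.keys u \<subseteq> I" for u
    using that \<phi> inv_into_f_f[of ?\<phi> "carrier (free_Abelian_group I)" u] by (simp add: p_def iso_def bij_betw_def)
  have q\<psi>: "q (?\<psi> u) = u" if "Poly_Mapping.keys u \<subseteq> J" for u
    using that \<psi> inv_into_f_f[of ?\<psi> "carrier (free_Abelian_group J)" u] by (simp add: q_def iso_def bij_betw_def)
  have bG: "b i \<in> carrier G" if "i \<in> I" for i using b that by (auto simp: free_basis_def)
  have cH: "c j \<in> carrier H" if "j \<in> J" for j using c that by (auto simp: free_basis_def)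
  have pb: "p (b i) = frag_of i" if "i \<in> I" for i
    using p\<phi>[of "frag_of i"] G.combination_frag_of[of b i] bG that by simp
  have qc: "q (c j) = frag_of j" if "j \<in> J" for j
    using q\<psi>[of "frag_of j"] H.combination_frag_of[of c j] cH that by simp
  let ?F = "free_Abelian_group (carrier G \<times> carrier H)"
  let ?R = "generate ?F (tensor_relations G H)"
  interpret F: comm_group ?F by (rule abelian_free_Abelian_group)
  note rel = tensor_relations_carrier[OF G H]
  have R: "subgroup ?R ?F" by (rule F.generate_is_subgroup[OF rel])
  have R0: "0 \<in> ?R" using subgroup.one_closed[OF R] by simp
  have R_add: "x + y \<in> ?R" if "x \<in> ?R" "y \<in> ?R" for x y
    using subgroup.m_closed[OF R that] by simp
  have R_minus: "- x \<in> ?R" if "x \<in> ?R" for x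
    using subgroup.m_inv_closed[OF R that] subgroup.mem_carrier[OF R that] by simp
  have R_diff: "x - y \<in> ?R" if "x \<in> ?R" "y \<in> ?R" for x y
    using R_add[OF that(1) R_minus[OF that(2)]] by simp
  \<comment> \<open>\<open>T\<close> takes the tensor product of the coordinates;
    \<open>B\<close> is a section of it\<close>
  define T where "T = frag_extend (\<lambda>(a, d). frag_prod (p a) (q d))"
  define B where "B = frag_extend (\<lambda>(i, j). frag_of (b i, c j))"
  have T_hom: "T \<in> hom ?F (free_Abelian_group (I \<times> J))"
  proof (rule homI)
    fix u assume u: "u \<in> carrier ?F"
    have "Poly_Mapping.keys (T u) \<subseteq> I \<times> J"
      unfolding T_def
    proof (rule order_trans[OF keys_frag_extend], rule UN_least)
      fix ad assume "ad \<in> Poly_Mapping.keys u"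
      then obtain a d where "ad = (a, d)" "a \<in> carrier G" "d \<in> carrier H" using u by auto
      then show "Poly_Mapping.keys (case ad of (a, d) \<Rightarrow> frag_prod (p a) (q d)) \<subseteq> I \<times> J"
        using keys_frag_prod[OF pin qin] by simp
    qed
    then show "T u \<in> carrier (free_Abelian_group (I \<times> J))" by simp
  qed (simp add: T_def frag_extend_add)
  interpret T: group_hom ?F "free_Abelian_group (I \<times> J)" T
    using T_hom by (simp add: group_hom_def group_hom_axioms_def)
  have frag_prod_add: "frag_prod (u + u') v = frag_prod u v + frag_prod u' v"
     "frag_prod w (v + v') = frag_prod w v + frag_prod w v'" for u u' w :: "'e \<Rightarrow>\<^sub>0 int" and v v' :: "'f \<Rightarrow>\<^sub>0 int"
    using frag_prod_diff_left[of "u + u'" u' v] frag_prod_diff_right[of w "v + v'" v'] by (simp_all add: algebra_simps)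
  have TB: "T (B w) = w" if "Poly_Mapping.keys w \<subseteq> I \<times> J" for w
    using that
    by (induction w rule: frag_induction) (auto simp: T_def B_def pb qc frag_extend_diff)
  have R_cmul: "frag_cmul k x \<in> ?R" if "x \<in> ?R" for k x
    by (rule frag_closure_minus_cmul[where P = "\<lambda>x. x \<in> ?R", OF R0 R_diff that])
  have R_ext: "frag_extend g x \<in> ?R" if "\<And>i. i \<in> Poly_Mapping.keys x \<Longrightarrow> g i \<in> ?R" for g and x :: "'e \<Rightarrow>\<^sub>0 int"
  proof -
    have sumR: "sum F A \<in> ?R" if "\<And>i. i \<in> A \<Longrightarrow> F i \<in> ?R" for F and A :: "'e set"
      using that by (induction A rule: infinite_finite_induct) (auto intro: R0 R_add)
    show ?thesis unfolding frag_extend_def by (rule sumR, rule R_cmul, rule that)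
  qed
  have left: "frag_of (a, d) - frag_extend (\<lambda>i. frag_of (b i, d)) (p a) \<in> ?R"
    if a: "a \<in> carrier G" and d: "d \<in> carrier H" for a d
  proof -
    have "frag_of (?\<phi> (p a), d) - frag_extend (\<lambda>i. frag_of (b i, d)) (p a) \<in> ?R"
    proof (rule G.combination_additive_mod[where s = "\<lambda>a. frag_of (a, d)", OF _ R0 R_diff _ pin[OF a]])
      fix x y assume "x \<in> carrier G" "y \<in> carrier G"
      then show "frag_of (x \<otimes>\<^bsub>G\<^esub> y, d) - frag_of (x, d) - frag_of (y, d) \<in> ?R"
        using d by (intro generate.incl) (auto simp: tensor_relations_def)
    qed (use bG in auto)
    then show ?thesis by (simp add: \<phi>p[OF a])
  qed
  have right: "frag_of (a, d) - frag_extend (\<lambda>j. frag_of (a, c j)) (q d) \<in> ?R"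
    if a: "a \<in> carrier G" and d: "d \<in> carrier H" for a d
  proof -
    have "frag_of (a, ?\<psi> (q d)) - frag_extend (\<lambda>j. frag_of (a, c j)) (q d) \<in> ?R"
    proof (rule H.combination_additive_mod[where s = "\<lambda>d. frag_of (a, d)", OF _ R0 R_diff _ qin[OF d]])
      fix x y assume "x \<in> carrier H" "y \<in> carrier H"
      then show "frag_of (a, x \<otimes>\<^bsub>H\<^esub> y) - frag_of (a, x) - frag_of (a, y) \<in> ?R"
        using a by (intro generate.incl) (auto simp: tensor_relations_def)
    qed (use cH in auto)
    then show ?thesis by (simp add: \<psi>q[OF d])
  qed
  have reduce: "u - B (T u) \<in> ?R" if "Poly_Mapping.keys u \<subseteq> carrier G \<times> carrier H" for u
    using that
  proof (induction u rule: frag_induction)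
    case zero
    then show ?case using R0 by (simp add: T_def B_def)
  next
    case (one ad)
    then obtain a d where ad: "ad = (a, d)" "a \<in> carrier G" "d \<in> carrier H" by auto
    have BT: "B (T (frag_of ad)) = frag_extend (\<lambda>i. frag_extend (\<lambda>j. frag_of (b i, c j)) (q d)) (p a)"
    proof -
      have "B (frag_prod (p a) (q d)) = frag_extend (\<lambda>i. B (frag_extend (\<lambda>j. frag_of (i, j)) (q d))) (p a)"
        unfolding frag_prod_def by (rule additive_frag_extend) (simp add: B_def frag_extend_diff)
      moreover have "B (frag_extend (\<lambda>j. frag_of (i, j)) (q d)) = frag_extend (\<lambda>j. B (frag_of (i, j))) (q d)" for i
        by (rule additive_frag_extend) (simp add: B_def frag_extend_diff)
      ultimately show ?thesis by (simp add: T_def ad(1)) (simp add: B_def)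
    qed
    have ext: "frag_extend (\<lambda>i. frag_of (b i, d) - frag_extend (\<lambda>j. frag_of (b i, c j)) (q d)) (p a) \<in> ?R"
    proof (rule R_ext)
      fix i assume "i \<in> Poly_Mapping.keys (p a)"
      then have "b i \<in> carrier G" using pin[OF ad(2)] bG by auto
      then show "frag_of (b i, d) - frag_extend (\<lambda>j. frag_of (b i, c j)) (q d) \<in> ?R"
        by (rule right[OF _ ad(3)])
    qed
    have "frag_of ad - B (T (frag_of ad)) = (frag_of (a, d) - frag_extend (\<lambda>i. frag_of (b i, d)) (p a))
        + frag_extend (\<lambda>i. frag_of (b i, d) - frag_extend (\<lambda>j. frag_of (b i, c j)) (q d)) (p a)"
      unfolding BT frag_extend_fun_diff by (simp add: ad(1))
    then show ?case using R_add[OF left[OF ad(2,3)] ext] by simp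
  next
    case (diff x y)
    have "x - y - B (T (x - y)) = (x - B (T x)) - (y - B (T y))"
      by (simp add: T_def B_def frag_extend_diff)
    then show ?case using R_diff[OF diff] by (simp only:)
  qed
  have ker: "kernel ?F (free_Abelian_group (I \<times> J)) T = ?R"
  proof
    show "kernel ?F (free_Abelian_group (I \<times> J)) T \<subseteq> ?R"
    proof
      fix u assume "u \<in> kernel ?F (free_Abelian_group (I \<times> J)) T"
      then have "Poly_Mapping.keys u \<subseteq> carrier G \<times> carrier H" "T u = 0" by (auto simp: kernel_def)
      then show "u \<in> ?R" using reduce[of u] by (simp add: B_def)
    qed
    have "tensor_relations G H \<subseteq> kernel ?F (free_Abelian_group (I \<times> J)) T"
    proof
      fix x assume x: "x \<in> tensor_relations G H"
      then have "T x = 0"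
        unfolding tensor_relations_def T_def
        by (auto simp: frag_extend_diff p_add q_add frag_prod_add)
      then show "x \<in> kernel ?F (free_Abelian_group (I \<times> J)) T" using subsetD[OF rel x] by (simp add: kernel_def)
    qed
    then show "?R \<subseteq> kernel ?F (free_Abelian_group (I \<times> J)) T"
      by (rule F.generate_subgroup_incl[OF _ T.subgroup_kernel])
  qed
  have "T ` carrier ?F = carrier (free_Abelian_group (I \<times> J))"
  proof
    show "T ` carrier ?F \<subseteq> carrier (free_Abelian_group (I \<times> J))" using T.hom_closed by blast
    show "carrier (free_Abelian_group (I \<times> J)) \<subseteq> T ` carrier ?F"
    proof
      fix w assume "w \<in> carrier (free_Abelian_group (I \<times> J))"
      then have w: "Poly_Mapping.keys w \<subseteq> I \<times> J" by simp
      have "Poly_Mapping.keys (B w) \<subseteq> carrier G \<times> carrier H"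
        unfolding B_def
        by (rule order_trans[OF keys_frag_extend], rule UN_least) (use w bG cH in auto)
      then show "w \<in> T ` carrier ?F" using TB[OF w] by (intro image_eqI[of _ _ "B w"]) auto
    qed
  qed
  from T.FactGroup_iso_set[OF this] show ?thesis
    unfolding ker tensor_product_def Let_def is_iso_def by blast
qed

section \<open>Homology groups in terms of chains\<close>

lemma carrier_chain_group: "carrier (chain_group (int k - 1) K) = chain_space k K"
  by (auto simp: chain_group_def chain_space_def)

lemma cycles_eq: "cycles (int k - 1) K = cycle_space k K"
  by (simp add: cycles_def carrier_chain_group cycle_space_def)

lemma boundaries_eq: "boundaries (int k - 1) K = boundary ` chain_space (Suc k) K"
  using carrier_chain_group[of "Suc k" K] by (simp add: boundaries_def)

lemma comm_group_chain_group: "comm_group (chain_group p K)"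
  unfolding chain_group_def by (rule abelian_free_Abelian_group)

lemma chain_group_simps [simp]:
  "a \<otimes>\<^bsub>chain_group p K\<^esub> b = a + b" "\<one>\<^bsub>chain_group p K\<^esub> = 0"
  by (simp_all add: chain_group_def)

lemma homology_class_eq: "homology_class p K z = (\<lambda>b. b + z) ` boundaries p K"
  by (auto simp: homology_class_def r_coset_def)

abbreviation cycle_group :: "int \<Rightarrow> 'v set set \<Rightarrow> ('v set \<Rightarrow>\<^sub>0 int) monoid" where
  "cycle_group p K \<equiv> subgroup_generated (chain_group p K) (cycles p K)"

lemma subgroup_cycles: "subgroup (cycles (int k - 1) K) (chain_group (int k - 1) K)"
proof -
  interpret G: comm_group "chain_group (int k - 1) K" by (rule comm_group_chain_group)
  show ?thesis
  proof (rule G.subgroupI)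
    show "cycles (int k - 1) K \<subseteq> carrier (chain_group (int k - 1) K)" by (auto simp: cycles_def)
    show "cycles (int k - 1) K \<noteq> {}" unfolding cycles_eq using cycle_space_0 by blast
    fix a assume a: "a \<in> cycles (int k - 1) K"
    then have "inv\<^bsub>chain_group (int k - 1) K\<^esub> a = - a"
      unfolding chain_group_def by (intro inv_free_Abelian_group) (auto simp: cycles_def chain_group_def)
    then show "inv\<^bsub>chain_group (int k - 1) K\<^esub> a \<in> cycles (int k - 1) K"
      using a cycle_space_minus by (simp add: cycles_eq)
    fix b assume "b \<in> cycles (int k - 1) K"
    then show "a \<otimes>\<^bsub>chain_group (int k - 1) K\<^esub> b \<in> cycles (int k - 1) K"
      using a cycle_space_add by (simp add: cycles_eq)
  qed
qed

lemma cycle_group: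
  "comm_group (cycle_group (int k - 1) K)" "carrier (cycle_group (int k - 1) K) = cycle_space k K"
proof -
  interpret G: comm_group "chain_group (int k - 1) K" by (rule comm_group_chain_group)
  show "comm_group (cycle_group (int k - 1) K)" by (rule G.abelian_subgroup_generated) (rule comm_group_chain_group)
  show "carrier (cycle_group (int k - 1) K) = cycle_space k K"
    using subgroup.carrier_subgroup_generated_subgroup[OF subgroup_cycles] by (simp add: cycles_eq)
qed

lemma subgroup_boundaries:
  assumes K: "simplicial_complex K"
  shows "subgroup (boundaries (int k - 1) K) (cycle_group (int k - 1) K)"
proof -
  interpret Z: comm_group "cycle_group (int k - 1) K" by (rule cycle_group)
  show ?thesis
  proof (rule Z.subgroupI)
    show sub: "boundaries (int k - 1) K \<subseteq> carrier (cycle_group (int k - 1) K)"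
      unfolding cycle_group(2) boundaries_eq using boundary_cycle[OF K] by blast
    show "boundaries (int k - 1) K \<noteq> {}" unfolding boundaries_eq using chain_space_0 by blast
    fix a assume a: "a \<in> boundaries (int k - 1) K"
    then obtain c where c: "c \<in> chain_space (Suc k) K" "a = boundary c" by (auto simp: boundaries_eq)
    have m: "- a \<in> boundaries (int k - 1) K"
      unfolding boundaries_eq using c chain_space_minus[OF c(1)] by (intro image_eqI[of _ _ "- c"]) (auto simp: boundary_minus)
    then have "- a \<in> carrier (cycle_group (int k - 1) K)" "a \<in> carrier (cycle_group (int k - 1) K)" using sub a by auto
    then have "inv\<^bsub>cycle_group (int k - 1) K\<^esub> a = - a" by (intro Z.inv_equality) simp_all
    then show "inv\<^bsub>cycle_group (int k - 1) K\<^esub> a \<in> boundaries (int k - 1) K" using m by simp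
    fix b assume "b \<in> boundaries (int k - 1) K"
    then obtain d where d: "d \<in> chain_space (Suc k) K" "b = boundary d" by (auto simp: boundaries_eq)
    show "a \<otimes>\<^bsub>cycle_group (int k - 1) K\<^esub> b \<in> boundaries (int k - 1) K"
      unfolding boundaries_eq using c d chain_space_add[OF c(1) d(1)]
      by (intro image_eqI[of _ _ "c + d"]) (auto simp: boundary_add)
  qed
qed

lemma homology_class_r_coset: "homology_class p K z = boundaries p K #>\<^bsub>cycle_group p K\<^esub> z"
  by (simp add: homology_class_def r_coset_def)

lemma comm_group_homology:
  assumes "simplicial_complex K" shows "comm_group (homology (int k - 1) K)"
  unfolding homology_def
  by (rule comm_group.abelian_FactGroup[OF cycle_group(1) subgroup_boundaries[OF assms]])

lemma carrier_homology: "carrier (homology (int k - 1) K) = homology_class (int k - 1) K ` cycle_space k K"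
  unfolding homology_def carrier_FactGroup cycle_group(2) by (simp add: homology_class_r_coset)

lemma homology_class_hom:
  assumes "simplicial_complex K"
  shows "homology_class (int k - 1) K \<in> hom (cycle_group (int k - 1) K) (homology (int k - 1) K)"
proof -
  have "boundaries (int k - 1) K \<lhd> cycle_group (int k - 1) K"
    using comm_group.normal_iff_subgroup[OF cycle_group(1)] subgroup_boundaries[OF assms] by blast
  from normal.r_coset_hom_Mod[OF this] show ?thesis
    unfolding homology_def by (simp add: homology_class_r_coset[abs_def])
qed

lemma homology_class_mult:
  assumes "simplicial_complex K" "a \<in> cycle_space k K" "b \<in> cycle_space k K"
  shows "homology_class (int k - 1) K a \<otimes>\<^bsub>homology (int k - 1) K\<^esub> homology_class (int k - 1) K b
     = homology_class (int k - 1) K (a + b)"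
  using hom_mult[OF homology_class_hom[OF assms(1), of k], of a b] assms(2,3) by (simp add: cycle_group(2))

lemma homology_one: "\<one>\<^bsub>homology p K\<^esub> = boundaries p K"
  by (simp add: homology_def)

lemma homology_class_eq_iff:
  assumes K: "simplicial_complex K" and z: "a \<in> cycle_space k K" "b \<in> cycle_space k K"
  shows "homology_class (int k - 1) K a = homology_class (int k - 1) K b \<longleftrightarrow> homologous k K a b"
proof -
  have "homology_class (int k - 1) K a = homology_class (int k - 1) K b \<longleftrightarrow>
      a \<in> homology_class (int k - 1) K b"
  proof
    assume "homology_class (int k - 1) K a = homology_class (int k - 1) K b"
    moreover have "a \<in> homology_class (int k - 1) K a"
      unfolding homology_class_eq boundaries_eq by (rule image_eqI[of _ _ 0], simp, rule image_eqI[of _ _ 0]) simp_all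
    ultimately show "a \<in> homology_class (int k - 1) K b" by simp
  next
    assume "a \<in> homology_class (int k - 1) K b"
    then show "homology_class (int k - 1) K a = homology_class (int k - 1) K b"
      unfolding homology_class_r_coset
      using group.repr_independence[OF comm_group.axioms(2)[OF cycle_group(1)] _ _ subgroup_boundaries[OF K], of a k b] z
      by (simp add: cycle_group(2))
  qed
  also have "\<dots> \<longleftrightarrow> homologous k K a b"
    unfolding homology_class_eq boundaries_eq homologous_def by (auto simp: image_iff algebra_simps)
  finally show ?thesis .
qed

lemma representative_cycle:
  assumes K: "simplicial_complex K" and a: "a \<in> carrier (homology (int k - 1) K)"
  shows "representative a \<in> cycle_space k K" "homology_class (int k - 1) K (representative a) = a"
proof -
  obtain z where z: "z \<in> cycle_space k K" "a = homology_class (int k - 1) K z"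
    using a unfolding carrier_homology by blast
  have "z \<in> a"
    unfolding z(2) homology_class_eq boundaries_eq by (rule image_eqI[of _ _ 0], simp, rule image_eqI[of _ _ 0]) simp_all
  then have "representative a \<in> a" unfolding representative_def by (rule someI)
  then obtain c where c: "c \<in> chain_space (Suc k) K" "representative a = boundary c + z"
    unfolding z(2) homology_class_eq boundaries_eq by auto
  show r: "representative a \<in> cycle_space k K"
    unfolding c(2) by (rule cycle_space_add[OF boundary_cycle[OF K c(1)] z(1)])
  have "homologous k K (representative a) z" unfolding homologous_def using c by auto
  then show "homology_class (int k - 1) K (representative a) = a"
    using homology_class_eq_iff[OF K r z(1)] z(2) by simp
qed

lemma trivial_homology_iff:
  assumes K: "simplicial_complex K"
  shows "trivial_group (homology (int k - 1) K) \<longleftrightarrow>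
     (\<forall>z\<in>cycle_space k K. \<exists>c\<in>chain_space (Suc k) K. boundary c = z)"
proof -
  have one: "\<one>\<^bsub>homology (int k - 1) K\<^esub> = homology_class (int k - 1) K 0"
    by (simp add: homology_one homology_class_eq)
  have "trivial_group (homology (int k - 1) K) \<longleftrightarrow>
     carrier (homology (int k - 1) K) = {\<one>\<^bsub>homology (int k - 1) K\<^esub>}"
    using comm_group.axioms(2)[OF comm_group_homology[OF K, of k]] by (simp add: trivial_group_def)
  also have "\<dots> \<longleftrightarrow> (\<forall>z\<in>cycle_space k K. homology_class (int k - 1) K z = homology_class (int k - 1) K 0)"
    unfolding carrier_homology one using cycle_space_0[of k K] by blast
  also have "\<dots> \<longleftrightarrow> (\<forall>z\<in>cycle_space k K. \<exists>c\<in>chain_space (Suc k) K. boundary c = z)"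
    using homology_class_eq_iff[OF K _ cycle_space_0] by (auto simp: homologous_def)
  finally show ?thesis .
qed

lemma trivial_homology_negative:
  assumes K: "simplicial_complex K" and p: "p < -1"
  shows "trivial_group (homology p K)"
proof -
  have c0: "carrier (chain_group q K) = {0}" if "q < -1" for q
    using that by (auto simp: chain_group_def)
  have "boundary c = 0" if "c \<in> carrier (chain_group (p + 1) K)" for c
  proof (cases "p + 1 < -1")
    case True
    then show ?thesis using that c0 by simp
  next
    case False
    then have e: "p + 1 = int 0 - 1" using p by simp
    show ?thesis using that unfolding e carrier_chain_group by (rule boundary_degree_0[OF K])
  qed
  moreover have "0 \<in> carrier (chain_group (p + 1) K)" by (simp add: chain_group_def)
  ultimately have b: "boundaries p K = {0}" unfolding boundaries_def by (auto intro: image_eqI[of _ _ 0])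
  interpret G: comm_group "chain_group p K" by (rule comm_group_chain_group)
  have G0: "carrier (chain_group p K) = {\<one>\<^bsub>chain_group p K\<^esub>}" using c0[OF p] by simp
  interpret Z: comm_group "cycle_group p K" by (rule G.abelian_subgroup_generated) (rule comm_group_chain_group)
  have "carrier (cycle_group p K) \<subseteq> {0}"
    using G.carrier_subgroup_generated_subset[of "cycles p K"] G0 by simp
  then have carr: "carrier (cycle_group p K) = {0}" using Z.one_closed by auto
  have "subgroup {0} (cycle_group p K)" using Z.triv_subgroup by simp
  then have "comm_group (homology p K)" unfolding homology_def b by (rule Z.abelian_FactGroup)
  moreover have "carrier (homology p K) = {\<one>\<^bsub>homology p K\<^esub>}"
    unfolding homology_def carrier_FactGroup carr b by (auto simp: r_coset_def)
  ultimately show ?thesis by (simp add: trivial_group_def comm_group.axioms(2))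
qed

section \<open>Spherical complexes\<close>

lemma complex_dim_eq:
  assumes "dim_below d K" "\<sigma> \<in> K" "card \<sigma> = d"
  shows "complex_dim K = int d - 1"
  unfolding complex_dim_def
proof (rule cSup_eq_maximum)
  show "int d - 1 \<in> (\<lambda>\<sigma>. int (card \<sigma>) - 1) ` K" using assms by auto
qed (use assms(1) in \<open>auto simp: dim_below_def\<close>)

lemma exact_dim:
  assumes "dim_below N K" "K \<noteq> {}"
  obtains d \<sigma> where "d \<le> N" "dim_below d K" "\<sigma> \<in> K" "card \<sigma> = d"
proof -
  have "card ` K \<subseteq> {..N}" using assms(1) by (auto simp: dim_below_def)
  then have fin: "finite (card ` K)" by (rule finite_subset) simp
  have "Max (card ` K) \<in> card ` K" using fin assms(2) by (intro Max_in) auto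
  then obtain \<sigma> where s: "\<sigma> \<in> K" "card \<sigma> = Max (card ` K)" by auto
  have "dim_below (Max (card ` K)) K" unfolding dim_below_def using fin by auto
  then show thesis using that[OF _ _ s] dim_belowD[OF assms(1) s(1)] s(2) by simp
qed

lemma finite_dimensional_iff: "finite_dimensional K \<longleftrightarrow> (\<exists>N. dim_below N K)"
  by (auto simp: finite_dimensional_def dim_below_def bdd_above_def)

text \<open>The dimension is a supremum, which is attained by a simplex; and since there are no
  chains with fewer than zero vertices, homology has to vanish only in degrees of the form
  \<open>k - 1\<close>.\<close>

lemma spherical_iff:
  assumes K: "simplicial_complex K"
  shows "homologically_spherical m K \<longleftrightarrow>
    (\<exists>d. m = int d - 1 \<and> dim_below d K \<and> (\<exists>\<sigma>\<in>K. card \<sigma> = d) \<and> acyclic_below d K)"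
proof
  assume s: "homologically_spherical m K"
  then obtain N where "dim_below N K" by (auto simp: homologically_spherical_def finite_dimensional_iff)
  moreover have "K \<noteq> {}" using complex_empty[OF K] by blast
  ultimately obtain d \<sigma> where d: "dim_below d K" "\<sigma> \<in> K" "card \<sigma> = d" by (rule exact_dim)
  have m: "m = int d - 1" using s complex_dim_eq[OF d] by (simp add: homologically_spherical_def)
  have "trivial_group (homology (int k - 1) K)" if "k < d" for k
    using s m that by (simp add: homologically_spherical_def)
  then have "acyclic_below d K" unfolding acyclic_below_def using trivial_homology_iff[OF K] by blast
  then show "\<exists>d. m = int d - 1 \<and> dim_below d K \<and> (\<exists>\<sigma>\<in>K. card \<sigma> = d) \<and> acyclic_below d K"
    using d m by blast
next
  assume "\<exists>d. m = int d - 1 \<and> dim_below d K \<and> (\<exists>\<sigma>\<in>K. card \<sigma> = d) \<and> acyclic_below d K"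
  then obtain d \<sigma> where d: "m = int d - 1" "dim_below d K" "\<sigma> \<in> K" "card \<sigma> = d" "acyclic_below d K" by blast
  have "trivial_group (homology i K)" if i: "i < m" for i
  proof (cases "i < -1")
    case True
    then show ?thesis by (rule trivial_homology_negative[OF K])
  next
    case False
    then have "i = int (nat (i + 1)) - 1" "nat (i + 1) < d" using i d(1) by auto
    then show ?thesis
      using trivial_homology_iff[OF K, of "nat (i + 1)"] acyclic_belowD[OF d(5)] by metis
  qed
  then show "homologically_spherical m K"
    using d complex_dim_eq[OF d(2-4)] by (auto simp: homologically_spherical_def finite_dimensional_iff)
qed

lemma poset_spherical_iff:
  "poset_spherical (int d - 1) X \<longleftrightarrow>
    dim_below d (order_complex X) \<and> (\<exists>s\<in>order_complex X. card s = d) \<and> acyclic_below d (order_complex X)"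
  unfolding poset_spherical_def spherical_iff[OF simplicial_complex_order_complex] by auto

lemma poset_spherical_degree: "poset_spherical m X \<Longrightarrow> \<exists>d. m = int d - 1"
  unfolding poset_spherical_def spherical_iff[OF simplicial_complex_order_complex] by auto

section \<open>Top homology\<close>

text \<open>There are no chains above the dimension. Hence a top homology class consists of a
  single cycle, and top homology can be identified with the group of cycles.\<close>

lemma top_boundaries:
  assumes "dim_below k K" shows "boundaries (int k - 1) K = {0}"
proof -
  have "chain_space (Suc k) K = {0}"
    using chain_space_above_dim[OF assms lessI] by (auto simp del: chain_space_0) simp
  then show ?thesis by (simp add: boundaries_eq)
qed

lemma top_class: "dim_below k K \<Longrightarrow> homology_class (int k - 1) K z = {z}"
  by (simp add: homology_class_eq top_boundaries)

lemma representative_singleton [simp]: "representative {z} = z"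
  by (simp add: representative_def)

lemma top_carrier: "dim_below k K \<Longrightarrow> carrier (homology (int k - 1) K) = (\<lambda>z. {z}) ` cycle_space k K"
  by (auto simp: carrier_homology top_class)

lemma top_combination:
  assumes K: "simplicial_complex K" and dim: "dim_below k K"
    and b: "b \<in> I \<rightarrow> carrier (homology (int k - 1) K)" and c: "Poly_Mapping.keys c \<subseteq> I"
  shows "combination (homology (int k - 1) K) b c = {frag_extend (\<lambda>i. representative (b i)) c}"
proof -
  interpret H: comm_group "homology (int k - 1) K" by (rule comm_group_homology[OF K])
  let ?e = "\<lambda>c. {frag_extend (\<lambda>i. representative (b i)) c}"
  have r: "representative (b i) \<in> cycle_space k K" if "i \<in> I" for i
    using representative_cycle(1)[OF K, of "b i" k] b that by auto
  have e_in: "frag_extend (\<lambda>i. representative (b i)) c \<in> cycle_space k K" if "Poly_Mapping.keys c \<subseteq> I" for c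
    using r that by (intro cycle_space_frag_extend) auto
  have e: "?e \<in> hom (free_Abelian_group I) (homology (int k - 1) K)"
  proof (rule homI)
    fix c assume "c \<in> carrier (free_Abelian_group I)"
    then show "?e c \<in> carrier (homology (int k - 1) K)" using e_in[of c] top_carrier[OF dim] by simp
    fix d assume d: "d \<in> carrier (free_Abelian_group I)"
    show "?e (c \<otimes>\<^bsub>free_Abelian_group I\<^esub> d) = ?e c \<otimes>\<^bsub>homology (int k - 1) K\<^esub> ?e d"
      using homology_class_mult[OF K e_in e_in, of c d] d \<open>c \<in> _\<close>
      by (simp add: top_class[OF dim] frag_extend_add)
  qed
  show ?thesis
  proof (rule H.free_hom_unique[OF H.combination_hom[OF b] e _ c])
    fix i assume "i \<in> I"
    then have bi: "b i \<in> carrier (homology (int k - 1) K)" using b by blast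
    then show "combination (homology (int k - 1) K) b (frag_of i) = ?e (frag_of i)"
      using H.combination_frag_of[of b i] representative_cycle(2)[OF K bi] top_class[OF dim] by simp
  qed
qed

lemma free_basis_top_iff:
  assumes K: "simplicial_complex K" and dim: "dim_below k K"
  shows "free_basis (homology (int k - 1) K) I b \<longleftrightarrow>
    b \<in> I \<rightarrow> carrier (homology (int k - 1) K) \<and> int_basis (cycle_space k K) I (\<lambda>i. representative (b i))"
proof -
  let ?H = "homology (int k - 1) K" and ?r = "\<lambda>i. representative (b i)"
  have "bij_betw (combination ?H b) (carrier (free_Abelian_group I)) (carrier ?H) \<longleftrightarrow>
      int_basis (cycle_space k K) I ?r"
    if b: "b \<in> I \<rightarrow> carrier ?H"
  proof -
    have comb: "combination ?H b c = {frag_extend ?r c}" if "Poly_Mapping.keys c \<subseteq> I" for c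
      by (rule top_combination[OF K dim b that])
    have r: "?r i \<in> cycle_space k K" if "i \<in> I" for i
      using representative_cycle(1)[OF K, of "b i" k] b that by auto
    have ext: "frag_extend ?r c \<in> cycle_space k K" if "Poly_Mapping.keys c \<subseteq> I" for c
      using r that by (intro cycle_space_frag_extend) auto
    have img: "combination ?H b ` carrier (free_Abelian_group I) = carrier ?H \<longleftrightarrow>
       (\<forall>z\<in>cycle_space k K. \<exists>c. Poly_Mapping.keys c \<subseteq> I \<and> z = frag_extend ?r c)" (is "?L \<longleftrightarrow> ?R")
    proof
      assume L: ?L
      show ?R
      proof
        fix z assume "z \<in> cycle_space k K"
        then have "{z} \<in> combination ?H b ` carrier (free_Abelian_group I)" using L top_carrier[OF dim] by simp
        then obtain c where "Poly_Mapping.keys c \<subseteq> I" "{z} = combination ?H b c" by auto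
        then show "\<exists>c. Poly_Mapping.keys c \<subseteq> I \<and> z = frag_extend ?r c" using comb[of c] by auto
      qed
    next
      assume R: ?R
      show ?L
      proof
        show "combination ?H b ` carrier (free_Abelian_group I) \<subseteq> carrier ?H"
          using comb ext top_carrier[OF dim] by auto
        show "carrier ?H \<subseteq> combination ?H b ` carrier (free_Abelian_group I)"
        proof
          fix a assume "a \<in> carrier ?H"
          then obtain z where "z \<in> cycle_space k K" "a = {z}" using top_carrier[OF dim] by auto
          then show "a \<in> combination ?H b ` carrier (free_Abelian_group I)"
            using R comb by (metis carrier_free_Abelian_group_iff image_eqI)
        qed
      qed
    qed
    have inj: "inj_on (combination ?H b) (carrier (free_Abelian_group I)) \<longleftrightarrow>
      (\<forall>c. Poly_Mapping.keys c \<subseteq> I \<longrightarrow> frag_extend ?r c = 0 \<longrightarrow> c = 0)" (is "?L \<longleftrightarrow> ?R")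
    proof
      assume L: ?L
      show ?R
      proof (intro allI impI)
        fix c assume c: "Poly_Mapping.keys c \<subseteq> I" "frag_extend ?r c = 0"
        then have "combination ?H b c = combination ?H b 0" using comb[of c] comb[of 0] by simp
        then show "c = 0" using L c(1) by (auto dest: inj_onD)
      qed
    next
      assume R: ?R
      show ?L
      proof (rule inj_onI)
        fix c d assume cd: "c \<in> carrier (free_Abelian_group I)" "d \<in> carrier (free_Abelian_group I)"
          "combination ?H b c = combination ?H b d"
        then have "frag_extend ?r (c - d) = 0" using comb[of c] comb[of d] by (simp add: frag_extend_diff)
        moreover have "Poly_Mapping.keys (c - d) \<subseteq> I" using keys_diff[of c d] cd by auto
        ultimately have "c - d = 0" using R[rule_format, of "c - d"] by blast
        then show "c = d" by simp
      qed
    qed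
    show ?thesis unfolding bij_betw_def int_basis_def inj img using r by blast
  qed
  then show ?thesis unfolding free_basis_combination by blast
qed

lemma free_basis_of_int_basis:
  assumes K: "simplicial_complex K" and dim: "dim_below k K" and b: "int_basis (cycle_space k K) I b"
  shows "free_basis (homology (int k - 1) K) I (\<lambda>i. {b i})"
  unfolding free_basis_top_iff[OF K dim] using b int_basis_in[OF b] top_carrier[OF dim] by auto

lemma int_basis_reindex:
  assumes b: "int_basis Z I b" and eq: "\<And>i. i \<in> I \<Longrightarrow> b' (\<phi> i) = b i"
  shows "int_basis Z (\<phi> ` I) b'"
proof -
  define g where "g = inv_into I \<phi>"
  have g: "g x \<in> I" "\<phi> (g x) = x" if "x \<in> \<phi> ` I" for x
    using that by (auto simp: g_def inv_into_into f_inv_into_f)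
  show ?thesis
  proof (rule int_basisI)
    fix z assume "z \<in> Z"
    then obtain c where c: "Poly_Mapping.keys c \<subseteq> I" "z = frag_extend b c" by (rule int_basis_span[OF b])
    let ?d = "frag_extend (\<lambda>i. frag_of (\<phi> i)) c"
    have "Poly_Mapping.keys ?d \<subseteq> \<phi> ` I" by (rule order_trans[OF keys_frag_extend], rule UN_least) (use c in auto)
    moreover have "frag_extend b' ?d = frag_extend (\<lambda>i. b' (\<phi> i)) c"
      by (subst additive_frag_extend) (simp_all add: frag_extend_diff)
    moreover have "\<dots> = z" unfolding c(2) by (rule frag_extend_eq) (use c eq in auto)
    ultimately show "\<exists>c. Poly_Mapping.keys c \<subseteq> \<phi> ` I \<and> z = frag_extend b' c" by auto
  next
    fix c assume c: "Poly_Mapping.keys c \<subseteq> \<phi> ` I" "frag_extend b' c = 0"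
    let ?d = "frag_extend (\<lambda>x. frag_of (g x)) c"
    have "Poly_Mapping.keys ?d \<subseteq> I" by (rule order_trans[OF keys_frag_extend], rule UN_least) (use c g in auto)
    moreover have "frag_extend b ?d = frag_extend (\<lambda>x. b (g x)) c"
      by (subst additive_frag_extend) (simp_all add: frag_extend_diff)
    moreover have "frag_extend (\<lambda>x. b (g x)) c = frag_extend b' c"
    proof (rule frag_extend_eq)
      fix x assume "x \<in> Poly_Mapping.keys c"
      then have "x \<in> \<phi> ` I" using c by blast
      then show "b (g x) = b' x" using eq[of "g x"] g[of x] by simp
    qed
    ultimately have d0: "?d = 0" using c(2) int_basis_independent[OF b] by simp
    have "c = frag_extend frag_of c" by (rule frag_expansion)
    also have "\<dots> = frag_extend (\<lambda>x. frag_of (\<phi> (g x))) c"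
      by (rule frag_extend_eq) (use c g in auto)
    also have "\<dots> = frag_extend (\<lambda>i. frag_of (\<phi> i)) ?d"
      by (subst additive_frag_extend) (simp_all add: frag_extend_diff)
    finally show "c = 0" using d0 by simp
  qed (use int_basis_in[OF b] eq in auto)
qed

lemma top_homology_free:
  assumes K: "simplicial_complex K" and dim: "dim_below k K"
  shows "\<exists>B. free_basis (homology (int k - 1) K) B (\<lambda>b. b)"
proof -
  obtain S :: "'a set set" and h where h: "int_basis (cycle_space k K) S h"
    using subgroup_int_basis[of "cycle_space k K"] cycle_space_diff[of _ k K] cycle_space_0[of k K] by blast
  have "int_basis (cycle_space k K) ((\<lambda>i. {h i}) ` S) representative"
    by (rule int_basis_reindex[OF h]) simp
  then show ?thesis
    unfolding free_basis_top_iff[OF K dim] using top_carrier[OF dim] int_basis_in[OF h]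
    by (intro exI[of _ "(\<lambda>i. {h i}) ` S"]) auto
qed

section \<open>The homology of the source of a spherical map\<close>

context spherical_poset_map
begin

lemma link_basis:
  assumes y: "y \<in> Y"
    and \<alpha>: "int_basis (cycle_space (Suc (ht y)) (order_complex (fiber X f y))) I \<alpha>"
    and \<beta>: "int_basis (cycle_space (N - Suc (ht y)) (order_complex (strictly_above Y y))) J \<beta>"
  shows "int_basis (cycle_space N (cyl_link y)) (I \<times> J)
     (\<lambda>(i, j). chain_join (simplicial_chain_map Inl (\<alpha> i)) (simplicial_chain_map Inr (\<beta> j)))"
proof -
  interpret J: spherical_join "(`) Inl ` order_complex (fiber X f y)" "(`) Inr ` order_complex (strictly_above Y y)"
     "range Inl" "Suc (ht y)" "N - Suc (ht y)" by (rule spherical_join_link[OF y])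
  have "int_basis (cycle_space (Suc (ht y)) ((`) Inl ` order_complex (fiber X f y))) I
     (\<lambda>i. simplicial_chain_map (Inl :: 'a \<Rightarrow> 'a + 'b) (\<alpha> i))"
    by (rule relabel_basis[OF simplicial_complex_order_complex _ \<alpha>]) (simp add: inj_def)
  moreover have "int_basis (cycle_space (N - Suc (ht y)) ((`) Inr ` order_complex (strictly_above Y y))) J
     (\<lambda>j. simplicial_chain_map (Inr :: 'b \<Rightarrow> 'a + 'b) (\<beta> j))"
    by (rule relabel_basis[OF simplicial_complex_order_complex _ \<beta>]) (simp add: inj_def)
  ultimately show ?thesis
    using J.join_basis ht_split[OF y] unfolding cyl_link_def by metis
qed

lemma source_basis_exists:
  assumes \<gamma>: "int_basis (cycle_space N (order_complex Y)) I \<gamma>"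
    and \<alpha>: "\<And>y. y \<in> Y \<Longrightarrow> int_basis (cycle_space (Suc (ht y)) (order_complex (fiber X f y))) (I' y) (\<alpha> y)"
    and \<beta>: "\<And>y. y \<in> Y \<Longrightarrow> int_basis (cycle_space (N - Suc (ht y)) (order_complex (strictly_above Y y))) (J' y) (\<beta> y)"
  shows "\<exists>b. int_basis (cycle_space N (order_complex X)) (I <+> (SIGMA y:Y. I' y \<times> J' y)) b"
proof -
  have "\<exists>w\<in>cycle_space N (order_complex X). simplicial_chain_map f w = \<gamma> i" if "i \<in> I" for i
    by (rule induced_surjective[OF int_basis_in[OF \<gamma> that]])
  then obtain c where c: "\<And>i. i \<in> I \<Longrightarrow> c i \<in> cycle_space N (order_complex X)"
    "\<And>i. i \<in> I \<Longrightarrow> simplicial_chain_map f (c i) = \<gamma> i" by metis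
  define \<zeta> where "\<zeta> y = (\<lambda>(i, j). chain_join (simplicial_chain_map (Inl :: 'a \<Rightarrow> 'a + 'b) (\<alpha> y i))
     (simplicial_chain_map Inr (\<beta> y j)))" for y
  have \<zeta>: "int_basis (cycle_space N (cyl_link y)) (I' y \<times> J' y) (\<zeta> y)" if "y \<in> Y" for y
    unfolding \<zeta>_def by (rule link_basis[OF that \<alpha>[OF that] \<beta>[OF that]])
  have "\<exists>w\<in>cycle_space N (order_complex X). homologous N (cyl_level (Suc (ht y))) (\<zeta> y e) (simplicial_chain_map Inl w)"
    if "y \<in> Y" "e \<in> I' y \<times> J' y" for y e
    by (rule link_push[OF that(1) int_basis_in[OF \<zeta>[OF that(1)] that(2)]])
  then obtain w where w: "\<And>y e. y \<in> Y \<Longrightarrow> e \<in> I' y \<times> J' y \<Longrightarrow> w y e \<in> cycle_space N (order_complex X)"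
    "\<And>y e. y \<in> Y \<Longrightarrow> e \<in> I' y \<times> J' y \<Longrightarrow> homologous N (cyl_level (Suc (ht y))) (\<zeta> y e) (simplicial_chain_map Inl (w y e))"
    by metis
  have "int_basis (cycle_space N (order_complex Y)) I (\<lambda>i. simplicial_chain_map f (c i))"
    by (rule int_basis_cong[OF \<gamma>]) (simp add: c(2))
  from cylinder_basis[OF c(1) this \<zeta> w] show ?thesis by blast
qed

end

text \<open>The bound on the lengths of chains ensures that the supremum in the definition of the
  height is attained.\<close>

lemma height_bounds:
  assumes dim: "dim_below N (order_complex Y)" and y: "y \<in> (Y :: 'b::order set)"
  obtains d s where "0 < d" "d \<le> N" "height Y y = int d - 1"
    "dim_below d (order_complex {z \<in> Y. z \<le> y})" "s \<in> order_complex {z \<in> Y. z \<le> y}" "card s = d"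
proof -
  let ?L = "{z \<in> Y. z \<le> y}"
  have sub: "order_complex ?L \<subseteq> order_complex Y" by (intro order_complex_mono) auto
  have "dim_below N (order_complex ?L)" using dim sub by (auto simp: dim_below_def)
  moreover have "order_complex ?L \<noteq> {}" using complex_empty[OF simplicial_complex_order_complex] by blast
  ultimately obtain d s where d: "d \<le> N" "dim_below d (order_complex ?L)" "s \<in> order_complex ?L" "card s = d"
    by (rule exact_dim)
  have "{y} \<in> order_complex ?L" using y by (auto simp: order_complex_def)
  then have "0 < d" using dim_belowD[OF d(2)] by fastforce
  moreover have "height Y y = int d - 1" unfolding height_def by (rule complex_dim_eq[OF d(2-4)])
  ultimately show thesis using that d by blast
qed

lemma height_strict_mono:
  assumes dim: "dim_below N (order_complex Y)" and y: "y \<in> (Y :: 'b::order set)" "y' \<in> Y" "y < y'"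
  shows "height Y y < height Y y'"
proof -
  obtain d s where d: "height Y y = int d - 1" "s \<in> order_complex {z \<in> Y. z \<le> y}" "card s = d"
    using height_bounds[OF dim y(1)] by metis
  obtain d' where d': "height Y y' = int d' - 1" "dim_below d' (order_complex {z \<in> Y. z \<le> y'})"
    using height_bounds[OF dim y(2)] by metis
  have less: "z < y'" if "z \<in> s" for z using d(2) that y(3) by (auto simp: order_complex_def intro: le_less_trans)
  have "insert y' s \<in> order_complex {z \<in> Y. z \<le> y'}"
    using d(2) less y(2) by (auto simp: order_complex_def less_imp_le)
  then have "card (insert y' s) \<le> d'" by (rule dim_belowD[OF d'(2)])
  moreover have "y' \<notin> s" using less by auto
  moreover have "finite s" using d(2) by (simp add: order_complex_def)
  ultimately show ?thesis using d d' by simp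
qed

locale spherical_map_setup =
  fixes X :: "'a::order set" and Y :: "'b::order set" and f :: "'a \<Rightarrow> 'b" and N :: nat
  assumes target: "poset_spherical (int N - 1) Y" and map: "spherical_map (int N - 1) X Y f"
begin

definition ht :: "'b \<Rightarrow> nat" where "ht y = nat (height Y y)"

lemma target_dim': "dim_below N (order_complex Y)"
  using target by (simp add: poset_spherical_iff)

lemma height_ht: assumes y: "y \<in> Y" shows "height Y y = int (ht y)"
proof -
  obtain d where "0 < d" "height Y y = int d - 1" by (rule height_bounds[OF target_dim' y])
  then show ?thesis by (simp add: ht_def)
qed

lemma height_ht': "y \<in> Y \<Longrightarrow> height Y y = int (Suc (ht y)) - 1"
  by (simp add: height_ht)

lemma ht_N: assumes y: "y \<in> Y" shows "ht y < N"
proof -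
  obtain d where "d \<le> N" "0 < d" "height Y y = int d - 1" using height_bounds[OF target_dim' y] by metis
  then show ?thesis using height_ht[OF y] by simp
qed

lemma coheight: "y \<in> Y \<Longrightarrow> int N - 1 - height Y y - 1 = int (N - Suc (ht y)) - 1"
  using ht_N[of y] height_ht[of y] by simp

lemma fiber_spherical:
  assumes y: "y \<in> Y" shows "poset_spherical (int (Suc (ht y)) - 1) (fiber X f y)"
proof -
  have "poset_spherical (height Y y) (fiber X f y)" using map y by (simp add: spherical_map_def)
  then show ?thesis by (simp only: height_ht'[OF y])
qed

lemma above_spherical:
  assumes y: "y \<in> Y" shows "poset_spherical (int (N - Suc (ht y)) - 1) (strictly_above Y y)"
proof -
  have "poset_spherical (int N - 1 - height Y y - 1) (strictly_above Y y)"
    using map y by (simp only: spherical_map_def)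
  then show ?thesis by (simp only: coheight[OF y])
qed

sublocale spherical_poset_map X Y f N ht
proof
  show "f \<in> X \<rightarrow> Y" "mono_on X f" using map by (auto simp: spherical_map_def)
  show "ht y < ht y'" if "y \<in> Y" "y' \<in> Y" "y < y'" for y y'
    using height_strict_mono[OF target_dim' that] height_ht that by simp
  show "dim_below N (order_complex Y)" "acyclic_below N (order_complex Y)"
    using target by (auto simp: poset_spherical_iff)
  fix y assume y: "y \<in> Y"
  show "ht y < N" by (rule ht_N[OF y])
  show "dim_below (Suc (ht y)) (order_complex (fiber X f y))" "acyclic_below (Suc (ht y)) (order_complex (fiber X f y))"
    using fiber_spherical[OF y] unfolding poset_spherical_iff by auto
  show "dim_below (N - Suc (ht y)) (order_complex (strictly_above Y y))"
    "acyclic_below (N - Suc (ht y)) (order_complex (strictly_above Y y))"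
    using above_spherical[OF y] unfolding poset_spherical_iff by auto
qed

text \<open>The fibre contains a chain with \<open>ht y + 1\<close> elements. It lies in the fibre
  below the image of its greatest element, and that fibre would have smaller dimension if the
  image were not \<open>y\<close>.\<close>

lemma surjective: assumes y: "y \<in> Y" shows "\<exists>x\<in>X. f x = y"
proof -
  obtain s where s: "s \<in> order_complex (fiber X f y)" "card s = Suc (ht y)"
    using fiber_spherical[OF y] unfolding poset_spherical_iff by blast
  have ne: "s \<noteq> {}" and sX: "s \<subseteq> X" using s by (auto simp: order_complex_def fiber_def)
  obtain m where m: "m \<in> s" "\<forall>x\<in>s. x \<le> m"
    using finite_chain_Max[of s] s(1) ne by (auto simp: order_complex_def)
  have fm: "f m \<in> Y" "f m \<le> y" using m(1) sX f_in s(1) by (auto simp: order_complex_def fiber_def)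
  have "f x \<le> f m" if "x \<in> s" for x using mono_onD[OF f_mono, of x m] m sX that by auto
  then have "s \<in> order_complex (fiber X f (f m))"
    using s(1) sX by (auto simp: order_complex_def fiber_def)
  then have "Suc (ht y) \<le> Suc (ht (f m))" using dim_belowD[OF fiber_dim[OF fm(1)]] s(2) by metis
  then have "f m = y" using ht_less[OF fm(1) y] fm(2) by (auto simp: le_less)
  then show ?thesis using m(1) sX by blast
qed

theorem source_spherical: "poset_spherical (int N - 1) X"
proof -
  \<comment> \<open>the dimension is attained: unless \<open>Y\<close> is empty, a longest chain
    in \<open>Y\<close> ends at an element of height \<open>n\<close>, over which there is a
    fibre of dimension \<open>n\<close>\<close>
  have "\<exists>s\<in>order_complex X. card s = N"
  proof (cases N)
    case 0
    then show ?thesis using complex_empty[OF simplicial_complex_order_complex] by force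
  next
    case (Suc k)
    obtain t where t: "t \<in> order_complex Y" "card t = N" using target by (auto simp: poset_spherical_iff)
    then have "t \<noteq> {}" using Suc by auto
    then obtain m where m: "m \<in> t" "\<forall>y\<in>t. y \<le> m" using finite_chain_Max[of t] t(1) by (auto simp: order_complex_def)
    have mY: "m \<in> Y" using m(1) t(1) by (auto simp: order_complex_def)
    obtain d where d: "height Y m = int d - 1" "dim_below d (order_complex {z \<in> Y. z \<le> m})"
      using height_bounds[OF target_dim' mY] by metis
    have "t \<in> order_complex {z \<in> Y. z \<le> m}" using t(1) m(2) by (auto simp: order_complex_def)
    then have "N \<le> d" using dim_belowD[OF d(2)] t(2) by blast
    then have "N = Suc (ht m)" using d(1) height_ht[OF mY] ht_N[OF mY] by simp
    then obtain s where "s \<in> order_complex (fiber X f m)" "card s = N"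
      using fiber_spherical[OF mY] unfolding poset_spherical_iff by metis
    then show ?thesis by (auto simp: order_complex_def fiber_def)
  qed
  then show ?thesis using source_dim acyclic_source by (simp add: poset_spherical_iff)
qed

lemma induced_class:
  "dim_below k (order_complex Y') \<Longrightarrow> poset_induced (int k - 1) Y' g a = {simplicial_chain_map g (representative a)}"
  by (simp add: poset_induced_def induced_def top_class)

theorem induced_epi:
  "poset_induced (int N - 1) Y f \<in> epi (poset_homology (int N - 1) X) (poset_homology (int N - 1) Y)"
proof -
  note KX = simplicial_complex_order_complex[of X] and KY = simplicial_complex_order_complex[of Y]
  have cX: "carrier (poset_homology (int N - 1) X) = (\<lambda>z. {z}) ` cycle_space N (order_complex X)"
    unfolding poset_homology_def by (rule top_carrier[OF source_dim])
  have cY: "carrier (poset_homology (int N - 1) Y) = (\<lambda>z. {z}) ` cycle_space N (order_complex Y)"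
    unfolding poset_homology_def by (rule top_carrier[OF target_dim])
  have fz: "simplicial_chain_map f z \<in> cycle_space N (order_complex Y)" if "z \<in> cycle_space N (order_complex X)" for z
    by (rule simplicial_chain_map_cycle_space[OF that KX]) (rule order_complex_image[OF f_mono f_in])
  have mX: "{a} \<otimes>\<^bsub>poset_homology (int N - 1) X\<^esub> {b} = {a + b}"
    if "a \<in> cycle_space N (order_complex X)" "b \<in> cycle_space N (order_complex X)" for a b
    using homology_class_mult[OF KX that] by (simp add: top_class[OF source_dim] poset_homology_def)
  have mY: "{a} \<otimes>\<^bsub>poset_homology (int N - 1) Y\<^esub> {b} = {a + b}"
    if "a \<in> cycle_space N (order_complex Y)" "b \<in> cycle_space N (order_complex Y)" for a b
    using homology_class_mult[OF KY that] by (simp add: top_class[OF target_dim] poset_homology_def)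
  have add: "simplicial_chain_map f (a + b) = simplicial_chain_map f a + simplicial_chain_map f b" for a b
    by (simp add: simplicial_chain_map_def frag_extend_add)
  show ?thesis
    unfolding epi_def
  proof (intro CollectI conjI homI)
    show "poset_induced (int N - 1) Y f a \<in> carrier (poset_homology (int N - 1) Y)"
      if "a \<in> carrier (poset_homology (int N - 1) X)" for a
      using that fz unfolding cX cY by (auto simp: induced_class[OF target_dim])
    show "poset_induced (int N - 1) Y f (a \<otimes>\<^bsub>poset_homology (int N - 1) X\<^esub> b) =
        poset_induced (int N - 1) Y f a \<otimes>\<^bsub>poset_homology (int N - 1) Y\<^esub> poset_induced (int N - 1) Y f b"
      if "a \<in> carrier (poset_homology (int N - 1) X)" "b \<in> carrier (poset_homology (int N - 1) X)" for a b
      using that fz unfolding cX by (auto simp: induced_class[OF target_dim] mX mY add)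
    show "poset_induced (int N - 1) Y f ` carrier (poset_homology (int N - 1) X) = carrier (poset_homology (int N - 1) Y)"
    proof
      show "poset_induced (int N - 1) Y f ` carrier (poset_homology (int N - 1) X) \<subseteq> carrier (poset_homology (int N - 1) Y)"
        using fz unfolding cX cY by (auto simp: induced_class[OF target_dim])
      show "carrier (poset_homology (int N - 1) Y) \<subseteq> poset_induced (int N - 1) Y f ` carrier (poset_homology (int N - 1) X)"
      proof
        fix b assume "b \<in> carrier (poset_homology (int N - 1) Y)"
        then obtain z where z: "z \<in> cycle_space N (order_complex Y)" "b = {z}" unfolding cY by blast
        obtain w where "w \<in> cycle_space N (order_complex X)" "simplicial_chain_map f w = z"
          using induced_surjective[OF z(1)] by blast
        then show "b \<in> poset_induced (int N - 1) Y f ` carrier (poset_homology (int N - 1) X)"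
          unfolding cX image_image using z(2) by (intro image_eqI[of _ _ w]) (auto simp: induced_class[OF target_dim])
      qed
    qed
  qed
qed

end

lemma free_Abelian_group_Plus:
  "free_Abelian_group (A <+> B) \<cong> free_Abelian_group A \<times>\<times> free_Abelian_group B"
proof -
  let ?F = "free_Abelian_group (A <+> B)" and ?G = "free_Abelian_group A \<times>\<times> free_Abelian_group B"
  let ?l = "frag_extend (case_sum frag_of (\<lambda>_. 0)) :: ('a + 'b \<Rightarrow>\<^sub>0 int) \<Rightarrow> 'a \<Rightarrow>\<^sub>0 int"
  let ?r = "frag_extend (case_sum (\<lambda>_. 0) frag_of) :: ('a + 'b \<Rightarrow>\<^sub>0 int) \<Rightarrow> 'b \<Rightarrow>\<^sub>0 int"
  let ?i = "frag_extend (\<lambda>a. frag_of (Inl a)) :: ('a \<Rightarrow>\<^sub>0 int) \<Rightarrow> 'a + 'b \<Rightarrow>\<^sub>0 int"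
  let ?j = "frag_extend (\<lambda>b. frag_of (Inr b)) :: ('b \<Rightarrow>\<^sub>0 int) \<Rightarrow> 'a + 'b \<Rightarrow>\<^sub>0 int"
  have l: "Poly_Mapping.keys (?l c) \<subseteq> A" if "Poly_Mapping.keys c \<subseteq> A <+> B" for c
    by (rule order_trans[OF keys_frag_extend], rule UN_least) (use that in \<open>auto split: sum.splits\<close>)
  have r: "Poly_Mapping.keys (?r c) \<subseteq> B" if "Poly_Mapping.keys c \<subseteq> A <+> B" for c
    by (rule order_trans[OF keys_frag_extend], rule UN_least) (use that in \<open>auto split: sum.splits\<close>)
  have i: "Poly_Mapping.keys (?i a) \<subseteq> A <+> B" if "Poly_Mapping.keys a \<subseteq> A" for a
    by (rule order_trans[OF keys_frag_extend], rule UN_least) (use that in auto)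
  have j: "Poly_Mapping.keys (?j b) \<subseteq> A <+> B" if "Poly_Mapping.keys b \<subseteq> B" for b
    by (rule order_trans[OF keys_frag_extend], rule UN_least) (use that in auto)
  have li: "?l (?i a) = a" "?r (?i a) = 0" for a
    by (induction a rule: frag_induction[OF order_refl]) (simp_all add: frag_extend_diff)
  have rj: "?r (?j b) = b" "?l (?j b) = 0" for b
    by (induction b rule: frag_induction[OF order_refl]) (simp_all add: frag_extend_diff)
  have ij: "?i (?l c) + ?j (?r c) = c" for c
  proof (induction c rule: frag_induction[OF order_refl])
    case (2 x)
    then show ?case by (cases x) simp_all
  next
    case (3 a b)
    have "?i (?l (a - b)) + ?j (?r (a - b)) = (?i (?l a) + ?j (?r a)) - (?i (?l b) + ?j (?r b))"
      by (simp add: frag_extend_diff)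
    then show ?case using 3 by simp
  qed simp
  have "(\<lambda>c. (?l c, ?r c)) \<in> iso ?F ?G"
  proof (rule isoI)
    show "(\<lambda>c. (?l c, ?r c)) \<in> hom ?F ?G"
      by (rule homI) (use l r in \<open>auto simp: DirProd_def frag_extend_add\<close>)
    show "bij_betw (\<lambda>c. (?l c, ?r c)) (carrier ?F) (carrier ?G)"
    proof (rule bij_betwI[where g = "\<lambda>(a, b). ?i a + ?j b"])
      show "(\<lambda>c. (?l c, ?r c)) \<in> carrier ?F \<rightarrow> carrier ?G" using l r by (auto simp: DirProd_def)
      show "(\<lambda>(a, b). ?i a + ?j b) \<in> carrier ?G \<rightarrow> carrier ?F"
      proof
        fix ab assume "ab \<in> carrier ?G"
        then obtain a b where ab: "ab = (a, b)" "Poly_Mapping.keys a \<subseteq> A" "Poly_Mapping.keys b \<subseteq> B"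
          by (auto simp: DirProd_def)
        have "Poly_Mapping.keys (?i a + ?j b) \<subseteq> A <+> B"
          by (rule order_trans[OF keys_add Un_least[OF i[OF ab(2)] j[OF ab(3)]]])
        then show "(case ab of (a, b) \<Rightarrow> ?i a + ?j b) \<in> carrier ?F" by (simp add: ab(1))
      qed
      show "(case (?l c, ?r c) of (a, b) \<Rightarrow> ?i a + ?j b) = c" for c using ij by simp
      show "(\<lambda>c. (?l c, ?r c)) (case ab of (a, b) \<Rightarrow> ?i a + ?j b) = ab" for ab
        by (cases ab) (simp add: frag_extend_add li rj)
    qed
  qed
  then show ?thesis by (auto simp: is_iso_def)
qed

lemma free_Abelian_group_Sigma:
  "free_Abelian_group (SIGMA y:Y. E y) \<cong> sum_group Y (\<lambda>y. free_Abelian_group (E y))"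
proof -
  have U: "(\<Union>y\<in>Y. {y} \<times> E y) = (SIGMA y:Y. E y)" by auto
  have "sum_group Y (\<lambda>y. free_Abelian_group ({y} \<times> E y)) \<cong> free_Abelian_group (\<Union>y\<in>Y. {y} \<times> E y)"
    unfolding is_iso_def
    using iso_free_Abelian_group_sum[of "\<lambda>y. {y} \<times> E y" Y] by (auto simp: pairwise_def disjnt_def)
  moreover have "group (sum_group Y (\<lambda>y. free_Abelian_group ({y} \<times> E y)))" by (rule sum_group) simp
  ultimately have "free_Abelian_group (SIGMA y:Y. E y) \<cong> sum_group Y (\<lambda>y. free_Abelian_group ({y} \<times> E y))"
    unfolding U using group.iso_sym by blast
  also have "\<dots> \<cong> sum_group Y (\<lambda>y. free_Abelian_group (E y))"
  proof (rule iso_sum_groupI)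
    fix y
    have "bij_betw snd ({y} \<times> E y) (E y)" by (auto simp: bij_betw_def inj_on_def image_iff)
    then have "{y} \<times> E y \<approx> E y" by (auto simp: eqpoll_def)
    then show "free_Abelian_group ({y} \<times> E y) \<cong> free_Abelian_group (E y)"
      by (simp add: isomorphic_free_Abelian_groups)
  qed simp_all
  finally show ?thesis .
qed

context spherical_map_setup
begin

text \<open>Both sides are free, with bases indexed by the disjoint union of a basis for
  \<open>Y\<close> and the pairs of basis elements of the two factors belonging to each
  \<open>y\<close>.\<close>

theorem source_homology_iso:
  "poset_homology (int N - 1) X \<cong> poset_homology (int N - 1) Y \<times>\<times>
     sum_group Y (\<lambda>y. tensor_product (poset_homology (height Y y) (fiber X f y))
        (poset_homology (int N - 1 - height Y y - 1) (strictly_above Y y)))"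
proof -
  note K = simplicial_complex_order_complex
  let ?HX = "poset_homology (int N - 1) X" and ?HY = "poset_homology (int N - 1) Y"
  let ?HF = "\<lambda>y. poset_homology (height Y y) (fiber X f y)"
  let ?HU = "\<lambda>y. poset_homology (int N - 1 - height Y y - 1) (strictly_above Y y)"
  have HF: "?HF y = homology (int (Suc (ht y)) - 1) (order_complex (fiber X f y))" if "y \<in> Y" for y
    by (simp only: height_ht'[OF that] poset_homology_def)
  have HU: "?HU y = homology (int (N - Suc (ht y)) - 1) (order_complex (strictly_above Y y))" if "y \<in> Y" for y
    by (simp only: coheight[OF that] poset_homology_def)
  obtain B where B: "free_basis ?HY B (\<lambda>b. b)"
    using top_homology_free[OF K target_dim] by (auto simp: poset_homology_def)
  have "\<exists>A. free_basis (?HF y) A (\<lambda>b. b)" if "y \<in> Y" for y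
    unfolding HF[OF that] by (rule top_homology_free[OF K fiber_dim[OF that]])
  then obtain A where A: "\<And>y. y \<in> Y \<Longrightarrow> free_basis (?HF y) (A y) (\<lambda>b. b)" by metis
  have "\<exists>C. free_basis (?HU y) C (\<lambda>b. b)" if "y \<in> Y" for y
    unfolding HU[OF that] by (rule top_homology_free[OF K above_dim[OF that]])
  then obtain C where C: "\<And>y. y \<in> Y \<Longrightarrow> free_basis (?HU y) (C y) (\<lambda>b. b)" by metis
  have bY: "int_basis (cycle_space N (order_complex Y)) B representative"
    using B unfolding poset_homology_def free_basis_top_iff[OF K target_dim] by blast
  have bA: "int_basis (cycle_space (Suc (ht y)) (order_complex (fiber X f y))) (A y) representative" if "y \<in> Y" for y
    using A[OF that] unfolding HF[OF that] free_basis_top_iff[OF K fiber_dim[OF that]] by blast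
  have bC: "int_basis (cycle_space (N - Suc (ht y)) (order_complex (strictly_above Y y))) (C y) representative" if "y \<in> Y" for y
    using C[OF that] unfolding HU[OF that] free_basis_top_iff[OF K above_dim[OF that]] by blast
  obtain b where "int_basis (cycle_space N (order_complex X)) (B <+> (SIGMA y:Y. A y \<times> C y)) b"
    using source_basis_exists[OF bY bA bC] by blast
  from free_basis_of_int_basis[OF K source_dim this]
  have X: "free_basis ?HX (B <+> (SIGMA y:Y. A y \<times> C y)) (\<lambda>i. {b i})" by (simp add: poset_homology_def)
  have cX: "comm_group ?HX" and cY: "comm_group ?HY"
    unfolding poset_homology_def by (rule comm_group_homology[OF K])+
  have cF: "comm_group (?HF y)" and cU: "comm_group (?HU y)" if "y \<in> Y" for y
    unfolding HF[OF that] HU[OF that] by (rule comm_group_homology[OF K])+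
  have iX: "free_Abelian_group (B <+> (SIGMA y:Y. A y \<times> C y)) \<cong> ?HX"
    using comm_group.free_basis_iso[OF cX X] by (auto simp: is_iso_def)
  have iY: "free_Abelian_group B \<cong> ?HY"
    using comm_group.free_basis_iso[OF cY B] by (auto simp: is_iso_def)
  have t: "tensor_product (?HF y) (?HU y) \<cong> free_Abelian_group (A y \<times> C y)" if "y \<in> Y" for y
    by (rule tensor_free[OF cF[OF that] cU[OF that] A[OF that] C[OF that]])
  have tg: "group (tensor_product (?HF y) (?HU y))" if "y \<in> Y" for y
    by (rule comm_group.axioms(2)[OF comm_group_tensor_product[OF cF[OF that] cU[OF that]]])
  have iS: "free_Abelian_group (SIGMA y:Y. A y \<times> C y) \<cong> sum_group Y (\<lambda>y. tensor_product (?HF y) (?HU y))"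
  proof (rule iso_trans[OF free_Abelian_group_Sigma])
    show "sum_group Y (\<lambda>y. free_Abelian_group (A y \<times> C y)) \<cong> sum_group Y (\<lambda>y. tensor_product (?HF y) (?HU y))"
    proof (rule iso_sum_groupI)
      fix y assume y: "y \<in> Y"
      show "free_Abelian_group (A y \<times> C y) \<cong> tensor_product (?HF y) (?HU y)"
        by (rule group.iso_sym[OF tg[OF y] t[OF y]])
      show "group (tensor_product (?HF y) (?HU y))" by (rule tg[OF y])
    qed (rule group_free_Abelian_group)
  qed
  have "?HX \<cong> free_Abelian_group (B <+> (SIGMA y:Y. A y \<times> C y))"
    by (rule group.iso_sym[OF group_free_Abelian_group iX])
  also have "\<dots> \<cong> free_Abelian_group B \<times>\<times> free_Abelian_group (SIGMA y:Y. A y \<times> C y)"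
    by (rule free_Abelian_group_Plus)
  also have "\<dots> \<cong> ?HY \<times>\<times> sum_group Y (\<lambda>y. tensor_product (?HF y) (?HU y))"
    by (rule group.DirProd_iso_trans[OF group_free_Abelian_group iY iS])
  finally show ?thesis .
qed

end

section \<open>Subdivision in the top degree\<close>

lemma full_chain_of_faces:
  assumes "finite \<sigma>" shows "\<exists>s\<in>order_complex {\<tau>. \<tau> \<noteq> {} \<and> \<tau> \<subseteq> \<sigma>}. card s = card \<sigma>"
  using assms
proof (induction \<sigma>)
  case empty
  show ?case by (rule bexI[of _ "{}"]) (simp_all add: order_complex_def)
next
  case (insert v \<sigma>)
  then obtain s where s: "s \<in> order_complex {\<tau>. \<tau> \<noteq> {} \<and> \<tau> \<subseteq> \<sigma>}" "card s = card \<sigma>" by blast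
  have "insert v \<sigma> \<notin> s" using s(1) insert.hyps(2) by (auto simp: order_complex_def)
  moreover have "insert (insert v \<sigma>) s \<in> order_complex {\<tau>. \<tau> \<noteq> {} \<and> \<tau> \<subseteq> insert v \<sigma>}"
    using s(1) by (auto simp: order_complex_def)
  moreover have "finite s" using s(1) by (simp add: order_complex_def)
  ultimately show ?case using s(2) insert.hyps by (intro bexI[of _ "insert (insert v \<sigma>) s"]) auto
qed

lemma dim_below_of_face_poset:
  assumes K: "simplicial_complex K" and dim: "dim_below d (order_complex (face_poset K))"
  shows "dim_below d K"
  unfolding dim_below_def
proof
  fix \<sigma> assume \<sigma>: "\<sigma> \<in> K"
  obtain s where s: "s \<in> order_complex {\<tau>. \<tau> \<noteq> {} \<and> \<tau> \<subseteq> \<sigma>}" "card s = card \<sigma>"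
    using full_chain_of_faces[OF complex_finite[OF K \<sigma>]] by blast
  have "{\<tau>. \<tau> \<noteq> {} \<and> \<tau> \<subseteq> \<sigma>} \<subseteq> face_poset K" using complex_face[OF K \<sigma>] by (auto simp: face_poset_def)
  then have "s \<in> order_complex (face_poset K)" using s(1) order_complex_mono by blast
  then show "card \<sigma> \<le> d" using dim_belowD[OF dim] s(2) by metis
qed

text \<open>The members of a chain of faces have different numbers of vertices, at most that of
  the largest one.\<close>

lemma dim_below_face_poset:
  assumes K: "simplicial_complex K" and dim: "dim_below d K"
  shows "dim_below d (order_complex (face_poset K))"
  unfolding dim_below_def
proof
  fix s assume s: "s \<in> order_complex (face_poset K)"
  show "card s \<le> d"
  proof (cases "s = {}")
    case False
    have U: "\<Union>s \<in> s" by (rule chain_Union_in[OF s False])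
    have sK: "s \<subseteq> face_poset K" using s by (simp add: order_complex_def)
    then have UK: "\<Union>s \<in> K" using U by (auto simp: face_poset_def)
    have fin: "finite \<tau>" "\<tau> \<noteq> {}" if "\<tau> \<in> s" for \<tau>
      using sK that complex_finite[OF K] by (auto simp: face_poset_def)
    have "inj_on card s"
    proof (rule inj_onI)
      fix \<tau> \<upsilon> assume t: "\<tau> \<in> s" "\<upsilon> \<in> s" "card \<tau> = card \<upsilon>"
      then have "\<tau> \<subseteq> \<upsilon> \<or> \<upsilon> \<subseteq> \<tau>" using s by (auto simp: order_complex_def)
      then show "\<tau> = \<upsilon>" using card_subset_eq[OF fin(1)[OF t(1)]] card_subset_eq[OF fin(1)[OF t(2)]] t(3) by metis
    qed
    moreover have "card ` s \<subseteq> {1..card (\<Union>s)}"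
    proof
      fix k assume "k \<in> card ` s"
      then obtain \<tau> where t: "\<tau> \<in> s" "k = card \<tau>" by blast
      then have "0 < k" using fin[OF t(1)] by (simp add: card_gt_0_iff)
      moreover have "k \<le> card (\<Union>s)" unfolding t(2) by (rule card_mono[OF fin(1)[OF U]]) (use t in blast)
      ultimately show "k \<in> {1..card (\<Union>s)}" by simp
    qed
    ultimately have "card s \<le> card {1..card (\<Union>s)}" by (rule card_inj_on_le) simp
    then show ?thesis using dim_belowD[OF dim UK] by simp
  qed simp
qed

lemma subdivision_vertex_choice_top:
  assumes K: "simplicial_complex K" and dim: "dim_below k K" and w: "w \<in> cycle_space k (order_complex (face_poset K))"
  shows "simplicial_chain_map vertex_choice w \<in> cycle_space k K"
    "subdivision (simplicial_chain_map vertex_choice w) = w"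
proof -
  show "simplicial_chain_map vertex_choice w \<in> cycle_space k K"
    by (rule simplicial_chain_map_cycle_space[OF w simplicial_complex_order_complex vertex_choice_image[OF K]])
  show "subdivision (simplicial_chain_map vertex_choice w) = w"
    by (rule homologous_top[OF dim_belowD[OF dim_below_face_poset[OF K dim]] subdivision_vertex_choice[OF K w]])
qed

text \<open>Subdivision and vertex choice are inverse up to homology, and homologous top cycles
  are equal.\<close>

lemma subdivision_bij:
  assumes K: "simplicial_complex K" and dim: "dim_below k K"
  shows "bij_betw subdivision (cycle_space k K) (cycle_space k (order_complex (face_poset K)))"
proof (rule bij_betwI[where g = "simplicial_chain_map vertex_choice"])
  show "subdivision \<in> cycle_space k K \<rightarrow> cycle_space k (order_complex (face_poset K))"
    using subdivision_cycle_space[OF K] by blast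
  show "simplicial_chain_map vertex_choice (subdivision z) = z" if "z \<in> cycle_space k K" for z
    by (rule homologous_top[OF dim_belowD[OF dim] vertex_choice_subdivision[OF K that]])
qed (use subdivision_vertex_choice_top[OF K dim] in auto)

lemma homology_subdivision_top:
  assumes "simplicial_complex K" "dim_below k K"
  shows "homology_subdivision (int k - 1) K a = {subdivision (representative a)}"
  by (simp add: homology_subdivision_def induced_def top_class[OF dim_below_face_poset[OF assms]])

section \<open>Spherical maps from face posets\<close>

locale face_map_setup = spherical_map_setup "face_poset K" Y g N
  for K :: "'v set set" and Y :: "'b::order set" and g :: "'v set \<Rightarrow> 'b" and N :: nat +
  assumes K: "simplicial_complex K"
    and link_anti: "\<And>\<sigma>1 \<sigma>2. \<sigma>1 \<in> face_poset K \<Longrightarrow> \<sigma>2 \<in> face_poset K \<Longrightarrow> g \<sigma>1 \<le> g \<sigma>2 \<Longrightarrow> link \<sigma>2 K \<subseteq> link \<sigma>1 K"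
    and union_mono: "\<And>\<sigma>1 \<sigma>2 \<tau>1 \<tau>2. \<sigma>1 \<in> face_poset K \<Longrightarrow> \<sigma>2 \<in> face_poset K \<Longrightarrow>
      \<tau>1 \<in> face_poset K \<Longrightarrow> \<tau>2 \<in> face_poset K \<Longrightarrow> g \<sigma>1 \<le> g \<sigma>2 \<Longrightarrow> g \<tau>1 \<le> g \<tau>2 \<Longrightarrow>
      \<sigma>1 \<union> \<tau>1 \<in> K \<Longrightarrow> \<sigma>2 \<union> \<tau>2 \<in> K \<Longrightarrow> g (\<sigma>1 \<union> \<tau>1) \<le> g (\<sigma>2 \<union> \<tau>2)"
begin

lemma K_dim: "dim_below N K"
  by (rule dim_below_of_face_poset[OF K source_dim])

lemma g_mono: "\<sigma> \<in> face_poset K \<Longrightarrow> \<tau> \<in> face_poset K \<Longrightarrow> \<sigma> \<subseteq> \<tau> \<Longrightarrow> g \<sigma> \<le> g \<tau>"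
  using mono_onD[OF f_mono] by blast

lemma g_in: "\<sigma> \<in> face_poset K \<Longrightarrow> g \<sigma> \<in> Y"
  using f_in by blast

lemma link_face: "\<tau> \<in> link \<sigma> K \<Longrightarrow> \<tau> \<in> K \<and> \<sigma> \<union> \<tau> \<in> K \<and> \<sigma> \<inter> \<tau> = {}"
  using complex_face[OF K, of "\<sigma> \<union> \<tau>" \<tau>] by (auto simp: link_def)

lemma simplicial_complex_below: "simplicial_complex (subcomplex_below K g y)"
  unfolding simplicial_complex_def
proof (intro conjI ballI allI impI)
  show "{} \<in> subcomplex_below K g y" by (simp add: subcomplex_below_def)
  fix \<sigma> assume \<sigma>: "\<sigma> \<in> subcomplex_below K g y"
  then show "finite \<sigma>" using complex_finite[OF K] by (auto simp: subcomplex_below_def fiber_def face_poset_def)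
  fix \<tau> assume "\<tau> \<subseteq> \<sigma>"
  show "\<tau> \<in> subcomplex_below K g y"
  proof (cases "\<tau> = {}")
    case False
    then have s: "\<sigma> \<in> face_poset K" "g \<sigma> \<le> y" using \<sigma> \<open>\<tau> \<subseteq> \<sigma>\<close> by (auto simp: subcomplex_below_def fiber_def)
    then have "\<tau> \<in> face_poset K" using complex_face[OF K, of \<sigma> \<tau>] False \<open>\<tau> \<subseteq> \<sigma>\<close> by (auto simp: face_poset_def)
    then show ?thesis using g_mono[of \<tau> \<sigma>] s \<open>\<tau> \<subseteq> \<sigma>\<close> by (auto simp: subcomplex_below_def fiber_def)
  qed (simp add: subcomplex_below_def)
qed

lemma face_poset_below: "face_poset (subcomplex_below K g y) = fiber (face_poset K) g y"
  by (auto simp: subcomplex_below_def face_poset_def fiber_def)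

lemma below_dim: "y \<in> Y \<Longrightarrow> dim_below (Suc (ht y)) (subcomplex_below K g y)"
  by (rule dim_below_of_face_poset[OF simplicial_complex_below]) (simp add: face_poset_below fiber_dim)

end

text \<open>An element \<open>y\<close> together with a chosen face \<open>\<sigma>\<close> in its
  preimage, which enters through its link.\<close>

locale face_map_point = face_map_setup K Y g N
  for K :: "'v set set" and Y :: "'b::order set" and g :: "'v set \<Rightarrow> 'b" and N :: nat +
  fixes y :: 'b and \<sigma> :: "'v set"
  assumes y: "y \<in> Y" and \<sigma>: "\<sigma> \<in> face_poset K" and g\<sigma>: "g \<sigma> = y"
begin

abbreviation "Ky \<equiv> subcomplex_below K g y"
abbreviation "Lk \<equiv> link \<sigma> K"
abbreviation "codim \<equiv> N - Suc (ht y)"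

text \<open>Stands for \<open>g\<close> with a tilde: the map that \<open>g\<close> induces on the
  link.\<close>

definition gt :: "'v set \<Rightarrow> 'b" where "gt \<tau> = g (\<sigma> \<union> \<tau>)"

lemma simplicial_complex_lk: "simplicial_complex Lk"
  unfolding simplicial_complex_def
proof (intro conjI ballI allI impI)
  show "{} \<in> Lk" using \<sigma> by (simp add: link_def face_poset_def)
  fix \<tau> assume t: "\<tau> \<in> Lk"
  then show "finite \<tau>" using link_face complex_finite[OF K] by blast
  fix \<upsilon> assume "\<upsilon> \<subseteq> \<tau>"
  then show "\<upsilon> \<in> Lk" using t complex_face[OF K, of "\<sigma> \<union> \<tau>" "\<sigma> \<union> \<upsilon>"] by (auto simp: link_def)
qed

text \<open>As \<open>g \<rho> \<le> g \<sigma>\<close>, the link of \<open>\<sigma>\<close> is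
  contained in the link of \<open>\<rho>\<close>.\<close>

lemma below_join: assumes "\<rho> \<in> Ky" "\<tau> \<in> Lk" shows "\<rho> \<union> \<tau> \<in> K" "\<rho> \<inter> \<tau> = {}"
proof -
  have "\<rho> \<union> \<tau> \<in> K \<and> \<rho> \<inter> \<tau> = {}"
  proof (cases "\<rho> = {}")
    case True
    then show ?thesis using link_face[OF assms(2)] by simp
  next
    case False
    then have "\<rho> \<in> face_poset K" "g \<rho> \<le> g \<sigma>" using assms(1) g\<sigma> by (auto simp: subcomplex_below_def fiber_def)
    then have "\<tau> \<in> link \<rho> K" using link_anti[OF _ \<sigma>] assms(2) by blast
    then show ?thesis by (simp add: link_def)
  qed
  then show "\<rho> \<union> \<tau> \<in> K" "\<rho> \<inter> \<tau> = {}" by auto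
qed

lemma join_subset: "complex_join Ky Lk \<subseteq> K"
  using below_join(1) by (auto simp: complex_join_def)

lemma disjoint_vertices: "\<Union>Ky \<inter> \<Union>Lk = {}"
  using below_join(2) by blast

sublocale J: disjoint_join Ky Lk "\<Union>Ky"
proof
  show "simplicial_complex Ky" by (rule simplicial_complex_below)
  show "simplicial_complex Lk" by (rule simplicial_complex_lk)
qed (use disjoint_vertices in blast)+

text \<open>Since the fibre of \<open>y\<close> attains its dimension, there is a face with at
  least \<open>ht y + 1\<close> vertices in \<open>Ky\<close>, and its join with a face of the
  link has at most \<open>N\<close> vertices.\<close>

lemma lk_dim: "dim_below codim Lk"
  unfolding dim_below_def
proof
  fix \<tau> assume \<tau>: "\<tau> \<in> Lk"
  obtain s where s: "s \<in> order_complex (fiber (face_poset K) g y)" "card s = Suc (ht y)"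
    using fiber_spherical[OF y] unfolding poset_spherical_iff by blast
  have ne: "s \<noteq> {}" using s(2) by auto
  have U: "\<Union>s \<in> s" by (rule chain_Union_in[OF s(1) ne])
  have "\<not> dim_below (ht y) Ky"
    using dim_below_face_poset[OF simplicial_complex_below, of "ht y" y] dim_belowD[OF _ s(1), of "ht y"] s(2)
    unfolding face_poset_below by auto
  then obtain \<rho> where r: "\<rho> \<in> Ky" "Suc (ht y) \<le> card \<rho>" by (auto simp: dim_below_def not_le Suc_le_eq)
  have "card (\<rho> \<union> \<tau>) \<le> N" by (rule dim_belowD[OF K_dim below_join(1)[OF r(1) \<tau>]])
  then show "card \<tau> \<le> codim" using J.card_join[OF r(1) \<tau>] r(2) by simp
qed

lemma lk_face: "\<tau> \<in> face_poset Lk \<Longrightarrow> \<tau> \<in> face_poset K \<and> \<sigma> \<union> \<tau> \<in> face_poset K"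
  using link_face[of \<tau> \<sigma>] by (auto simp: face_poset_def)

text \<open>If \<open>\<sigma> \<union> \<tau>\<close> had the same image as
  \<open>\<sigma>\<close>, its link would contain that of \<open>\<sigma>\<close> and so
  \<open>\<tau>\<close>; but a nonempty face is not in the link of a face containing it.\<close>

lemma gt_above: "gt \<in> face_poset Lk \<rightarrow> strictly_above Y y"
proof
  fix \<tau> assume \<tau>: "\<tau> \<in> face_poset Lk"
  note f = lk_face[OF \<tau>]
  have "y \<le> gt \<tau>" using g_mono[of \<sigma> "\<sigma> \<union> \<tau>"] f \<sigma> g\<sigma> by (auto simp: gt_def)
  moreover have "gt \<tau> \<noteq> y"
  proof
    assume "gt \<tau> = y"
    then have "link \<sigma> K \<subseteq> link (\<sigma> \<union> \<tau>) K" using link_anti[of "\<sigma> \<union> \<tau>" \<sigma>] f \<sigma> g\<sigma> by (simp add: gt_def)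
    then have "\<tau> \<in> link (\<sigma> \<union> \<tau>) K" using \<tau> by (auto simp: face_poset_def)
    then show False using \<tau> by (auto simp: link_def face_poset_def)
  qed
  ultimately show "gt \<tau> \<in> strictly_above Y y"
    using g_in[of "\<sigma> \<union> \<tau>"] f by (auto simp: strictly_above_def gt_def)
qed

lemma gt_mono: "mono_on (face_poset Lk) gt"
proof (rule mono_onI)
  fix \<tau> \<upsilon> assume "\<tau> \<in> face_poset Lk" "\<upsilon> \<in> face_poset Lk" "\<tau> \<le> \<upsilon>"
  then show "gt \<tau> \<le> gt \<upsilon>"
    unfolding gt_def using lk_face by (intro g_mono) auto
qed

lemma independent_of_choice:
  assumes s': "\<sigma>' \<in> face_poset K" "g \<sigma>' = y"
  shows "link \<sigma>' K = Lk" "\<And>\<tau>. \<tau> \<in> face_poset Lk \<Longrightarrow> g (\<sigma>' \<union> \<tau>) = g (\<sigma> \<union> \<tau>)"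
proof -
  show l: "link \<sigma>' K = Lk"
    using link_anti[OF s'(1) \<sigma>] link_anti[OF \<sigma> s'(1)] s'(2) g\<sigma> by auto
  fix \<tau> assume \<tau>: "\<tau> \<in> face_poset Lk"
  have "\<sigma>' \<union> \<tau> \<in> K" using \<tau> link_face[of \<tau> \<sigma>'] l by (auto simp: face_poset_def)
  moreover have "\<sigma> \<union> \<tau> \<in> K" using lk_face[OF \<tau>] by (simp add: face_poset_def)
  ultimately have "g (\<sigma>' \<union> \<tau>) \<le> g (\<sigma> \<union> \<tau>)" "g (\<sigma> \<union> \<tau>) \<le> g (\<sigma>' \<union> \<tau>)"
    using union_mono[of \<sigma>' \<sigma> \<tau> \<tau>] union_mono[of \<sigma> \<sigma>' \<tau> \<tau>] s' g\<sigma> \<sigma> lk_face[OF \<tau>] by auto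
  then show "g (\<sigma>' \<union> \<tau>) = g (\<sigma> \<union> \<tau>)" by simp
qed

text \<open>Removing \<open>\<sigma>\<close> identifies the faces above \<open>\<sigma>\<close>
  with the faces of the link, and on top cycles the subdivision operator of the link can be
  inverted.\<close>

lemma cycle_lift:
  assumes epi: "poset_induced (int codim - 1) (strictly_above Y y) g
       \<in> epi (poset_homology (int codim - 1) (strictly_above (face_poset K) \<sigma>))
             (poset_homology (int codim - 1) (strictly_above Y y))"
    and b: "b \<in> carrier (poset_homology (int codim - 1) (strictly_above Y y))"
  shows "\<exists>z\<in>cycle_space codim Lk. {simplicial_chain_map gt (subdivision z)} = b"
proof -
  let ?X = "strictly_above (face_poset K) \<sigma>"
  note K' = simplicial_complex_order_complex[of ?X]
  have "b \<in> poset_induced (int codim - 1) (strictly_above Y y) g ` carrier (poset_homology (int codim - 1) ?X)"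
    using epi b by (simp add: epi_def)
  then obtain a where a: "a \<in> carrier (poset_homology (int codim - 1) ?X)"
    "b = poset_induced (int codim - 1) (strictly_above Y y) g a" by blast
  let ?z = "representative a" and ?\<theta> = "\<lambda>\<rho>. \<rho> - \<sigma>"
  have z: "?z \<in> cycle_space codim (order_complex ?X)"
    using representative_cycle(1)[OF K'] a(1) unfolding poset_homology_def by blast
  have bz: "b = {simplicial_chain_map g ?z}" unfolding a(2) by (rule induced_class[OF above_dim[OF y]])
  have \<theta>: "\<rho> - \<sigma> \<in> face_poset Lk" "gt (\<rho> - \<sigma>) = g \<rho>" if "\<rho> \<in> ?X" for \<rho>
  proof -
    have r: "\<rho> \<in> K" "\<sigma> \<subset> \<rho>" using that by (auto simp: strictly_above_def face_poset_def)
    then have u: "\<sigma> \<union> (\<rho> - \<sigma>) = \<rho>" by auto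
    then show "gt (\<rho> - \<sigma>) = g \<rho>" by (simp add: gt_def)
    show "\<rho> - \<sigma> \<in> face_poset Lk" using r u by (auto simp: face_poset_def link_def)
  qed
  have \<theta>z: "simplicial_chain_map ?\<theta> ?z \<in> cycle_space codim (order_complex (face_poset Lk))"
  proof (rule simplicial_chain_map_cycle_space[OF z K'])
    show "?\<theta> ` s \<in> order_complex (face_poset Lk)" if "s \<in> order_complex ?X" for s
      by (rule order_complex_image[OF _ _ that]) (use \<theta>(1) in \<open>auto intro!: mono_onI\<close>)
  qed
  have fin: "finitary ?z" by (rule chain_space_finitary[OF K' cycle_space_chain[OF z]])
  have "simplicial_chain_map gt (simplicial_chain_map ?\<theta> ?z) = simplicial_chain_map (gt \<circ> ?\<theta>) ?z"
    by (rule simplicial_chain_map_compose[OF fin])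
  also have "\<dots> = simplicial_chain_map g ?z"
  proof (rule simplicial_chain_map_cong[OF _ fin])
    fix \<rho> assume "\<rho> \<in> \<Union>(Poly_Mapping.keys ?z)"
    then obtain s where s: "s \<in> Poly_Mapping.keys ?z" "\<rho> \<in> s" by blast
    then have "\<rho> \<in> ?X" using chain_spaceD[OF cycle_space_chain[OF z] s(1)] by (auto simp: order_complex_def)
    then show "(gt \<circ> ?\<theta>) \<rho> = g \<rho>" using \<theta>(2) by simp
  qed
  finally show ?thesis
    using subdivision_vertex_choice_top[OF simplicial_complex_lk lk_dim \<theta>z] bz by auto
qed

text \<open>The carrier that compares two ways of sending a simplex \<open>\<rho>\<close> of the
  join to the cylinder: subdividing it in the source, and sending its part in \<open>Ky\<close> to
  the source and its part in the link to the target. It contains the chains formed by faces of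
  \<open>\<rho>\<close> and images of faces of the second part.\<close>

definition join_carrier :: "'v set \<Rightarrow> ('v set + 'b) set set" where
  "join_carrier \<rho> = {\<pi> \<in> cyl_level (Suc (ht y)). Inl -` \<pi> \<subseteq> {\<upsilon>. \<upsilon> \<noteq> {} \<and> \<upsilon> \<subseteq> \<rho>} \<and>
     Inr -` \<pi> \<subseteq> gt ` {\<upsilon>. \<upsilon> \<noteq> {} \<and> \<upsilon> \<subseteq> \<rho> - \<Union>Ky}}"

lemma join_split:
  assumes "\<rho> \<in> complex_join Ky Lk"
  shows "\<rho> \<inter> \<Union>Ky \<in> Ky" "\<rho> - \<Union>Ky \<in> Lk" "card \<rho> = card (\<rho> \<inter> \<Union>Ky) + card (\<rho> - \<Union>Ky)"
proof -
  obtain \<alpha> \<tau> where r: "\<alpha> \<in> Ky" "\<tau> \<in> Lk" "\<rho> = \<alpha> \<union> \<tau>" using assms by (auto simp: complex_join_def)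
  have "\<tau> \<inter> \<Union>Ky = {}" using J.BV[OF r(2)] .
  then have e: "\<rho> \<inter> \<Union>Ky = \<alpha>" "\<rho> - \<Union>Ky = \<tau>" using r by auto
  show "\<rho> \<inter> \<Union>Ky \<in> Ky" "\<rho> - \<Union>Ky \<in> Lk" unfolding e using r by auto
  show "card \<rho> = card (\<rho> \<inter> \<Union>Ky) + card (\<rho> - \<Union>Ky)" 
    using J.card_join[OF r(1,2)] unfolding e r(3)[symmetric] .
qed

text \<open>This is where compatibility with unions enters: \<open>\<upsilon>\<close> is the union
  of a part in \<open>Ky\<close>, whose image is at most \<open>g \<sigma>\<close>, and a part
  contained in \<open>\<rho> - \<Union>Ky\<close>.\<close>

lemma gt_bound:
  assumes \<rho>: "\<rho> \<in> complex_join Ky Lk" and \<upsilon>: "\<upsilon> \<noteq> {}" "\<upsilon> \<subseteq> \<rho>" and \<tau>: "\<rho> - \<Union>Ky \<noteq> {}"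
  shows "g \<upsilon> \<le> gt (\<rho> - \<Union>Ky)"
proof -
  let ?\<tau> = "\<rho> - \<Union>Ky" and ?a = "\<upsilon> \<inter> \<Union>Ky" and ?t = "\<upsilon> - \<Union>Ky"
  note r = join_split[OF \<rho>]
  have rK: "\<rho> \<in> K" using join_subset \<rho> by blast
  have \<tau>L: "?\<tau> \<in> face_poset Lk" using r(2) \<tau> by (simp add: face_poset_def)
  note f = lk_face[OF \<tau>L]
  have y_le: "y \<le> gt ?\<tau>" using funcset_mem[OF gt_above \<tau>L] by (simp add: strictly_above_def less_imp_le)
  have "?a \<in> Ky" using complex_face[OF simplicial_complex_below r(1)] \<upsilon>(2) by blast
  then have a: "?a \<in> face_poset K \<and> g ?a \<le> y" if "?a \<noteq> {}" using that by (auto simp: subcomplex_below_def fiber_def)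
  have t: "?t \<in> face_poset K" if "?t \<noteq> {}"
    using that complex_face[OF K rK, of ?t] \<upsilon>(2) by (auto simp: face_poset_def)
  have \<upsilon>_eq: "\<upsilon> = ?a \<union> ?t" by auto
  consider "?t = {}" | "?a = {}" | "?a \<noteq> {}" "?t \<noteq> {}" by blast
  then show ?thesis
  proof cases
    case 1
    then have "\<upsilon> = ?a" by auto
    then show ?thesis using a \<upsilon>(1) y_le by (metis order_trans)
  next
    case 2
    then have "\<upsilon> = ?t" by auto
    moreover from this have "\<upsilon> \<in> face_poset K" using t \<upsilon>(1) by metis
    moreover have "?t \<subseteq> \<sigma> \<union> ?\<tau>" using \<upsilon>(2) by auto
    ultimately show ?thesis unfolding gt_def using f by (intro g_mono) auto
  next
    case 3
    have "g ?t \<le> g ?\<tau>" using t[OF 3(2)] f \<upsilon>(2) by (intro g_mono) auto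
    moreover have "?a \<union> ?t \<in> K" using complex_face[OF K rK \<upsilon>(2)] \<upsilon>_eq by simp
    moreover have "\<sigma> \<union> ?\<tau> \<in> K" using f by (simp add: face_poset_def)
    ultimately have "g (?a \<union> ?t) \<le> g (\<sigma> \<union> ?\<tau>)"
      using union_mono[of ?a \<sigma> ?t ?\<tau>] a[OF 3(1)] t[OF 3(2)] \<sigma> f g\<sigma> by simp
    then show ?thesis using \<upsilon>_eq by (simp add: gt_def)
  qed
qed

lemma join_carrier_complex: "simplicial_complex (join_carrier \<rho>)"
  unfolding simplicial_complex_def
proof (intro conjI ballI allI impI)
  show "{} \<in> join_carrier \<rho>" using complex_empty[OF simplicial_complex_level] by (simp add: join_carrier_def)
  fix \<pi> assume p: "\<pi> \<in> join_carrier \<rho>"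
  then show "finite \<pi>" using complex_finite[OF simplicial_complex_level] by (auto simp: join_carrier_def)
  fix \<pi>' assume sub: "\<pi>' \<subseteq> \<pi>"
  have "Inl -` \<pi>' \<subseteq> Inl -` \<pi>" "Inr -` \<pi>' \<subseteq> Inr -` \<pi>" using sub by auto
  moreover have "\<pi>' \<in> cyl_level (Suc (ht y))"
    using p complex_face[OF simplicial_complex_level _ sub] by (simp add: join_carrier_def)
  ultimately show "\<pi>' \<in> join_carrier \<rho>"
    using p unfolding join_carrier_def by (simp add: subset_trans)
qed

text \<open>If \<open>\<rho>\<close> has vertices in the link, the apex is the image of its part
  there, which dominates everything in the carrier. Otherwise the carrier is the subdivision of
  \<open>\<rho>\<close>, a cone from the barycentre.\<close>

lemma join_carrier_cone:
  assumes \<rho>: "\<rho> \<in> complex_join Ky Lk" and ne: "\<rho> \<noteq> {}"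
  shows "\<exists>v. \<forall>\<pi>\<in>join_carrier \<rho>. insert v \<pi> \<in> join_carrier \<rho>"
proof (cases "\<rho> - \<Union>Ky = {}")
  case True
  have rK: "\<rho> \<in> face_poset K" using join_subset \<rho> ne by (auto simp: face_poset_def)
  have "insert (Inl \<rho>) \<pi> \<in> join_carrier \<rho>" if p: "\<pi> \<in> join_carrier \<rho>" for \<pi>
  proof -
    have e: "Inl -` insert (Inl \<rho>) \<pi> = insert \<rho> (Inl -` \<pi>)" "Inr -` insert (Inl \<rho>) \<pi> = Inr -` \<pi>" by auto
    have "Inr -` \<pi> = {}" using p True by (auto simp: join_carrier_def)
    moreover have "insert \<rho> (Inl -` \<pi>) \<in> order_complex (face_poset K)"
      using p rK by (auto simp: join_carrier_def cyl_level_def cylinder_iff order_complex_def)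
    ultimately show ?thesis
      using p ne e by (auto simp: join_carrier_def cyl_level_def cylinder_iff)
  qed
  then show ?thesis by blast
next
  case False
  let ?\<tau> = "\<rho> - \<Union>Ky" and ?m = "gt (\<rho> - \<Union>Ky)"
  have \<tau>L: "?\<tau> \<in> face_poset Lk" using join_split(2)[OF \<rho>] False by (simp add: face_poset_def)
  have m: "?m \<in> Y" "y < ?m" using funcset_mem[OF gt_above \<tau>L] by (auto simp: strictly_above_def)
  then have m_ht: "Suc (ht y) \<le> ht ?m" using ht_less[OF y] by (simp add: Suc_le_eq)
  have le: "gt \<upsilon> \<le> ?m" if "\<upsilon> \<noteq> {}" "\<upsilon> \<subseteq> ?\<tau>" for \<upsilon>
  proof -
    have "\<upsilon> \<in> face_poset Lk"
      using complex_face[OF simplicial_complex_lk join_split(2)[OF \<rho>] that(2)] that(1) by (simp add: face_poset_def)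
    then show ?thesis using mono_onD[OF gt_mono _ \<tau>L that(2)] by blast
  qed
  have "insert (Inr ?m) \<pi> \<in> join_carrier \<rho>" if p: "\<pi> \<in> join_carrier \<rho>" for \<pi>
  proof -
    have e: "Inr -` insert (Inr ?m) \<pi> = insert ?m (Inr -` \<pi>)" "Inl -` insert (Inr ?m) \<pi> = Inl -` \<pi>" by auto
    have i: "g \<upsilon> \<le> ?m" if "Inl \<upsilon> \<in> \<pi>" for \<upsilon>
      using gt_bound[OF \<rho> _ _ False, of \<upsilon>] p that by (auto simp: join_carrier_def)
    have j: "z \<le> ?m" if "Inr z \<in> \<pi>" for z
    proof -
      have "z \<in> gt ` {\<upsilon>. \<upsilon> \<noteq> {} \<and> \<upsilon> \<subseteq> ?\<tau>}" using p that by (auto simp: join_carrier_def)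
      then show ?thesis using le by auto
    qed
    have "insert ?m (Inr -` \<pi>) \<in> order_complex {z \<in> Y. Suc (ht y) \<le> ht z}"
      using p j m m_ht by (auto simp: join_carrier_def cyl_level_def cylinder_iff order_complex_def)
    then have "insert (Inr ?m) \<pi> \<in> cyl_level (Suc (ht y))"
      using p i e by (auto simp: join_carrier_def cyl_level_def cylinder_iff)
    moreover have "Inr -` insert (Inr ?m) \<pi> \<subseteq> gt ` {\<upsilon>. \<upsilon> \<noteq> {} \<and> \<upsilon> \<subseteq> ?\<tau>}"
      unfolding e(1) using p False by (auto simp: join_carrier_def)
    ultimately show ?thesis using p e(2) by (simp add: join_carrier_def)
  qed
  then show ?thesis by blast
qed

end

section \<open>Joins of cycles inside the complex\<close>

context face_map_point
begin

text \<open>The chain maps that send \<open>\<alpha>\<close> to \<open>\<alpha>'\<close> at the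
  source end of the cylinder and \<open>\<beta>\<close> to the image of \<open>\<beta>'\<close> at
  the target end.\<close>

abbreviation "left_map \<equiv> \<lambda>c. simplicial_chain_map (Inl :: 'v set \<Rightarrow> 'v set + 'b) (subdivision c)"
abbreviation "right_map \<equiv> \<lambda>c. simplicial_chain_map (Inr :: 'b \<Rightarrow> 'v set + 'b) (simplicial_chain_map gt (subdivision c))"

lemma left_chain:
  assumes L: "simplicial_complex L" and c: "c \<in> chain_space k L"
  shows "left_map c \<in> chain_space k ((`) Inl ` order_complex (face_poset L))"
  by (rule simplicial_chain_map_chain_space[OF subdivision_chain_space[OF L c] simplicial_complex_order_complex]) simp

lemma gt_image:
  assumes \<tau>: "\<tau> \<in> Lk" and s: "s \<in> order_complex (face_poset (Pow \<tau>))"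
  shows "gt ` s \<in> order_complex (gt ` face_poset (Pow \<tau>))"
proof (rule order_complex_image[OF _ _ s])
  have "face_poset (Pow \<tau>) \<subseteq> face_poset Lk"
    using complex_face[OF simplicial_complex_lk \<tau>] by (auto simp: face_poset_def)
  then show "mono_on (face_poset (Pow \<tau>)) gt" using gt_mono by (rule mono_on_subset[rotated])
qed simp

lemma right_chain:
  assumes \<tau>: "\<tau> \<in> Lk"
  shows "right_map (frag_of \<tau>) \<in> chain_space (card \<tau>) ((`) Inr ` order_complex (gt ` face_poset (Pow \<tau>)))"
proof -
  have fin: "finite \<tau>" using complex_finite[OF simplicial_complex_lk \<tau>] .
  have "frag_of \<tau> \<in> chain_space (card \<tau>) (Pow \<tau>)" by (simp add: chain_space_def)
  then have "subdivision (frag_of \<tau>) \<in> chain_space (card \<tau>) (order_complex (face_poset (Pow \<tau>)))"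
    by (rule subdivision_chain_space[OF simplicial_complex_Pow[OF fin]])
  then have "simplicial_chain_map gt (subdivision (frag_of \<tau>)) \<in>
      chain_space (card \<tau>) (order_complex (gt ` face_poset (Pow \<tau>)))"
    by (rule simplicial_chain_map_chain_space[OF _ simplicial_complex_order_complex gt_image[OF \<tau>]])
  then show ?thesis
    by (rule simplicial_chain_map_chain_space[OF _ simplicial_complex_order_complex]) simp
qed

lemma boundary_left: "finitary c \<Longrightarrow> boundary (left_map c) = left_map (boundary c)"
  by (simp add: boundary_simplicial_chain_map boundary_subdivision)

lemma boundary_right: "finitary c \<Longrightarrow> boundary (right_map c) = right_map (boundary c)"
  by (simp add: boundary_simplicial_chain_map boundary_subdivision)

lemma map_diff: "left_map (a - b) = left_map a - left_map b" "right_map (a - b) = right_map a - right_map b"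
  by (simp_all add: subdivision_diff simplicial_chain_map_diff)

text \<open>Subdivision and the join of the two maps to the ends of the cylinder are carried by
  the same cones. The homology takes place above the height of \<open>y\<close>, so the
  subdivision of \<open>a * b\<close> is one of the possible results of pushing the link cycle
  into the source.\<close>

lemma subdivided_join_homologous:
  assumes a: "a \<in> cycle_space (Suc (ht y)) Ky" and b: "b \<in> cycle_space codim Lk"
  shows "homologous N (cyl_level (Suc (ht y))) (chain_join (left_map a) (right_map b)) (left_map (chain_join a b))"
proof (rule homologous_sym)
  let ?J = "complex_join Ky Lk" and ?V = "\<Union>Ky"
  let ?\<psi> = "join_map ?V left_map right_map"
  have ab: "chain_join a b \<in> cycle_space N ?J"
    using J.chain_join_cycle[OF a b] ht_split[OF y] by simp
  have ka: "Poly_Mapping.keys a \<subseteq> Ky" "Poly_Mapping.keys b \<subseteq> Lk"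
    using chain_spaceD[OF cycle_space_chain[OF a]] chain_spaceD[OF cycle_space_chain[OF b]] by auto
  have \<psi>: "?\<psi> (chain_join a b) = chain_join (left_map a) (right_map b)"
    by (rule J.join_map_join[OF ka map_diff])
  have fin: "finite \<rho>" if "\<rho> \<in> ?J" for \<rho> using complex_finite[OF J.simplicial_complex_join that] .
  have "\<exists>d\<in>chain_space (Suc N) (cyl_level (Suc (ht y))). boundary d = left_map (chain_join a b) - ?\<psi> (chain_join a b)"
  proof (rule conical_carrier_homologous[OF J.simplicial_complex_join _ _ _ _ _ _ _ _ _ _ _ ab, where \<Phi> = join_carrier])
    fix \<rho> assume \<rho>: "\<rho> \<in> ?J"
    note sp = join_split[OF \<rho>]
    have rK: "\<rho> \<in> K" using join_subset \<rho> by blast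
    have fr: "frag_of \<rho> \<in> chain_space (card \<rho>) ?J" using \<rho> by (simp add: chain_space_def)
    show "boundary (left_map (frag_of \<rho>)) = left_map (boundary (frag_of \<rho>))"
      by (rule boundary_left) (simp add: fin[OF \<rho>])
    show "boundary (?\<psi> (frag_of \<rho>)) = ?\<psi> (boundary (frag_of \<rho>))"
    proof (rule J.join_map_chain_map[OF map_diff _ _ _ _ _ _ fr])
      show "left_map (frag_of \<alpha>) \<in> chain_space (card \<alpha>) ((`) Inl ` order_complex (face_poset Ky))" if "\<alpha> \<in> Ky" for \<alpha>
        by (rule left_chain[OF simplicial_complex_below]) (use that in \<open>simp add: chain_space_def\<close>)
      show "boundary (left_map (frag_of \<alpha>)) = left_map (boundary (frag_of \<alpha>))" if "\<alpha> \<in> Ky" for \<alpha>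
        by (rule boundary_left) (use complex_finite[OF simplicial_complex_below that] in simp)
      show "right_map (frag_of \<tau>) \<in> chain_space (card \<tau>) ((`) Inr ` order_complex (strictly_above Y y))" if \<tau>: "\<tau> \<in> Lk" for \<tau>
      proof -
        have "gt ` face_poset (Pow \<tau>) \<subseteq> strictly_above Y y"
          using gt_above complex_face[OF simplicial_complex_lk \<tau>] by (auto simp: face_poset_def)
        then have "(`) Inr ` order_complex (gt ` face_poset (Pow \<tau>)) \<subseteq> ((`) Inr ` order_complex (strictly_above Y y) :: ('v set + 'b) set set)"
          by (intro image_mono order_complex_mono)
        then show ?thesis using right_chain[OF \<tau>] by (rule chain_space_mono)
      qed
      show "boundary (right_map (frag_of \<tau>)) = right_map (boundary (frag_of \<tau>))" if "\<tau> \<in> Lk" for \<tau>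
        by (rule boundary_right) (use complex_finite[OF simplicial_complex_lk that] in simp)
    qed (rule simplicial_complex_image[OF simplicial_complex_order_complex])+
    show "join_carrier \<rho> \<subseteq> cyl_level (Suc (ht y))" by (auto simp: join_carrier_def)
    show "simplicial_complex (join_carrier \<rho>)" by (rule join_carrier_complex)
    show "\<exists>v. \<forall>\<pi>\<in>join_carrier \<rho>. insert v \<pi> \<in> join_carrier \<rho>" if "\<rho> \<noteq> {}" by (rule join_carrier_cone[OF \<rho> that])
    show "join_carrier \<tau> \<subseteq> join_carrier \<rho>" if "\<tau> \<subseteq> \<rho>" for \<tau>
    proof -
      have "{\<upsilon>. \<upsilon> \<noteq> {} \<and> \<upsilon> \<subseteq> \<tau>} \<subseteq> {\<upsilon>. \<upsilon> \<noteq> {} \<and> \<upsilon> \<subseteq> \<rho>}"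
        using that by blast
      moreover have "gt ` {\<upsilon>. \<upsilon> \<noteq> {} \<and> \<upsilon> \<subseteq> \<tau> - ?V} \<subseteq> gt ` {\<upsilon>. \<upsilon> \<noteq> {} \<and> \<upsilon> \<subseteq> \<rho> - ?V}"
        using that by (intro image_mono) blast
      ultimately show ?thesis
        unfolding join_carrier_def by (intro Collect_mono) (meson order_trans)
    qed
    have faces: "face_poset (Pow \<alpha>) \<subseteq> face_poset K" if "\<alpha> \<subseteq> \<rho>" for \<alpha>
      using complex_face[OF K rK] that by (auto simp: face_poset_def)
    show "left_map (frag_of \<rho>) \<in> chain_space (card \<rho>) (join_carrier \<rho>)"
    proof -
      have "frag_of \<rho> \<in> chain_space (card \<rho>) (Pow \<rho>)" by (simp add: chain_space_def)
      then have lc: "left_map (frag_of \<rho>) \<in> chain_space (card \<rho>) ((`) Inl ` order_complex (face_poset (Pow \<rho>)))"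
        by (rule left_chain[OF simplicial_complex_Pow[OF fin[OF \<rho>]]])
      have "(`) Inl ` order_complex (face_poset (Pow \<rho>)) \<subseteq> join_carrier \<rho>"
      proof
        fix \<pi> :: "('v set + 'b) set" assume "\<pi> \<in> (`) Inl ` order_complex (face_poset (Pow \<rho>))"
        then obtain s where s: "s \<in> order_complex (face_poset (Pow \<rho>))" "\<pi> = Inl ` s" by blast
        have "s \<in> order_complex (face_poset K)" using s(1) order_complex_mono[OF faces] by blast
        then have "\<pi> \<in> cyl_level (Suc (ht y))" unfolding cyl_level_def s(2) by (rule Inl_in_cylinder)
        moreover have "Inl -` \<pi> = s" "Inr -` \<pi> = {}" using s(2) by auto
        moreover have "s \<subseteq> {\<upsilon>. \<upsilon> \<noteq> {} \<and> \<upsilon> \<subseteq> \<rho>}" using s(1) by (auto simp: order_complex_def face_poset_def)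
        ultimately show "\<pi> \<in> join_carrier \<rho>" by (simp add: join_carrier_def)
      qed
      then show ?thesis using lc by (rule chain_space_mono)
    qed
    show "?\<psi> (frag_of \<rho>) \<in> chain_space (card \<rho>) (join_carrier \<rho>)"
    proof -
      let ?a = "\<rho> \<inter> ?V" and ?t = "\<rho> - ?V"
      have fa: "finite ?a" using fin[OF \<rho>] by simp
      have "frag_of ?a \<in> chain_space (card ?a) (Pow ?a)" by (simp add: chain_space_def)
      then have l: "left_map (frag_of ?a) \<in> chain_space (card ?a) ((`) Inl ` order_complex (face_poset (Pow ?a)))"
        by (rule left_chain[OF simplicial_complex_Pow[OF fa]])
      have "chain_join (left_map (frag_of ?a)) (right_map (frag_of ?t)) \<in> chain_space (card ?a + card ?t) (join_carrier \<rho>)"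
      proof (rule chain_join_chain_space[OF l right_chain[OF sp(2)]])
        fix \<pi> \<pi>' :: "('v set + 'b) set" assume "\<pi> \<in> (`) Inl ` order_complex (face_poset (Pow ?a))"
          "\<pi>' \<in> (`) Inr ` order_complex (gt ` face_poset (Pow ?t))"
        then obtain s u where s: "s \<in> order_complex (face_poset (Pow ?a))" "\<pi> = Inl ` s"
          and u: "u \<in> order_complex (gt ` face_poset (Pow ?t))" "\<pi>' = Inr ` u" by blast
        have sK: "s \<in> order_complex (face_poset K)" using s(1) order_complex_mono[OF faces[of ?a]] by blast
        have uY: "z \<in> Y \<and> y < z" if zu: "z \<in> u" for z
        proof -
          have "z \<in> gt ` face_poset (Pow ?t)" using u(1) zu by (auto simp: order_complex_def)
          then obtain \<upsilon> where "z = gt \<upsilon>" "\<upsilon> \<in> face_poset (Pow ?t)" by blast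
          moreover from this have "\<upsilon> \<in> face_poset Lk"
            using complex_face[OF simplicial_complex_lk sp(2), of \<upsilon>] by (simp add: face_poset_def)
          ultimately show ?thesis using funcset_mem[OF gt_above] by (auto simp: strictly_above_def)
        qed
        have "u \<in> order_complex {z \<in> Y. Suc (ht y) \<le> ht z}"
          using u(1) uY ht_less[OF y] by (auto simp: order_complex_def Suc_le_eq)
        moreover have "g \<upsilon> \<le> z" if "\<upsilon> \<in> s" "z \<in> u" for \<upsilon> z
        proof -
          have "\<upsilon> \<noteq> {}" "\<upsilon> \<subseteq> ?a" using s(1) that(1) by (auto simp: order_complex_def face_poset_def)
          then have "\<upsilon> \<in> Ky" "\<upsilon> \<noteq> {}" using complex_face[OF simplicial_complex_below sp(1)] by auto
          then have "g \<upsilon> \<le> y" by (auto simp: subcomplex_below_def fiber_def)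
          then show ?thesis using uY[OF that(2)] by (meson less_imp_le order_trans)
        qed
        ultimately have "\<pi> \<union> \<pi>' \<in> cyl_level (Suc (ht y))"
          unfolding s(2) u(2) cyl_level_def by (intro cylinderI sK)
        moreover have "Inl -` (\<pi> \<union> \<pi>') = s" "Inr -` (\<pi> \<union> \<pi>') = u" using s(2) u(2) by auto
        moreover have "s \<subseteq> {\<upsilon>. \<upsilon> \<noteq> {} \<and> \<upsilon> \<subseteq> \<rho>}" using s(1) by (auto simp: order_complex_def face_poset_def)
        moreover have "u \<subseteq> gt ` {\<upsilon>. \<upsilon> \<noteq> {} \<and> \<upsilon> \<subseteq> ?t}" using u(1) by (auto simp: order_complex_def face_poset_def)
        ultimately show "\<pi> \<union> \<pi>' \<in> join_carrier \<rho>" by (simp add: join_carrier_def)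
      qed (rule simplicial_complex_image[OF simplicial_complex_order_complex])+
      then show ?thesis using sp(3) by (simp add: join_map_def chain_space_cmul)
    qed
  next
    have "?\<psi> (chain_join (frag_of {}) (frag_of {})) = chain_join (left_map (frag_of {})) (right_map (frag_of {}))"
      by (rule J.join_map_simplex) (simp_all add: complex_empty[OF simplicial_complex_below] complex_empty[OF simplicial_complex_lk])
    then show "left_map (frag_of {}) = ?\<psi> (frag_of {})" by simp
  qed (simp_all add: map_diff join_map_diff)
  then show "homologous N (cyl_level (Suc (ht y))) (left_map (chain_join a b)) (chain_join (left_map a) (right_map b))"
    unfolding homologous_def \<psi> .
qed

end

context face_map_setup
begin

lemma face_map_pointI: "y \<in> Y \<Longrightarrow> \<sigma> \<in> face_poset K \<Longrightarrow> g \<sigma> = y \<Longrightarrow> face_map_point K Y g N y \<sigma>"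
  by unfold_locales

text \<open>Subdivision identifies the top cycles of \<open>K\<close> with those of its face
  poset. There the subdivided joins are pushed link cycles, and the link cycles form bases by the
  description of the top homology of a join.\<close>

theorem join_basis_of_choices:
  assumes z: "\<And>i. i \<in> I \<Longrightarrow> z i \<in> cycle_space N K"
    and z_basis: "int_basis (cycle_space N (order_complex Y)) I (\<lambda>i. simplicial_chain_map g (subdivision (z i)))"
    and x: "\<And>y. y \<in> Y \<Longrightarrow> x y \<in> face_poset K \<and> g (x y) = y"
    and a: "\<And>y. y \<in> Y \<Longrightarrow> int_basis (cycle_space (Suc (ht y)) (subcomplex_below K g y)) (I' y) (a y)"
    and b: "\<And>y j. y \<in> Y \<Longrightarrow> j \<in> J' y \<Longrightarrow> b y j \<in> cycle_space (N - Suc (ht y)) (link (x y) K)"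
    and b_basis: "\<And>y. y \<in> Y \<Longrightarrow> int_basis (cycle_space (N - Suc (ht y)) (order_complex (strictly_above Y y))) (J' y)
       (\<lambda>j. simplicial_chain_map (\<lambda>\<tau>. g (x y \<union> \<tau>)) (subdivision (b y j)))"
  shows "int_basis (cycle_space N K) (I <+> (SIGMA y:Y. I' y \<times> J' y))
     (case_sum z (\<lambda>(y, i, j). chain_join (a y i) (b y j)))"
proof -
  let ?B = "case_sum z (\<lambda>(y, i, j). chain_join (a y i) (b y j))"
  have pt: "face_map_point K Y g N y (x y)" if "y \<in> Y" for y
    using face_map_pointI[OF that] x[OF that] by blast
  have gt: "face_map_point.gt g (x y) = (\<lambda>\<tau>. g (x y \<union> \<tau>))" if "y \<in> Y" for y
    using face_map_point.gt_def[OF pt[OF that]] by (intro ext)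
  have join_in: "chain_join (a y i) (b y j) \<in> cycle_space N K" if "y \<in> Y" "i \<in> I' y" "j \<in> J' y" for y i j
  proof -
    interpret P: face_map_point K Y g N y "x y" by (rule pt[OF that(1)])
    show ?thesis
      using P.J.chain_join_cycle[OF int_basis_in[OF a[OF that(1)] that(2)] b[OF that(1,3)]] ht_split[OF that(1)]
        cycle_space_mono[OF P.join_subset] by simp
  qed
  \<comment> \<open>the basis of the top cycles of the link of \<open>y\<close> that the joins
    of cycles come from\<close>
  define \<zeta> where "\<zeta> y = (\<lambda>(i, j). chain_join (simplicial_chain_map (Inl :: 'v set \<Rightarrow> 'v set + 'b) (subdivision (a y i)))
     (simplicial_chain_map Inr (simplicial_chain_map (\<lambda>\<tau>. g (x y \<union> \<tau>)) (subdivision (b y j)))))" for y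
  have sdz: "subdivision c \<in> cycle_space N (order_complex (face_poset K))" if "c \<in> cycle_space N K" for c
    by (rule subdivision_cycle_space[OF K that])
  have "int_basis (cycle_space N (order_complex (face_poset K))) (I <+> (SIGMA y:Y. I' y \<times> J' y))
     (case_sum (\<lambda>i. subdivision (z i)) (\<lambda>(y, e). (case e of (i, j) \<Rightarrow> subdivision (chain_join (a y i) (b y j)))))"
  proof (rule cylinder_basis[where \<zeta> = \<zeta>, OF sdz[OF z] z_basis])
    fix y assume y: "y \<in> Y"
    interpret P: face_map_point K Y g N y "x y" by (rule pt[OF y])
    have "int_basis (cycle_space (Suc (ht y)) (order_complex (fiber (face_poset K) g y))) (I' y) (\<lambda>i. subdivision (a y i))"
    proof (rule int_basis_image[OF a[OF y] subdivision_diff])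
      show "bij_betw subdivision (cycle_space (Suc (ht y)) (subcomplex_below K g y))
          (cycle_space (Suc (ht y)) (order_complex (fiber (face_poset K) g y)))"
        using subdivision_bij[OF simplicial_complex_below below_dim[OF y]] by (simp only: face_poset_below)
      show "frag_extend (a y) c \<in> cycle_space (Suc (ht y)) (subcomplex_below K g y)" if "Poly_Mapping.keys c \<subseteq> I' y" for c
        using that int_basis_in[OF a[OF y]] by (intro cycle_space_frag_extend) auto
    qed simp
    then show "int_basis (cycle_space N (cyl_link y)) (I' y \<times> J' y) (\<zeta> y)"
      unfolding \<zeta>_def by (rule link_basis[OF y _ b_basis[OF y]])
    fix e assume "e \<in> I' y \<times> J' y"
    then obtain i j where e: "e = (i, j)" "i \<in> I' y" "j \<in> J' y" by blast
    show "(case e of (i, j) \<Rightarrow> subdivision (chain_join (a y i) (b y j))) \<in> cycle_space N (order_complex (face_poset K))"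
      using sdz[OF join_in[OF y e(2,3)]] e(1) by simp
    show "homologous N (cyl_level (Suc (ht y))) (\<zeta> y e)
        (simplicial_chain_map Inl (case e of (i, j) \<Rightarrow> subdivision (chain_join (a y i) (b y j))))"
      using P.subdivided_join_homologous[OF int_basis_in[OF a[OF y] e(2)] b[OF y e(3)]]
      unfolding gt[OF y] \<zeta>_def e(1) by simp
  qed
  then have basis: "int_basis (cycle_space N (order_complex (face_poset K))) (I <+> (SIGMA y:Y. I' y \<times> J' y)) (\<lambda>s. subdivision (?B s))"
    by (rule int_basis_cong) (auto split: sum.splits)
  have B: "?B s \<in> cycle_space N K" if "s \<in> I <+> (SIGMA y:Y. I' y \<times> J' y)" for s
    using that z join_in by auto
  have ext: "frag_extend ?B c \<in> cycle_space N K" if "Poly_Mapping.keys c \<subseteq> I <+> (SIGMA y:Y. I' y \<times> J' y)" for c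
    using that by (intro cycle_space_frag_extend B) auto
  have inj: "inj_on subdivision (cycle_space N K)"
    using subdivision_bij[OF K K_dim] by (simp add: bij_betw_def)
  show ?thesis by (rule int_basis_reflect[OF basis subdivision_diff inj B sdz ext])
qed

end

section \<open>Bases of homology classes\<close>

context face_map_setup
begin

lemma carrier_top_complex: "dim_below k L \<Longrightarrow> z \<in> cycle_space k L \<Longrightarrow> {z} \<in> carrier (homology (int k - 1) L)"
  by (simp add: top_carrier)

lemma lifts_exist:
  "\<exists>B \<gamma>0. free_basis (poset_homology (int N - 1) Y) B (\<lambda>b. b) \<and>
     (\<forall>b\<in>B. \<gamma>0 b \<in> carrier (homology (int N - 1) K) \<and>
        poset_induced (int N - 1) Y g (homology_subdivision (int N - 1) K (\<gamma>0 b)) = b)"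
proof -
  note KY = simplicial_complex_order_complex[of Y]
  obtain B where B: "free_basis (poset_homology (int N - 1) Y) B (\<lambda>b. b)"
    using top_homology_free[OF KY target_dim] by (auto simp: poset_homology_def)
  have "\<exists>c. c \<in> carrier (homology (int N - 1) K) \<and>
      poset_induced (int N - 1) Y g (homology_subdivision (int N - 1) K c) = b" if b: "b \<in> B" for b
  proof -
    have "b \<in> carrier (poset_homology (int N - 1) Y)" using B b by (auto simp: free_basis_def)
    then obtain z where z: "z \<in> cycle_space N (order_complex Y)" "b = {z}"
      using top_carrier[OF target_dim] by (auto simp: poset_homology_def)
    obtain w where w: "w \<in> cycle_space N (order_complex (face_poset K))" "simplicial_chain_map g w = z"
      using induced_surjective[OF z(1)] by blast
    note v = subdivision_vertex_choice_top[OF K K_dim w(1)]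
    have "poset_induced (int N - 1) Y g (homology_subdivision (int N - 1) K {simplicial_chain_map vertex_choice w}) = b"
      using v(2) w(2) z(2) by (simp add: induced_class[OF target_dim] homology_subdivision_top[OF K K_dim])
    then show ?thesis using carrier_top_complex[OF K_dim v(1)] by blast
  qed
  then obtain \<gamma>0 where "\<forall>b\<in>B. \<gamma>0 b \<in> carrier (homology (int N - 1) K) \<and>
      poset_induced (int N - 1) Y g (homology_subdivision (int N - 1) K (\<gamma>0 b)) = b" by metis
  then show ?thesis using B by blast
qed

lemma below_homology_free:
  assumes "y \<in> Y" shows "\<exists>B. free_basis (homology (height Y y) (subcomplex_below K g y)) B (\<lambda>b. b)"
  unfolding height_ht'[OF assms] by (rule top_homology_free[OF simplicial_complex_below below_dim[OF assms]])

text \<open>All groups involved are top homology groups, so every class can be replaced by its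
  only cycle.\<close>

theorem homology_basis_of_choices:
  assumes \<gamma>: "\<gamma> \<in> I \<rightarrow> carrier (homology (int N - 1) K)"
    and \<gamma>_basis: "free_basis (poset_homology (int N - 1) Y) I
       (\<lambda>i. poset_induced (int N - 1) Y g (homology_subdivision (int N - 1) K (\<gamma> i)))"
    and choice: "\<forall>y\<in>Y. x y \<in> face_poset K \<and> g (x y) = y \<and>
            free_basis (homology (height Y y) (subcomplex_below K g y)) (I' y) (\<alpha> y) \<and>
            \<beta> y \<in> J' y \<rightarrow> carrier (homology (int N - 1 - height Y y - 1) (link (x y) K)) \<and>
            free_basis (poset_homology (int N - 1 - height Y y - 1) (strictly_above Y y)) (J' y)
              (\<lambda>j. poset_induced (int N - 1 - height Y y - 1) (strictly_above Y y) (\<lambda>\<tau>. g (x y \<union> \<tau>))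
                     (homology_subdivision (int N - 1 - height Y y - 1) (link (x y) K) (\<beta> y j)))"
  shows "free_basis (homology (int N - 1) K) (I <+> (SIGMA y:Y. I' y \<times> J' y))
           (case_sum \<gamma> (\<lambda>(y, i, j). homology_join (height Y y) (int N - 1 - height Y y - 1) K (\<alpha> y i) (\<beta> y j)))"
proof -
  note OC = simplicial_complex_order_complex
  define z where "z i = representative (\<gamma> i)" for i
  define a where "a y i = representative (\<alpha> y i)" for y i
  define b where "b y j = representative (\<beta> y j)" for y j
  have \<gamma>z: "z i \<in> cycle_space N K" "\<gamma> i = {z i}" if "i \<in> I" for i
    using representative_cycle[OF K, of "\<gamma> i" N] funcset_mem[OF \<gamma> that] by (simp_all add: z_def top_class[OF K_dim])
  have 1: "int_basis (cycle_space N (order_complex Y)) I (\<lambda>i. simplicial_chain_map g (subdivision (z i)))"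
    using \<gamma>_basis unfolding poset_homology_def free_basis_top_iff[OF OC target_dim]
    by (simp add: induced_class[OF target_dim] homology_subdivision_top[OF K K_dim] z_def)
  have x: "x y \<in> face_poset K \<and> g (x y) = y" if "y \<in> Y" for y using choice that by blast
  have pt: "face_map_point K Y g N y (x y)" if "y \<in> Y" for y
    using face_map_pointI[OF that] x[OF that] by blast
  have 2: "int_basis (cycle_space (Suc (ht y)) (subcomplex_below K g y)) (I' y) (a y)" if y: "y \<in> Y" for y
  proof -
    have "free_basis (homology (int (Suc (ht y)) - 1) (subcomplex_below K g y)) (I' y) (\<alpha> y)"
      using choice y height_ht'[OF y] by metis
    then show ?thesis
      unfolding free_basis_top_iff[OF simplicial_complex_below below_dim[OF y]] a_def by blast
  qed
  have \<beta>_in: "\<beta> y j \<in> carrier (homology (int (N - Suc (ht y)) - 1) (link (x y) K))" if y: "y \<in> Y" and j: "j \<in> J' y" for y j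
  proof -
    have "\<beta> y \<in> J' y \<rightarrow> carrier (homology (int (N - Suc (ht y)) - 1) (link (x y) K))"
      using choice y coheight[OF y] by metis
    then show ?thesis using j by blast
  qed
  have 3: "b y j \<in> cycle_space (N - Suc (ht y)) (link (x y) K)" if y: "y \<in> Y" and j: "j \<in> J' y" for y j
    unfolding b_def
    by (rule representative_cycle(1)[OF face_map_point.simplicial_complex_lk[OF pt[OF y]] \<beta>_in[OF y j]])
  have 4: "int_basis (cycle_space (N - Suc (ht y)) (order_complex (strictly_above Y y))) (J' y)
       (\<lambda>j. simplicial_chain_map (\<lambda>\<tau>. g (x y \<union> \<tau>)) (subdivision (b y j)))" if y: "y \<in> Y" for y
  proof -
    let ?m = "int (N - Suc (ht y)) - 1"
    have "free_basis (poset_homology (int N - 1 - height Y y - 1) (strictly_above Y y)) (J' y)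
              (\<lambda>j. poset_induced (int N - 1 - height Y y - 1) (strictly_above Y y) (\<lambda>\<tau>. g (x y \<union> \<tau>))
                     (homology_subdivision (int N - 1 - height Y y - 1) (link (x y) K) (\<beta> y j)))"
      using choice y by blast
    then show ?thesis
      unfolding coheight[OF y] poset_homology_def free_basis_top_iff[OF OC above_dim[OF y]]
      by (simp add: induced_class[OF above_dim[OF y]] b_def
          homology_subdivision_top[OF face_map_point.simplicial_complex_lk[OF pt[OF y]] face_map_point.lk_dim[OF pt[OF y]]])
  qed
  have basis: "int_basis (cycle_space N K) (I <+> (SIGMA y:Y. I' y \<times> J' y))
     (case_sum z (\<lambda>(y, i, j). chain_join (a y i) (b y j)))"
    by (rule join_basis_of_choices[OF \<gamma>z(1) 1 x 2 3 4])
  have hj: "homology_join (height Y y) (int N - 1 - height Y y - 1) K (\<alpha> y i) (\<beta> y j) = {chain_join (a y i) (b y j)}" for y i j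
    by (simp add: homology_join_def a_def b_def top_class[OF K_dim])
  let ?c = "case_sum \<gamma> (\<lambda>(y, i, j). homology_join (height Y y) (int N - 1 - height Y y - 1) K (\<alpha> y i) (\<beta> y j))"
  have c: "?c s = {case_sum z (\<lambda>(y, i, j). chain_join (a y i) (b y j)) s}" if "s \<in> I <+> (SIGMA y:Y. I' y \<times> J' y)" for s
    using that \<gamma>z(2) by (cases s) (auto simp only: sum.case prod.case hj)
  show ?thesis
    unfolding free_basis_top_iff[OF K K_dim]
  proof
    show "?c \<in> (I <+> (SIGMA y:Y. I' y \<times> J' y)) \<rightarrow> carrier (homology (int N - 1) K)"
    proof
      fix s assume s: "s \<in> I <+> (SIGMA y:Y. I' y \<times> J' y)"
      show "?c s \<in> carrier (homology (int N - 1) K)"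
        unfolding c[OF s] by (rule carrier_top_complex[OF K_dim int_basis_in[OF basis s]])
    qed
    show "int_basis (cycle_space N K) (I <+> (SIGMA y:Y. I' y \<times> J' y)) (\<lambda>i. representative (?c i))"
      by (rule int_basis_cong[OF basis]) (simp only: c representative_singleton)
  qed
qed

end

context face_map_point
begin

lemma upper_lifts_exist:
  assumes epi: "poset_induced (int N - 1 - height Y y - 1) (strictly_above Y y) g
       \<in> epi (poset_homology (int N - 1 - height Y y - 1) (strictly_above (face_poset K) \<sigma>))
             (poset_homology (int N - 1 - height Y y - 1) (strictly_above Y y))"
  shows "\<exists>B \<beta>0. free_basis (poset_homology (int N - 1 - height Y y - 1) (strictly_above Y y)) B (\<lambda>b. b) \<and>
     (\<forall>b\<in>B. \<beta>0 b \<in> carrier (homology (int N - 1 - height Y y - 1) (link \<sigma> K)) \<and>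
        poset_induced (int N - 1 - height Y y - 1) (strictly_above Y y) (\<lambda>\<tau>. g (\<sigma> \<union> \<tau>))
          (homology_subdivision (int N - 1 - height Y y - 1) (link \<sigma> K) (\<beta>0 b)) = b)"
proof -
  note OC = simplicial_complex_order_complex
  note epi' = epi[unfolded coheight[OF y]]
  obtain B where B: "free_basis (poset_homology (int codim - 1) (strictly_above Y y)) B (\<lambda>b. b)"
    using top_homology_free[OF OC above_dim[OF y]] by (auto simp: poset_homology_def)
  have gt: "gt = (\<lambda>\<tau>. g (\<sigma> \<union> \<tau>))" by (rule ext) (rule gt_def)
  have "\<exists>c. c \<in> carrier (homology (int codim - 1) Lk) \<and>
      poset_induced (int codim - 1) (strictly_above Y y) gt (homology_subdivision (int codim - 1) Lk c) = b" if b: "b \<in> B" for b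
  proof -
    have "b \<in> carrier (poset_homology (int codim - 1) (strictly_above Y y))" using B b by (auto simp: free_basis_def)
    then obtain z where z: "z \<in> cycle_space codim Lk" "{simplicial_chain_map gt (subdivision z)} = b"
      using cycle_lift[OF epi'] by blast
    then have "poset_induced (int codim - 1) (strictly_above Y y) gt (homology_subdivision (int codim - 1) Lk {z}) = b"
      by (simp add: induced_class[OF above_dim[OF y]] homology_subdivision_top[OF simplicial_complex_lk lk_dim])
    then show ?thesis using carrier_top_complex[OF lk_dim z(1)] by blast
  qed
  then obtain \<beta>0 where "\<forall>b\<in>B. \<beta>0 b \<in> carrier (homology (int codim - 1) Lk) \<and>
      poset_induced (int codim - 1) (strictly_above Y y) gt (homology_subdivision (int codim - 1) Lk (\<beta>0 b)) = b" by metis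
  then show ?thesis using B unfolding coheight[OF y] gt by blast
qed

lemma point_facts:
  "(\<forall>\<sigma>'\<in>face_poset K. g \<sigma>' = y \<longrightarrow> link \<sigma>' K = link \<sigma> K \<and>
      (\<forall>\<tau>\<in>face_poset (link \<sigma> K). g (\<sigma>' \<union> \<tau>) = g (\<sigma> \<union> \<tau>))) \<and>
   simplicial_complex (subcomplex_below K g y) \<and> simplicial_complex (link \<sigma> K) \<and>
   \<Union>(subcomplex_below K g y) \<inter> \<Union>(link \<sigma> K) = {} \<and>
   complex_join (subcomplex_below K g y) (link \<sigma> K) \<subseteq> K \<and>
   (\<lambda>\<tau>. g (\<sigma> \<union> \<tau>)) \<in> face_poset (link \<sigma> K) \<rightarrow> strictly_above Y y \<and>
   mono_on (face_poset (link \<sigma> K)) (\<lambda>\<tau>. g (\<sigma> \<union> \<tau>))"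
  using independent_of_choice simplicial_complex_below simplicial_complex_lk disjoint_vertices join_subset
    gt_above[unfolded gt_def[abs_def]] gt_mono[unfolded gt_def[abs_def]] by auto

end

section \<open>Homology of spherical maps\<close>

theorem theorem4p7:
  fixes n :: int
    and X :: "'a::order set" and Y :: "'b::order set" and f :: "'a \<Rightarrow> 'b"
    and K :: "'v set set" and g :: "'v set \<Rightarrow> 'b"
    and I :: "'i set" and \<gamma> :: "'i \<Rightarrow> ('v set \<Rightarrow>\<^sub>0 int) set"
    and I' :: "'b \<Rightarrow> 'j set" and \<alpha> :: "'b \<Rightarrow> 'j \<Rightarrow> ('v set \<Rightarrow>\<^sub>0 int) set"
    and J' :: "'b \<Rightarrow> 'k set" and \<beta> :: "'b \<Rightarrow> 'k \<Rightarrow> ('v set \<Rightarrow>\<^sub>0 int) set"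
    and x :: "'b \<Rightarrow> 'v set"
  assumes Y: "poset_spherical n Y"
  shows
    "(spherical_map n X Y f \<longrightarrow>
        poset_spherical n X \<and>
        poset_induced n Y f \<in> epi (poset_homology n X) (poset_homology n Y) \<and>
        poset_homology n X \<cong>
          poset_homology n Y \<times>\<times>
          sum_group Y (\<lambda>y. tensor_product (poset_homology (height Y y) (fiber X f y))
                                          (poset_homology (n - height Y y - 1) (strictly_above Y y))))
     \<and>
     (simplicial_complex K \<and> spherical_map n (face_poset K) Y g \<and>
      (\<forall>\<sigma>1\<in>face_poset K. \<forall>\<sigma>2\<in>face_poset K. g \<sigma>1 \<le> g \<sigma>2 \<longrightarrow> link \<sigma>2 K \<subseteq> link \<sigma>1 K) \<and>
      (\<forall>\<sigma>1\<in>face_poset K. \<forall>\<sigma>2\<in>face_poset K. \<forall>\<tau>1\<in>face_poset K. \<forall>\<tau>2\<in>face_poset K.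
         g \<sigma>1 \<le> g \<sigma>2 \<and> g \<tau>1 \<le> g \<tau>2 \<and> \<sigma>1 \<union> \<tau>1 \<in> K \<and> \<sigma>2 \<union> \<tau>2 \<in> K \<longrightarrow>
         g (\<sigma>1 \<union> \<tau>1) \<le> g (\<sigma>2 \<union> \<tau>2)) \<and>
      (\<forall>y\<in>Y. \<forall>\<sigma>\<in>face_poset K. g \<sigma> = y \<longrightarrow>
         poset_induced (n - height Y y - 1) (strictly_above Y y) g
           \<in> epi (poset_homology (n - height Y y - 1) (strictly_above (face_poset K) \<sigma>))
                 (poset_homology (n - height Y y - 1) (strictly_above Y y))) \<longrightarrow>
        \<comment> \<open>the objects used in the construction exist and are well defined\<close>
        (\<exists>B \<gamma>0. free_basis (poset_homology n Y) B (\<lambda>b. b) \<and>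
           (\<forall>b\<in>B. \<gamma>0 b \<in> carrier (homology n K) \<and>
                  poset_induced n Y g (homology_subdivision n K (\<gamma>0 b)) = b)) \<and>
        (\<forall>y\<in>Y. \<exists>\<sigma>\<in>face_poset K. g \<sigma> = y) \<and>
        (\<forall>y\<in>Y. \<exists>B. free_basis (homology (height Y y) (subcomplex_below K g y)) B (\<lambda>b. b)) \<and>
        (\<forall>y\<in>Y. \<forall>\<sigma>\<in>face_poset K. g \<sigma> = y \<longrightarrow>
           (\<forall>\<sigma>'\<in>face_poset K. g \<sigma>' = y \<longrightarrow>
              link \<sigma>' K = link \<sigma> K \<and>
              (\<forall>\<tau>\<in>face_poset (link \<sigma> K). g (\<sigma>' \<union> \<tau>) = g (\<sigma> \<union> \<tau>))) \<and>
           simplicial_complex (subcomplex_below K g y) \<and>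
           simplicial_complex (link \<sigma> K) \<and>
           \<Union>(subcomplex_below K g y) \<inter> \<Union>(link \<sigma> K) = {} \<and>
           complex_join (subcomplex_below K g y) (link \<sigma> K) \<subseteq> K \<and>
           (\<lambda>\<tau>. g (\<sigma> \<union> \<tau>)) \<in> face_poset (link \<sigma> K) \<rightarrow> strictly_above Y y \<and>
           mono_on (face_poset (link \<sigma> K)) (\<lambda>\<tau>. g (\<sigma> \<union> \<tau>)) \<and>
           (\<exists>B \<beta>0. free_basis (poset_homology (n - height Y y - 1) (strictly_above Y y)) B (\<lambda>b. b) \<and>
              (\<forall>b\<in>B. \<beta>0 b \<in> carrier (homology (n - height Y y - 1) (link \<sigma> K)) \<and>
                 poset_induced (n - height Y y - 1) (strictly_above Y y) (\<lambda>\<tau>. g (\<sigma> \<union> \<tau>))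
                   (homology_subdivision (n - height Y y - 1) (link \<sigma> K) (\<beta>0 b)) = b))) \<and>
        \<comment> \<open>every such choice yields a basis\<close>
        (\<gamma> \<in> I \<rightarrow> carrier (homology n K) \<and>
         free_basis (poset_homology n Y) I
           (\<lambda>i. poset_induced n Y g (homology_subdivision n K (\<gamma> i))) \<and>
         (\<forall>y\<in>Y. x y \<in> face_poset K \<and> g (x y) = y \<and>
            free_basis (homology (height Y y) (subcomplex_below K g y)) (I' y) (\<alpha> y) \<and>
            \<beta> y \<in> J' y \<rightarrow> carrier (homology (n - height Y y - 1) (link (x y) K)) \<and>
            free_basis (poset_homology (n - height Y y - 1) (strictly_above Y y)) (J' y)
              (\<lambda>j. poset_induced (n - height Y y - 1) (strictly_above Y y) (\<lambda>\<tau>. g (x y \<union> \<tau>))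
                     (homology_subdivision (n - height Y y - 1) (link (x y) K) (\<beta> y j)))) \<longrightarrow>
         free_basis (homology n K)
           (I <+> (SIGMA y:Y. I' y \<times> J' y))
           (case_sum \<gamma> (\<lambda>(y, i, j).
              homology_join (height Y y) (n - height Y y - 1) K (\<alpha> y i) (\<beta> y j)))))"
proof -
  obtain N where n: "n = int N - 1" using poset_spherical_degree[OF Y] by blast
  note Y' = Y[unfolded n]
  show ?thesis
    unfolding n
  proof (intro conjI impI)
    assume "spherical_map (int N - 1) X Y f"
    then interpret S: spherical_map_setup X Y f N using Y' by unfold_locales
    show "poset_spherical (int N - 1) X" by (rule S.source_spherical)
    show "poset_induced (int N - 1) Y f \<in> epi (poset_homology (int N - 1) X) (poset_homology (int N - 1) Y)"
      by (rule S.induced_epi)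
    show "poset_homology (int N - 1) X \<cong> poset_homology (int N - 1) Y \<times>\<times>
       sum_group Y (\<lambda>y. tensor_product (poset_homology (height Y y) (fiber X f y))
          (poset_homology (int N - 1 - height Y y - 1) (strictly_above Y y)))"
      by (rule S.source_homology_iso)
  next
    assume A: "simplicial_complex K \<and> spherical_map (int N - 1) (face_poset K) Y g \<and>
      (\<forall>\<sigma>1\<in>face_poset K. \<forall>\<sigma>2\<in>face_poset K. g \<sigma>1 \<le> g \<sigma>2 \<longrightarrow> link \<sigma>2 K \<subseteq> link \<sigma>1 K) \<and>
      (\<forall>\<sigma>1\<in>face_poset K. \<forall>\<sigma>2\<in>face_poset K. \<forall>\<tau>1\<in>face_poset K. \<forall>\<tau>2\<in>face_poset K.
         g \<sigma>1 \<le> g \<sigma>2 \<and> g \<tau>1 \<le> g \<tau>2 \<and> \<sigma>1 \<union> \<tau>1 \<in> K \<and> \<sigma>2 \<union> \<tau>2 \<in> K \<longrightarrow>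
         g (\<sigma>1 \<union> \<tau>1) \<le> g (\<sigma>2 \<union> \<tau>2)) \<and>
      (\<forall>y\<in>Y. \<forall>\<sigma>\<in>face_poset K. g \<sigma> = y \<longrightarrow>
         poset_induced (int N - 1 - height Y y - 1) (strictly_above Y y) g
           \<in> epi (poset_homology (int N - 1 - height Y y - 1) (strictly_above (face_poset K) \<sigma>))
                 (poset_homology (int N - 1 - height Y y - 1) (strictly_above Y y)))"
    interpret F: face_map_setup K Y g N
    proof unfold_locales
      show "poset_spherical (int N - 1) Y" by (rule Y')
      show "spherical_map (int N - 1) (face_poset K) Y g" "simplicial_complex K" using A by blast+
      show "link \<sigma>2 K \<subseteq> link \<sigma>1 K" if "\<sigma>1 \<in> face_poset K" "\<sigma>2 \<in> face_poset K" "g \<sigma>1 \<le> g \<sigma>2" for \<sigma>1 \<sigma>2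
        using A that by blast
      show "g (\<sigma>1 \<union> \<tau>1) \<le> g (\<sigma>2 \<union> \<tau>2)"
        if "\<sigma>1 \<in> face_poset K" "\<sigma>2 \<in> face_poset K" "\<tau>1 \<in> face_poset K" "\<tau>2 \<in> face_poset K"
          "g \<sigma>1 \<le> g \<sigma>2" "g \<tau>1 \<le> g \<tau>2" "\<sigma>1 \<union> \<tau>1 \<in> K" "\<sigma>2 \<union> \<tau>2 \<in> K" for \<sigma>1 \<sigma>2 \<tau>1 \<tau>2
        using A that by blast
    qed
    have pt: "face_map_point K Y g N y \<sigma>" if "y \<in> Y" "\<sigma> \<in> face_poset K" "g \<sigma> = y" for y \<sigma>
      by (rule F.face_map_pointI[OF that])
    show "\<exists>B \<gamma>0. free_basis (poset_homology (int N - 1) Y) B (\<lambda>b. b) \<and>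
       (\<forall>b\<in>B. \<gamma>0 b \<in> carrier (homology (int N - 1) K) \<and>
          poset_induced (int N - 1) Y g (homology_subdivision (int N - 1) K (\<gamma>0 b)) = b)"
      by (rule F.lifts_exist)
    show "\<forall>y\<in>Y. \<exists>\<sigma>\<in>face_poset K. g \<sigma> = y" using F.surjective by blast
    show "\<forall>y\<in>Y. \<exists>B. free_basis (homology (height Y y) (subcomplex_below K g y)) B (\<lambda>b. b)"
      using F.below_homology_free by blast
    show "\<forall>y\<in>Y. \<forall>\<sigma>\<in>face_poset K. g \<sigma> = y \<longrightarrow>
           (\<forall>\<sigma>'\<in>face_poset K. g \<sigma>' = y \<longrightarrow>
              link \<sigma>' K = link \<sigma> K \<and>
              (\<forall>\<tau>\<in>face_poset (link \<sigma> K). g (\<sigma>' \<union> \<tau>) = g (\<sigma> \<union> \<tau>))) \<and>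
           simplicial_complex (subcomplex_below K g y) \<and>
           simplicial_complex (link \<sigma> K) \<and>
           \<Union>(subcomplex_below K g y) \<inter> \<Union>(link \<sigma> K) = {} \<and>
           complex_join (subcomplex_below K g y) (link \<sigma> K) \<subseteq> K \<and>
           (\<lambda>\<tau>. g (\<sigma> \<union> \<tau>)) \<in> face_poset (link \<sigma> K) \<rightarrow> strictly_above Y y \<and>
           mono_on (face_poset (link \<sigma> K)) (\<lambda>\<tau>. g (\<sigma> \<union> \<tau>)) \<and>
           (\<exists>B \<beta>0. free_basis (poset_homology (int N - 1 - height Y y - 1) (strictly_above Y y)) B (\<lambda>b. b) \<and>
              (\<forall>b\<in>B. \<beta>0 b \<in> carrier (homology (int N - 1 - height Y y - 1) (link \<sigma> K)) \<and>
                 poset_induced (int N - 1 - height Y y - 1) (strictly_above Y y) (\<lambda>\<tau>. g (\<sigma> \<union> \<tau>))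
                   (homology_subdivision (int N - 1 - height Y y - 1) (link \<sigma> K) (\<beta>0 b)) = b))"
    proof (intro ballI impI)
      fix y \<sigma> assume ys: "y \<in> Y" "\<sigma> \<in> face_poset K" "g \<sigma> = y"
      have epi: "poset_induced (int N - 1 - height Y y - 1) (strictly_above Y y) g
           \<in> epi (poset_homology (int N - 1 - height Y y - 1) (strictly_above (face_poset K) \<sigma>))
                 (poset_homology (int N - 1 - height Y y - 1) (strictly_above Y y))"
        using A ys by blast
      note facts = face_map_point.point_facts[OF pt[OF ys]] face_map_point.upper_lifts_exist[OF pt[OF ys] epi]
      show "(\<forall>\<sigma>'\<in>face_poset K. g \<sigma>' = y \<longrightarrow>
              link \<sigma>' K = link \<sigma> K \<and>
              (\<forall>\<tau>\<in>face_poset (link \<sigma> K). g (\<sigma>' \<union> \<tau>) = g (\<sigma> \<union> \<tau>))) \<and>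
           simplicial_complex (subcomplex_below K g y) \<and>
           simplicial_complex (link \<sigma> K) \<and>
           \<Union>(subcomplex_below K g y) \<inter> \<Union>(link \<sigma> K) = {} \<and>
           complex_join (subcomplex_below K g y) (link \<sigma> K) \<subseteq> K \<and>
           (\<lambda>\<tau>. g (\<sigma> \<union> \<tau>)) \<in> face_poset (link \<sigma> K) \<rightarrow> strictly_above Y y \<and>
           mono_on (face_poset (link \<sigma> K)) (\<lambda>\<tau>. g (\<sigma> \<union> \<tau>)) \<and>
           (\<exists>B \<beta>0. free_basis (poset_homology (int N - 1 - height Y y - 1) (strictly_above Y y)) B (\<lambda>b. b) \<and>
              (\<forall>b\<in>B. \<beta>0 b \<in> carrier (homology (int N - 1 - height Y y - 1) (link \<sigma> K)) \<and>
                 poset_induced (int N - 1 - height Y y - 1) (strictly_above Y y) (\<lambda>\<tau>. g (\<sigma> \<union> \<tau>))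
                   (homology_subdivision (int N - 1 - height Y y - 1) (link \<sigma> K) (\<beta>0 b)) = b))"
        using facts by (elim conjE) (intro conjI; assumption)
    qed
    assume C: "\<gamma> \<in> I \<rightarrow> carrier (homology (int N - 1) K) \<and>
         free_basis (poset_homology (int N - 1) Y) I
           (\<lambda>i. poset_induced (int N - 1) Y g (homology_subdivision (int N - 1) K (\<gamma> i))) \<and>
         (\<forall>y\<in>Y. x y \<in> face_poset K \<and> g (x y) = y \<and>
            free_basis (homology (height Y y) (subcomplex_below K g y)) (I' y) (\<alpha> y) \<and>
            \<beta> y \<in> J' y \<rightarrow> carrier (homology (int N - 1 - height Y y - 1) (link (x y) K)) \<and>
            free_basis (poset_homology (int N - 1 - height Y y - 1) (strictly_above Y y)) (J' y)
              (\<lambda>j. poset_induced (int N - 1 - height Y y - 1) (strictly_above Y y) (\<lambda>\<tau>. g (x y \<union> \<tau>))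
                     (homology_subdivision (int N - 1 - height Y y - 1) (link (x y) K) (\<beta> y j))))"
    show "free_basis (homology (int N - 1) K)
           (I <+> (SIGMA y:Y. I' y \<times> J' y))
           (case_sum \<gamma> (\<lambda>(y, i, j).
              homology_join (height Y y) (int N - 1 - height Y y - 1) K (\<alpha> y i) (\<beta> y j)))"
      using C by (elim conjE) (rule F.homology_basis_of_choices)
  qed
qed

end
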